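(* Let $A=\varinjlim(A_n,\phi_{m,n})$ be a $C^*$-algebra which is an inductive limit of (finite direct sums of) Elliott–Thomsen building blocks $A_n$ with morphisms $\phi_{m,n}:A_m\to A_n$. If $RR(A)=0$, then for any $m$, any finite subset $G\subset A_m$, any $\varepsilon>0$ and any $L>0$, there exists $n\ge m$ such that there are two orthogonal projections $q_1,q_2\in A_n$ and a unital homomorphism $\phi':A_m\to q_2A_nq_2$ with finite dimensional image satisfying: (1) $\operatorname{rank}q_2\ge L\cdot\operatorname{rank}q_1$, where $q_1+q_2=\phi_{m,n}(1_{A_m})$; (2) $\|q_1\phi_{m,n}(g)-\phi_{m,n}(g)q_1\|<\varepsilon$ for any $g\in G$; (3) $\|\phi_{m,n}(g)-q_1\phi_{m,n}(g)q_1\oplus\phi'(g)\|<\varepsilon$ for any $g\in G$, where $q_1\phi_{m,n}(g)q_1\oplus\phi'(g)$ means $q_1\phi_{m,n}(g)q_1+\phi'(g)\in q_1A_nq_1\oplus q_2A_nq_2$.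
   Context: Homomorphism (morphism) means $*$-homomorphism; the $\phi_{m,n}$ are not assumed unital. **Building blocks.** For finite dimensional $C^*$-algebras $F_1,F_2$ and unital homomorphisms $\varphi_0,\varphi_1:F_1\to F_2$, put $$A(F_1,F_2,\varphi_0,\varphi_1)=\{(f,a)\in C([0,1],F_2)\oplus F_1: f(0)=\varphi_0(a),\ f(1)=\varphi_1(a)\}.$$ The class $\mathcal C$ of Elliott–Thomsen building blocks consists of all unital $C^*$-algebras of this form together with all finite dimensional $C^*$-algebras. An algebra in $\mathcal C$ is a minimal block if it is not a direct sum of two or more algebras in $\mathcal C$. **Real rank zero.** A unital $C^*$-algebra has real rank zero, $RR(A)=0$, if the invertible self-adjoint elements are dense in the set $A_{sa}$ of self-adjoint elements (as usual, a non-unital algebra has real rank zero if its unitization does). **Rank.** If $C=A(F_1,F_2,\varphi_0,\varphi_1)$ is a minimal block with $F_2=\bigoplus_{i=1}^lM_{l_i}(\mathbb C)$ and $L(C)=\sum_il_i$, the rank of a projection $p\in C$ is the (constant) rank of $p$ regarded as a projection in $C([0,1],M_{L(C)}(\mathbb C))$ (usual matrix rank when $C$ is a finite dimensional minimal block). If $C=\bigoplus_{k=1}^NC_k$ with minimal blocks $C_k$ and coordinate maps $\sigma_k:C\to C_k$, then $\operatorname{rank}p=(\operatorname{rank}\sigma_1(p),\dots,\operatorname{rank}\sigma_N(p))\in\mathbb N^N$, and inequalities between ranks are componentwise. *)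

theory Defs
  imports "Jordan_Normal_Form.DL_Rank" "Jordan_Normal_Form.Schur_Decomposition"
begin

record 'a cstar = "(complex, 'a) module" +
  adj :: "'a \<Rightarrow> 'a"
  nrm :: "'a \<Rightarrow> real"

text \<open>C*-algebras need not be unital.  The inherited record field for the unit is required to
  be the unit whenever a unit exists (\<open>one_unique\<close>), and is irrelevant otherwise; hence \<open>A\<close> is
  unital iff \<^term>\<open>monoid A\<close> holds, and \<^term>\<open>Units A\<close> is then its set of invertible elements.
  The zero algebra is a unital C*-algebra.\<close>

locale cstar_algebra = vectorspace class_ring A for A :: "'a cstar" +
  assumes mult_closed: "\<lbrakk>x \<in> carrier A; y \<in> carrier A\<rbrakk> \<Longrightarrow> x \<otimes>\<^bsub>A\<^esub> y \<in> carrier A"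
    and mult_assoc: "\<lbrakk>x \<in> carrier A; y \<in> carrier A; z \<in> carrier A\<rbrakk>
      \<Longrightarrow> (x \<otimes>\<^bsub>A\<^esub> y) \<otimes>\<^bsub>A\<^esub> z = x \<otimes>\<^bsub>A\<^esub> (y \<otimes>\<^bsub>A\<^esub> z)"
    and mult_distl: "\<lbrakk>x \<in> carrier A; y \<in> carrier A; z \<in> carrier A\<rbrakk>
      \<Longrightarrow> (x \<oplus>\<^bsub>A\<^esub> y) \<otimes>\<^bsub>A\<^esub> z = (x \<otimes>\<^bsub>A\<^esub> z) \<oplus>\<^bsub>A\<^esub> (y \<otimes>\<^bsub>A\<^esub> z)"
    and mult_distr: "\<lbrakk>x \<in> carrier A; y \<in> carrier A; z \<in> carrier A\<rbrakk>
      \<Longrightarrow> z \<otimes>\<^bsub>A\<^esub> (x \<oplus>\<^bsub>A\<^esub> y) = (z \<otimes>\<^bsub>A\<^esub> x) \<oplus>\<^bsub>A\<^esub> (z \<otimes>\<^bsub>A\<^esub> y)"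
    and mult_smult_left: "\<lbrakk>x \<in> carrier A; y \<in> carrier A\<rbrakk>
      \<Longrightarrow> (c \<odot>\<^bsub>A\<^esub> x) \<otimes>\<^bsub>A\<^esub> y = c \<odot>\<^bsub>A\<^esub> (x \<otimes>\<^bsub>A\<^esub> y)"
    and mult_smult_right: "\<lbrakk>x \<in> carrier A; y \<in> carrier A\<rbrakk>
      \<Longrightarrow> x \<otimes>\<^bsub>A\<^esub> (c \<odot>\<^bsub>A\<^esub> y) = c \<odot>\<^bsub>A\<^esub> (x \<otimes>\<^bsub>A\<^esub> y)"
    and one_unique: "\<lbrakk>e \<in> carrier A; \<And>x. x \<in> carrier A \<Longrightarrow> e \<otimes>\<^bsub>A\<^esub> x = x \<and> x \<otimes>\<^bsub>A\<^esub> e = x\<rbrakk>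
      \<Longrightarrow> \<one>\<^bsub>A\<^esub> = e"
    and adj_closed: "x \<in> carrier A \<Longrightarrow> adj A x \<in> carrier A"
    and adj_adj: "x \<in> carrier A \<Longrightarrow> adj A (adj A x) = x"
    and adj_add: "\<lbrakk>x \<in> carrier A; y \<in> carrier A\<rbrakk> \<Longrightarrow> adj A (x \<oplus>\<^bsub>A\<^esub> y) = adj A x \<oplus>\<^bsub>A\<^esub> adj A y"
    and adj_smult: "x \<in> carrier A \<Longrightarrow> adj A (c \<odot>\<^bsub>A\<^esub> x) = cnj c \<odot>\<^bsub>A\<^esub> adj A x"
    and adj_mult: "\<lbrakk>x \<in> carrier A; y \<in> carrier A\<rbrakk> \<Longrightarrow> adj A (x \<otimes>\<^bsub>A\<^esub> y) = adj A y \<otimes>\<^bsub>A\<^esub> adj A x"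
    and nrm_nonneg: "x \<in> carrier A \<Longrightarrow> 0 \<le> nrm A x"
    and nrm_eq_zero: "x \<in> carrier A \<Longrightarrow> nrm A x = 0 \<longleftrightarrow> x = \<zero>\<^bsub>A\<^esub>"
    and nrm_triangle: "\<lbrakk>x \<in> carrier A; y \<in> carrier A\<rbrakk> \<Longrightarrow> nrm A (x \<oplus>\<^bsub>A\<^esub> y) \<le> nrm A x + nrm A y"
    and nrm_smult: "x \<in> carrier A \<Longrightarrow> nrm A (c \<odot>\<^bsub>A\<^esub> x) = cmod c * nrm A x"
    and nrm_mult: "\<lbrakk>x \<in> carrier A; y \<in> carrier A\<rbrakk> \<Longrightarrow> nrm A (x \<otimes>\<^bsub>A\<^esub> y) \<le> nrm A x * nrm A y"
    and cstar_identity: "x \<in> carrier A \<Longrightarrow> nrm A (adj A x \<otimes>\<^bsub>A\<^esub> x) = (nrm A x)\<^sup>2"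
    and complete: "\<lbrakk>\<And>n. X n \<in> carrier A;
        \<And>e. 0 < e \<Longrightarrow> \<exists>N. \<forall>m\<ge>N. \<forall>n\<ge>N. nrm A (X m \<ominus>\<^bsub>A\<^esub> X n) < e\<rbrakk>
      \<Longrightarrow> \<exists>x\<in>carrier A. (\<lambda>n. nrm A (X n \<ominus>\<^bsub>A\<^esub> x)) \<longlonglongrightarrow> 0"

definition fd_cstar_algebra :: "'a cstar \<Rightarrow> bool" where
  "fd_cstar_algebra A \<longleftrightarrow> cstar_algebra A \<and> vectorspace.fin_dim class_ring A"

definition star_hom :: "'a cstar \<Rightarrow> 'b cstar \<Rightarrow> ('a \<Rightarrow> 'b) set" where
  "star_hom A B = {h \<in> LinearCombinations.module_hom class_ring A B.
     (\<forall>x\<in>carrier A. \<forall>y\<in>carrier A. h (x \<otimes>\<^bsub>A\<^esub> y) = h x \<otimes>\<^bsub>B\<^esub> h y) \<and>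
     (\<forall>x\<in>carrier A. h (adj A x) = adj B (h x))}"

definition unital_star_hom :: "'a cstar \<Rightarrow> 'b cstar \<Rightarrow> ('a \<Rightarrow> 'b) set" where
  "unital_star_hom A B = {h \<in> star_hom A B. h \<one>\<^bsub>A\<^esub> = \<one>\<^bsub>B\<^esub>}"

definition star_iso :: "'a cstar \<Rightarrow> 'b cstar \<Rightarrow> ('a \<Rightarrow> 'b) set" where
  "star_iso A B = {h \<in> star_hom A B. bij_betw h (carrier A) (carrier B)}"

definition projection :: "'a cstar \<Rightarrow> 'a \<Rightarrow> bool" where
  "projection A p \<longleftrightarrow> p \<in> carrier A \<and> p \<otimes>\<^bsub>A\<^esub> p = p \<and> adj A p = p"

definition corner :: "'a cstar \<Rightarrow> 'a \<Rightarrow> 'a cstar" where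
  "corner A q = A\<lparr>carrier := (\<lambda>x. q \<otimes>\<^bsub>A\<^esub> x \<otimes>\<^bsub>A\<^esub> q) ` carrier A, one := q\<rparr>"

definition direct_sum :: "'a cstar list \<Rightarrow> 'a list cstar" where
  "direct_sum As = \<lparr>
     carrier = {xs. list_all2 (\<lambda>x A. x \<in> carrier A) xs As},
     monoid.mult = (\<lambda>xs ys. map (\<lambda>i. xs ! i \<otimes>\<^bsub>As ! i\<^esub> ys ! i) [0..<length As]),
     one = map monoid.one As,
     zero = map ring.zero As,
     add = (\<lambda>xs ys. map (\<lambda>i. xs ! i \<oplus>\<^bsub>As ! i\<^esub> ys ! i) [0..<length As]),
     module.smult = (\<lambda>c xs. map (\<lambda>i. c \<odot>\<^bsub>As ! i\<^esub> xs ! i) [0..<length As]),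
     adj = (\<lambda>xs. map (\<lambda>i. adj (As ! i) (xs ! i)) [0..<length As]),
     nrm = (\<lambda>xs. Max (insert 0 ((\<lambda>i. nrm (As ! i) (xs ! i)) ` {..<length As})))\<rparr>"

definition transport :: "('a \<Rightarrow> 'b) \<Rightarrow> ('b \<Rightarrow> 'a) \<Rightarrow> 'a cstar \<Rightarrow> 'b cstar" where
  "transport f g A = \<lparr>
     carrier = f ` carrier A,
     monoid.mult = (\<lambda>x y. f (g x \<otimes>\<^bsub>A\<^esub> g y)),
     one = f \<one>\<^bsub>A\<^esub>,
     zero = f \<zero>\<^bsub>A\<^esub>,
     add = (\<lambda>x y. f (g x \<oplus>\<^bsub>A\<^esub> g y)),
     module.smult = (\<lambda>c x. f (c \<odot>\<^bsub>A\<^esub> g x)),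
     adj = (\<lambda>x. f (adj A (g x))),
     nrm = (\<lambda>x. nrm A (g x))\<rparr>"

text \<open>The norm is the operator norm of the left multiplication by \<open>a + \<lambda>\<close> on \<open>A\<close>.  It is
  the C*-norm of the unitization when \<open>A\<close> has no unit, the only case used below.\<close>

definition unitization :: "'a cstar \<Rightarrow> ('a \<times> complex) cstar" where
  "unitization A = \<lparr>
     carrier = carrier A \<times> UNIV,
     monoid.mult = (\<lambda>(a, l) (b, k). (a \<otimes>\<^bsub>A\<^esub> b \<oplus>\<^bsub>A\<^esub> k \<odot>\<^bsub>A\<^esub> a \<oplus>\<^bsub>A\<^esub> l \<odot>\<^bsub>A\<^esub> b, l * k)),
     one = (\<zero>\<^bsub>A\<^esub>, 1),
     zero = (\<zero>\<^bsub>A\<^esub>, 0),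
     add = (\<lambda>(a, l) (b, k). (a \<oplus>\<^bsub>A\<^esub> b, l + k)),
     module.smult = (\<lambda>c (a, l). (c \<odot>\<^bsub>A\<^esub> a, c * l)),
     adj = (\<lambda>(a, l). (adj A a, cnj l)),
     nrm = (\<lambda>(a, l). Sup {nrm A (a \<otimes>\<^bsub>A\<^esub> b \<oplus>\<^bsub>A\<^esub> l \<odot>\<^bsub>A\<^esub> b) |b. b \<in> carrier A \<and> nrm A b \<le> 1})\<rparr>"

definition self_adjoints :: "'a cstar \<Rightarrow> 'a set" where
  "self_adjoints A = {x \<in> carrier A. adj A x = x}"

definition unital_real_rank_zero :: "'a cstar \<Rightarrow> bool" where
  "unital_real_rank_zero A \<longleftrightarrow>
     (\<forall>a\<in>self_adjoints A. \<forall>e>0. \<exists>b\<in>self_adjoints A \<inter> Units A. nrm A (a \<ominus>\<^bsub>A\<^esub> b) < e)"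

definition real_rank_zero :: "'a cstar \<Rightarrow> bool" where
  "real_rank_zero A \<longleftrightarrow>
     (if monoid A then unital_real_rank_zero A else unital_real_rank_zero (unitization A))"

text \<open>The map \<open>\<phi> m n\<close> is only relevant for \<open>m \<le> n\<close>.\<close>

definition inductive_system :: "(nat \<Rightarrow> 'a cstar) \<Rightarrow> (nat \<Rightarrow> nat \<Rightarrow> 'a \<Rightarrow> 'a) \<Rightarrow> bool" where
  "inductive_system A \<phi> \<longleftrightarrow>
     (\<forall>n. cstar_algebra (A n)) \<and>
     (\<forall>m n. m \<le> n \<longrightarrow> \<phi> m n \<in> star_hom (A m) (A n)) \<and>
     (\<forall>n. \<forall>x\<in>carrier (A n). \<phi> n n x = x) \<and>
     (\<forall>l m n. l \<le> m \<longrightarrow> m \<le> n \<longrightarrow> (\<forall>x\<in>carrier (A l). \<phi> m n (\<phi> l m x) = \<phi> l n x))"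

text \<open>\<open>B\<close> with the canonical maps \<open>\<mu> n\<close> is the completion of the algebraic direct limit for the
  C*-seminorm \<open>lim \<parallel>\<phi> m n x\<parallel>\<close> (as \<open>n\<close> tends to infinity), divided by its null space.  This
  determines \<open>B\<close> up to isomorphism.\<close>

definition inductive_limit ::
  "(nat \<Rightarrow> 'a cstar) \<Rightarrow> (nat \<Rightarrow> nat \<Rightarrow> 'a \<Rightarrow> 'a) \<Rightarrow> 'b cstar \<Rightarrow> (nat \<Rightarrow> 'a \<Rightarrow> 'b) \<Rightarrow> bool" where
  "inductive_limit A \<phi> B \<mu> \<longleftrightarrow>
     inductive_system A \<phi> \<and> cstar_algebra B \<and>
     (\<forall>n. \<mu> n \<in> star_hom (A n) B) \<and>
     (\<forall>m n. m \<le> n \<longrightarrow> (\<forall>x\<in>carrier (A m). \<mu> n (\<phi> m n x) = \<mu> m x)) \<and>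
     (\<forall>b\<in>carrier B. \<forall>e>0. \<exists>n. \<exists>x\<in>carrier (A n). nrm B (b \<ominus>\<^bsub>B\<^esub> \<mu> n x) < e) \<and>
     (\<forall>m. \<forall>x\<in>carrier (A m). (\<lambda>n. nrm (A n) (\<phi> m n x)) \<longlonglongrightarrow> nrm B (\<mu> m x))"

text \<open>Continuous functions on the unit interval are extensional, i.e. \<open>undefined\<close> outside it.\<close>

definition et_alg ::
  "'f cstar \<Rightarrow> 'f cstar \<Rightarrow> ('f \<Rightarrow> 'f) \<Rightarrow> ('f \<Rightarrow> 'f) \<Rightarrow> ((real \<Rightarrow> 'f) \<times> 'f) cstar" where
  "et_alg F1 F2 \<phi>0 \<phi>1 = \<lparr>
     carrier = {(f, a). f \<in> {0..1} \<rightarrow>\<^sub>E carrier F2 \<and> a \<in> carrier F1 \<and>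
       (\<forall>t\<in>{0..1}. ((\<lambda>s. nrm F2 (f s \<ominus>\<^bsub>F2\<^esub> f t)) \<longlongrightarrow> 0) (at t within {0..1})) \<and>
       f 0 = \<phi>0 a \<and> f 1 = \<phi>1 a},
     monoid.mult = (\<lambda>(f, a) (g, b). (\<lambda>t\<in>{0..1}. f t \<otimes>\<^bsub>F2\<^esub> g t, a \<otimes>\<^bsub>F1\<^esub> b)),
     one = (\<lambda>t\<in>{0..1}. \<one>\<^bsub>F2\<^esub>, \<one>\<^bsub>F1\<^esub>),
     zero = (\<lambda>t\<in>{0..1}. \<zero>\<^bsub>F2\<^esub>, \<zero>\<^bsub>F1\<^esub>),
     add = (\<lambda>(f, a) (g, b). (\<lambda>t\<in>{0..1}. f t \<oplus>\<^bsub>F2\<^esub> g t, a \<oplus>\<^bsub>F1\<^esub> b)),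
     module.smult = (\<lambda>c (f, a). (\<lambda>t\<in>{0..1}. c \<odot>\<^bsub>F2\<^esub> f t, c \<odot>\<^bsub>F1\<^esub> a)),
     adj = (\<lambda>(f, a). (\<lambda>t\<in>{0..1}. adj F2 (f t), adj F1 a)),
     nrm = (\<lambda>(f, a). max (Sup ((\<lambda>t. nrm F2 (f t)) ` {0..1})) (nrm F1 a))\<rparr>"

datatype 'f et_block =
    FinDim "'f cstar"
  | ET "'f cstar" "'f cstar" "'f \<Rightarrow> 'f" "'f \<Rightarrow> 'f"

primrec is_et_block :: "'f et_block \<Rightarrow> bool" where
  "is_et_block (FinDim F) \<longleftrightarrow> fd_cstar_algebra F"
| "is_et_block (ET F1 F2 \<phi>0 \<phi>1) \<longleftrightarrow> fd_cstar_algebra F1 \<and> fd_cstar_algebra F2 \<and>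
     \<phi>0 \<in> unital_star_hom F1 F2 \<and> \<phi>1 \<in> unital_star_hom F1 F2"

primrec block_alg :: "'f et_block \<Rightarrow> ('f + (real \<Rightarrow> 'f) \<times> 'f) cstar" where
  "block_alg (FinDim F) = transport Inl projl F"
| "block_alg (ET F1 F2 \<phi>0 \<phi>1) = transport Inr projr (et_alg F1 F2 \<phi>0 \<phi>1)"

definition nonzero_et_block :: "'f et_block \<Rightarrow> bool" where
  "nonzero_et_block C \<longleftrightarrow> is_et_block C \<and> carrier (block_alg C) \<noteq> {\<zero>\<^bsub>block_alg C\<^esub>}"

text \<open>The summands in \<open>minimal_block\<close> range over blocks on the same type \<open>'f\<close>.  This is no
  restriction: a nonzero block needs a nonzero \<open>F1\<close>, so \<open>'f\<close> has at least the cardinality of the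
  continuum, and every finite dimensional C*-algebra has an isomorphic copy with carrier in \<open>'f\<close>.\<close>

definition minimal_block :: "'f et_block \<Rightarrow> bool" where
  "minimal_block C \<longleftrightarrow> nonzero_et_block C \<and>
     \<not> (\<exists>Bs :: 'f et_block list. 2 \<le> length Bs \<and> (\<forall>B\<in>set Bs. nonzero_et_block B) \<and>
          star_iso (block_alg C) (direct_sum (map block_alg Bs)) \<noteq> {})"

text \<open>\<open>\<theta>\<close> identifies \<open>A\<close> with the direct sum of the minimal blocks \<open>Cs\<close>; its \<open>k\<close>-th component is
  the coordinate map onto the \<open>k\<close>-th block.\<close>

definition et_decomposition ::
  "'a cstar \<Rightarrow> 'f et_block list \<Rightarrow> ('a \<Rightarrow> ('f + (real \<Rightarrow> 'f) \<times> 'f) list) \<Rightarrow> bool" where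
  "et_decomposition A Cs \<theta> \<longleftrightarrow>
     (\<forall>C\<in>set Cs. minimal_block C) \<and> \<theta> \<in> star_iso A (direct_sum (map block_alg Cs))"

definition op_norm :: "nat \<Rightarrow> complex mat \<Rightarrow> real" where
  "op_norm d M = Sup {sqrt (Re ((M *\<^sub>v v) \<bullet>c (M *\<^sub>v v))) |v. v \<in> carrier_vec d \<and> Re (v \<bullet>c v) \<le> 1}"

definition matrix_alg :: "nat \<Rightarrow> complex mat cstar" where
  "matrix_alg d = \<lparr>
     carrier = carrier_mat d d,
     monoid.mult = (*),
     one = 1\<^sub>m d,
     zero = 0\<^sub>m d d,
     add = (+),
     module.smult = (\<cdot>\<^sub>m),
     adj = mat_adjoint,
     nrm = op_norm d\<rparr>"

text \<open>Identify \<open>F\<close> with a direct sum of matrix algebras of sizes \<open>ls\<close>, embed the latter block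
  diagonally into the matrices of size \<open>L = sum_list ls\<close>, and take the matrix rank.  The
  identification is unique up to a permutation of the summands and unitary conjugation, so the
  result does not depend on it.\<close>

definition fd_rank :: "'f cstar \<Rightarrow> 'f \<Rightarrow> nat" where
  "fd_rank F x = (THE r. \<exists>ls h. (\<forall>l\<in>set ls. 0 < l) \<and>
     h \<in> star_iso F (direct_sum (map matrix_alg ls)) \<and>
     r = vec_space.rank (sum_list ls) (diag_block_mat (h x)))"

text \<open>A block \<open>ET F1 F2 \<phi>0 \<phi>1\<close> is finite dimensional iff \<open>F2 = 0\<close>; it is then isomorphic to \<open>F1\<close>
  and carries the usual matrix rank.\<close>

primrec block_rank :: "'f et_block \<Rightarrow> 'f + (real \<Rightarrow> 'f) \<times> 'f \<Rightarrow> nat" where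
  "block_rank (FinDim F) x = fd_rank F (projl x)"
| "block_rank (ET F1 F2 \<phi>0 \<phi>1) x =
     (if vectorspace.fin_dim class_ring (et_alg F1 F2 \<phi>0 \<phi>1)
      then fd_rank (et_alg F1 F2 \<phi>0 \<phi>1) (projr x)
      else (THE r. \<forall>t\<in>{0..1}. fd_rank F2 (fst (projr x) t) = r))"

text \<open>The rank vector depends on the chosen presentation of the blocks, not only on the algebra:
  \<open>C([0,1])\<close> can be presented with \<open>F2 = \<complex>\<close>, but also, after cutting the interval into two
  halves, with \<open>F2 = \<complex> \<oplus> \<complex>\<close>, which doubles all ranks.\<close>

definition et_rank :: "'f et_block list \<Rightarrow> ('f + (real \<Rightarrow> 'f) \<times> 'f) list \<Rightarrow> nat list" where
  "et_rank Cs xs = map2 block_rank Cs xs"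

end

theory Submission imports Defs "HOL-Library.Function_Algebras" begin

text \<open>The statement is a form of the fact that a C*-algebra of real rank zero that is built from
interval algebras has many projections, enough to diagonalise a given finite set up to a small part.

Work in \<open>A m\<close> first. Cut the interval of each block into short arcs on which the elements of \<open>G\<close>
hardly vary, and put on each arc a chain of four bump functions, each equal to one on the support of
the next smaller one. An arc in the interior carries the fibre \<open>F2\<close>. The arc around the two end
points carries the fibre \<open>F1\<close>, which acts through \<open>\<phi>0\<close> near 0 and through \<open>\<phi>1\<close> near 1. Up to
\<open>\<epsilon>\<close>, multiplication by \<open>g\<close> on the arcs agrees with multiplication by the constant value of \<open>g\<close> there
(locale \<open>pieces\<close>). Only the neighbourhoods of the cut points are left out. There are \<open>N\<close>
choices of cut points whose neighbourhoods are pairwise disjoint.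

Real rank zero of the limit produces, at all late stages, projections that lie between two bumps of an arc
(\<open>interpolating_projection\<close>): an invertible self-adjoint element close to \<open>x - 1/2\<close> is
lifted from the limit, and its sign yields the projection. One such projection for each minimal projection of a fibre,
moved around by the matrix units of the fibre, gives a system of matrix units at stage \<open>n\<close> and hence a homomorphism
\<open>\<Psi>\<close> with finite dimensional image. Its unit \<open>r\<close> covers everything outside the neighbourhoods of the
cut points (locale \<open>stage\<close>).

It remains to make \<open>r\<close> large. The \<open>N\<close> complements of the \<open>N\<close> candidates for \<open>r\<close> live near disjoint sets,
hence are almost orthogonal and their sum has norm at most 2. A trace that computes the rank in a block shows that
their ranks add up to at most twice the rank of the image of the unit, so in every block one of them has rank
at most \<open>2/N\<close> of the total. The candidate may be chosen block by block, because the blocks are cut out by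
central projections (\<open>hosted_decomposition\<close>).

All computations take place in a type class ring: every C*-algebra record is represented faithfully by linear
operators, so that the ring simplification procedures apply. The structure of finite dimensional C*-algebras
that is needed (matrix units, an isomorphism with matrix algebras, the rank as a trace) is
developed from minimal projections.\<close>

section \<open>Representing a C*-algebra inside a type class ring\<close>

class complex_alg = ring_1 +
 fixes scl :: "complex => 'a => 'a"  (infixr "*c" 75)
 assumes scl_add_right: "c *c (x + y) = c *c x + c *c y"
  and scl_add_left: "(c + d) *c x = c *c x + d *c x"
  and scl_scl [simp]: "c *c d *c x = (c * d) *c x"
  and scl_1 [simp]: "1 *c x = x"
  and scl_mult_left [simp]: "(c *c x) * y = c *c (x * y)"
  and scl_mult_right [simp]: "x * (c *c y) = c *c (x * y)"
begin
lemma scl_0_left [simp]: "0 *c x = 0"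
 using scl_add_left[of 0 0 x] by simp
lemma scl_0_right [simp]: "c *c 0 = 0"
 using scl_add_right[of c 0 0] by simp
lemma scl_minus_left [simp]: "(- c) *c x = - (c *c x)"
 using scl_add_left[of "- c" c x] by (simp add: eq_neg_iff_add_eq_0)
lemma scl_minus_right [simp]: "c *c (- x) = - (c *c x)"
 using scl_add_right[of c "- x" x] by (simp add: eq_neg_iff_add_eq_0)
lemma scl_diff_right: "c *c (x - y) = c *c x - c *c y"
 using scl_add_right[of c x "- y"] by simp
lemma scl_diff_left: "(c - d) *c x = c *c x - d *c x"
 using scl_add_left[of c "- d" x] by simp
lemma scl_sum_right: "c *c sum f I = (\<Sum>i\<in>I. c *c f i)"
 by (induction I rule: infinite_finite_induct) (simp_all add: scl_add_right)
lemma scl_sum_left: "sum f I *c x = (\<Sum>i\<in>I. f i *c x)"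
 by (induction I rule: infinite_finite_induct) (simp_all add: scl_add_left)
lemma scl_half: "(1/2) *c (x + x) = x"
proof -
 have "(1/2) *c (x + x) = (1/2 + 1/2) *c x" unfolding scl_add_left by (simp add: scl_add_right)
 then show ?thesis by simp
qed
lemma scl_half_diff: "x - (1/2) *c x = (1/2) *c x"
 using scl_half[of x] by (simp add: scl_add_right diff_eq_eq)
lemmas scl_simps = scl_add_right scl_add_left scl_diff_right scl_diff_left
end

typedef 'a host = "{T :: ('a => complex) => ('a => complex).
  (\<forall>u v. T (\<lambda>a. u a + v a) = (\<lambda>a. T u a + T v a)) & (\<forall>c v. T (\<lambda>a. c * v a) = (\<lambda>a. c * T v a))}"
 by (rule exI[of _ id]) simp

setup_lifting type_definition_host

text \<open>Linear operators on all complex functions on \<open>'a\<close> form a unital ring of the type class,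
large enough to contain every C*-algebra with carrier in \<open>'a\<close>.\<close>

instantiation host :: (type) complex_alg
begin
lift_definition zero_host :: "'a host" is "\<lambda>v a. 0" by simp
lift_definition one_host :: "'a host" is "\<lambda>v. v" by simp
lift_definition plus_host :: "'a host => 'a host => 'a host" is "\<lambda>S T v a. S v a + T v a"
 by (simp add: algebra_simps)
lift_definition minus_host :: "'a host => 'a host => 'a host" is "\<lambda>S T v a. S v a - T v a"
 by (simp add: algebra_simps)
lift_definition uminus_host :: "'a host => 'a host" is "\<lambda>T v a. - T v a"
 by simp
lift_definition times_host :: "'a host => 'a host => 'a host" is "\<lambda>S T v. S (T v)"
 by simp
lift_definition scl_host :: "complex => 'a host => 'a host" is "\<lambda>c T v a. c * T v a"
 by (simp add: algebra_simps)
instance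
proof
 show "(0::'a host) ~= 1"
 proof transfer
  show "(\<lambda>v a. 0) ~= (\<lambda>v. v :: 'a => complex)"
   by (metis zero_neq_one)
 qed
qed (transfer; force simp: algebra_simps)+
end

lemma fun_vector_space: "vector_space (\<lambda>c (v :: 'a => complex) a. c * v a)"
 by unfold_locales (auto simp: algebra_simps fun_eq_iff)

text \<open>Needed to extend an operator from a subspace to the whole function space.\<close>

lemma fun_projection:
 fixes W :: "('a => complex) set"
 assumes "0 \<in> W" "!!u v. u \<in> W ==> v \<in> W ==> u + v \<in> W" "!!c v. v \<in> W ==> (\<lambda>a. c * v a) \<in> W"
 shows "\<exists>k. (\<forall>v. k v \<in> W) & (\<forall>v\<in>W. k v = v) & (\<forall>u v. k (u + v) = k u + k v)
  & (\<forall>c v. k (\<lambda>a. c * v a) = (\<lambda>a. c * k v a))"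
proof -
 interpret V: vector_space "\<lambda>c (v :: 'a => complex) a. c * v a" by (rule fun_vector_space)
 interpret VV: vector_space_pair "\<lambda>c (v :: 'a => complex) a. c * v a" "\<lambda>c (v :: 'a => complex) a. c * v a"
  by unfold_locales
 have "V.subspace W" using assms by (auto simp: V.subspace_def)
 then obtain g where g: "g ` UNIV \<subseteq> W" "Vector_Spaces.linear (\<lambda>c v a. c * v a) (\<lambda>c v a. c * v a) g" "\<forall>v\<in>W. g v = v"
  using VV.linear_exists_left_inverse_on[of id W] V.linear_id by (auto simp: id_def)
 then interpret g: Vector_Spaces.linear "\<lambda>c (v :: 'a => complex) a. c * v a" "\<lambda>c (v :: 'a => complex) a. c * v a" g
  by simp
 show ?thesis using g(1,3) g.add g.scale by (intro exI[of _ g]) auto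
qed

lemma cstar_smult:
 assumes "cstar_algebra (A :: 'a cstar)"
 shows "x \<in> carrier A ==> c \<odot>\<^bsub>A\<^esub> x \<in> carrier A"
  and "x \<in> carrier A ==> y \<in> carrier A ==> c \<odot>\<^bsub>A\<^esub> (x \<oplus>\<^bsub>A\<^esub> y) = c \<odot>\<^bsub>A\<^esub> x \<oplus>\<^bsub>A\<^esub> c \<odot>\<^bsub>A\<^esub> y"
  and "x \<in> carrier A ==> (c + d) \<odot>\<^bsub>A\<^esub> x = c \<odot>\<^bsub>A\<^esub> x \<oplus>\<^bsub>A\<^esub> d \<odot>\<^bsub>A\<^esub> x"
  and "x \<in> carrier A ==> (c * d) \<odot>\<^bsub>A\<^esub> x = c \<odot>\<^bsub>A\<^esub> (d \<odot>\<^bsub>A\<^esub> x)"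
  and "x \<in> carrier A ==> 1 \<odot>\<^bsub>A\<^esub> x = x"
  and "x \<in> carrier A ==> 0 \<odot>\<^bsub>A\<^esub> x = \<zero>\<^bsub>A\<^esub>"
  and "c \<odot>\<^bsub>A\<^esub> \<zero>\<^bsub>A\<^esub> = \<zero>\<^bsub>A\<^esub>"
  and "abelian_group A"
proof -
 interpret cstar_algebra A by fact
 show "x \<in> carrier A ==> c \<odot>\<^bsub>A\<^esub> x \<in> carrier A" by simp
 show "x \<in> carrier A ==> y \<in> carrier A ==> c \<odot>\<^bsub>A\<^esub> (x \<oplus>\<^bsub>A\<^esub> y) = c \<odot>\<^bsub>A\<^esub> x \<oplus>\<^bsub>A\<^esub> c \<odot>\<^bsub>A\<^esub> y"
  using module.smult_r_distr[of c x y] by simp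
 show "x \<in> carrier A ==> (c + d) \<odot>\<^bsub>A\<^esub> x = c \<odot>\<^bsub>A\<^esub> x \<oplus>\<^bsub>A\<^esub> d \<odot>\<^bsub>A\<^esub> x"
  using module.smult_l_distr[of c d x] by simp
 show "x \<in> carrier A ==> (c * d) \<odot>\<^bsub>A\<^esub> x = c \<odot>\<^bsub>A\<^esub> (d \<odot>\<^bsub>A\<^esub> x)"
  using module.smult_assoc1[of c d x] by simp
 show "x \<in> carrier A ==> 1 \<odot>\<^bsub>A\<^esub> x = x" using module.smult_one[of x] by simp
 show "x \<in> carrier A ==> 0 \<odot>\<^bsub>A\<^esub> x = \<zero>\<^bsub>A\<^esub>" using module.smult_l_null[of x] by simp
 show "c \<odot>\<^bsub>A\<^esub> \<zero>\<^bsub>A\<^esub> = \<zero>\<^bsub>A\<^esub>" using module.smult_r_null[of c] by simp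
 show "abelian_group A" by unfold_locales
qed

definition is_hosting :: "'a cstar => ('a => 'a host) => bool" where
 "is_hosting A H \<longleftrightarrow> inj_on H (carrier A) &
   (\<forall>x\<in>carrier A. \<forall>y\<in>carrier A. H (x \<oplus>\<^bsub>A\<^esub> y) = H x + H y & H (x \<otimes>\<^bsub>A\<^esub> y) = H x * H y) &
   (\<forall>c. \<forall>x\<in>carrier A. H (c \<odot>\<^bsub>A\<^esub> x) = c *c H x)"

text \<open>Left multiplication is faithful without a unit, because \<open>z * z\<^sup>* = 0\<close> forces \<open>z = 0\<close>.\<close>

lemma cstar_mult_faithful:
 assumes A: "cstar_algebra A" and xy: "x \<in> carrier A" "y \<in> carrier A"
  and eq: "!!b. b \<in> carrier A ==> x \<otimes>\<^bsub>A\<^esub> b = y \<otimes>\<^bsub>A\<^esub> b"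
 shows "x = y"
proof -
 interpret cstar_algebra A by fact
 interpret abelian_group A using cstar_smult(8)[OF A] .
 define z where "z = x \<oplus>\<^bsub>A\<^esub> (-1) \<odot>\<^bsub>A\<^esub> y"
 have z: "z \<in> carrier A" using xy cstar_smult(1)[OF A] by (simp add: z_def)
 have "z \<otimes>\<^bsub>A\<^esub> b = \<zero>\<^bsub>A\<^esub>" if b: "b \<in> carrier A" for b
 proof -
  have yb: "y \<otimes>\<^bsub>A\<^esub> b \<in> carrier A" using b xy by (simp add: mult_closed)
  have "z \<otimes>\<^bsub>A\<^esub> b = y \<otimes>\<^bsub>A\<^esub> b \<oplus>\<^bsub>A\<^esub> (-1) \<odot>\<^bsub>A\<^esub> (y \<otimes>\<^bsub>A\<^esub> b)"
   using b xy cstar_smult(1)[OF A] by (simp add: z_def mult_distl mult_smult_left eq)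
  also have "\<dots> = (1 + (-1)) \<odot>\<^bsub>A\<^esub> (y \<otimes>\<^bsub>A\<^esub> b)"
   using yb by (subst cstar_smult(3)[OF A]) (simp_all add: cstar_smult(5)[OF A])
  also have "\<dots> = \<zero>\<^bsub>A\<^esub>" using yb cstar_smult(6)[OF A] by simp
  finally show ?thesis .
 qed
 then have "nrm A (adj A (adj A z) \<otimes>\<^bsub>A\<^esub> adj A z) = 0"
  using z nrm_eq_zero[of "\<zero>\<^bsub>A\<^esub>"] by (simp add: adj_adj adj_closed)
 then have "adj A z = \<zero>\<^bsub>A\<^esub>" using z cstar_identity[of "adj A z"] nrm_eq_zero[of "adj A z"] by (simp add: adj_closed)
 then have "adj A z = 0 \<odot>\<^bsub>A\<^esub> z" using z cstar_smult(6)[OF A] by simp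
 then have "adj A (adj A z) = cnj 0 \<odot>\<^bsub>A\<^esub> adj A z" using z by (simp add: adj_smult)
 then have z0: "z = \<zero>\<^bsub>A\<^esub>" using z cstar_smult(6)[OF A] by (simp add: adj_adj adj_closed)
 have "z \<oplus>\<^bsub>A\<^esub> y = x \<oplus>\<^bsub>A\<^esub> ((-1) \<odot>\<^bsub>A\<^esub> y \<oplus>\<^bsub>A\<^esub> 1 \<odot>\<^bsub>A\<^esub> y)"
  unfolding z_def using xy cstar_smult(1)[OF A] by (simp add: a_assoc cstar_smult(5)[OF A])
 also have "\<dots> = x \<oplus>\<^bsub>A\<^esub> ((-1) + 1) \<odot>\<^bsub>A\<^esub> y" using xy by (simp only: cstar_smult(3)[OF A])
 also have "\<dots> = x" using xy cstar_smult(6)[OF A] by simp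
 finally show ?thesis using z0 xy by simp
qed

text \<open>The regular representation. The algebra is a quotient of the space of finitely supported functions on its carrier.
Once this quotient map is split linearly, left multiplication becomes an operator on all functions.\<close>

lemma hosting_exists:
 assumes A: "cstar_algebra (A :: 'a cstar)"
 shows "\<exists>H. is_hosting A H"
proof -
 interpret cstar_algebra A by fact
 interpret abelian_group A using cstar_smult(8)[OF A] .
 note sm = cstar_smult(1-7)[OF A]
 define Fin where "Fin = {v :: 'a => complex. finite {a. v a ~= 0} & {a. v a ~= 0} \<subseteq> carrier A}"
 define \<pi> where "\<pi> v = finsum A (\<lambda>a. v a \<odot>\<^bsub>A\<^esub> a) {a. v a ~= 0}" for v :: "'a => complex"
 have \<pi>_eq: "\<pi> v = finsum A (\<lambda>a. v a \<odot>\<^bsub>A\<^esub> a) T" if "finite T" "T \<subseteq> carrier A" "{a. v a ~= 0} \<subseteq> T" for v T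
  unfolding \<pi>_def using that sm(1,6)
  by (intro add.finprod_mono_neutral_cong_left) (auto simp: subset_iff)
 have \<pi>_closed: "\<pi> v \<in> carrier A" if "v \<in> Fin" for v
  unfolding \<pi>_def using that sm(1) by (intro finsum_closed) (auto simp: Fin_def)
 have Fin0: "0 \<in> Fin" by (simp add: Fin_def)
 have Fin_add: "u + v \<in> Fin" if "u \<in> Fin" "v \<in> Fin" for u v
 proof -
  have "{a. (u + v) a ~= 0} \<subseteq> {a. u a ~= 0} \<union> {a. v a ~= 0}" by auto
  moreover have "finite ({a. u a ~= 0} \<union> {a. v a ~= 0})" using that by (simp add: Fin_def)
  ultimately show ?thesis using that finite_subset unfolding Fin_def by blast
 qed
 have Fin_smult: "(\<lambda>a. c * v a) \<in> Fin" if "v \<in> Fin" for c v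
 proof -
  have "{a. c * v a ~= 0} \<subseteq> {a. v a ~= 0}" by auto
  then show ?thesis using that finite_subset unfolding Fin_def by blast
 qed
 have \<pi>_add: "\<pi> (u + v) = \<pi> u \<oplus>\<^bsub>A\<^esub> \<pi> v" if "u \<in> Fin" "v \<in> Fin" for u v
 proof -
  let ?T = "{a. u a ~= 0} \<union> {a. v a ~= 0}"
  have T: "finite ?T" "?T \<subseteq> carrier A" using that by (auto simp: Fin_def)
  have "\<pi> (u + v) = finsum A (\<lambda>a. (u + v) a \<odot>\<^bsub>A\<^esub> a) ?T"
   using T by (intro \<pi>_eq) auto
  also have "\<dots> = finsum A (\<lambda>a. u a \<odot>\<^bsub>A\<^esub> a \<oplus>\<^bsub>A\<^esub> v a \<odot>\<^bsub>A\<^esub> a) ?T"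
   using T sm(1) by (intro finsum_cong') (auto simp: sm(3) subset_iff)
  also have "\<dots> = finsum A (\<lambda>a. u a \<odot>\<^bsub>A\<^esub> a) ?T \<oplus>\<^bsub>A\<^esub> finsum A (\<lambda>a. v a \<odot>\<^bsub>A\<^esub> a) ?T"
   using T sm(1) by (intro finsum_addf) auto
  also have "\<dots> = \<pi> u \<oplus>\<^bsub>A\<^esub> \<pi> v" using T by (simp add: \<pi>_eq[of ?T])
  finally show ?thesis .
 qed
 have \<pi>_smult: "\<pi> (\<lambda>a. c * v a) = c \<odot>\<^bsub>A\<^esub> \<pi> v" if "v \<in> Fin" for c v
 proof -
  let ?T = "{a. v a ~= 0}"
  have T: "finite ?T" "?T \<subseteq> carrier A" using that by (auto simp: Fin_def)
  have "\<pi> (\<lambda>a. c * v a) = finsum A (\<lambda>a. c \<odot>\<^bsub>A\<^esub> (v a \<odot>\<^bsub>A\<^esub> a)) ?T"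
   using T sm(1,4) by (subst \<pi>_eq[of ?T]) (auto intro!: finsum_cong' simp: subset_iff)
  also have "\<dots> = c \<odot>\<^bsub>A\<^esub> finsum A (\<lambda>a. v a \<odot>\<^bsub>A\<^esub> a) ?T"
   using T sm(1) by (intro module.finsum_smult[symmetric]) auto
  finally show ?thesis unfolding \<pi>_def .
 qed
 define \<delta> where "\<delta> a = (\<lambda>b. if b = a then 1 else 0 :: complex)" for a :: 'a
 have \<delta>_Fin: "\<delta> a \<in> Fin" if "a \<in> carrier A" for a using that by (auto simp: Fin_def \<delta>_def)
 have \<pi>_\<delta>: "\<pi> (\<delta> a) = a" if "a \<in> carrier A" for a
  using that sm(1,5) by (subst \<pi>_eq[of "{a}"]) (auto simp: \<delta>_def)
 obtain h where h: "!!v. h v \<in> Fin" "!!v. v \<in> Fin ==> h v = v" "!!u v. h (u + v) = h u + h v"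
  "!!c v. h (\<lambda>a. c * v a) = (\<lambda>a. c * h v a)"
  using fun_projection[of Fin] Fin0 Fin_add Fin_smult by blast
 define K where "K = {v \<in> Fin. \<pi> v = \<zero>\<^bsub>A\<^esub>}"
 have "0 \<in> K" using Fin0 by (simp add: K_def \<pi>_def)
 moreover have "u + v \<in> K" if "u \<in> K" "v \<in> K" for u v using that Fin_add by (simp add: K_def \<pi>_add)
 moreover have "(\<lambda>a. c * v a) \<in> K" if "v \<in> K" for c v using that Fin_smult sm(7) by (simp add: K_def \<pi>_smult)
 ultimately obtain k where k: "!!v. k v \<in> K" "!!v. v \<in> K ==> k v = v" "!!u v. k (u + v) = k u + k v"
  "!!c v. k (\<lambda>a. c * v a) = (\<lambda>a. c * k v a)"
  using fun_projection[of K] by blast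
 define g where "g v = v - k v" for v
 have g_add: "g (u + v) = g u + g v" for u v by (simp add: g_def k)
 have g_smult: "g (\<lambda>a. c * v a) = (\<lambda>a. c * g v a)" for c v by (simp add: g_def k fun_eq_iff algebra_simps)
 have g_K: "g v = 0" if "v \<in> K" for v using that k by (simp add: g_def)
 have g_minus: "g (u - v) = g u - g v" for u v using g_add[of "u - v" v] by simp
 have neg_Fin: "- v \<in> Fin" if "v \<in> Fin" for v using Fin_smult[OF that, of "-1"] by (simp add: fun_Compl_def)
 have \<pi>_neg: "\<pi> (- v) = (-1) \<odot>\<^bsub>A\<^esub> \<pi> v" if "v \<in> Fin" for v
  using \<pi>_smult[OF that, of "-1"] by (simp add: fun_Compl_def)
 have diff_K: "u - v \<in> K" if "u \<in> Fin" "v \<in> Fin" "\<pi> u = \<pi> v" for u v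
 proof -
  have "\<pi> (u + - v) = \<pi> v \<oplus>\<^bsub>A\<^esub> (-1) \<odot>\<^bsub>A\<^esub> \<pi> v"
   using that by (simp only: \<pi>_add neg_Fin \<pi>_neg)
  also have "\<dots> = (1 + (-1)) \<odot>\<^bsub>A\<^esub> \<pi> v"
   using \<pi>_closed[OF that(2)] by (simp only: sm(3) sm(5))
  also have "\<dots> = \<zero>\<^bsub>A\<^esub>" using \<pi>_closed[OF that(2)] sm(6) by simp
  finally show ?thesis using Fin_add[OF that(1) neg_Fin[OF that(2)]] by (simp add: K_def)
 qed
 define \<iota> where "\<iota> a = g (\<delta> a)" for a
 have \<iota>_Fin: "\<iota> a \<in> Fin" if "a \<in> carrier A" for a
  using Fin_add[OF \<delta>_Fin[OF that] neg_Fin, of "k (\<delta> a)"] k(1)[of "\<delta> a"] by (simp add: \<iota>_def g_def K_def)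
 have \<pi>_\<iota>: "\<pi> (\<iota> a) = a" if "a \<in> carrier A" for a
 proof -
  have k': "k (\<delta> a) \<in> Fin" "\<pi> (k (\<delta> a)) = \<zero>\<^bsub>A\<^esub>" using k(1) by (auto simp: K_def)
  have "\<pi> (\<iota> a) = \<pi> (\<delta> a + - k (\<delta> a))" by (simp add: \<iota>_def g_def)
  also have "\<dots> = a \<oplus>\<^bsub>A\<^esub> (-1) \<odot>\<^bsub>A\<^esub> \<zero>\<^bsub>A\<^esub>"
   unfolding \<pi>_add[OF \<delta>_Fin[OF that] neg_Fin[OF k'(1)]] \<pi>_neg[OF k'(1)] k'(2) \<pi>_\<delta>[OF that] ..
  finally show ?thesis using that sm(7) by simp
 qed
 have \<iota>_add: "\<iota> (a \<oplus>\<^bsub>A\<^esub> b) = \<iota> a + \<iota> b" if "a \<in> carrier A" "b \<in> carrier A" for a b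
 proof -
  have "\<delta> (a \<oplus>\<^bsub>A\<^esub> b) - (\<delta> a + \<delta> b) \<in> K"
   using that by (intro diff_K) (simp_all add: \<delta>_Fin Fin_add \<pi>_add \<pi>_\<delta>)
  from g_K[OF this] show ?thesis using g_minus[of "\<delta> (a \<oplus>\<^bsub>A\<^esub> b)" "\<delta> a + \<delta> b"] by (simp add: g_add \<iota>_def)
 qed
 have \<iota>_smult: "\<iota> (c \<odot>\<^bsub>A\<^esub> a) = (\<lambda>b. c * \<iota> a b)" if "a \<in> carrier A" for a c
 proof -
  have "\<delta> (c \<odot>\<^bsub>A\<^esub> a) - (\<lambda>b. c * \<delta> a b) \<in> K"
   using that by (intro diff_K) (simp_all add: \<delta>_Fin Fin_smult \<pi>_smult \<pi>_\<delta> sm(1))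
  from g_K[OF this] show ?thesis using g_minus[of "\<delta> (c \<odot>\<^bsub>A\<^esub> a)" "\<lambda>b. c * \<delta> a b"] by (simp add: g_smult \<iota>_def)
 qed
 define P where "P v = \<pi> (h v)" for v
 have P: "P v \<in> carrier A" for v unfolding P_def by (rule \<pi>_closed[OF h(1)])
 have P_add: "P (u + v) = P u \<oplus>\<^bsub>A\<^esub> P v" for u v unfolding P_def h(3) by (rule \<pi>_add[OF h(1) h(1)])
 have P_smult: "P (\<lambda>a. c * v a) = c \<odot>\<^bsub>A\<^esub> P v" for c v unfolding P_def h(4) by (rule \<pi>_smult[OF h(1)])
 have P\<iota>: "P (\<iota> a) = a" if "a \<in> carrier A" for a using that by (simp add: P_def h \<iota>_Fin \<pi>_\<iota>)
 define T where "T x = (\<lambda>v. \<iota> (x \<otimes>\<^bsub>A\<^esub> P v))" for x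
 define H where "H x = (if x \<in> carrier A then Abs_host (T x) else 0)" for x
 have RH: "Rep_host (H x) = T x" if x: "x \<in> carrier A" for x
 proof -
  have "T x (\<lambda>a. u a + v a) = (\<lambda>a. T x u a + T x v a)" for u v
  proof -
   have "T x (u + v) = \<iota> (x \<otimes>\<^bsub>A\<^esub> P u \<oplus>\<^bsub>A\<^esub> x \<otimes>\<^bsub>A\<^esub> P v)"
    unfolding T_def P_add mult_distr[OF P P x] ..
   also have "\<dots> = T x u + T x v" unfolding T_def by (intro \<iota>_add mult_closed x P)
   finally show ?thesis by (simp only: plus_fun_def)
  qed
  moreover have "T x (\<lambda>a. c * v a) = (\<lambda>a. c * T x v a)" for c v
   unfolding T_def P_smult mult_smult_right[OF x P] by (intro \<iota>_smult mult_closed x P)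
  ultimately show ?thesis using x unfolding H_def by (simp only: if_True, intro Abs_host_inverse) blast
 qed
 have HI: "H x = h'" if "x \<in> carrier A" "!!v. T x v = Rep_host h' v" for x h'
 proof -
  have "Rep_host (H x) = Rep_host h'" unfolding RH[OF that(1)] using that(2) by (rule ext)
  then show ?thesis by (simp only: Rep_host_inject)
 qed
 have "inj_on H (carrier A)"
 proof (rule inj_onI)
  fix x y assume xy: "x \<in> carrier A" "y \<in> carrier A" and "H x = H y"
  then have eq: "T x = T y" using RH[OF xy(1)] RH[OF xy(2)] by simp
  have "x \<otimes>\<^bsub>A\<^esub> b = y \<otimes>\<^bsub>A\<^esub> b" if b: "b \<in> carrier A" for b
  proof -
   have "P (\<iota> (x \<otimes>\<^bsub>A\<^esub> P (\<iota> b))) = P (\<iota> (y \<otimes>\<^bsub>A\<^esub> P (\<iota> b)))"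
    using arg_cong[OF fun_cong[OF eq, of "\<iota> b"], of P] unfolding T_def .
   then show ?thesis
    unfolding P\<iota>[OF b] P\<iota>[OF mult_closed[OF xy(1) b]] P\<iota>[OF mult_closed[OF xy(2) b]] .
  qed
  then show "x = y" by (rule cstar_mult_faithful[OF A xy])
 qed
 moreover have "H (x \<oplus>\<^bsub>A\<^esub> y) = H x + H y" if xy: "x \<in> carrier A" "y \<in> carrier A" for x y
 proof (rule HI)
  fix v
  have c: "x \<otimes>\<^bsub>A\<^esub> P v \<in> carrier A" "y \<otimes>\<^bsub>A\<^esub> P v \<in> carrier A" using xy P mult_closed by blast+
  have "T (x \<oplus>\<^bsub>A\<^esub> y) v = \<iota> (x \<otimes>\<^bsub>A\<^esub> P v \<oplus>\<^bsub>A\<^esub> y \<otimes>\<^bsub>A\<^esub> P v)"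
   unfolding T_def using mult_distl[OF xy P] by simp
  then show "T (x \<oplus>\<^bsub>A\<^esub> y) v = Rep_host (H x + H y) v"
   unfolding \<iota>_add[OF c] plus_host.rep_eq RH[OF xy(1)] RH[OF xy(2)] by (simp add: T_def fun_eq_iff)
 qed (use xy in simp)
 moreover have "H (x \<otimes>\<^bsub>A\<^esub> y) = H x * H y" if xy: "x \<in> carrier A" "y \<in> carrier A" for x y
 proof (rule HI)
  fix v
  have c: "y \<otimes>\<^bsub>A\<^esub> P v \<in> carrier A" using xy P mult_closed by blast
  show "T (x \<otimes>\<^bsub>A\<^esub> y) v = Rep_host (H x * H y) v"
   unfolding times_host.rep_eq RH[OF xy(1)] RH[OF xy(2)] T_def P\<iota>[OF c] mult_assoc[OF xy P] ..
 qed (use xy mult_closed in simp)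
 moreover have "H (c \<odot>\<^bsub>A\<^esub> x) = c *c H x" if x: "x \<in> carrier A" for c x
 proof (rule HI)
  fix v
  have c: "x \<otimes>\<^bsub>A\<^esub> P v \<in> carrier A" using x P mult_closed by blast
  show "T (c \<odot>\<^bsub>A\<^esub> x) v = Rep_host (c *c H x) v"
   unfolding scl_host.rep_eq RH[OF x] T_def mult_smult_left[OF x P] \<iota>_smult[OF c] ..
 qed (use x sm(1) in simp)
 ultimately show ?thesis unfolding is_hosting_def by blast
qed

section \<open>C*-algebras as subsets of a complex algebra\<close>

text \<open>A C*-algebra whose elements form a subset of a ring type. Only the algebra \<open>S\<close> is complete and normed; the unit of the
ring type has no relation to \<open>S\<close>.\<close>

locale hcstar =
 fixes S :: "'h::complex_alg set" and st :: "'h => 'h" and nm :: "'h => real"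
 assumes S_0 [simp]: "0 \<in> S"
  and S_add [simp]: "x \<in> S ==> y \<in> S ==> x + y \<in> S"
  and S_mult [simp]: "x \<in> S ==> y \<in> S ==> x * y \<in> S"
  and S_scl [simp]: "x \<in> S ==> c *c x \<in> S"
  and S_st [simp]: "x \<in> S ==> st x \<in> S"
  and st_st [simp]: "x \<in> S ==> st (st x) = x"
  and st_add: "x \<in> S ==> y \<in> S ==> st (x + y) = st x + st y"
  and st_scl: "x \<in> S ==> st (c *c x) = (cnj c) *c st x"
  and st_mult: "x \<in> S ==> y \<in> S ==> st (x * y) = st y * st x"
  and nm_nonneg [simp]: "x \<in> S ==> 0 <= nm x"
  and nm_eq_0: "x \<in> S ==> nm x = 0 \<longleftrightarrow> x = 0"
  and nm_add: "x \<in> S ==> y \<in> S ==> nm (x + y) <= nm x + nm y"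
  and nm_scl: "x \<in> S ==> nm (c *c x) = cmod c * nm x"
  and nm_mult: "x \<in> S ==> y \<in> S ==> nm (x * y) <= nm x * nm y"
  and nm_cstar: "x \<in> S ==> nm (st x * x) = (nm x)\<^sup>2"
  and S_complete: "(!!n. X n \<in> S) ==> (!!d. 0 < d ==> \<exists>N. \<forall>m\<ge>N. \<forall>n\<ge>N. nm (X m - X n) < d)
   ==> \<exists>x\<in>S. (\<lambda>n. nm (X n - x)) \<longlonglongrightarrow> 0"
begin

lemma S_minus [simp]: "x \<in> S ==> - x \<in> S"
 using S_scl[of x "-1"] by (simp add:)
lemma S_diff [simp]: "x \<in> S ==> y \<in> S ==> x - y \<in> S"
 using S_add[of x "- y"] by simp
lemma S_sum [simp]: "(!!i. i \<in> I ==> f i \<in> S) ==> sum f I \<in> S"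
 by (induction I rule: infinite_finite_induct) auto

lemma st_0 [simp]: "st 0 = 0"
 using st_scl[of 0 0] by simp
lemma st_minus: "x \<in> S ==> st (- x) = - st x"
 using st_scl[of x "-1"] by (simp add:)
lemma st_diff: "x \<in> S ==> y \<in> S ==> st (x - y) = st x - st y"
 using st_add[of x "- y"] by (simp add: st_minus)
lemma st_sum: "(!!i. i \<in> I ==> f i \<in> S) ==> st (sum f I) = (\<Sum>i\<in>I. st (f i))"
 by (induction I rule: infinite_finite_induct) (auto simp: st_add)

lemma nm_0 [simp]: "nm 0 = 0" by (simp add: nm_eq_0)
lemma nm_minus [simp]: "x \<in> S ==> nm (- x) = nm x"
 using nm_scl[of x "-1"] by (simp add:)
lemma nm_diff_commute: "x \<in> S ==> y \<in> S ==> nm (x - y) = nm (y - x)"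
 using nm_minus[of "x - y"] by simp
lemma nm_diff: "x \<in> S ==> y \<in> S ==> nm (x - y) <= nm x + nm y"
 using nm_add[of x "- y"] by simp
lemma nm_diff_triangle: "x \<in> S ==> y \<in> S ==> z \<in> S ==> nm (x - z) <= nm (x - y) + nm (y - z)"
 using nm_add[of "x - y" "y - z"] by simp
lemma nm_sum: "(!!i. i \<in> I ==> f i \<in> S) ==> nm (sum f I) <= (\<Sum>i\<in>I. nm (f i))"
proof (induction I rule: infinite_finite_induct)
 case (insert i I)
 then have "nm (sum f (insert i I)) <= nm (f i) + nm (sum f I)" by (simp add: nm_add)
 then show ?case using insert by fastforce
qed auto
lemma nm_mult_le: "x \<in> S ==> y \<in> S ==> nm x <= a ==> nm y <= b ==> nm (x * y) <= a * b"
 using nm_mult[of x y] mult_mono[of "nm x" a "nm y" b] nm_nonneg[of x] nm_nonneg[of y] by linarith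
lemma nm_st [simp]: "x \<in> S ==> nm (st x) = nm x"
proof -
 have le: "nm x <= nm (st x)" if x: "x \<in> S" for x
 proof (cases "nm x = 0")
  case False
  then have "0 < nm x" using x nm_nonneg[of x] by linarith
  moreover have "nm x * nm x <= nm (st x) * nm x"
   using nm_cstar[OF x] nm_mult[of "st x" x] x by (simp add: power2_eq_square)
  ultimately show ?thesis by simp
 qed (use x in simp)
 assume "x \<in> S"
 then show ?thesis using le[of x] le[of "st x"] by simp
qed

lemma proj_nm_le_1: "p \<in> S ==> p * p = p ==> st p = p ==> nm p <= 1"
 using nm_cstar[of p] nm_nonneg[of p] by (auto simp: power2_eq_square)

definition conv :: "(nat => 'h) => 'h => bool" where
 "conv X x \<longleftrightarrow> x \<in> S & (\<forall>n. X n \<in> S) & (\<lambda>n. nm (X n - x)) \<longlonglongrightarrow> 0"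

lemma conv_const: "x \<in> S ==> conv (\<lambda>n. x) x"
 by (simp add: conv_def)
lemma conv_Suc: "conv X x ==> conv (\<lambda>n. X (Suc n)) x"
 unfolding conv_def using LIMSEQ_Suc by blast
lemma conv_unique: assumes "conv X x" "conv X y" shows "x = y"
proof -
 have "(\<lambda>n. nm (X n - x) + nm (X n - y)) \<longlonglongrightarrow> 0 + 0"
  using assms by (intro tendsto_add) (auto simp: conv_def)
 moreover have "nm (x - y) <= nm (X n - x) + nm (X n - y)" for n
  using assms nm_diff_triangle[of x "X n" y] nm_diff_commute[of x "X n"] by (auto simp: conv_def)
 ultimately have "nm (x - y) <= 0 + 0" by (intro tendsto_lowerbound[where F = sequentially]) auto
 moreover have c: "x - y \<in> S" using assms by (auto simp: conv_def)
 ultimately have "nm (x - y) = 0" using nm_nonneg[OF c] by linarith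
 then show ?thesis using nm_eq_0[OF c] by simp
qed
lemma conv_bound: assumes "x \<in> S" "!!n. X n \<in> S" "!!n. nm (X n - x) <= f n" "f \<longlonglongrightarrow> 0" shows "conv X x"
proof -
 have "(\<lambda>n. nm (X n - x)) \<longlonglongrightarrow> 0"
  by (rule real_tendsto_sandwich[of "\<lambda>n. 0" _ sequentially f]) (use assms in \<open>simp_all add: eventually_sequentially\<close>)
 then show ?thesis using assms by (simp add: conv_def)
qed
lemma conv_add: assumes "conv X x" "conv Y y" shows "conv (\<lambda>n. X n + Y n) (x + y)"
proof (rule conv_bound)
 show "(\<lambda>n. nm (X n - x) + nm (Y n - y)) \<longlonglongrightarrow> 0"
  using assms tendsto_add[of "\<lambda>n. nm (X n - x)" 0 sequentially "\<lambda>n. nm (Y n - y)" 0] by (simp add: conv_def)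
 show "nm (X n + Y n - (x + y)) <= nm (X n - x) + nm (Y n - y)" for n
  using assms nm_add[of "X n - x" "Y n - y"] by (simp add: conv_def algebra_simps)
qed (use assms in \<open>auto simp: conv_def\<close>)
lemma conv_scl: assumes "conv X x" shows "conv (\<lambda>n. c *c X n) (c *c x)"
proof (rule conv_bound)
 show "(\<lambda>n. cmod c * nm (X n - x)) \<longlonglongrightarrow> 0"
  using assms tendsto_mult_left[of "\<lambda>n. nm (X n - x)" 0] by (simp add: conv_def)
 show "nm (c *c X n - c *c x) <= cmod c * nm (X n - x)" for n
  using assms by (simp add: conv_def nm_scl flip: scl_diff_right)
qed (use assms in \<open>auto simp: conv_def\<close>)
lemma conv_diff: "conv X x ==> conv Y y ==> conv (\<lambda>n. X n - Y n) (x - y)"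
 using conv_add[OF _ conv_scl, of X x Y y "-1"] by (simp add:)
lemma conv_st: assumes "conv X x" shows "conv (\<lambda>n. st (X n)) (st x)"
 using assms by (simp add: conv_def flip: st_diff)
lemma conv_mult: assumes "conv X x" "conv Y y" shows "conv (\<lambda>n. X n * Y n) (x * y)"
proof (rule conv_bound)
 let ?f = "\<lambda>n. nm (X n - x) * (nm (Y n - y) + nm y) + nm x * nm (Y n - y)"
 have "?f \<longlonglongrightarrow> 0 * (0 + nm y) + nm x * 0"
  using assms by (intro tendsto_intros) (auto simp: conv_def)
 then show "?f \<longlonglongrightarrow> 0" by simp
 fix n
 have c: "X n \<in> S" "x \<in> S" "Y n \<in> S" "y \<in> S" using assms by (auto simp: conv_def)
 have "X n * Y n - x * y = (X n - x) * Y n + x * (Y n - y)" by (simp add: algebra_simps)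
 moreover have "nm (Y n) <= nm (Y n - y) + nm y" using nm_add[of "Y n - y" y] c by simp
 moreover have "nm ((X n - x) * Y n + x * (Y n - y)) <= nm ((X n - x) * Y n) + nm (x * (Y n - y))"
  using c by (intro nm_add) auto
 ultimately show "nm (X n * Y n - x * y) <= ?f n"
  using c nm_mult_le[of "X n - x" "Y n" _ "nm (Y n - y) + nm y"] nm_mult[of x "Y n - y"] by fastforce
qed (use assms in \<open>auto simp: conv_def\<close>)
lemma conv_nm_le: assumes "conv X x" "!!n. nm (X n - y) <= c" "y \<in> S" shows "nm (x - y) <= c"
proof -
 have "(\<lambda>n. nm (X n - x) + c) \<longlonglongrightarrow> 0 + c"
  using assms by (intro tendsto_intros) (auto simp: conv_def)
 moreover have "nm (x - y) <= nm (X n - x) + c" for n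
  using assms(1,3) assms(2)[of n] nm_diff_triangle[of x "X n" y] nm_diff_commute[of x "X n"] by (auto simp: conv_def)
 ultimately show ?thesis using tendsto_lowerbound[of _ "0 + c" sequentially] by auto
qed

lemma conv_exists:
 assumes X: "!!n. X n \<in> S" and d: "!!n. nm (X (Suc n) - X n) <= \<alpha> (Suc n) - \<alpha> n" and \<alpha>: "convergent \<alpha>"
 shows "\<exists>x. conv X x"
proof -
 have le: "nm (X (n + k) - X n) <= \<alpha> (n + k) - \<alpha> n" for n k
 proof (induction k)
  case (Suc k)
  then show ?case using nm_diff_triangle[of "X (n + Suc k)" "X (n + k)" "X n"] d[of "n + k"] X by simp
 qed simp
 have le: "nm (X m - X n) <= \<bar>\<alpha> m - \<alpha> n\<bar>" for m n
 proof (cases "n <= m")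
  case True
  then show ?thesis using le[of n "m - n"] by simp
 next
  case False
  then show ?thesis using le[of m "n - m"] nm_diff_commute[OF X X, of m n] by simp
 qed
 have "Cauchy \<alpha>" using \<alpha> by (simp add: Cauchy_convergent_iff)
 then have "\<exists>N. \<forall>m\<ge>N. \<forall>n\<ge>N. \<bar>\<alpha> m - \<alpha> n\<bar> < d" if "0 < d" for d
  using that unfolding Cauchy_def dist_real_def by blast
 then have "\<exists>N. \<forall>m\<ge>N. \<forall>n\<ge>N. nm (X m - X n) < d" if "0 < d" for d
  using that le by (meson order_le_less_trans)
 from S_complete[OF X this] X show ?thesis unfolding conv_def by blast
qed

text \<open>The element \<open>1 - v\<close> is a square root of \<open>1 - w\<close>. The iteration \<open>v := (w + v * v) / 2\<close>
converges because its increments are dominated by those of the same iteration for real numbers, which is monotone and bounded.\<close>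

lemma sqrt_exists:
 assumes w: "w \<in> S" "nm w <= 1"
 shows "\<exists>v\<in>S. v + v = w + v * v & nm v <= 1 & (st w = w --> st v = v) & (\<forall>z\<in>S. z * w = w * z --> z * v = v * z)"
proof -
 define V where "V = rec_nat 0 (\<lambda>_ v. (1/2) *c (w + v * v))"
 have V0: "V 0 = 0" and VS: "V (Suc n) = (1/2) *c (w + V n * V n)" for n by (simp_all add: V_def)
 define \<alpha> :: "nat => real" where "\<alpha> = rec_nat 0 (\<lambda>_ a. (1 + a\<^sup>2) / 2)"
 have \<alpha>0: "\<alpha> 0 = 0" and \<alpha>S: "\<alpha> (Suc n) = (1 + (\<alpha> n)\<^sup>2) / 2" for n by (simp_all add: \<alpha>_def)
 have \<alpha>: "0 <= \<alpha> n" "\<alpha> n <= 1" for n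
  by (induction n) (auto simp: \<alpha>0 \<alpha>S power_le_one)
 have "\<alpha> (Suc n) - \<alpha> n = (1 - \<alpha> n)\<^sup>2 / 2" for n by (simp add: \<alpha>S power2_eq_square field_simps)
 then have inc: "\<alpha> n <= \<alpha> (Suc n)" for n by (metis diff_ge_0_iff_ge divide_nonneg_nonneg zero_le_numeral zero_le_power2)
 have conv\<alpha>: "convergent \<alpha>"
  using inc \<alpha> by (intro Bseq_mono_convergent BseqI'[of _ 1]) (auto simp: incseq_Suc_iff intro: lift_Suc_mono_le[of \<alpha>])
 have VS_in: "V n \<in> S" for n by (induction n) (auto simp: V0 VS w)
 have nmV: "nm (V n) <= \<alpha> n" for n
 proof (induction n)
  case (Suc n)
  have "nm (V n * V n) <= (\<alpha> n)\<^sup>2" using nm_mult_le[OF VS_in VS_in Suc Suc] by (simp add: power2_eq_square)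
  then show ?case using nm_add[of w "V n * V n"] w VS_in by (simp add: VS \<alpha>S nm_scl)
 qed (simp add: V0 \<alpha>0)
 have dV: "nm (V (Suc n) - V n) <= \<alpha> (Suc n) - \<alpha> n" for n
 proof (induction n)
  case 0
  then show ?case using nmV[of 1] by (simp add: V0 \<alpha>0)
 next
  case (Suc n)
  let ?d = "V (Suc n) - V n"
  have "V (Suc (Suc n)) - V (Suc n) = (1/2) *c (V (Suc n) * ?d + ?d * V n)"
   unfolding VS[of "Suc n"] VS[of n, symmetric] by (subst (3) VS) (simp add: algebra_simps scl_simps)
  moreover have "nm (V (Suc n) * ?d + ?d * V n) <= \<alpha> (Suc n) * (\<alpha> (Suc n) - \<alpha> n) + (\<alpha> (Suc n) - \<alpha> n) * \<alpha> n"
   using nm_add[of "V (Suc n) * ?d" "?d * V n"] VS_in nmV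
    nm_mult_le[of "V (Suc n)" ?d _ _, OF _ _ nmV Suc] nm_mult_le[of ?d "V n" _ _, OF _ _ Suc nmV] by force
  moreover have "\<alpha> (Suc (Suc n)) - \<alpha> (Suc n) = (\<alpha> (Suc n) * (\<alpha> (Suc n) - \<alpha> n) + (\<alpha> (Suc n) - \<alpha> n) * \<alpha> n) / 2"
  proof -
   have "\<alpha> (Suc (Suc n)) - \<alpha> (Suc n) = (1 + (\<alpha> (Suc n))\<^sup>2) / 2 - (1 + (\<alpha> n)\<^sup>2) / 2"
    using \<alpha>S[of "Suc n"] \<alpha>S[of n] by linarith
   also have "\<dots> = (\<alpha> (Suc n) * (\<alpha> (Suc n) - \<alpha> n) + (\<alpha> (Suc n) - \<alpha> n) * \<alpha> n) / 2"
    by (simp add: power2_eq_square field_simps)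
   finally show ?thesis .
  qed
  ultimately show ?case using VS_in by (simp add: nm_scl)
 qed
 obtain v where v: "conv V v" using conv_exists[OF VS_in dV conv\<alpha>] by blast
 then have vS: "v \<in> S" by (simp add: conv_def)
 have "conv (\<lambda>n. V (Suc n)) ((1/2) *c (w + v * v))"
  using conv_scl[OF conv_add[OF conv_const[OF w(1)] conv_mult[OF v v]], of "1/2"] by (simp only: VS)
 then have "v = (1/2) *c (w + v * v)" by (rule conv_unique[OF conv_Suc[OF v]])
 then have "v + v = (1/2) *c (w + v * v) + (1/2) *c (w + v * v)" by (rule arg_cong2[where f = plus]) fact
 then have "v + v = (1/2) *c ((w + v * v) + (w + v * v))" by (simp only: scl_add_right)
 then have "v + v = w + v * v" by (simp only: scl_half)
 moreover have "nm (v - 0) <= 1"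
  by (rule conv_nm_le[OF v]) (use order.trans[OF nmV \<alpha>(2)] in simp_all)
 then have "nm v <= 1" by simp
 moreover have "st v = v" if "st w = w"
 proof -
  have "st (V n) = V n" for n
   by (induction n) (simp_all add: V0 VS st_scl st_add st_mult VS_in w that)
  then have "conv V (st v)" using conv_st[OF v] by simp
  from conv_unique[OF this v] show ?thesis .
 qed
 moreover have "z * v = v * z" if z: "z \<in> S" "z * w = w * z" for z
 proof -
  have "z * V n = V n * z" for n
  proof (induction n)
   case (Suc n)
   have "z * V (Suc n) = (1/2) *c (z * w + z * V n * V n)" by (simp add: VS distrib_left mult.assoc)
   also have "\<dots> = (1/2) *c (w * z + V n * (z * V n))" using z Suc by (simp add: mult.assoc)
   also have "\<dots> = V (Suc n) * z" using Suc by (simp add: VS scl_simps distrib_right mult.assoc)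
   finally show ?case .
  qed (simp add: V0)
  then have "conv (\<lambda>n. z * V n) (v * z)" using conv_mult[OF v conv_const[OF z(1)]] by simp
  from conv_unique[OF conv_mult[OF conv_const[OF z(1)] v] this] show ?thesis .
 qed
 ultimately show ?thesis using vS by blast
qed

lemma sa_power:
 assumes "h \<in> S" "st h = h" shows "h ^ Suc n \<in> S & st (h ^ Suc n) = h ^ Suc n"
proof (induction n)
 case (Suc n)
 then show ?case using assms by (simp add: st_mult power_commutes mult.assoc)
qed (use assms in simp)

lemma sa_nm_power:
 assumes "h \<in> S" "st h = h" shows "nm (h ^ (2 ^ n)) = nm h ^ (2 ^ n)"
proof (induction n)
 case (Suc n)
 obtain k where k: "(2::nat) ^ n = Suc k" by (metis not0_implies_Suc power_not_zero zero_neq_numeral)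
 have x: "h ^ (2 ^ n) \<in> S" "st (h ^ (2 ^ n)) = h ^ (2 ^ n)" using sa_power[OF assms, of k] k by simp_all
 have "nm (h ^ (2 ^ Suc n)) = nm (st (h ^ (2 ^ n)) * h ^ (2 ^ n))" by (simp add: x flip: power_add mult_2)
 also have "\<dots> = (nm h ^ (2 ^ n))\<^sup>2" using nm_cstar[OF x(1)] Suc by simp
 also have "\<dots> = nm h ^ (2 ^ Suc n)" by (simp add: mult.commute flip: power_mult)
 finally show ?case .
qed simp

end

lemma real_le_of_pow2:
 fixes a b K :: real assumes "0 <= b" "!!n. a ^ (2 ^ n) <= K * b ^ (2 ^ n)" shows "a <= b"
proof (rule ccontr)
 assume "\<not> a <= b"
 then have ab: "b < a" "0 < a" using assms by auto
 show False
 proof (cases "b = 0")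
  case True
  then show False using assms(2)[of 0] ab by simp
 next
  case False
  then have b: "0 < b" using assms by simp
  define q where "q = a / b"
  have q: "1 < q" using ab b by (simp add: q_def)
  have "q ^ (2 ^ n) <= K" for n
   using assms(2)[of n] b by (simp add: q_def power_divide divide_le_eq)
  moreover obtain n where "K < q ^ n" using real_arch_pow[OF q] by blast
  moreover have "q ^ n <= q ^ (2 ^ n)" using q by (intro power_increasing) (auto simp: less_imp_le)
  ultimately show False by (meson not_le order_trans)
 qed
qed

locale hcstar1 = hcstar S st nm for S :: "'h::complex_alg set" and st nm +
 fixes e :: 'h
 assumes e_S [simp]: "e \<in> S" and e_left [simp]: "x \<in> S ==> e * x = x" and e_right [simp]: "x \<in> S ==> x * e = x"
begin

lemma st_e [simp]: "st e = e"
 using st_mult[of e "st e"] by simp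
lemma nm_e: "nm e <= 1"
 by (intro proj_nm_le_1) simp_all

text \<open>The element \<open>u = a + i b\<close> satisfies \<open>u\<^sup>* u = a\<^sup>2 + b\<^sup>2\<close>, so its norm is known, and \<open>a\<close> is its
real part. This replaces the spectral theorem below.\<close>

lemma nm_le_of_sum_of_squares:
 assumes a: "a \<in> S" "st a = a" and b: "b \<in> S" "st b = b" and ab: "a * b = b * a"
  and eq: "a * a + b * b = (of_real ka) *c e" and ka: "0 <= ka"
 shows "(nm a)\<^sup>2 <= ka"
proof -
 define u where "u = a + \<i> *c b"
 have u: "u \<in> S" using a b by (simp add: u_def)
 have stu: "st u = a - \<i> *c b" using a b by (simp add: u_def st_add st_scl)
 have "st u * u = a * a + \<i> *c (a * b) - \<i> *c (b * a) - \<i> *c (\<i> *c (b * b))"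
  unfolding stu by (simp add: u_def algebra_simps scl_simps)
 also have "\<dots> = a * a + b * b" by (simp add: ab)
 finally have "(nm u)\<^sup>2 = nm ((of_real ka) *c e)" using nm_cstar[OF u] eq by simp
 also have "\<dots> <= ka" using nm_e ka by (simp add: nm_scl mult_left_le)
 finally have nmu: "(nm u)\<^sup>2 <= ka" .
 have "u + st u = a + a" unfolding stu by (simp add: u_def)
 then have "nm a = nm ((1/2) *c (u + st u))" by (simp only: scl_half)
 also have "\<dots> = nm (u + st u) / 2" using u nm_scl[of "u + st u" "1/2"] by simp
 also have "\<dots> <= nm u" using nm_add[of u "st u"] u by simp
 finally show ?thesis using nmu power_mono[of "nm a" "nm u" 2] a by simp
qed

lemma neumann:
 assumes z: "z \<in> S" "nm z < 1"
 shows "\<exists>y\<in>S. (e - z) * y = e & y * (e - z) = e"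
proof -
 define Y where "Y = rec_nat 0 (\<lambda>_ y. e + z * y)"
 have Y0: "Y 0 = 0" and YS: "Y (Suc n) = e + z * Y n" for n by (simp_all add: Y_def)
 have Y_S: "Y n \<in> S" for n by (induction n) (simp_all add: Y0 YS z)
 define \<alpha> where "\<alpha> n = (1 - nm z ^ n) / (1 - nm z)" for n
 have d: "nm (Y (Suc n) - Y n) <= nm z ^ n" for n
 proof (induction n)
  case 0
  then show ?case using nm_e by (simp add: Y0 YS)
 next
  case (Suc n)
  have "Y (Suc (Suc n)) - Y (Suc n) = z * (Y (Suc n) - Y n)" 
   unfolding YS[of "Suc n"] by (subst (2) YS) (simp add: algebra_simps)
  then show ?case using nm_mult_le[OF z(1) _ order.refl Suc] Y_S by simp
 qed
 have "\<alpha> (Suc n) - \<alpha> n = nm z ^ n" for n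
 proof -
  have "(1 - nm z ^ Suc n) - (1 - nm z ^ n) = nm z ^ n * (1 - nm z)" by (simp add: algebra_simps)
  then show ?thesis using z by (simp add: \<alpha>_def flip: diff_divide_distrib)
 qed
 moreover have "convergent \<alpha>"
 proof -
  have "(\<lambda>n. (1 - nm z ^ n) / (1 - nm z)) \<longlonglongrightarrow> (1 - 0) / (1 - nm z)"
   using z by (intro tendsto_intros LIMSEQ_realpow_zero) auto
  then show ?thesis unfolding \<alpha>_def convergent_def by blast
 qed
 ultimately obtain y where y: "conv Y y" using conv_exists[of Y, where \<alpha> = \<alpha>] Y_S d by auto
 then have yS: "y \<in> S" by (simp add: conv_def)
 have "conv (\<lambda>n. Y (Suc n)) (e + z * y)" 
  using conv_add[OF conv_const[OF e_S] conv_mult[OF conv_const[OF z(1)] y]] by (simp only: YS)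
 then have eq: "y = e + z * y" by (rule conv_unique[OF conv_Suc[OF y]])
 have "Y n * z = z * Y n" for n
 proof (induction n)
  case (Suc n)
  then show ?case using z Y_S by (simp add: YS algebra_simps)
 qed (simp add: Y0)
 then have "conv (\<lambda>n. Y n * z) (z * y)" using conv_mult[OF conv_const[OF z(1)] y] by simp
 from conv_unique[OF conv_mult[OF y conv_const[OF z(1)]] this] have "y * z = z * y" .
 moreover have "y - z * y = e" 
  using arg_cong[OF eq, of "\<lambda>t. t - z * y"] by (simp only: add_diff_cancel_right')
 ultimately have "(e - z) * y = e & y * (e - z) = e" using yS by (simp add: left_diff_distrib right_diff_distrib)
 then show ?thesis using yS by blast
qed

lemma inverse_commutes:
 assumes "x \<in> S" "y \<in> S" "x * y = e" "y * x = e" "z \<in> S" "z * x = x * z"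
 shows "z * y = y * z"
proof -
 have "z * y = (y * x) * (z * y)" using assms by simp
 also have "\<dots> = y * (x * z) * y" by (simp only: mult.assoc)
 also have "\<dots> = y * (z * x) * y" using assms by simp
 also have "\<dots> = (y * z) * (x * y)" by (simp only: mult.assoc)
 also have "\<dots> = y * z" using assms by simp
 finally show ?thesis .
qed

lemma inverse_sa:
 assumes "x \<in> S" "y \<in> S" "x * y = e" "y * x = e" "st x = x"
 shows "st y = y"
proof -
 have "st y * x = e" using st_mult[of x y] assms by simp
 then have "st y * x * y = y" using assms by simp
 then have "st y * (x * y) = y" by (simp only: mult.assoc)
 then show ?thesis using assms by simp
qed

lemma sqrt_one_minus_square:
 assumes h: "h \<in> S" "st h = h" "nm h <= 1"
 shows "\<exists>b\<in>S. st b = b & b * b = e - h * h & nm (e - b) <= 1 & nm b <= 1 & (\<forall>z\<in>S. z * (h * h) = h * h * z --> z * b = b * z)"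
proof -
 have w: "h * h \<in> S" "nm (h * h) <= 1" using h nm_mult_le[OF h(1) h(1) h(3) h(3)] by auto
 obtain v where v: "v \<in> S" "v + v = h * h + v * v" "nm v <= 1" "st v = v" "\<forall>z\<in>S. z * (h * h) = h * h * z --> z * v = v * z"
  using sqrt_exists[OF w] st_mult[OF h(1) h(1)] unfolding h(2) by blast
 define b where "b = e - v"
 have b: "b \<in> S" "st b = b" using v by (simp_all add: b_def st_diff)
 have "b * b = e - (v + v) + v * v" using v by (simp add: b_def algebra_simps)
 also have "\<dots> = e - h * h" by (simp only: v(2)) simp
 finally have bb: "b * b = e - h * h" .
 have comm: "\<forall>z\<in>S. z * (h * h) = h * h * z --> z * b = b * z" using v by (auto simp: b_def algebra_simps)
 have "(nm b)\<^sup>2 <= 1"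
  using comm h b bb by (intro nm_le_of_sum_of_squares[of b h]) (auto simp: mult.assoc)
 then have "nm b <= 1" using b by (simp add: abs_square_le_1)
 moreover have "nm (e - b) <= 1" using v by (simp add: b_def)
 ultimately show ?thesis using b bb comm by blast
qed

text \<open>Invertibility bounds \<open>1 - h\<^sup>2\<close> below by the positive number \<open>c = 1 / (1 + nm y)\<close>. The bound takes the form of
a square \<open>d\<^sup>2 = 1 - h\<^sup>2 - c\<close>, which gives \<open>(nm h)\<^sup>2 <= 1 - c\<close>.\<close>

lemma nm_less_1:
 assumes h: "h \<in> S" "st h = h" "nm h <= 1" and y: "y \<in> S" "(e - h * h) * y = e" "y * (e - h * h) = e"
 shows "nm h < 1"
proof -
 obtain b where b: "b \<in> S" "st b = b" "b * b = e - h * h" "\<forall>z\<in>S. z * (h * h) = h * h * z --> z * b = b * z"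
  using sqrt_one_minus_square[OF h] by blast
 have ehh: "e - h * h \<in> S" using h by simp
 have y_comm: "z * y = y * z" if "z \<in> S" "z * (h * h) = h * h * z" for z
  using that h by (intro inverse_commutes[OF ehh y]) (simp_all add: algebra_simps)
 have hb: "h * b = b * h" using b h by (simp add: mult.assoc)
 have hy: "h * y = y * h" using y_comm[of h] h by (simp add: mult.assoc)
 have yb: "b * y = y * b" using b h y_comm by (metis mult.assoc hb)
 have sty: "st y = y" using inverse_sa[OF ehh y] h by (simp add: st_diff st_mult)
 define c where "c = 1 / (1 + nm y)"
 have c: "0 < c" "c <= 1" "c * nm y <= 1" using nm_nonneg[OF y(1)] by (auto simp: c_def field_simps)
 define w where "w = (of_real c) *c y"
 have w: "w \<in> S" "nm w <= 1" "st w = w" using y c sty by (simp_all add: w_def nm_scl st_scl)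
 obtain v where v: "v \<in> S" "v + v = w + v * v" "st v = v" "\<forall>z\<in>S. z * w = w * z --> z * v = v * z"
  using sqrt_exists[OF w(1,2)] w(3) by blast
 have vb: "b * v = v * b" and vh: "h * v = v * h"
  using v(4) b(1) h(1) yb hy by (simp_all add: w_def mult.assoc)
 define d where "d = b * (e - v)"
 have d: "d \<in> S" using b v by (simp add: d_def)
 have std: "st d = d" using b v vb by (simp add: d_def st_mult st_diff algebra_simps)
 have hd: "h * d = d * h"
  using b v h hb vh by (simp add: d_def algebra_simps) (metis mult.assoc)
 have ev: "(e - v) * b = b * (e - v)" using b v vb by (simp add: algebra_simps)
 have "d * d = b * ((e - v) * b) * (e - v)" by (simp add: d_def mult.assoc)
 also have "\<dots> = (b * b) * ((e - v) * (e - v))" by (simp add: ev mult.assoc)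
 also have "(e - v) * (e - v) = e - (v + v) + v * v" using v by (simp add: algebra_simps)
 also have "\<dots> = e - w" by (simp only: v(2)) simp
 also have "b * b * (e - w) = e - h * h - (of_real c) *c ((e - h * h) * y)"
  unfolding b(3) w_def using ehh by (simp add: right_diff_distrib scl_simps)
 finally have "d * d = e - h * h - (of_real c) *c e" using y by simp
 then have "h * h + d * d = (of_real (1 - c)) *c e" by (simp add: scl_simps algebra_simps)
 from nm_le_of_sum_of_squares[OF h(1,2) d std hd this] c have "(nm h)\<^sup>2 <= 1 - c" by simp
 then have "(nm h)\<^sup>2 < 1\<^sup>2" using c by simp
 then show ?thesis by (rule power_less_imp_less_base) simp
qed

end

section \<open>Projections near self-adjoint elements\<close>

context hcstar begin

lemma nm_add_le: "x \<in> S ==> y \<in> S ==> nm x <= a ==> nm y <= b ==> nm (x + y) <= a + b"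
 using nm_add[of x y] by linarith
lemma nm_diff_le: "x \<in> S ==> y \<in> S ==> nm x <= a ==> nm y <= b ==> nm (x - y) <= a + b"
 using nm_diff[of x y] by linarith

text \<open>Newton's iteration \<open>x := 3 x\<^sup>2 - 2 x\<^sup>3\<close> converges quadratically to a projection. All iterates are
polynomials in \<open>k\<close> without constant term, so whatever annihilates \<open>k\<close> annihilates the limit. This
exact statement about annihilators is what makes the matrix units constructed later exact.\<close>

lemma almost_idempotent:
 assumes k: "k \<in> S" "st k = k" and \<eta>: "nm (k * k - k) <= \<eta>" "\<eta> <= 1/20" and nmk: "nm k <= 3/2"
 shows "\<exists>p\<in>S. p * p = p & st p = p & nm (p - k) <= 10 * \<eta> & (\<forall>z\<in>S. z * k = 0 --> z * p = 0)"
proof -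
 \<comment> \<open>This is \<open>3 x\<^sup>2 - 2 x\<^sup>3\<close>, written so that its distance from \<open>x\<close> is visible.\<close>
 define F where "F x = (let d = x * x - x in x + d - (x * d + x * d))" for x :: 'h
 define K where "K = rec_nat k (\<lambda>_. F)"
 have K0: "K 0 = k" and KS: "K (Suc n) = F (K n)" for n by (simp_all add: K_def)
 define D where "D n = K n * K n - K n" for n
 have KS': "K (Suc n) - K n = D n - (K n * D n + K n * D n)" for n
  by (simp add: KS F_def Let_def D_def)
 have D_Suc: "D (Suc n) = D n * (D n * (D n + D n + D n + D n)) - D n * (D n + D n + D n)" for n
  by (simp add: D_def KS F_def Let_def algebra_simps)
 have KS_in: "K n \<in> S" for n using k by (induction n) (simp_all add: K0 KS F_def Let_def)
 have D_in: "D n \<in> S" for n using KS_in by (simp add: D_def)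
 define \<alpha> where "\<alpha> n = 10 * \<eta> * (1 - 1 / 2 ^ n)" for n :: nat
 have \<eta>0: "0 <= \<eta>" using \<eta>(1) nm_nonneg[OF D_in[of 0]] by (simp add: D_def K0)
 have step: "\<alpha> (Suc n) - \<alpha> n = 5 * (\<eta> / 2 ^ n)" for n by (simp add: \<alpha>_def field_simps)
 have \<alpha>_le: "\<alpha> n <= 1/2" for n
 proof -
  have "\<eta> * (1 - 1 / 2 ^ n) <= \<eta> * 1" using \<eta>0 by (intro mult_left_mono) auto
  then show ?thesis using \<eta>(2) unfolding \<alpha>_def by linarith
 qed
 have main: "nm (D n) <= \<eta> / 2 ^ n & nm (K n - k) <= \<alpha> n & nm (K (Suc n) - K n) <= 5 * (\<eta> / 2 ^ n)" for n
 proof (induction n)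
  have diff: "nm (K (Suc n) - K n) <= 5 * (\<eta> / 2 ^ n)" if "nm (D n) <= \<eta> / 2 ^ n" "nm (K n - k) <= \<alpha> n" for n
  proof -
   have "nm (K n) <= 2" using nm_add[of "K n - k" k] KS_in k that(2) \<alpha>_le[of n] nmk by simp
   then have "nm (K n * D n) <= 2 * (\<eta> / 2 ^ n)" using KS_in D_in that(1) by (intro nm_mult_le) auto
   moreover have "nm (K (Suc n) - K n) <= nm (D n) + (nm (K n * D n) + nm (K n * D n))"
    unfolding KS' by (intro nm_diff_le nm_add_le order.refl S_add S_mult D_in KS_in)
   ultimately show ?thesis using that(1) by linarith
  qed
  {
   case 0
   have "nm (D 0) <= \<eta> / 2 ^ 0" "nm (K 0 - k) <= \<alpha> 0" using \<eta>(1) by (simp_all add: D_def K0 \<alpha>_def)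
   then show ?case using diff by blast
  next
   case (Suc n)
   let ?d = "nm (D n)"
   have d: "0 <= ?d" "?d <= 1/20"
   proof -
    have "\<eta> / 2 ^ n <= \<eta>" using \<eta>0 by (simp add: divide_le_eq mult_le_cancel_left1)
    then show "?d <= 1/20" using Suc \<eta>(2) by linarith
   qed (use D_in in simp)
   have "nm (D n + D n + D n + D n) <= ?d + ?d + ?d + ?d"
    by (intro nm_add_le order.refl S_add D_in)
   then have "nm (D n + D n + D n + D n) <= 4 * ?d" by linarith
   then have "nm (D n * (D n * (D n + D n + D n + D n))) <= ?d * (?d * (4 * ?d))"
    using D_in by (intro nm_mult_le) auto
   moreover have "nm (D n + D n + D n) <= ?d + ?d + ?d"
    by (intro nm_add_le order.refl S_add D_in)
   then have "nm (D n + D n + D n) <= 3 * ?d" by linarith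
   then have "nm (D n * (D n + D n + D n)) <= ?d * (3 * ?d)"
    using D_in by (intro nm_mult_le) auto
   moreover have "nm (D (Suc n)) <= nm (D n * (D n * (D n + D n + D n + D n))) + nm (D n * (D n + D n + D n))"
    unfolding D_Suc using D_in by (intro nm_diff) auto
   moreover have "?d * (?d * (4 * ?d)) <= ?d * (1/20 * (4 * (1/20)))" using d by (intro mult_left_mono mult_mono) auto
   moreover have "?d * (3 * ?d) <= ?d * (3 * (1/20))" using d by (intro mult_left_mono) auto
   ultimately have "nm (D (Suc n)) <= ?d / 2" using d by linarith
   moreover have "nm (K (Suc n) - k) <= \<alpha> (Suc n)"
    using nm_diff_triangle[OF KS_in[of "Suc n"] KS_in[of n] k(1)] Suc step[of n] by linarith
   ultimately have "nm (D (Suc n)) <= \<eta> / 2 ^ Suc n" "nm (K (Suc n) - k) <= \<alpha> (Suc n)" using Suc by auto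
   then show ?case using diff by blast
  }
 qed
 have "convergent \<alpha>"
 proof -
  have "(\<lambda>n. 10 * \<eta> * (1 - (1/2) ^ n)) \<longlonglongrightarrow> 10 * \<eta> * (1 - 0)"
   by (intro tendsto_intros LIMSEQ_realpow_zero) auto
  then show ?thesis unfolding \<alpha>_def convergent_def by (auto simp: power_one_over)
 qed
 then obtain p where p: "conv K p" using conv_exists[of K \<alpha>] KS_in main step by auto
 have pS: "p \<in> S" using p by (simp add: conv_def)
 have "conv D 0"
 proof (rule conv_bound)
  show "(\<lambda>n. \<eta> / 2 ^ n) \<longlonglongrightarrow> 0" using LIMSEQ_divide_realpow_zero[of 2 \<eta>] by simp
 qed (use D_in main in simp_all)
 moreover have "conv D (p * p - p)" unfolding D_def by (intro conv_diff conv_mult p)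
 ultimately have "p * p - p = 0" using conv_unique by blast
 then have pp: "p * p = p" by simp
 have "st (K n) = K n" for n
  by (induction n) (use KS_in k in \<open>simp_all add: K0 KS F_def Let_def st_diff st_add st_mult algebra_simps\<close>)
 then have "conv K (st p)" using conv_st[OF p] by simp
 then have stp: "st p = p" using conv_unique p by blast
 have near: "nm (p - k) <= 10 * \<eta>"
 proof (rule conv_nm_le[OF p _ k(1)])
  fix n
  have "\<eta> * (1 - 1 / 2 ^ n) <= \<eta> * 1" using \<eta>0 by (intro mult_left_mono) auto
  then show "nm (K n - k) <= 10 * \<eta>" using main[of n] unfolding \<alpha>_def by linarith
 qed
 have "z * p = 0" if z: "z \<in> S" "z * k = 0" for z
 proof -
  have "z * K n = 0" for n
  proof (induction n)
   case (Suc n)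
   have "z * F (K n) = z * K n * (K n + K n + K n) - z * K n * (K n * K n + K n * K n)"
    by (simp add: F_def Let_def algebra_simps)
   then show ?case using Suc by (simp add: KS)
  qed (simp add: K0 z)
  then have "conv (\<lambda>n. 0) (z * p)" using conv_mult[OF conv_const[OF z(1)] p] by simp
  then show ?thesis using conv_unique conv_const[OF S_0] by blast
 qed
 then show ?thesis using pS pp stp near by blast
qed

text \<open>Apply the iteration to \<open>g * s * g\<close>, which is annihilated by everything that annihilates \<open>g\<close>.\<close>

lemma cut_down_projection:
 assumes s: "s \<in> S" "s * s = s" "st s = s" and g: "g \<in> S" "st g = g"
  and \<delta>: "nm (s - s * g) <= \<delta>" "\<delta> * (1 + nm g) <= 1/70"
 shows "\<exists>p\<in>S. p * p = p & st p = p & nm (p - s) <= 36 * (\<delta> * (1 + nm g)) & (\<forall>z\<in>S. z * g = 0 --> z * p = 0)"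
proof -
 define k where "k = g * s * g"
 define \<eta> where "\<eta> = \<delta> * (1 + nm g)"
 have k: "k \<in> S" "st k = k" using s g by (simp_all add: k_def st_mult mult.assoc)
 have "st (s - s * g) = s - g * s" using s g by (simp add: st_diff st_mult)
 then have "nm (s - g * s) <= \<delta>" using nm_st[of "s - s * g"] s g \<delta> by simp
 then have "nm ((s - g * s) * g) <= \<delta> * nm g" using s g by (intro nm_mult_le) auto
 moreover have "s - k = (s - s * g) + (s - g * s) * g" by (simp add: k_def algebra_simps)
 ultimately have "nm (s - k) <= \<delta> + \<delta> * nm g"
  using s g \<delta> by (simp only:) (intro nm_add_le; simp)
 then have sk: "nm (s - k) <= \<eta>" by (simp add: \<eta>_def algebra_simps)
 have \<eta>: "0 <= \<eta>" "\<eta> <= 1/70" using \<delta> order.trans[OF nm_nonneg sk] s k by (auto simp: \<eta>_def)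
 have nms: "nm s <= 1" by (rule proj_nm_le_1[OF s])
 have ks: "nm (k - s) <= \<eta>" using sk nm_diff_commute s k by simp
 have nmk: "nm k <= 3/2" using nm_add[of "k - s" s] ks nms \<eta> s k by simp
 have kk: "k * k - k = (k - s) * k + (s * (k - s) - (k - s))" using s by (simp add: algebra_simps)
 have "nm ((k - s) * k) <= \<eta> * (3/2)" using ks nmk s k by (intro nm_mult_le) auto
 moreover have "nm (s * (k - s)) <= 1 * \<eta>" using ks nms s k by (intro nm_mult_le) auto
 moreover have "nm ((k - s) * k + (s * (k - s) - (k - s))) <= nm ((k - s) * k) + (nm (s * (k - s)) + nm (k - s))"
  by (intro nm_diff_le nm_add_le order.refl S_add S_mult S_diff s k)
 ultimately have "nm (k * k - k) <= 7/2 * \<eta>" unfolding kk using ks by linarith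
 then obtain p where p: "p \<in> S" "p * p = p" "st p = p" "nm (p - k) <= 10 * (7/2 * \<eta>)" "\<forall>z\<in>S. z * k = 0 --> z * p = 0"
  using almost_idempotent[OF k, of "7/2 * \<eta>"] \<eta> nmk by auto
 have "nm (p - s) <= 36 * \<eta>" using nm_diff_triangle[OF p(1) k(1) s(1)] p(4) ks by linarith
 moreover have "\<forall>z\<in>S. z * g = 0 --> z * p = 0"
 proof (intro ballI impI)
  fix z assume z: "z \<in> S" "z * g = 0"
  have "z * k = z * g * (s * g)" by (simp add: k_def mult.assoc)
  then show "z * p = 0" using p(5) z by simp
 qed
 ultimately show ?thesis using p unfolding \<eta>_def by blast
qed

text \<open>For the sum \<open>Y\<close>, the power of order \<open>k = 2^n\<close> of \<open>Y\<^sup>* Y\<close> has norm at most \<open>card I * M ^ (2 * k)\<close>,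
and roots of order \<open>k\<close> remove the factor \<open>card I\<close>.\<close>

lemma nm_central_sum_le:
 fixes z y :: "'i => 'h"
 assumes I: "finite I" and z: "!!i. i \<in> I ==> z i \<in> S" "!!i. i \<in> I ==> z i * z i = z i" "!!i. i \<in> I ==> st (z i) = z i"
  and central: "!!i x. i \<in> I ==> x \<in> S ==> z i * x = x * z i"
  and orth: "!!i j. i \<in> I ==> j \<in> I ==> i ~= j ==> z i * z j = 0"
  and y: "!!i. i \<in> I ==> y i \<in> S" "!!i. i \<in> I ==> nm (y i) <= M" and M: "0 <= M"
 shows "nm (\<Sum>i\<in>I. z i * y i) <= M"
proof -
 have prod: "(\<Sum>i\<in>I. z i * a i) * (\<Sum>i\<in>I. z i * b i) = (\<Sum>i\<in>I. z i * (a i * b i))"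
  if "!!i. i \<in> I ==> a i \<in> S" for a b
 proof -
  have "(\<Sum>i\<in>I. z i * a i) * (\<Sum>i\<in>I. z i * b i) = (\<Sum>i\<in>I. \<Sum>j\<in>I. (z i * a i) * (z j * b j))"
   by (simp add: sum_product)
  also have "\<dots> = (\<Sum>i\<in>I. \<Sum>j\<in>I. if j = i then z i * (a i * b i) else 0)"
  proof (intro sum.cong refl)
   fix i j assume ij: "i \<in> I" "j \<in> I"
   have "(z i * a i) * (z j * b j) = z i * (a i * z j) * b j" by (simp add: mult.assoc)
   also have "a i * z j = z j * a i" using central[OF ij(2) that[OF ij(1)]] by simp
   also have "z i * (z j * a i) * b j = (z i * z j) * (a i * b j)" by (simp add: mult.assoc)
   finally show "(z i * a i) * (z j * b j) = (if j = i then z i * (a i * b i) else 0)"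
    using z(2)[OF ij(1)] orth[OF ij] by auto
  qed
  finally show ?thesis using I by simp
 qed
 define h where "h i = st (y i) * y i" for i
 have h: "h i \<in> S" "st (h i) = h i" "nm (h i) <= M\<^sup>2" if "i \<in> I" for i
  using y[OF that] nm_cstar[of "y i"] by (auto simp: h_def st_mult intro!: power_mono)
 define Y where "Y = (\<Sum>i\<in>I. z i * y i)"
 have Y: "Y \<in> S" using z y by (simp add: Y_def)
 have stY: "st Y = (\<Sum>i\<in>I. z i * st (y i))"
 proof -
  have "st (z i * y i) = z i * st (y i)" if i: "i \<in> I" for i
   using st_mult[OF z(1)[OF i] y(1)[OF i]] z(3)[OF i] central[OF i S_st[OF y(1)[OF i]]] by simp
  then show ?thesis unfolding Y_def using z y by (simp add: st_sum)
 qed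
 have H: "st Y * Y = (\<Sum>i\<in>I. z i * h i)"
  unfolding stY h_def by (subst Y_def, rule prod) (simp add: y)
 define HH where "HH = st Y * Y"
 have HH: "HH \<in> S" "st HH = HH" using Y by (simp_all add: HH_def st_mult)
 have pow: "HH ^ Suc n = (\<Sum>i\<in>I. z i * h i ^ Suc n)" for n
 proof (induction n)
  case (Suc n)
  have "HH ^ Suc (Suc n) = (\<Sum>i\<in>I. z i * h i) * (\<Sum>i\<in>I. z i * h i ^ Suc n)"
   using Suc H by (simp add: HH_def)
  also have "\<dots> = (\<Sum>i\<in>I. z i * (h i * h i ^ Suc n))" using h by (intro prod) auto
  finally show ?case by simp
 qed (simp add: HH_def H)
 have "nm HH ^ (2 ^ n) <= real (card I) * (M\<^sup>2) ^ (2 ^ n)" for n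
 proof -
  obtain k where k: "(2::nat) ^ n = Suc k" by (metis not0_implies_Suc power_not_zero zero_neq_numeral)
  have hk: "h i ^ (2 ^ n) \<in> S" if "i \<in> I" for i using sa_power[OF h(1)[OF that] h(2)[OF that], of k] k by simp
  have "nm HH ^ (2 ^ n) = nm (HH ^ (2 ^ n))" using sa_nm_power[OF HH] by simp
  also have "\<dots> = nm (\<Sum>i\<in>I. z i * h i ^ (2 ^ n))" using pow[of k] k by simp
  also have "\<dots> <= (\<Sum>i\<in>I. nm (z i * h i ^ (2 ^ n)))" using hk z by (intro nm_sum) auto
  also have "\<dots> <= (\<Sum>i\<in>I. (M\<^sup>2) ^ (2 ^ n))"
  proof (rule sum_mono)
   fix i assume i: "i \<in> I"
   have "nm (z i * h i ^ (2 ^ n)) <= 1 * (M\<^sup>2) ^ (2 ^ n)"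
   proof (rule nm_mult_le)
    show "nm (z i) <= 1" using z[OF i] by (intro proj_nm_le_1)
    show "nm (h i ^ (2 ^ n)) <= (M\<^sup>2) ^ (2 ^ n)"
     using sa_nm_power[OF h(1)[OF i] h(2)[OF i], of n] h[OF i] by (simp add: power_mono)
   qed (use z i hk in auto)
   then show "nm (z i * h i ^ (2 ^ n)) <= (M\<^sup>2) ^ (2 ^ n)" by simp
  qed
  finally show ?thesis by simp
 qed
 then have "nm HH <= M\<^sup>2" by (rule real_le_of_pow2[OF zero_le_power2])
 then have "(nm Y)\<^sup>2 <= M\<^sup>2" using nm_cstar[OF Y] by (simp add: HH_def)
 then show ?thesis using M unfolding Y_def by (rule power2_le_imp_le)
qed

end

context hcstar1 begin

text \<open>With \<open>|y|\<close> the positive square root of \<open>y\<^sup>2\<close>, the element \<open>y\<^sup>-\<^sup>1 |y|\<close> is a symmetry, and \<open>s\<close> is its spectral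
projection for the value 1. If \<open>x f = f\<close> then \<open>y f\<close> is close to \<open>f / 2\<close>, so \<open>f\<close> is almost in the range of \<open>s\<close>; if \<open>x h = 0\<close>
then \<open>y h\<close> is close to \<open>- h / 2\<close>.\<close>

lemma sign_projection:
 assumes y: "y \<in> S" "st y = y" and yi: "yi \<in> S" "y * yi = e" "yi * y = e"
  and x: "x \<in> S" "nm (x - (1/2) *c e - y) <= \<delta>"
 shows "\<exists>s\<in>S. s * s = s & st s = s & (\<forall>f\<in>S. x * f = f --> nm (f - s * f) <= 2 * \<delta> * nm f)
  & (\<forall>h\<in>S. x * h = 0 --> nm (s * h) <= 2 * \<delta> * nm h)"
proof -
 define \<Lambda> where "\<Lambda> = 1 + nm y"
 have \<Lambda>: "0 < \<Lambda>" "nm y <= \<Lambda>" using nm_nonneg[OF y(1)] unfolding \<Lambda>_def by linarith+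
 define h where "h = of_real (1 / \<Lambda>) *c y"
 have h: "h \<in> S" "st h = h" "nm h <= 1" using y \<Lambda> by (simp_all add: h_def st_scl nm_scl norm_divide)
 obtain b where b: "b \<in> S" "st b = b" "b * b = e - h * h" "nm b <= 1"
  using sqrt_one_minus_square[OF h] by blast
 obtain a where a: "a \<in> S" "st a = a" "a * a = e - b * b" "nm (e - a) <= 1" "\<forall>z\<in>S. z * (b * b) = b * b * z --> z * a = a * z"
  using sqrt_one_minus_square[OF b(1,2,4)] by blast
 have ya: "y * a = a * y" using a(5) y(1) unfolding b(3) by (simp add: h_def algebra_simps)
 define m where "m = of_real \<Lambda> *c a"
 have m: "m \<in> S" "st m = m" using a by (simp_all add: m_def st_scl)
 have mm: "m * m = y * y"
 proof -
  have "a * a = h * h" using a(3) b(3) by simp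
  then have "m * m = (of_real \<Lambda> * of_real \<Lambda>) *c (h * h)" by (simp add: m_def)
  then show ?thesis using \<Lambda> by (simp add: h_def)
 qed
 have my: "m * y = y * m" by (simp add: m_def ya)
 have myi: "m * yi = yi * m" using inverse_commutes[OF y(1) yi m(1) my] .
 have styi: "st yi = yi" using inverse_sa[OF y(1) yi y(2)] .
 define r where "r = m * yi"
 have r: "r \<in> S" "st r = r" using m yi myi styi by (simp_all add: r_def st_mult)
 have mr: "m * r = y"
 proof -
  have "m * r = y * (y * yi)" using mm by (simp add: r_def flip: mult.assoc)
  then show ?thesis using yi y by simp
 qed
 have rr: "r * r = e"
 proof -
  have "r * r = m * (yi * m) * yi" by (simp add: r_def mult.assoc)
  also have "\<dots> = m * r * yi" unfolding myi[symmetric] r_def by (simp add: mult.assoc)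
  finally show ?thesis using mr yi by simp
 qed
 have ry: "r * y = m" using yi m by (simp add: r_def mult.assoc)
 define s where "s = (1/2) *c (e + r)"
 have s: "s \<in> S" "st s = s" using r by (simp_all add: s_def st_scl st_add)
 have ss: "s * s = s"
 proof -
  have "s * s = (1/2) *c ((1/2) *c ((e + r) + (e + r)))" using r rr by (simp add: s_def algebra_simps scl_simps)
  then show ?thesis by (simp only: scl_half s_def)
 qed
 have es: "e - s = (1/2) *c (e - r)"
 proof -
  have "e = (1/2) *c (e + e)" by (simp only: scl_half)
  then have "e - s = (1/2) *c ((e + e) - (e + r))" by (simp only: s_def scl_diff_right)
  then show ?thesis by simp
 qed
 have es_y: "(e - s) * y = - (m * (e - s))"
  unfolding es using y m ry mr by (simp add: algebra_simps flip: scl_minus_right)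
 have s_y: "s * y = m * s" using y m ry mr by (simp add: s_def algebra_simps)
 have esp: "nm (e - s) <= 1" using s ss by (intro proj_nm_le_1) (simp_all add: st_diff algebra_simps)
 have sp: "nm s <= 1" using proj_nm_le_1[OF s(1) ss s(2)] .
 define D where "D = x - (1/2) *c e - y"
 have D: "D \<in> S" "nm D <= \<delta>" using x y by (simp_all add: D_def)
 have halfm: "nm T <= 2 * \<delta> * nm f" if T: "T \<in> S" and f: "f \<in> S" and R: "nm ((1/2) *c T + m * T) <= \<delta> * nm f" for T f
 proof -
  have "((1/2) *c T + m * T) + of_real \<Lambda> *c ((e - a) * T) = of_real (1/2 + \<Lambda>) *c T"
   using T by (simp add: m_def algebra_simps scl_simps)
  moreover have "nm (of_real \<Lambda> *c ((e - a) * T)) <= \<Lambda> * (1 * nm T)"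
   using nm_mult_le[OF _ T a(4) order.refl] a T \<Lambda> by (simp add: nm_scl)
  ultimately have "(1/2 + \<Lambda>) * nm T <= \<delta> * nm f + \<Lambda> * nm T"
   using nm_add[of "(1/2) *c T + m * T" "of_real \<Lambda> *c ((e - a) * T)"] R T m a \<Lambda>
    nm_scl[of T "of_real (1/2 + \<Lambda>)"] by (simp del: of_real_add)
  then show ?thesis by (simp add: algebra_simps)
 qed
 have "nm (f - s * f) <= 2 * \<delta> * nm f" if f: "f \<in> S" "x * f = f" for f
 proof (rule halfm)
  have "(e - s) * (D * f) = (e - s) * (f - (1/2) *c f) - (e - s) * y * f"
   using f by (simp add: D_def algebra_simps)
  also have "f - (1/2) *c f = (1/2) *c f" by (rule scl_half_diff)
  finally have eq: "(e - s) * (D * f) = (1/2) *c (f - s * f) + m * (f - s * f)"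
   unfolding es_y using f s m by (simp add: algebra_simps scl_simps)
  have "nm ((e - s) * (D * f)) <= 1 * (\<delta> * nm f)"
   using D f s esp by (intro nm_mult_le) auto
  then show "nm ((1/2) *c (f - s * f) + m * (f - s * f)) <= \<delta> * nm f" by (simp add: eq)
 qed (use f s in auto)
 moreover have "nm (s * h) <= 2 * \<delta> * nm h" if h: "h \<in> S" "x * h = 0" for h
 proof (rule halfm)
  have eq: "s * (D * h) = - ((1/2) *c (s * h) + m * (s * h))"
   using h s_y by (simp add: D_def algebra_simps) (simp flip: mult.assoc)
  have "nm (s * (D * h)) <= 1 * (\<delta> * nm h)"
   using D h s sp by (intro nm_mult_le) auto
  moreover have "(1/2) *c (s * h) + m * (s * h) \<in> S" using h s m by simp
  ultimately show "nm ((1/2) *c (s * h) + m * (s * h)) <= \<delta> * nm h" unfolding eq by (simp only: nm_minus mult_1)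
 qed (use h s in auto)
 ultimately show ?thesis using s ss by blast
qed

end

definition star_map :: "'h::complex_alg set => ('h => 'h) => 'g::complex_alg set => ('g => 'g) => ('h => 'g) => bool" where
 "star_map S st S' st' f \<longleftrightarrow> (\<forall>x\<in>S. f x \<in> S' & f (st x) = st' (f x) & (\<forall>c. f (c *c x) = c *c f x) &
   (\<forall>y\<in>S. f (x + y) = f x + f y & f (x * y) = f x * f y))"

lemma star_mapD:
 assumes "star_map S st S' st' f" "x \<in> S"
 shows "f x \<in> S'" "f (st x) = st' (f x)" "f (c *c x) = c *c f x" "y \<in> S ==> f (x + y) = f x + f y" "y \<in> S ==> f (x * y) = f x * f y"
 using assms unfolding star_map_def by blast+

lemma star_map_diff:
 assumes "star_map S st S' st' f" "hcstar S st nm" "x \<in> S" "y \<in> S"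
 shows "f (x - y) = f x - f y" "f 0 = 0"
proof -
 interpret hcstar S st nm by fact
 note D = star_mapD[OF assms(1)]
 show "f (x - y) = f x - f y"
  using D(4)[OF assms(3) S_minus[OF assms(4)]] D(3)[OF assms(4), of "-1"] assms by simp
 show "f 0 = 0" using D(3)[OF S_0, of 0] by simp
qed

lemma star_map_sum:
 assumes "star_map S st S' st' f" "hcstar S st nm" "!!i. i \<in> I ==> g i \<in> S"
 shows "f (sum g I) = (\<Sum>i\<in>I. f (g i))"
proof -
 interpret hcstar S st nm by fact
 show ?thesis using assms(3)
  by (induction I rule: infinite_finite_induct)
   (use star_map_diff(2)[OF assms(1,2) S_0 S_0] star_mapD(4)[OF assms(1)] in auto)
qed

text \<open>Homomorphisms preserve the invertibility of \<open>1 - h\<^sup>2\<close>, which characterises \<open>nm h < 1\<close> for a self-adjoint contraction.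
If the map does not preserve the unit, the image of the inverse is completed by \<open>e' - f e\<close>.\<close>

lemma star_map_contractive:
 assumes "hcstar1 S st nm e" "hcstar1 S' st' nm' e'" and f: "star_map S st S' st' f" and x: "x \<in> S"
 shows "nm' (f x) <= nm x"
proof -
 interpret A: hcstar1 S st nm e by fact
 interpret B: hcstar1 S' st' nm' e' by fact
 note D = star_mapD[OF f]
 note fdiff = star_map_diff(1)[OF f A.hcstar_axioms]
 have sa: "nm' (f h) <= nm h" if h: "h \<in> S" "st h = h" for h
 proof (rule ccontr)
  assume "\<not> nm' (f h) <= nm h"
  then have less: "nm h < nm' (f h)" by simp
  have pos: "0 < nm' (f h)" using less A.nm_nonneg[OF h(1)] by linarith
  define k where "k = of_real (1 / nm' (f h)) *c h"
  have k: "k \<in> S" "st k = k" using h by (simp_all add: k_def A.st_scl)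
  have fk: "f k \<in> S'" "st' (f k) = f k" using D(1)[OF k(1)] D(2)[OF k(1)] k by simp_all
  have nk: "nm k < 1" using less pos h by (simp add: k_def A.nm_scl norm_divide)
  have fk1: "nm' (f k) = 1" using D(3)[OF h(1)] D(1)[OF h(1)] pos by (simp add: k_def B.nm_scl norm_divide)
  have "nm (k * k) <= nm k * nm k" using A.nm_mult k by simp
  moreover have "nm k * nm k < 1 * 1"
   using nk A.nm_nonneg[OF k(1)] by (intro mult_strict_mono') auto
  ultimately have "nm (k * k) < 1" by simp
  then obtain y where y: "y \<in> S" "(e - k * k) * y = e" "y * (e - k * k) = e"
   using A.neumann[OF A.S_mult[OF k(1) k(1)]] by blast
  define z where "z = f y + (e' - f e)"
  have in': "f y \<in> S'" "f e \<in> S'" using D(1) y by simp_all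
  have m: "f e * f y = f y" "f y * f e = f y" "f e * f k = f k" "f k * f e = f k" "f e * f e = f e"
   using D(5)[of e y] D(5)[of y e] D(5)[of e k] D(5)[of k e] D(5)[of e e] y k by simp_all
  have ek: "e - k * k \<in> S" using k by simp
  have fek: "f (e - k * k) = f e - f k * f k" using fdiff[of e "k * k"] D(5)[of k k] k by simp
  have e1: "(f e - f k * f k) * f y = f e" "f y * (f e - f k * f k) = f e"
   using D(5)[OF ek y(1)] D(5)[OF y(1) ek] y fek by simp_all
  have "(e' - f k * f k) * z = ((f e - f k * f k) * f y) + (e' - f e)"
   using in' fk m by (simp add: z_def algebra_simps)
  moreover have "z * (e' - f k * f k) = (f y * (f e - f k * f k)) + (e' - f e)"
   using in' fk m by (simp add: z_def algebra_simps flip: mult.assoc)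
  ultimately have "nm' (f k) < 1"
   using e1 in' fk fk1 by (intro B.nm_less_1[of _ z]) (simp_all add: z_def)
  then show False using fk1 by simp
 qed
 have "(nm' (f x))\<^sup>2 = nm' (f (st x * x))"
  using B.nm_cstar[of "f x"] D[OF x] D(5)[OF A.S_st[OF x] x] by simp
 also have "\<dots> <= nm (st x * x)" using x by (intro sa) (simp_all add: A.st_mult)
 also have "\<dots> = (nm x)\<^sup>2" using A.nm_cstar[OF x] .
 finally show ?thesis by (rule power2_le_imp_le[OF _ A.nm_nonneg[OF x]])
qed

section \<open>Passing between records and their representations\<close>

definition emb :: "'a cstar => 'a => 'a host" where "emb A = (SOME H. is_hosting A H)"
abbreviation hone :: "'a cstar => 'a host" where "hone A \<equiv> emb A \<one>\<^bsub>A\<^esub>"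
definition unemb :: "'a cstar => 'a host => 'a" where "unemb A = inv_into (carrier A) (emb A)"
definition hS :: "'a cstar => 'a host set" where "hS A = emb A ` carrier A"
definition hst :: "'a cstar => 'a host => 'a host" where "hst A x = emb A (adj A (unemb A x))"
definition hnm :: "'a cstar => 'a host => real" where "hnm A x = nrm A (unemb A x)"
definition hmap :: "'a cstar => 'b cstar => ('a => 'b) => 'a host => 'b host" where
 "hmap A B h x = emb B (h (unemb A x))"

context
 fixes A :: "'a cstar" assumes A: "cstar_algebra A"
begin

lemma emb_hosting: "is_hosting A (emb A)"
 unfolding emb_def using hosting_exists[OF A] by (rule someI_ex)

lemma emb_inj: "x \<in> carrier A ==> y \<in> carrier A ==> emb A x = emb A y \<longleftrightarrow> x = y"
 using emb_hosting unfolding is_hosting_def inj_on_def by blast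

lemma emb_add: "x \<in> carrier A ==> y \<in> carrier A ==> emb A (x \<oplus>\<^bsub>A\<^esub> y) = emb A x + emb A y"
 and emb_mult: "x \<in> carrier A ==> y \<in> carrier A ==> emb A (x \<otimes>\<^bsub>A\<^esub> y) = emb A x * emb A y"
 and emb_scl: "x \<in> carrier A ==> emb A (c \<odot>\<^bsub>A\<^esub> x) = c *c emb A x"
 using emb_hosting unfolding is_hosting_def by blast+

lemma unemb_emb [simp]: "x \<in> carrier A ==> unemb A (emb A x) = x"
 unfolding unemb_def using emb_hosting unfolding is_hosting_def by (simp add: inv_into_f_f)

lemma emb_in [simp]: "x \<in> carrier A ==> emb A x \<in> hS A" by (simp add: hS_def)
lemma unemb_in [simp]: "x \<in> hS A ==> unemb A x \<in> carrier A" by (auto simp: hS_def)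
lemma emb_unemb [simp]: "x \<in> hS A ==> emb A (unemb A x) = x" by (auto simp: hS_def)

lemma emb_st: "x \<in> carrier A ==> hst A (emb A x) = emb A (adj A x)" by (simp add: hst_def)
lemma emb_nm: "x \<in> carrier A ==> hnm A (emb A x) = nrm A x" by (simp add: hnm_def)

lemma zero_carrier [simp]: "\<zero>\<^bsub>A\<^esub> \<in> carrier A"
proof -
 interpret abelian_group A using cstar_smult(8)[OF A] .
 show ?thesis by simp
qed

lemma add_carrier [simp]: "x \<in> carrier A ==> y \<in> carrier A ==> x \<oplus>\<^bsub>A\<^esub> y \<in> carrier A"
proof -
 interpret abelian_group A using cstar_smult(8)[OF A] .
 show "x \<in> carrier A ==> y \<in> carrier A ==> x \<oplus>\<^bsub>A\<^esub> y \<in> carrier A" by simp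
qed

lemma minus_carrier [simp]: "x \<in> carrier A ==> y \<in> carrier A ==> x \<ominus>\<^bsub>A\<^esub> y \<in> carrier A"
proof -
 interpret abelian_group A using cstar_smult(8)[OF A] .
 show "x \<in> carrier A ==> y \<in> carrier A ==> x \<ominus>\<^bsub>A\<^esub> y \<in> carrier A" by simp
qed

lemma emb_zero [simp]: "emb A \<zero>\<^bsub>A\<^esub> = 0"
 using emb_scl[of "\<zero>\<^bsub>A\<^esub>" 0] cstar_smult(7)[OF A] by simp

lemma emb_eq_0: "x \<in> carrier A ==> emb A x = 0 \<longleftrightarrow> x = \<zero>\<^bsub>A\<^esub>"
 using emb_inj[of x "\<zero>\<^bsub>A\<^esub>"] by simp

lemma emb_minus: assumes "x \<in> carrier A" "y \<in> carrier A" shows "emb A (x \<ominus>\<^bsub>A\<^esub> y) = emb A x - emb A y"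
proof -
 interpret abelian_group A using cstar_smult(8)[OF A] .
 have "(x \<ominus>\<^bsub>A\<^esub> y) \<oplus>\<^bsub>A\<^esub> y = x" using assms by (simp add: a_minus_def a_assoc l_neg)
 then show ?thesis using emb_add[of "x \<ominus>\<^bsub>A\<^esub> y" y] assms by simp
qed

lemmas carrier_simps = cstar_algebra.mult_closed[OF A] cstar_algebra.adj_closed[OF A] cstar_smult(1)[OF A]

lemma unemb_ops:
 assumes "x \<in> hS A" "y \<in> hS A"
 shows "x + y = emb A (unemb A x \<oplus>\<^bsub>A\<^esub> unemb A y)" "x - y = emb A (unemb A x \<ominus>\<^bsub>A\<^esub> unemb A y)"
  "x * y = emb A (unemb A x \<otimes>\<^bsub>A\<^esub> unemb A y)" "c *c x = emb A (c \<odot>\<^bsub>A\<^esub> unemb A x)"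
 using assms by (simp_all add: emb_add emb_minus emb_mult emb_scl)

lemma hcstar_hosted: "hcstar (hS A) (hst A) (hnm A)"
proof -
 interpret C: cstar_algebra A by (rule A)
 note simps = emb_st emb_nm emb_add[symmetric] emb_mult[symmetric] emb_scl[symmetric] emb_minus[symmetric] carrier_simps
 show ?thesis
 proof
  show "0 \<in> hS A" using emb_in[OF zero_carrier] by simp
  fix X :: "nat => 'a host"
  assume X: "!!n. X n \<in> hS A" and cauchy: "!!d. 0 < d ==> \<exists>N. \<forall>m\<ge>N. \<forall>n\<ge>N. hnm A (X m - X n) < d"
  have nm: "hnm A (X m - emb A x) = nrm A (unemb A (X m) \<ominus>\<^bsub>A\<^esub> x)" if "x \<in> carrier A" for m x
   using emb_minus[of "unemb A (X m)" x] X that by (simp add: emb_nm[symmetric])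
  have "\<exists>x\<in>carrier A. (\<lambda>n. nrm A (unemb A (X n) \<ominus>\<^bsub>A\<^esub> x)) \<longlonglongrightarrow> 0"
  proof (rule C.complete)
   fix d :: real assume "0 < d"
   then show "\<exists>N. \<forall>m\<ge>N. \<forall>n\<ge>N. nrm A (unemb A (X m) \<ominus>\<^bsub>A\<^esub> unemb A (X n)) < d"
    using cauchy[of d] nm[of "unemb A (X n)" for n] X by simp
  qed (use X in simp)
  then obtain x where "x \<in> carrier A" "(\<lambda>n. nrm A (unemb A (X n) \<ominus>\<^bsub>A\<^esub> x)) \<longlonglongrightarrow> 0" by blast
  then show "\<exists>x\<in>hS A. (\<lambda>n. hnm A (X n - x)) \<longlonglongrightarrow> 0" by (intro bexI[of _ "emb A x"]) (simp_all add: nm)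
 next
  fix x assume "x \<in> hS A"
  then obtain y where "y \<in> carrier A" "x = emb A y" by (auto simp: hS_def)
  then show "hnm A x = 0 \<longleftrightarrow> x = 0" by (simp add: emb_nm emb_eq_0 C.nrm_eq_zero)
 qed (auto simp: hS_def simps C.adj_adj C.adj_add C.adj_smult C.adj_mult C.nrm_nonneg C.nrm_triangle C.nrm_smult C.nrm_mult C.cstar_identity)
qed

lemma hcstar1_hosted:
 assumes "u \<in> carrier A" "!!x. x \<in> carrier A ==> u \<otimes>\<^bsub>A\<^esub> x = x & x \<otimes>\<^bsub>A\<^esub> u = x"
 shows "hcstar1 (hS A) (hst A) (hnm A) (emb A u)"
proof -
 interpret hcstar "hS A" "hst A" "hnm A" by (rule hcstar_hosted)
 show ?thesis by unfold_locales (use assms in \<open>auto simp: hS_def emb_mult[symmetric]\<close>)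
qed

end

lemma star_homD:
 assumes "h \<in> star_hom A B"
 shows "x \<in> carrier A ==> h x \<in> carrier B"
  "x \<in> carrier A ==> y \<in> carrier A ==> h (x \<oplus>\<^bsub>A\<^esub> y) = h x \<oplus>\<^bsub>B\<^esub> h y"
  "x \<in> carrier A ==> h (c \<odot>\<^bsub>A\<^esub> x) = c \<odot>\<^bsub>B\<^esub> h x"
  "x \<in> carrier A ==> y \<in> carrier A ==> h (x \<otimes>\<^bsub>A\<^esub> y) = h x \<otimes>\<^bsub>B\<^esub> h y"
  "x \<in> carrier A ==> h (adj A x) = adj B (h x)"
 using assms by (auto simp: star_hom_def LinearCombinations.module_hom_def)

lemma star_homI:
 assumes "!!x. x \<in> carrier A ==> h x \<in> carrier B"
  "!!x y. x \<in> carrier A ==> y \<in> carrier A ==> h (x \<oplus>\<^bsub>A\<^esub> y) = h x \<oplus>\<^bsub>B\<^esub> h y"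
  "!!c x. x \<in> carrier A ==> h (c \<odot>\<^bsub>A\<^esub> x) = c \<odot>\<^bsub>B\<^esub> h x"
  "!!x y. x \<in> carrier A ==> y \<in> carrier A ==> h (x \<otimes>\<^bsub>A\<^esub> y) = h x \<otimes>\<^bsub>B\<^esub> h y"
  "!!x. x \<in> carrier A ==> h (adj A x) = adj B (h x)"
 shows "h \<in> star_hom A B"
 using assms by (auto simp: star_hom_def LinearCombinations.module_hom_def)

lemma hmap_emb: "cstar_algebra A ==> x \<in> carrier A ==> hmap A B h (emb A x) = emb B (h x)"
 by (simp add: hmap_def)

lemma star_map_hmap:
 assumes A: "cstar_algebra A" and B: "cstar_algebra B" and h: "h \<in> star_hom A B"
 shows "star_map (hS A) (hst A) (hS B) (hst B) (hmap A B h)"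
 unfolding star_map_def
 using star_homD[OF h]
 by (auto simp: hS_def emb_add[OF A, symmetric] emb_mult[OF A, symmetric] emb_scl[OF A, symmetric] emb_st[OF A] emb_st[OF B]
   hmap_emb[OF A] emb_add[OF B] emb_mult[OF B] emb_scl[OF B] carrier_simps[OF A] add_carrier[OF A])

lemma unitization_minus:
 assumes B: "cstar_algebra B" and "x \<in> carrier B" "b \<in> carrier B"
 shows "(x, k) \<ominus>\<^bsub>unitization B\<^esub> (b, l) = (x \<ominus>\<^bsub>B\<^esub> b, k - l)"
proof -
 interpret abelian_group B using cstar_smult(8)[OF B] .
 have "a_inv (unitization B) (b, l) = (\<ominus>\<^bsub>B\<^esub> b, - l)"
  unfolding a_inv_def[of "unitization B"] m_inv_def[of "add_monoid (unitization B)"]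
 proof (rule the_equality, goal_cases)
  case (2 y)
  note y = this
  obtain y1 y2 where yy: "y = (y1, y2)" by (cases y)
  have "y1 \<in> carrier B" "y1 \<oplus>\<^bsub>B\<^esub> b = \<zero>\<^bsub>B\<^esub>" "l + y2 = 0" using y yy by (simp_all add: unitization_def)
  then show "y = (\<ominus>\<^bsub>B\<^esub> b, - l)" using yy assms minus_equality[of y1 b] by (simp add: add_eq_0_iff)
 qed (use assms in \<open>simp add: unitization_def r_neg l_neg\<close>)
 then show ?thesis using assms by (simp add: a_minus_def) (simp add: unitization_def)
qed

text \<open>One formulation for both cases of the definition of real rank zero. The invertible element is
written \<open>b + lam\<close> with \<open>b\<close> in the algebra, and its inverse as \<open>c + ka\<close>; the
identities that express this involve elements of the algebra only, so they can be lifted to the algebras \<open>A n\<close>.\<close>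

lemma real_rank_zero_approx:
 assumes B: "cstar_algebra B" and rr: "real_rank_zero B"
  and x: "x \<in> hS B" "hst B x = x" and \<delta>: "0 < \<delta>"
 shows "\<exists>b\<in>hS B. \<exists>c\<in>hS B. \<exists>lam :: real. \<exists>ka. hst B b = b & of_real lam * ka = 1 &
  b * c + ka *c b + of_real lam *c c = 0 & c * b + ka *c b + of_real lam *c c = 0 &
  (\<forall>d\<in>hS B. hnm B d <= 1 --> hnm B ((x - b) * d - of_real (1/2 + lam) *c d) <= \<delta>)"
proof -
 interpret H: hcstar "hS B" "hst B" "hnm B" by (rule hcstar_hosted[OF B])
 note C = carrier_simps[OF B] add_carrier[OF B] minus_carrier[OF B]
 note E = emb_add[OF B] emb_mult[OF B] emb_scl[OF B] emb_minus[OF B]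
 define x' where "x' = unemb B x"
 have x': "x' \<in> carrier B" "emb B x' = x" using x by (simp_all add: x'_def B)
 have adjx': "adj B x' = x'"
  using x x' emb_st[OF B x'(1)] by (simp add: emb_inj[OF B] C)
 show ?thesis
 proof (cases "monoid B")
  case True
  then interpret M: monoid B .
  interpret I: hcstar1 "hS B" "hst B" "hnm B" "hone B"
   by (rule hcstar1_hosted[OF B]) auto
  define u where "u = hone B"
  have adj1: "adj B \<one>\<^bsub>B\<^esub> = \<one>\<^bsub>B\<^esub>" using I.st_e emb_st[OF B, of "\<one>\<^bsub>B\<^esub>"] by (simp add: emb_inj[OF B] C)
  define a where "a = x' \<oplus>\<^bsub>B\<^esub> (-1/2) \<odot>\<^bsub>B\<^esub> \<one>\<^bsub>B\<^esub>"
  have a: "a \<in> self_adjoints B" using x' adjx' adj1 cstar_algebra.adj_add[OF B] cstar_algebra.adj_smult[OF B]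
   by (simp add: self_adjoints_def a_def C)
  then obtain b0 where b0: "b0 \<in> self_adjoints B" "b0 \<in> Units B" "nrm B (a \<ominus>\<^bsub>B\<^esub> b0) < \<delta>"
   using rr True \<delta> unfolding real_rank_zero_def unital_real_rank_zero_def by auto
  then obtain c0 where c0: "c0 \<in> carrier B" "c0 \<otimes>\<^bsub>B\<^esub> b0 = \<one>\<^bsub>B\<^esub>" "b0 \<otimes>\<^bsub>B\<^esub> c0 = \<one>\<^bsub>B\<^esub>"
   unfolding Units_def by blast
  have b0c: "b0 \<in> carrier B" "adj B b0 = b0" using b0 by (auto simp: self_adjoints_def)
  define b c where "b = emb B b0 + (1/2) *c u" and "c = emb B c0 + 2 *c u"
  have bc0: "emb B b0 * emb B c0 = u" "emb B c0 * emb B b0 = u" using c0 b0c by (simp_all add: E(2)[symmetric] u_def)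
  have S: "emb B b0 \<in> hS B" "emb B c0 \<in> hS B" "u \<in> hS B" using b0c c0 by (simp_all add: B u_def)
  have ue: "!!y. y \<in> hS B ==> u * y = y" "!!y. y \<in> hS B ==> y * u = y" by (simp_all add: u_def)
  have "hst B b = b" using S b0c emb_st[OF B b0c(1)] I.st_e by (simp add: b_def H.st_add H.st_scl u_def)
  moreover have "b * c + (-2) *c b + of_real (-1/2) *c c = 0" "c * b + (-2) *c b + of_real (-1/2) *c c = 0"
   using S bc0 ue by (simp_all add: b_def c_def algebra_simps scl_simps)
  moreover have "hnm B ((x - b) * d - of_real (1/2 + (-1/2)) *c d) <= \<delta>" if d: "d \<in> hS B" "hnm B d <= 1" for d
  proof -
   have "x - b = emb B (a \<ominus>\<^bsub>B\<^esub> b0)"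
    using x' b0c a by (simp add: a_def E C b_def u_def self_adjoints_def)
   then have "hnm B ((x - b) * d) <= \<delta> * 1"
    using b0 d x b0c a S emb_nm[OF B] by (intro H.nm_mult_le) (auto simp: B C self_adjoints_def b_def)
   then show ?thesis by simp
  qed
  moreover have "b \<in> hS B" "c \<in> hS B" using S by (simp_all add: b_def c_def)
  ultimately show ?thesis
   by (intro bexI[of _ b] bexI[of _ c] exI[of _ "-1/2 :: real"] exI[of _ "-2 :: complex"]) auto
 next
  case False
  have "(x', -1/2) \<in> self_adjoints (unitization B)"
   using x' adjx' by (simp add: self_adjoints_def unitization_def)
  then obtain bl where bl: "bl \<in> self_adjoints (unitization B)" "bl \<in> Units (unitization B)"
    "nrm (unitization B) ((x', -1/2) \<ominus>\<^bsub>unitization B\<^esub> bl) < \<delta>"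
   using rr False \<delta> unfolding real_rank_zero_def unital_real_rank_zero_def by fastforce
  have "\<exists>ck\<in>carrier (unitization B). ck \<otimes>\<^bsub>unitization B\<^esub> bl = \<one>\<^bsub>unitization B\<^esub> &
    bl \<otimes>\<^bsub>unitization B\<^esub> ck = \<one>\<^bsub>unitization B\<^esub>"
   using bl(2) by (simp add: Units_def)
  then obtain ck where ck: "ck \<in> carrier (unitization B)" "ck \<otimes>\<^bsub>unitization B\<^esub> bl = \<one>\<^bsub>unitization B\<^esub>"
    "bl \<otimes>\<^bsub>unitization B\<^esub> ck = \<one>\<^bsub>unitization B\<^esub>"
   by blast
  obtain b0 l where bl': "bl = (b0, l)" by (cases bl)
  obtain c0 k where ck': "ck = (c0, k)" by (cases ck)
  have b0: "b0 \<in> carrier B" "adj B b0 = b0" "cnj l = l" and c0: "c0 \<in> carrier B"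
   using bl(1) ck(1) by (simp_all add: bl' ck' self_adjoints_def unitization_def)
  obtain lam :: real where l_eq: "l = of_real lam" using b0(3) by (metis Reals_cnj_iff Reals_cases)
  have inv: "b0 \<otimes>\<^bsub>B\<^esub> c0 \<oplus>\<^bsub>B\<^esub> k \<odot>\<^bsub>B\<^esub> b0 \<oplus>\<^bsub>B\<^esub> l \<odot>\<^bsub>B\<^esub> c0 = \<zero>\<^bsub>B\<^esub>" "l * k = 1"
   "c0 \<otimes>\<^bsub>B\<^esub> b0 \<oplus>\<^bsub>B\<^esub> l \<odot>\<^bsub>B\<^esub> c0 \<oplus>\<^bsub>B\<^esub> k \<odot>\<^bsub>B\<^esub> b0 = \<zero>\<^bsub>B\<^esub>"
   using ck by (simp_all add: bl' ck' unitization_def)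
  have i1: "emb B b0 * emb B c0 + k *c emb B b0 + l *c emb B c0 = 0"
   using arg_cong[OF inv(1), of "emb B"] b0 c0 by (simp add: E C B)
  have i2: "emb B c0 * emb B b0 + k *c emb B b0 + l *c emb B c0 = 0"
   using arg_cong[OF inv(3), of "emb B"] b0 c0 by (simp add: E C B algebra_simps)
  have i3: "hnm B ((x - emb B b0) * d - of_real (1/2 + lam) *c d) <= \<delta>" if d: "d \<in> hS B" "hnm B d <= 1" for d
  proof -
   let ?t = "- 1/2 - l"
   let ?f = "\<lambda>b. nrm B ((x' \<ominus>\<^bsub>B\<^esub> b0) \<otimes>\<^bsub>B\<^esub> b \<oplus>\<^bsub>B\<^esub> ?t \<odot>\<^bsub>B\<^esub> b)"
   let ?X = "{?f b |b. b \<in> carrier B & nrm B b <= 1}"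
   have f: "?f b = hnm B ((x - emb B b0) * emb B b + ?t *c emb B b)" if "b \<in> carrier B" for b
    using that x' b0 by (simp add: emb_nm[OF B, symmetric] E C)
   have "?f b <= hnm B (x - emb B b0) * 1 + cmod ?t * 1" if "b \<in> carrier B" "nrm B b <= 1" for b
    unfolding f[OF that(1)] using that x b0 emb_nm[OF B that(1)]
    by (intro H.nm_add_le H.nm_mult_le) (auto simp: B H.nm_scl mult_left_le)
   then have bdd: "bdd_above ?X" by (auto intro!: bdd_aboveI[where M = "hnm B (x - emb B b0) * 1 + cmod ?t * 1"])
   have "nrm (unitization B) (x' \<ominus>\<^bsub>B\<^esub> b0, ?t) < \<delta>"
    using bl(3) x' b0 by (simp add: bl' unitization_minus[OF B])
   then have "Sup ?X < \<delta>" by (simp add: unitization_def)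
   moreover have "?f (unemb B d) \<in> ?X" using d B by (auto simp: hnm_def)
   then have "?f (unemb B d) <= Sup ?X" using bdd by (rule cSup_upper)
   ultimately have "?f (unemb B d) <= \<delta>" by linarith
   moreover have "(x - emb B b0) * d + ?t *c d = (x - emb B b0) * d - of_real (1/2 + lam) *c d"
    by (simp add: l_eq scl_simps)
   ultimately show ?thesis using f[of "unemb B d"] d B by simp
  qed
  show ?thesis
   using i1 i2 i3 b0 c0 inv(2) emb_st[OF B b0(1)] unfolding l_eq
   by (intro bexI[of _ "emb B b0"] bexI[of _ "emb B c0"] exI[of _ lam] exI[of _ k]) (auto simp: B)
 qed
qed

section \<open>Projections lifted from an inductive limit of real rank zero\<close>

locale unital_limit =
 fixes A :: "nat => 'a cstar" and \<phi> :: "nat => nat => 'a => 'a" and B :: "'b cstar" and \<mu> :: "nat => 'a => 'b"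
 assumes lim: "inductive_limit A \<phi> B \<mu>" and unit: "!!n. monoid (A n)"
begin

abbreviation "S n \<equiv> hS (A n)"
abbreviation "st n \<equiv> hst (A n)"
abbreviation "nm n \<equiv> hnm (A n)"
abbreviation "e n \<equiv> hone (A n)"
abbreviation "F m n \<equiv> hmap (A m) (A n) (\<phi> m n)"
abbreviation "M n \<equiv> hmap (A n) B (\<mu> n)"

lemma alg: "cstar_algebra (A n)" and algB: "cstar_algebra B"
 using lim by (auto simp: inductive_limit_def inductive_system_def)

lemma C1: "hcstar1 (S n) (st n) (nm n) (e n)"
proof -
 interpret monoid "A n" by (rule unit)
 show ?thesis by (rule hcstar1_hosted[OF alg]) auto
qed

lemma CB: "hcstar (hS B) (hst B) (hnm B)" by (rule hcstar_hosted[OF algB])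

lemma \<phi>_hom: "m <= n ==> \<phi> m n \<in> star_hom (A m) (A n)"
 using lim by (simp add: inductive_limit_def inductive_system_def)
lemma \<mu>_hom: "\<mu> n \<in> star_hom (A n) B"
 using lim by (simp add: inductive_limit_def)

lemma F: "m <= n ==> star_map (S m) (st m) (S n) (st n) (F m n)"
 by (intro star_map_hmap alg \<phi>_hom)

lemma M: "star_map (S m) (st m) (hS B) (hst B) (M m)"
 by (intro star_map_hmap alg algB \<mu>_hom)

lemma \<phi>_in: "m <= n ==> x \<in> carrier (A m) ==> \<phi> m n x \<in> carrier (A n)"
 by (rule star_homD(1)[OF \<phi>_hom])

lemma F_comp: assumes "l <= m" "m <= n" "x \<in> S l" shows "F m n (F l m x) = F l n x"
proof -
 obtain y where y: "y \<in> carrier (A l)" "x = emb (A l) y" using assms(3) by (auto simp: hS_def)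
 have "\<phi> m n (\<phi> l m y) = \<phi> l n y" using lim assms y by (simp add: inductive_limit_def inductive_system_def)
 then show ?thesis using y \<phi>_in assms by (simp add: hmap_emb[OF alg])
qed

lemma M_F: assumes "m <= n" "x \<in> S m" shows "M n (F m n x) = M m x"
proof -
 obtain y where y: "y \<in> carrier (A m)" "x = emb (A m) y" using assms by (auto simp: hS_def)
 have "\<mu> n (\<phi> m n y) = \<mu> m y" using lim assms y by (simp add: inductive_limit_def)
 then show ?thesis using y \<phi>_in assms by (simp add: hmap_emb[OF alg])
qed

lemma F_contractive: "m <= n ==> x \<in> S m ==> nm n (F m n x) <= nm m x"
 by (rule star_map_contractive[OF C1 C1 F])

lemma nm_limit: assumes "x \<in> S m" shows "(\<lambda>n. nm n (F m n x)) \<longlonglongrightarrow> hnm B (M m x)"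
proof -
 obtain y where y: "y \<in> carrier (A m)" "x = emb (A m) y" using assms by (auto simp: hS_def)
 have \<mu>y: "\<mu> m y \<in> carrier B" using star_homD(1)[OF \<mu>_hom y(1)] .
 have "(\<lambda>n. nrm (A n) (\<phi> m n y)) \<longlonglongrightarrow> nrm B (\<mu> m y)" using lim y by (simp add: inductive_limit_def)
 moreover have "\<forall>\<^sub>F n in sequentially. nrm (A n) (\<phi> m n y) = nm n (F m n x)"
  using eventually_ge_at_top[of m] by eventually_elim (simp add: y hmap_emb[OF alg] emb_nm[OF alg] \<phi>_in)
 ultimately have "(\<lambda>n. nm n (F m n x)) \<longlonglongrightarrow> nrm B (\<mu> m y)" by (rule Lim_transform_eventually)
 then show ?thesis using y \<mu>y by (simp add: hmap_emb[OF alg] emb_nm[OF algB])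
qed

lemma eventually_less:
 assumes "x \<in> S m" "hnm B (M m x) < c" shows "\<exists>n0\<ge>m. \<forall>n\<ge>n0. nm n (F m n x) < c"
proof -
 have "\<forall>\<^sub>F n in sequentially. nm n (F m n x) < c" by (rule order_tendstoD(2)[OF nm_limit[OF assms(1)] assms(2)])
 then obtain n1 where "\<forall>n\<ge>n1. nm n (F m n x) < c" by (auto simp: eventually_sequentially)
 then show ?thesis by (intro exI[of _ "max m n1"]) auto
qed

lemma M_contractive: assumes "x \<in> S m" shows "hnm B (M m x) <= nm m x"
proof (rule LIMSEQ_le_const2[OF nm_limit[OF assms]])
 show "\<exists>N. \<forall>n\<ge>N. nm n (F m n x) <= nm m x" using F_contractive assms by blast
qed

lemma dense: assumes "b \<in> hS B" "0 < d" shows "\<exists>n. \<exists>x\<in>S n. hnm B (b - M n x) < d"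
proof -
 obtain y where y: "y \<in> carrier B" "b = emb B y" using assms by (auto simp: hS_def)
 obtain n x where x: "x \<in> carrier (A n)" "nrm B (y \<ominus>\<^bsub>B\<^esub> \<mu> n x) < d"
  using lim y assms unfolding inductive_limit_def by blast
 have "\<mu> n x \<in> carrier B" using star_homD(1)[OF \<mu>_hom x(1)] .
 then have "hnm B (b - M n (emb (A n) x)) < d"
  using x y by (simp add: hmap_emb[OF alg] emb_minus[OF algB, symmetric] emb_nm[OF algB] minus_carrier[OF algB])
 then show ?thesis using x emb_in[OF alg] by blast
qed

text \<open>The identities that express invertibility hold approximately for approximants at a finite stage;
a Neumann series turns the approximate inverse into an inverse.\<close>

lemma approximate_invertible:
 assumes rr: "real_rank_zero B" and x: "x \<in> S m" "st m x = x" and \<delta>: "0 < \<delta>"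
 shows "\<exists>n\<ge>m. \<exists>y\<in>S n. \<exists>yi\<in>S n. st n y = y & y * yi = e n & yi * y = e n &
  nm n (F m n x - (1/2) *c e n - y) <= \<delta>"
proof -
 interpret HB: hcstar "hS B" "hst B" "hnm B" by (rule CB)
 note MD = star_mapD[OF M]
 have Mdiff: "M n (u - v) = M n u - M n v" if "u \<in> S n" "v \<in> S n" for n u v
  by (rule star_map_diff(1)[OF M hcstar_hosted[OF alg] that])
 have Mx: "M m x \<in> hS B" "hst B (M m x) = M m x" using MD(1,2)[OF x(1)] x by auto
 obtain b c \<rho> ka where b: "b \<in> hS B" "hst B b = b" and c: "c \<in> hS B" and \<rho>ka: "of_real \<rho> * ka = (1::complex)"
  and bc: "b * c + ka *c b + of_real \<rho> *c c = 0" "c * b + ka *c b + of_real \<rho> *c c = 0"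
  and near: "!!d. d \<in> hS B ==> hnm B d <= 1 ==> hnm B ((M m x - b) * d - of_real (1/2 + \<rho>) *c d) <= \<delta>/4"
  using real_rank_zero_approx[OF algB rr Mx, of "\<delta>/4"] \<delta> by fastforce
 define K where "K = 3 + hnm B b + hnm B c + cmod ka + \<bar>\<rho>\<bar>"
 have K: "3 <= K" "hnm B b + hnm B c + cmod ka + \<bar>\<rho>\<bar> + 1 < K" using b c by (simp_all add: K_def)
 define \<eta> where "\<eta> = min (1/K) (\<delta>/4)"
 have \<eta>: "0 < \<eta>" "\<eta> <= \<delta>/4" "\<eta> * K <= 1" "\<eta> <= 1"
 proof -
  have "1 / K <= 1" using K by simp
  then show "\<eta> <= 1" unfolding \<eta>_def by linarith
  have "\<eta> * K <= 1 / K * K" using K by (intro mult_right_mono) (auto simp: \<eta>_def)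
  then show "\<eta> * K <= 1" using K by simp
 qed (use K \<delta> in \<open>auto simp: \<eta>_def\<close>)
 obtain n1 b1 where b1: "b1 \<in> S n1" "hnm B (b - M n1 b1) < \<eta>" using dense[OF b(1) \<eta>(1)] by blast
 obtain n2 c1 where c1: "c1 \<in> S n2" "hnm B (c - M n2 c1) < \<eta>" using dense[OF c \<eta>(1)] by blast
 define N where "N = max m (max n1 n2)"
 have N: "m <= N" "n1 <= N" "n2 <= N" by (simp_all add: N_def)
 interpret N: hcstar1 "S N" "st N" "nm N" "e N" by (rule C1)
 define b2 where "b2 = (1/2) *c (F n1 N b1 + st N (F n1 N b1))"
 define c2 where "c2 = F n2 N c1"
 define x2 where "x2 = F m N x"
 have Fb1: "F n1 N b1 \<in> S N" using star_mapD(1)[OF F[OF N(2)] b1(1)] .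
 have b2: "b2 \<in> S N" "st N b2 = b2" using Fb1 by (simp_all add: b2_def N.st_scl N.st_add add.commute)
 have c2: "c2 \<in> S N" using star_mapD(1)[OF F[OF N(3)] c1(1)] by (simp add: c2_def)
 have x2: "x2 \<in> S N" "st N x2 = x2"
  using star_mapD(1)[OF F[OF N(1)] x(1)] star_mapD(2)[OF F[OF N(1)] x(1)] x by (simp_all add: x2_def)
 have Mx2: "M N x2 = M m x" unfolding x2_def by (rule M_F[OF N(1) x(1)])
 have Mc2: "hnm B (M N c2 - c) <= \<eta>"
  using c1 c MD(1)[OF c1(1)] HB.nm_diff_commute unfolding c2_def M_F[OF N(3) c1(1)] by (simp add: less_imp_le)
 have Mb2: "hnm B (M N b2 - b) <= \<eta>"
 proof -
  let ?t = "M n1 b1 - b"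
  have t: "?t \<in> hS B" "hnm B ?t <= \<eta>" using b1 b MD(1)[OF b1(1)] HB.nm_diff_commute by (simp_all add: less_imp_le)
  have "M N b2 = (1/2) *c (M n1 b1 + hst B (M n1 b1))"
   using MD(3)[of "F n1 N b1 + st N (F n1 N b1)" N] MD(4)[OF Fb1 N.S_st[OF Fb1]] MD(2)[OF Fb1] Fb1
   unfolding M_F[OF N(2) b1(1)] b2_def by simp
  moreover have "b = (1/2) *c (b + b)" by (simp only: scl_half)
  ultimately have "M N b2 - b = (1/2) *c ((M n1 b1 + hst B (M n1 b1)) - (b + b))" by (simp only: scl_diff_right)
  also have "\<dots> = (1/2) *c (?t + hst B ?t)" using MD(1)[OF b1(1)] b by (simp add: HB.st_diff algebra_simps)
  finally have "hnm B (M N b2 - b) = 1/2 * hnm B (?t + hst B ?t)" using t by (simp add: HB.nm_scl)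
  moreover have "hnm B (?t + hst B ?t) <= \<eta> + \<eta>" using t by (intro HB.nm_add_le) auto
  ultimately show ?thesis by simp
 qed
 have MS: "M N b2 \<in> hS B" "M N c2 \<in> hS B" "M N x2 \<in> hS B" "M N (e N) \<in> hS B" using MD(1) b2 c2 x2 N.e_S by blast+
 define y where "y = b2 + of_real \<rho> *c e N"
 define z where "z = c2 + ka *c e N"
 have y: "y \<in> S N" "st N y = y" using b2 by (simp_all add: y_def N.st_add N.st_scl)
 have z: "z \<in> S N" using c2 by (simp add: z_def)
 have yz: "y * z - e N = b2 * c2 + ka *c b2 + of_real \<rho> *c c2" "z * y - e N = c2 * b2 + ka *c b2 + of_real \<rho> *c c2"
  using b2 c2 \<rho>ka by (simp_all add: y_def z_def algebra_simps scl_simps)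
 have Mlin: "M N (u * v + ka *c b2 + of_real \<rho> *c c2) = M N u * M N v + ka *c M N b2 + of_real \<rho> *c M N c2"
  if "u \<in> S N" "v \<in> S N" for u v
  using that b2 c2 by (simp add: MD(3-5))
 have bound: "hnm B (P * Q - p * q + ka *c (M N b2 - b) + of_real \<rho> *c (M N c2 - c)) < 1"
  if "P \<in> hS B" "Q \<in> hS B" "p \<in> hS B" "q \<in> hS B" "hnm B (P - p) <= \<eta>" "hnm B (Q - q) <= \<eta>"
   "hnm B p + hnm B q = hnm B b + hnm B c" for P Q p q
 proof -
  have "hnm B Q <= \<eta> + hnm B q" using HB.nm_add_le[of "Q - q" q \<eta> "hnm B q"] that by simp
  then have "hnm B ((P - p) * Q) <= \<eta> * (\<eta> + hnm B q)" using that by (intro HB.nm_mult_le) auto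
  moreover have "hnm B (p * (Q - q)) <= hnm B p * \<eta>" using that by (intro HB.nm_mult_le) auto
  moreover have "hnm B (ka *c (M N b2 - b)) <= cmod ka * \<eta>" using Mb2 b MS by (simp add: HB.nm_scl mult_left_mono)
  moreover have "hnm B (of_real \<rho> *c (M N c2 - c)) <= \<bar>\<rho>\<bar> * \<eta>" using Mc2 c MS by (simp add: HB.nm_scl mult_left_mono)
  moreover have "P * Q - p * q = (P - p) * Q + p * (Q - q)" by (simp add: algebra_simps)
  ultimately have "hnm B (P * Q - p * q + ka *c (M N b2 - b) + of_real \<rho> *c (M N c2 - c))
    <= \<eta> * (\<eta> + hnm B q) + hnm B p * \<eta> + cmod ka * \<eta> + \<bar>\<rho>\<bar> * \<eta>"
   using that b c MS by (simp only:) (intro HB.nm_add_le; simp)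
  also have "\<dots> = \<eta> * (\<eta> + (hnm B p + hnm B q) + cmod ka + \<bar>\<rho>\<bar>)" by (simp add: algebra_simps)
  also have "\<dots> < \<eta> * K" using \<eta> K that(7) by (intro mult_strict_left_mono) auto
  finally show ?thesis using \<eta> by linarith
 qed
 have small1: "hnm B (M N (y * z - e N)) < 1"
 proof -
  have "M N (y * z - e N) = (M N b2 * M N c2 + ka *c M N b2 + of_real \<rho> *c M N c2) - (b * c + ka *c b + of_real \<rho> *c c)"
   unfolding yz bc Mlin[OF b2(1) c2] by simp
  also have "\<dots> = M N b2 * M N c2 - b * c + ka *c (M N b2 - b) + of_real \<rho> *c (M N c2 - c)"
   by (simp add: algebra_simps scl_simps)
  finally show ?thesis using bound[OF MS(1,2) b(1) c Mb2 Mc2] by simp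
 qed
 have small2: "hnm B (M N (z * y - e N)) < 1"
 proof -
  have "M N (z * y - e N) = (M N c2 * M N b2 + ka *c M N b2 + of_real \<rho> *c M N c2) - (c * b + ka *c b + of_real \<rho> *c c)"
   unfolding yz bc Mlin[OF c2 b2(1)] by simp
  also have "\<dots> = M N c2 * M N b2 - c * b + ka *c (M N b2 - b) + of_real \<rho> *c (M N c2 - c)"
   by (simp add: algebra_simps scl_simps)
  finally show ?thesis using bound[OF MS(2,1) c b(1) Mc2 Mb2] by simp
 qed
 have small3: "hnm B (M N (x2 - (1/2) *c e N - y)) < \<delta>"
 proof -
  have p: "hnm B (M N (e N)) <= 1" using M_contractive[OF N.e_S] N.nm_e by linarith
  have xp: "M N x2 * M N (e N) = M N x2" "M N b2 * M N (e N) = M N b2"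
   using MD(5)[OF x2(1) N.e_S] MD(5)[OF b2(1) N.e_S] x2 b2 by simp_all
  have "M N (x2 - (1/2) *c e N - y) = M N x2 - (1/2) *c M N (e N) - (M N b2 + of_real \<rho> *c M N (e N))"
   using x2 b2 y by (simp add: Mdiff MD(3)) (simp add: y_def MD(3,4))
  also have "\<dots> = ((M m x - b) * M N (e N) - of_real (1/2 + \<rho>) *c M N (e N)) + (b - M N b2) * M N (e N)"
   using xp by (simp add: Mx2 algebra_simps scl_simps)
  finally have eq: "M N (x2 - (1/2) *c e N - y) = \<dots>" .
  have "hnm B ((b - M N b2) * M N (e N)) <= \<eta> * 1"
   using Mb2 p MS b by (intro HB.nm_mult_le) (auto simp: HB.nm_diff_commute)
  then have "hnm B (M N (x2 - (1/2) *c e N - y)) <= \<delta>/4 + \<eta> * 1"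
   unfolding eq using near[OF MS(4) p] MS Mx b by (intro HB.nm_add_le) auto
  then show ?thesis using \<eta> \<delta> by linarith
 qed
 have in': "y * z - e N \<in> S N" "z * y - e N \<in> S N" "x2 - (1/2) *c e N - y \<in> S N" using y z x2 by simp_all
 obtain N1 where N1: "N <= N1" "!!n. n \<ge> N1 ==> nm n (F N n (y * z - e N)) < 1" using eventually_less[OF in'(1) small1] by blast
 obtain N2 where N2: "N <= N2" "!!n. n \<ge> N2 ==> nm n (F N n (z * y - e N)) < 1" using eventually_less[OF in'(2) small2] by blast
 obtain N3 where N3: "N <= N3" "!!n. n \<ge> N3 ==> nm n (F N n (x2 - (1/2) *c e N - y)) < \<delta>" using eventually_less[OF in'(3) small3] by blast
 define n where "n = max N1 (max N2 N3)"
 have n: "N <= n" "N1 <= n" "N2 <= n" "N3 <= n" using N1 N2 N3 by (auto simp: n_def)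
 interpret n: hcstar1 "S n" "st n" "nm n" "e n" by (rule C1)
 define T where "T = F N n"
 have T: "star_map (S N) (st N) (S n) (st n) T" unfolding T_def by (rule F[OF n(1)])
 note TD = star_mapD[OF T]
 have Tdiff: "T (u - v) = T u - T v" if "u \<in> S N" "v \<in> S N" for u v
  by (rule star_map_diff(1)[OF T hcstar_hosted[OF alg] that])
 define p where "p = T (e N)"
 have p: "p \<in> S n" "st n p = p" "p * p = p" using TD(1)[OF N.e_S] TD(2)[OF N.e_S] TD(5)[OF N.e_S N.e_S] by (simp_all add: p_def)
 have pu: "p * T u = T u" "T u * p = T u" if "u \<in> S N" for u
  using TD(5)[OF N.e_S that] TD(5)[OF that N.e_S] that by (simp_all add: p_def)
 define y' where "y' = T y - (1/2) *c (e n - p)"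
 define z' where "z' = T z - 2 *c (e n - p)"
 have y': "y' \<in> S n" "st n y' = y'" and z': "z' \<in> S n"
  using p TD(1)[OF y(1)] TD(2)[OF y(1)] TD(1)[OF z] y by (simp_all add: y'_def z'_def n.st_diff n.st_scl)
 have "y' * z' = e n - (p - T y * T z)" "z' * y' = e n - (p - T z * T y)"
  using pu[OF y(1)] pu[OF z] p TD(1)[OF y(1)] TD(1)[OF z] by (simp_all add: y'_def z'_def algebra_simps scl_simps)
 moreover have "p - T y * T z = - T (y * z - e N)" "p - T z * T y = - T (z * y - e N)"
  using y z by (simp_all add: Tdiff TD(5) p_def)
 ultimately have prods: "y' * z' = e n - (- T (y * z - e N))" "z' * y' = e n - (- T (z * y - e N))" by simp_all
 have Tin: "T (y * z - e N) \<in> S n" "T (z * y - e N) \<in> S n" using TD(1) in' by blast+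
 obtain r1 where r1: "r1 \<in> S n" "y' * z' * r1 = e n"
  using n.neumann[of "- T (y * z - e N)"] N1(2)[OF n(2)] Tin unfolding prods T_def by auto
 obtain r2 where r2: "r2 \<in> S n" "r2 * (z' * y') = e n"
  using n.neumann[of "- T (z * y - e N)"] N2(2)[OF n(3)] Tin unfolding prods T_def by auto
 have "r2 * z' = r2 * z' * (y' * (z' * r1))" using r1 r2 z' by (simp add: mult.assoc)
 also have "\<dots> = r2 * (z' * y') * (z' * r1)" by (simp only: mult.assoc)
 also have "\<dots> = z' * r1" using r1 r2 z' by simp
 finally have r12: "r2 * z' = z' * r1" .
 have inv: "y' * (z' * r1) = e n" "z' * r1 * y' = e n"
 proof -
  show "y' * (z' * r1) = e n" using r1 by (simp add: mult.assoc)
  show "z' * r1 * y' = e n" unfolding r12[symmetric] using r2 by (simp add: mult.assoc)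
 qed
 have "F m n x = T x2" unfolding T_def x2_def using F_comp[OF N(1) n(1) x(1)] by simp
 then have "F m n x - (1/2) *c e n - y' = T (x2 - (1/2) *c e N - y)"
  using x2 y by (simp add: Tdiff TD(3) y'_def p_def scl_simps)
 then have "nm n (F m n x - (1/2) *c e n - y') <= \<delta>" using N3(2)[OF n(4)] by (simp add: T_def less_imp_le)
 then show ?thesis using inv y' z' r1 n N by (intro exI[of _ n] conjI bexI[of _ y'] bexI[of _ "z' * r1"]) auto
qed

text \<open>Think of \<open>f\<close>, \<open>x\<close>, \<open>g\<close> as three functions such that each is one on the support of the
preceding one. The projection \<open>s\<close> lies above \<open>f\<close> up to \<open>\<delta>\<close>, and exactly in the
hereditary subalgebra of \<open>g\<close>. The exactness is expressed through annihilators. It must hold for all late stages, so that several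
projections can be found at a common stage; therefore the projection is found once, and its images are cut down again.\<close>

lemma interpolating_projection:
 assumes rr: "real_rank_zero B" and x: "x \<in> S m" "st m x = x"
  and f: "f \<in> S m" "x * f = f" and g: "g \<in> S m" "st m g = g" "x * g = x" and \<delta>: "0 < \<delta>"
 shows "\<exists>n0\<ge>m. \<forall>n\<ge>n0. \<exists>s\<in>S n. s * s = s & st n s = s & nm n (F m n f - s * F m n f) <= \<delta> &
  (\<forall>z\<in>S n. z * F m n g = 0 --> z * s = 0)"
proof -
 interpret m: hcstar1 "S m" "st m" "nm m" "e m" by (rule C1)
 define a b where "a = 1 + nm m g" and "b = 1 + nm m f"
 have ab: "1 <= a" "1 <= b" "nm m g <= a" "nm m f <= b" using g f by (simp_all add: a_def b_def)
 \<comment> \<open>Small enough for the cut down at a later stage, where \<open>a\<close> bounds \<open>1 + nm g\<close>, and for the final estimate.\<close>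
 define d where "d = min (1 / (140 * a\<^sup>2)) (\<delta> / (74 * a\<^sup>2 * b))"
 have d: "0 < d" "2 * d * a * a <= 1/70" "74 * d * a * a * b <= \<delta>"
  using ab \<delta> by (auto simp: d_def min_def field_simps power2_eq_square)
 obtain n0 y yi where n0: "m <= n0" and y: "y \<in> S n0" "yi \<in> S n0" "st n0 y = y" "y * yi = e n0" "yi * y = e n0"
  and near: "nm n0 (F m n0 x - (1/2) *c e n0 - y) <= d"
  using approximate_invertible[OF rr x d(1)] by blast
 interpret n0: hcstar1 "S n0" "st n0" "nm n0" "e n0" by (rule C1)
 note F0 = star_mapD[OF F[OF n0]]
 obtain s where s: "s \<in> S n0" "s * s = s" "st n0 s = s"
  "!!f. f \<in> S n0 ==> F m n0 x * f = f ==> nm n0 (f - s * f) <= 2 * d * nm n0 f"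
  "!!h. h \<in> S n0 ==> F m n0 x * h = 0 ==> nm n0 (s * h) <= 2 * d * nm n0 h"
  using n0.sign_projection[OF y(1,3,2,4,5) F0(1)[OF x(1)] near] by blast
 have sf: "nm n0 (F m n0 f - s * F m n0 f) <= 2 * d * b"
 proof -
  have "F m n0 x * F m n0 f = F m n0 f" using F0(5)[OF x(1) f(1)] f by simp
  then have "nm n0 (F m n0 f - s * F m n0 f) <= 2 * d * nm n0 (F m n0 f)" by (intro s(4) F0(1) f)
  also have "\<dots> <= 2 * d * b" using F_contractive[OF n0 f(1)] ab d by (intro mult_left_mono) auto
  finally show ?thesis .
 qed
 have sg: "nm n0 (s - s * F m n0 g) <= 2 * d * a"
 proof -
  have "F m n0 x * (e n0 - F m n0 g) = 0"
   using F0(5)[OF x(1) g(1)] F0(1)[OF x(1)] g by (simp add: right_diff_distrib)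
  then have "nm n0 (s * (e n0 - F m n0 g)) <= 2 * d * nm n0 (e n0 - F m n0 g)" using F0(1) g by (intro s(5)) auto
  also have "nm n0 (e n0 - F m n0 g) <= 1 + nm m g"
   using F_contractive[OF n0 g(1)] n0.nm_e F0(1)[OF g(1)] by (intro n0.nm_diff_le) auto
  finally show ?thesis using d s by (simp add: a_def right_diff_distrib)
 qed
 have main: "\<exists>p\<in>S n. p * p = p & st n p = p & nm n (F m n f - p * F m n f) <= \<delta> & (\<forall>z\<in>S n. z * F m n g = 0 --> z * p = 0)"
  if n: "n0 <= n" for n
 proof -
  have mn: "m <= n" using n n0 by simp
  interpret n: hcstar1 "S n" "st n" "nm n" "e n" by (rule C1)
  note T = star_mapD[OF F[OF n]] and Fm = star_mapD[OF F[OF mn]]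
  have Tdiff: "F n0 n (u - v) = F n0 n u - F n0 n v" if "u \<in> S n0" "v \<in> S n0" for u v
   by (rule star_map_diff(1)[OF F[OF n] hcstar_hosted[OF alg] that])
  define t where "t = F n0 n s"
  have t: "t \<in> S n" "t * t = t" "st n t = t" using T(1)[OF s(1)] T(2)[OF s(1)] T(5)[OF s(1) s(1)] s by (simp_all add: t_def)
  have Fg: "F m n g \<in> S n" "st n (F m n g) = F m n g" "nm n (F m n g) <= nm m g"
   using Fm(1)[OF g(1)] Fm(2)[OF g(1)] g F_contractive[OF mn g(1)] by simp_all
  have Ff: "F m n f \<in> S n" "nm n (F m n f) <= b" using Fm(1)[OF f(1)] F_contractive[OF mn f(1)] ab by simp_all
  have "t - t * F m n g = F n0 n (s - s * F m n0 g)"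
   using s F0(1)[OF g(1)] F_comp[OF n0 n g(1)] by (simp add: Tdiff T(5) t_def)
  then have tg: "nm n (t - t * F m n g) <= 2 * d * a"
   using F_contractive[OF n, of "s - s * F m n0 g"] sg s F0(1)[OF g(1)] by simp
  have "F m n f - t * F m n f = F n0 n (F m n0 f - s * F m n0 f)"
   using s F0(1)[OF f(1)] F_comp[OF n0 n f(1)] by (simp add: Tdiff T(5) t_def)
  then have tf: "nm n (F m n f - t * F m n f) <= 2 * d * b"
   using F_contractive[OF n, of "F m n0 f - s * F m n0 f"] sf s F0(1)[OF f(1)] by simp
  have le: "2 * d * a * (1 + nm n (F m n g)) <= 2 * d * a * a"
   using Fg d ab by (intro mult_left_mono) (auto simp: a_def)
  then obtain p where p: "p \<in> S n" "p * p = p" "st n p = p" "nm n (p - t) <= 36 * (2 * d * a * (1 + nm n (F m n g)))"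
   "\<forall>z\<in>S n. z * F m n g = 0 --> z * p = 0"
   using n.cut_down_projection[OF t Fg(1,2) tg order.trans[OF le d(2)]] by blast
  have "nm n (p - t) <= 72 * d * a * a" using p(4) le by linarith
  then have "nm n ((p - t) * F m n f) <= 72 * d * a * a * b" using p t Ff by (intro n.nm_mult_le) auto
  moreover have "F m n f - p * F m n f = (F m n f - t * F m n f) - (p - t) * F m n f" by (simp add: algebra_simps)
  ultimately have "nm n (F m n f - p * F m n f) <= 2 * d * b + 72 * d * a * a * b"
   using tf p t Ff by (simp only:) (intro n.nm_diff_le; simp)
  also have "\<dots> <= 2 * d * b * (a * a) + 72 * d * a * a * b"
  proof -
   have "1 * 1 <= a * a" using ab by (intro mult_mono) auto
   then have "2 * d * b * 1 <= 2 * d * b * (a * a)" using d ab by (intro mult_left_mono) auto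
   then show ?thesis by linarith
  qed
  also have "\<dots> = 74 * d * a * a * b" by (simp add: algebra_simps)
  finally have "nm n (F m n f - p * F m n f) <= \<delta>" using d(3) by linarith
  then show ?thesis using p by blast
 qed
 then show ?thesis using n0 by blast
qed

end

section \<open>Minimal projections in finite dimension\<close>

interpretation cvs: vector_space "scl :: complex => 'h::complex_alg => 'h"
 by unfold_locales (simp_all add: scl_add_right scl_add_left)

lemma scl_eq_0_iff: "c *c x = 0 \<longleftrightarrow> c = 0 \<or> x = 0"
 by (rule cvs.scale_eq_0_iff)

lemma scl_cancel: "a *c x = b *c x ==> x ~= 0 ==> a = b"
 by (simp add: cvs.scale_right_imp_eq)

text \<open>The ambient space may have infinite dimension; finiteness comes from the span of \<open>X\<close>.\<close>

lemma subspace_dim_less: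
 assumes U: "cvs.subspace U" and W: "cvs.subspace W" and UW: "U \<subset> W" and X: "finite X" "W \<subseteq> cvs.span X"
 shows "cvs.dim U < cvs.dim W"
proof -
 obtain B where B: "B \<subseteq> U" "cvs.independent B" "U \<subseteq> cvs.span B" "card B = cvs.dim U" using cvs.basis_exists .
 obtain C where C: "C \<subseteq> W" "cvs.independent C" "W \<subseteq> cvs.span C" "card C = cvs.dim W" using cvs.basis_exists .
 obtain x where x: "x \<in> W" "x \<notin> U" using UW by blast
 have "cvs.span B \<subseteq> U" using B(1) U by (rule cvs.span_minimal)
 then have xB: "x \<notin> cvs.span B" using x by blast
 have ind: "cvs.independent (insert x B)" using B(2) xB by (simp add: cvs.independent_insertI)
 have finC: "finite C" using cvs.independent_span_bound[OF X(1) C(2)] C(1) X(2) by blast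
 have "insert x B \<subseteq> cvs.span C" using x B(1) UW C(3) by blast
 then have "finite (insert x B)" "card (insert x B) <= card C" using cvs.independent_span_bound[OF finC ind] by auto
 moreover have "x \<notin> B" using xB cvs.span_base by blast
 ultimately show ?thesis using B(4) C(4) by simp
qed

definition compress :: "'h::complex_alg => 'h set => 'h set" where "compress x S = (\<lambda>y. x * y * x) ` S"

context hcstar begin

lemma compress_subspace: "cvs.subspace (compress x S)"
proof -
 have "\<exists>w\<in>S. x * y * x + x * z * x = x * w * x" if "y \<in> S" "z \<in> S" for y z
  using that by (intro bexI[of _ "y + z"]) (auto simp: algebra_simps)
 moreover have "\<exists>w\<in>S. c *c (x * y * x) = x * w * x" if "y \<in> S" for c y
  using that by (intro bexI[of _ "c *c y"]) auto
 moreover have "\<exists>w\<in>S. 0 = x * w * x" by (intro bexI[of _ 0]) auto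
 ultimately show ?thesis unfolding cvs.subspace_def compress_def by (auto simp: image_iff)
qed

lemma compress_subset: assumes "z \<in> compress x S" "x \<in> S" shows "compress z S \<subseteq> compress x S"
proof
 fix w assume "w \<in> compress z S"
 then obtain y where y: "y \<in> S" "w = z * y * z" by (auto simp: compress_def)
 obtain v where v: "v \<in> S" "z = x * v * x" using assms by (auto simp: compress_def)
 have "w = x * (v * x * y * x * v) * x" by (simp add: y v mult.assoc)
 then show "w \<in> compress x S" using y v assms by (auto simp: compress_def)
qed

lemma compress_in: "x \<in> S ==> z \<in> compress x S ==> z \<in> S" by (auto simp: compress_def)

lemma compress_proj_iff: assumes "p \<in> S" "p * p = p" shows "z \<in> compress p S \<longleftrightarrow> z \<in> S & p * z = z & z * p = z"
proof
 assume "z \<in> compress p S"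
 then obtain y where "y \<in> S" "z = p * y * p" by (auto simp: compress_def)
 then show "z \<in> S & p * z = z & z * p = z" using assms by (simp add: mult.assoc) (simp flip: mult.assoc)
next
 assume z: "z \<in> S & p * z = z & z * p = z"
 then have "z = p * z * p" by simp
 then show "z \<in> compress p S" using z unfolding compress_def by blast
qed

lemma corner_hcstar1:
 assumes p: "p \<in> S" "p * p = p" "st p = p"
 shows "hcstar1 (compress p S) st nm p"
proof -
 note iff = compress_proj_iff[OF p(1,2)]
 have stz: "p * st z = st z & st z * p = st z" if "z \<in> S" "p * z = z" "z * p = z" for z
  using st_mult[OF p(1) that(1)] st_mult[OF that(1) p(1)] that p by simp
 show ?thesis
 proof
  fix X :: "nat => 'h"
  assume X: "!!n. X n \<in> compress p S" and c: "!!d. 0 < d ==> \<exists>N. \<forall>m\<ge>N. \<forall>n\<ge>N. nm (X m - X n) < d"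
  then have XS: "X n \<in> S" "p * X n = X n" "X n * p = X n" for n using iff by blast+
  obtain x where x: "x \<in> S" "(\<lambda>n. nm (X n - x)) \<longlonglongrightarrow> 0" using S_complete[OF XS(1) c] by blast
  then have cx: "conv X x" using XS by (simp add: conv_def)
  have "p * x = x" using conv_unique[OF conv_mult[OF conv_const[OF p(1)] cx], of x] cx XS by simp
  moreover have "x * p = x" using conv_unique[OF conv_mult[OF cx conv_const[OF p(1)]], of x] cx XS by simp
  ultimately show "\<exists>x\<in>compress p S. (\<lambda>n. nm (X n - x)) \<longlonglongrightarrow> 0" using x iff by blast
 next
  fix x y assume "x \<in> compress p S" "y \<in> compress p S"
  then have xy: "x \<in> S" "p * x = x" "x * p = x" "y \<in> S" "p * y = y" "y * p = y" using iff by blast+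
  show "x * y \<in> compress p S" using xy iff by (simp add: mult.assoc) (simp flip: mult.assoc)
 qed (use p stz in \<open>auto simp: iff st_add st_scl st_mult nm_eq_0 nm_add nm_scl nm_mult nm_cstar algebra_simps\<close>)
qed

lemma st_mult_eq_0: "x \<in> S ==> st x * x = 0 ==> x = 0"
 using nm_cstar[of x] nm_eq_0[of x] by simp

lemma sa_square_nonzero: "x \<in> S ==> st x = x ==> x ~= 0 ==> x * x ~= 0"
 using st_mult_eq_0[of x] by metis

definition minproj :: "'h => bool" where
 "minproj p \<longleftrightarrow> p \<in> S & p ~= 0 & p * p = p & st p = p & (\<forall>y\<in>S. \<exists>c. p * y * p = c *c p)"

text \<open>Both \<open>v\<^sup>* v\<close> and \<open>v v\<^sup>*\<close> are scalars times a minimal projection; comparing \<open>v v\<^sup>* v\<close> shows that the scalars agree.\<close>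

lemma minproj_isometry:
 assumes e: "minproj e" and f: "minproj f" and v: "v \<in> S" "v ~= 0" "e * v = v" "v * f = v"
 shows "\<exists>c::real. 0 < c & st v * v = of_real c *c f & v * st v = of_real c *c e"
proof -
 have eS: "e \<in> S" "e * e = e" "st e = e" "e ~= 0" and fS: "f \<in> S" "f * f = f" "st f = f" "f ~= 0"
  using e f by (auto simp: minproj_def)
 have sv: "f * st v = st v" "st v * e = st v"
  using st_mult[OF v(1) fS(1)] st_mult[OF eS(1) v(1)] v eS fS by simp_all
 obtain c where c: "f * (st v * v) * f = c *c f" using f v unfolding minproj_def by fastforce
 have svv: "st v * v = c *c f" using c sv v by (metis mult.assoc)
 obtain d where d: "e * (v * st v) * e = d *c e" using e v unfolding minproj_def by fastforce
 have vsv: "v * st v = d *c e" using d sv v by (metis mult.assoc)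
 have "v * st v * v = d *c v" using v vsv by simp
 moreover have "v * st v * v = c *c v" using svv v by (simp add: mult.assoc)
 ultimately have cd: "d = c" using scl_cancel v by metis
 have "st (st v * v) = st v * v" using v by (simp add: st_mult)
 then have "cnj c *c f = c *c f" using svv fS by (simp add: st_scl)
 then have "cnj c = c" using scl_cancel fS by blast
 then obtain r :: real where r: "c = of_real r" by (metis Reals_cnj_iff Reals_cases)
 have "0 < r"
 proof (rule ccontr)
  assume "\<not> 0 < r"
  obtain g where g: "f * v * f = g *c f" using f v unfolding minproj_def by fastforce
  have fv: "f * v = g *c f" using g v by (simp add: mult.assoc)
  have svf: "st v * f = cnj g *c f" using st_mult[OF fS(1) v(1)] fv fS by (simp add: st_scl)
  define w where "w = v - g *c f"
  have w: "w \<in> S" "f * w = 0" "w * f = w" using v fS fv by (simp_all add: w_def algebra_simps)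
  have stw: "st w = st v - cnj g *c f" using v fS by (simp add: w_def st_diff st_scl)
  have stwf: "st w * f = 0" using st_mult[OF fS(1) w(1)] w fS by simp
  define k where "k = r - (cmod g)\<^sup>2"
  have "st w * w = st v * v - g *c (st v * f) - cnj g *c (f * v) + (cnj g * g) *c (f * f)"
   unfolding stw by (simp add: w_def algebra_simps)
  also have "cnj g * g = of_real ((cmod g)\<^sup>2)" by (simp only: complex_norm_square mult.commute)
  also have "st v * v - g *c (st v * f) - cnj g *c (f * v) + of_real ((cmod g)\<^sup>2) *c (f * f) = of_real k *c f"
  proof -
   have "g * cnj g = of_real ((cmod g)\<^sup>2)" "cnj g * g = of_real ((cmod g)\<^sup>2)"
    by (simp_all only: complex_norm_square mult.commute)
   then show ?thesis unfolding svv svf fv fS(2) r k_def by (simp only: scl_scl) (simp add: scl_simps)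
  qed
  finally have sww: "st w * w = of_real k *c f" .
  define s where "s = sqrt (- k)"
  have k0: "k <= 0" unfolding k_def using \<open>\<not> 0 < r\<close> zero_le_power2[of "cmod g"] by linarith
  then have s2: "s * s = - k" by (simp add: s_def)
  define a where "a = of_real s *c f + w"
  have a: "a \<in> S" using fS w by (simp add: a_def)
  have "st a = of_real s *c f + st w" using fS w by (simp add: a_def st_add st_scl)
  then have "st a * a = of_real (s * s) *c f + of_real k *c f"
   using fS w stwf sww by (simp add: a_def algebra_simps)
  also have "\<dots> = 0" unfolding s2 by simp
  finally have "a = 0" using st_mult_eq_0[OF a] by blast
  then have "f * a = 0" by simp
  then have "of_real s *c f = 0" using w fS by (simp add: a_def algebra_simps)
  then have "s = 0" using fS by (simp add: scl_eq_0_iff)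
  then have "k = 0" "w = 0" using s2 \<open>a = 0\<close> by (simp_all add: a_def)
  then have "r = (cmod g)\<^sup>2" "v = g *c f" by (simp_all add: k_def w_def)
  then have "g ~= 0" using v by auto
  then show False using \<open>r = (cmod g)\<^sup>2\<close> \<open>\<not> 0 < r\<close> by simp
 qed
 then show ?thesis using svv vsv cd r by auto
qed

end

locale hfd = hcstar S st nm for S :: "'h::complex_alg set" and st nm +
 fixes X :: "'h set" assumes finX: "finite X" and spanX: "S \<subseteq> cvs.span X"
begin

text \<open>Among the nonzero self-adjoint elements \<open>x\<close> of \<open>h S h\<close> take one for which \<open>x S x\<close> has least dimension. By minimality every
nonzero self-adjoint \<open>z\<close> in \<open>x S x\<close> satisfies \<open>z S z = x S x\<close>, which leaves room only for the multiples of one projection.\<close>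

lemma minproj_exists:
 assumes h: "h \<in> S" "st h = h" "h ~= 0"
 shows "\<exists>p\<in>compress h S. minproj p"
proof -
 define P where "P n \<longleftrightarrow> (\<exists>x. x \<in> compress h S & st x = x & x ~= 0 & cvs.dim (compress x S) = n)" for n
 have "h * h * h ~= 0"
 proof
  assume "h * h * h = 0"
  then have "(h * h) * (h * h) = 0" by (metis mult.assoc mult_zero_left)
  then show False using sa_square_nonzero[OF h] sa_square_nonzero[of "h * h"] h by (simp add: st_mult)
 qed
 then have "P (cvs.dim (compress (h * h * h) S))"
  unfolding P_def using h by (intro exI[of _ "h * h * h"]) (auto simp: st_mult mult.assoc compress_def)
 then have "P (LEAST n. P n)" by (rule LeastI)
 then obtain x where x: "x \<in> compress h S" "st x = x" "x ~= 0" "cvs.dim (compress x S) = (LEAST n. P n)" unfolding P_def by blast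
 have xS: "x \<in> S" using x compress_in h by blast
 define W where "W = compress x S"
 have WS: "W \<subseteq> S" using compress_in[OF xS] by (auto simp: W_def)
 have Wh: "W \<subseteq> compress h S" unfolding W_def using compress_subset[OF x(1) h(1)] .
 have full: "compress z S = W" if z: "z \<in> W" "st z = z" "z ~= 0" for z
 proof (rule ccontr)
  assume "compress z S ~= W"
  then have sub: "compress z S \<subset> compress x S" using compress_subset[OF _ xS] z by (auto simp: W_def)
  have "compress x S \<subseteq> cvs.span X" using WS spanX by (auto simp: W_def)
  then have "cvs.dim (compress z S) < cvs.dim W"
   unfolding W_def by (rule subspace_dim_less[OF compress_subspace compress_subspace sub finX])
  moreover have "P (cvs.dim (compress z S))" unfolding P_def using z Wh by blast
  ultimately show False using x(4) not_less_Least unfolding W_def by metis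
 qed
 define z where "z = x * x * x"
 have z: "z \<in> W" "z \<in> S" "st z = z" "z ~= 0"
 proof -
  show "z \<in> W" using xS by (auto simp: W_def compress_def z_def)
  then show "z \<in> S" using WS by blast
  show "st z = z" using xS x by (simp add: z_def st_mult mult.assoc)
  show "z ~= 0"
  proof
   assume "z = 0"
   then have "(x * x) * (x * x) = 0" by (metis mult.assoc mult_zero_left z_def)
   then show False using sa_square_nonzero[OF xS x(2,3)] sa_square_nonzero[of "x * x"] xS x by (simp add: st_mult)
  qed
 qed
 have Wz: "compress z S = W" using full z by blast
 have "z * z = x * (x * x * x * x) * x" by (simp add: z_def mult.assoc)
 then have zz: "z * z \<in> W" using xS by (auto simp: W_def compress_def)
 have "compress (z * z) S = W" using zz z sa_square_nonzero by (intro full) (auto simp: st_mult)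
 then have "z \<in> compress (z * z) S" using z by simp
 then obtain y where y: "y \<in> S" "z = z * z * y * (z * z)" by (auto simp: compress_def)
 define p where "p = z * (y * z) * z"
 have pW: "p \<in> W" using Wz y z by (auto simp: p_def compress_def)
 have pS: "p \<in> S" using pW WS by blast
 have zp: "z * p = z" using y by (simp add: p_def mult.assoc)
 have right: "w * p = w" if w: "w \<in> W" for w
 proof -
  obtain v where "w = z * v * z" using w unfolding Wz[symmetric] by (auto simp: compress_def)
  then show ?thesis using zp by (simp add: mult.assoc)
 qed
 have stW: "st w \<in> W" if w: "w \<in> W" for w
 proof -
  obtain v where v: "w = x * v * x" "v \<in> S" using w unfolding W_def by (auto simp: compress_def)
  then have "st w = x * st v * x" using xS x by (simp add: st_mult mult.assoc)
  then show ?thesis using v by (auto simp: W_def compress_def)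
 qed
 have left: "st p * w = w" if w: "w \<in> W" for w
  using st_mult[of "st w" p] right[OF stW[OF w]] w WS pS by auto
 have stp: "st p = p" using left[OF pW] right[OF stW[OF pW]] by simp
 have pp: "p * p = p" using right[OF pW] .
 have p0: "p ~= 0" using zp z by auto
 have Wp: "compress p S = W" using full pW stp p0 by blast
 interpret W: hcstar1 W st nm p using corner_hcstar1[OF pS pp stp] Wp by simp
 have invertible: "\<exists>r\<in>W. w * r = p & r * w = p" if w: "w \<in> W" "st w = w" "w ~= 0" for w
 proof -
  have "p \<in> compress w S" using full[OF w] pW by simp
  then obtain v where v: "v \<in> S" "p = w * v * w" by (auto simp: compress_def)
  define r where "r = p * v * w * p" define r' where "r' = p * w * v * p"
  have pwp: "p * w = w" "w * p = w" using w by simp_all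
  have "w * r = p" using v pwp pp by (simp add: r_def flip: mult.assoc) 
  moreover have "r' * w = p" using v pwp pp by (simp add: r'_def mult.assoc)
  moreover have "r \<in> W" "r' \<in> W"
  proof -
   have "v * w \<in> S" "w * v \<in> S" using v w WS by auto
   moreover have "r = p * (v * w) * p" "r' = p * (w * v) * p" by (simp_all only: r_def r'_def mult.assoc)
   ultimately show "r \<in> W" "r' \<in> W" unfolding Wp[symmetric] compress_def by blast+
  qed
  moreover have "r' = r"
  proof -
   have "r' = r' * (w * r)" using \<open>w * r = p\<close> \<open>r' \<in> W\<close> by simp
   also have "\<dots> = (r' * w) * r" by (simp only: mult.assoc)
   also have "\<dots> = r" using \<open>r' * w = p\<close> \<open>r \<in> W\<close> by simp
   finally show ?thesis .
  qed
  ultimately show ?thesis by blast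
 qed
 have sa_scalar: "\<exists>c. w = c *c p" if w: "w \<in> W" "st w = w" for w
 proof (cases "w = 0")
  case True then show ?thesis by (intro exI[of _ 0]) simp
 next
  case False
  have nw: "0 < nm w" using False W.nm_eq_0[OF w(1)] W.nm_nonneg[OF w(1)] by linarith
  define u where "u = of_real (1 / nm w) *c w"
  have u: "u \<in> W" "st u = u" "nm u = 1" using w nw by (simp_all add: u_def W.st_scl W.nm_scl norm_divide)
  have wu: "w = of_real (nm w) *c u" using nw by (simp add: u_def)
  have d0: "p - u * u = 0"
  proof (rule ccontr)
   assume ne: "p - u * u ~= 0"
   have "p - u * u \<in> W" "st (p - u * u) = p - u * u" using u by (simp_all add: W.st_diff W.st_mult)
   then obtain r where "r \<in> W" "(p - u * u) * r = p" "r * (p - u * u) = p" using invertible[OF _ _ ne] by blast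
   then have "nm u < 1" using W.nm_less_1[OF u(1,2)] u(3) by simp
   then show False using u by simp
  qed
  have "u = p \<or> u = - p"
  proof (rule ccontr)
   assume ne: "\<not> ?thesis"
   have a: "p + u \<in> W" "st (p + u) = p + u" "p + u ~= 0" using u ne by (auto simp: W.st_add add_eq_0_iff)
   obtain r where r: "r \<in> W" "r * (p + u) = p" using invertible[OF a] by blast
   have "(p + u) * (p - u) = p - u * u" using u by (simp add: ring_distribs)
   then have "(p + u) * (p - u) = 0" using d0 by simp
   then have "r * (p + u) * (p - u) = 0" by (simp only: mult.assoc mult_zero_right)
   then have "p - u = 0" using r u by simp
   then show False using ne by simp
  qed
  then show ?thesis
  proof
   assume "u = p" then show ?thesis using wu by blast
  next
   assume "u = - p" then have "w = (- of_real (nm w)) *c p" using wu by simp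
   then show ?thesis by blast
  qed
 qed
 have "\<exists>c. p * y * p = c *c p" if y: "y \<in> S" for y
 proof -
  define w where "w = p * y * p"
  have w: "w \<in> W" using y Wp by (auto simp: w_def compress_def)
  obtain a where a: "w + st w = a *c p" using sa_scalar[of "w + st w"] w by (auto simp: W.st_add add.commute)
  have "st (\<i> *c (w - st w)) = \<i> *c (w - st w)" using w by (simp add: W.st_scl W.st_diff scl_simps)
  then obtain b where b: "\<i> *c (w - st w) = b *c p" using sa_scalar[of "\<i> *c (w - st w)"] w by auto
  have "- (\<i> *c (b *c p)) = w - st w" unfolding b[symmetric] by simp
  then have "w + w = a *c p - \<i> *c (b *c p)" using a by (simp add: algebra_simps)
  then have "(1/2) *c (w + w) = (1/2 * (a - \<i> * b)) *c p" by (simp add: scl_simps diff_divide_distrib)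
  then have "w = (1/2 * (a - \<i> * b)) *c p" by (simp only: scl_half)
  then show ?thesis unfolding w_def by blast
 qed
 then have "minproj p" unfolding minproj_def using pS p0 pp stp by simp
 then show ?thesis by (rule bexI[OF _ subsetD[OF Wh pW]])
qed

lemma proj_decomposition:
 assumes "p \<in> S" "p * p = p" "st p = p"
 shows "\<exists>d (es :: nat => 'h). (\<forall>i<d. minproj (es i)) & (\<forall>i<d. \<forall>j<d. i ~= j --> es i * es j = 0) & p = (\<Sum>i<d. es i)"
 using assms
proof (induction "cvs.dim (compress p S)" arbitrary: p rule: less_induct)
 case less
 show ?case
 proof (cases "p = 0")
  case True
  then show ?thesis by (intro exI[of _ 0]) simp
 next
  case False
  obtain f where f: "f \<in> compress p S" "minproj f" using minproj_exists[OF less(2,4) False] by blast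
  have f': "f \<in> S" "p * f = f" "f * p = f" "f * f = f" "st f = f" "f ~= 0"
   using f compress_proj_iff[OF less(2,3)] by (auto simp: minproj_def)
  define q where "q = p - f"
  have q: "q \<in> S" "q * q = q" "st q = q" "q * f = 0" "f * q = 0" "p * q = q" "q * p = q"
   using less f' by (simp_all add: q_def st_diff algebra_simps)
  have "q \<in> compress p S" using q compress_proj_iff[OF less(2,3)] by blast
  then have "compress q S \<subseteq> compress p S" by (rule compress_subset[OF _ less(2)])
  moreover have "f \<notin> compress q S" using compress_proj_iff[OF q(1,2)] q f' by auto
  ultimately have sub: "compress q S \<subset> compress p S" using f by blast
  have "compress p S \<subseteq> cvs.span X" using compress_in[OF less(2)] spanX by blast
  then have "cvs.dim (compress q S) < cvs.dim (compress p S)"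
   by (rule subspace_dim_less[OF compress_subspace compress_subspace sub finX])
  from less(1)[OF this q(1-3)] obtain d and es :: "nat => 'h" where es: "\<forall>i<d. minproj (es i)"
   "\<forall>i<d. \<forall>j<d. i ~= j --> es i * es j = 0" "q = (\<Sum>i<d. es i)" by blast
  have fe: "f * es i = 0" "es i * f = 0" if "i < d" for i
  proof -
   have ei: "es i \<in> S" "es i * es i = es i" using es(1) that by (auto simp: minproj_def)
   have "es i * q = (\<Sum>j<d. if j = i then es i else 0)" unfolding es(3) sum_distrib_left
    using es(2) that ei by (intro sum.cong) auto
   then have 1: "es i * q = es i" using that by simp
   have "q * es i = (\<Sum>j<d. if j = i then es i else 0)" unfolding es(3) sum_distrib_right
    using es(2) that ei by (intro sum.cong) auto
   then have 2: "q * es i = es i" using that by simp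
   show "f * es i = 0" using arg_cong[OF 2, of "\<lambda>t. f * t"] q(5) by (simp flip: mult.assoc)
   show "es i * f = 0" using arg_cong[OF 1, of "\<lambda>t. t * f"] q(4) by (simp add: mult.assoc)
  qed
  show ?thesis
  proof (intro exI[of _ "Suc d"] exI[of _ "es(d := f)"] conjI allI impI)
   show "p = (\<Sum>i<Suc d. (es(d := f)) i)" using es(3) by (simp add: q_def algebra_simps)
  qed (use es fe f in \<open>auto simp: less_Suc_eq\<close>)
 qed
qed

lemma unit_exists: "\<exists>u. hcstar1 S st nm u"
proof -
 define P where "P n \<longleftrightarrow> (\<exists>p\<in>S. p * p = p & st p = p & cvs.dim (compress p S) = n)" for n
 have "P (cvs.dim (compress 0 S))" unfolding P_def by (intro bexI[of _ 0]) auto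
 moreover have "n <= card X" if Pn: "P n" for n
 proof -
  obtain p where p: "p \<in> S" "cvs.dim (compress p S) = n" using Pn unfolding P_def by blast
  have "compress p S \<subseteq> cvs.span X" using compress_in[OF p(1)] spanX by blast
  then show ?thesis using cvs.dim_le_card finX p by blast
 qed
 ultimately have "P (GREATEST n. P n)" "!!k. P k ==> k <= (GREATEST n. P n)"
  by (blast intro: GreatestI_nat Greatest_le_nat)+
 then obtain n where n: "P n" "!!k. P k ==> k <= n" by blast
 then obtain p where p: "p \<in> S" "p * p = p" "st p = p" "cvs.dim (compress p S) = n" unfolding P_def by blast
 have left: "p * x = x" if x: "x \<in> S" for x
 proof (rule ccontr)
  assume ne: "p * x ~= x"
  define y where "y = x - p * x"
  have y: "y \<in> S" "y ~= 0" "p * y = 0" using p x ne by (simp_all add: y_def algebra_simps flip: mult.assoc)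
  define h where "h = y * st y"
  have h: "h \<in> S" "st h = h" using y by (simp_all add: h_def st_mult)
  have h0: "h ~= 0" using st_mult_eq_0[of "st y"] y st_st[OF y(1)] unfolding h_def by (metis S_st st_0)
  have ph: "p * h = 0" using y by (simp add: h_def flip: mult.assoc)
  then have hp: "h * p = 0" using st_mult[OF p(1) h(1)] p h by simp
  obtain f where f: "f \<in> compress h S" "minproj f" using minproj_exists[OF h h0] by blast
  then obtain v where v: "f = h * v * h" by (auto simp: compress_def)
  have "p * f = p * h * (v * h)" "f * p = h * v * (h * p)" by (simp_all only: v mult.assoc)
  then have f': "f \<in> S" "f * f = f" "st f = f" "f ~= 0" "p * f = 0" "f * p = 0"
   using f ph hp by (simp_all add: minproj_def)
  define q where "q = p + f"
  have q: "q \<in> S" "q * q = q" "st q = q" "q * p = p" "p * q = p" "q * f = f" "f * q = f"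
   using p f' by (simp_all add: q_def st_add algebra_simps)
  have "p \<in> compress q S" "f \<in> compress q S" using q p f' compress_proj_iff[OF q(1,2)] by blast+
  moreover have "f \<notin> compress p S" using compress_proj_iff[OF p(1,2)] f' by auto
  ultimately have sub: "compress p S \<subset> compress q S" using compress_subset[OF _ q(1)] by blast
  have "compress q S \<subseteq> cvs.span X" using compress_in[OF q(1)] spanX by blast
  then have "n < cvs.dim (compress q S)"
   using subspace_dim_less[OF compress_subspace compress_subspace sub finX] p(4) by simp
  then show False using n(2)[of "cvs.dim (compress q S)"] q unfolding P_def by fastforce
 qed
 have "x * p = x" if x: "x \<in> S" for x
  using st_mult[OF p(1) S_st[OF x]] left[OF S_st[OF x]] x p by simp
 then have "hcstar1 S st nm p" using left p by unfold_locales auto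
 then show ?thesis by blast
qed

end

section \<open>Matrix units and the trace\<close>

text \<open>Matrix units for a direct sum of matrix algebras, without naming the summands: \<open>rp\<close> maps an index to a
representative of its class, and \<open>m i j\<close> exists exactly for \<open>i\<close> and \<open>j\<close> of the same class. The function \<open>\<beta> i j\<close> is the coordinate at \<open>m i j\<close>.\<close>

locale munits = hcstar1 S st nm u for S :: "'h::complex_alg set" and st nm u +
 fixes d :: nat and rp :: "nat => nat" and m :: "nat => nat => 'h" and \<beta> :: "nat => nat => 'h => complex"
 assumes rp: "i < d ==> rp i < d" "i < d ==> rp (rp i) = rp i"
  and m: "i < d ==> j < d ==> rp i = rp j ==> m i j \<in> S" "i < d ==> j < d ==> rp i = rp j ==> m i j ~= 0"
   "i < d ==> j < d ==> rp i = rp j ==> st (m i j) = m j i"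
  and m_mult: "i < d ==> j < d ==> k < d ==> l < d ==> rp i = rp j ==> rp k = rp l ==>
   m i j * m k l = (if j = k then m i l else 0)"
  and u_sum: "u = (\<Sum>i<d. m i i)"
  and cut: "x \<in> S ==> i < d ==> j < d ==> m i i * x * m j j = (if rp i = rp j then \<beta> i j x *c m i j else 0)"
begin

lemma expand: assumes "x \<in> S" shows "x = (\<Sum>i<d. \<Sum>j<d. if rp i = rp j then \<beta> i j x *c m i j else 0)"
proof -
 have "x = u * x * u" using assms by simp
 also have "\<dots> = (\<Sum>i<d. \<Sum>j<d. m i i * x * m j j)"
  by (subst (1 2) u_sum) (simp only: sum_distrib_right sum_distrib_left, rule sum.swap)
 also have "\<dots> = (\<Sum>i<d. \<Sum>j<d. if rp i = rp j then \<beta> i j x *c m i j else 0)"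
  using assms cut by (intro sum.cong) auto
 finally show ?thesis .
qed

lemma \<beta>_eqI: "x \<in> S ==> i < d ==> j < d ==> rp i = rp j ==> m i i * x * m j j = c *c m i j ==> \<beta> i j x = c"
 using cut[of x i j] m(2)[of i j] scl_cancel by metis

lemma \<beta>_add: "x \<in> S ==> y \<in> S ==> i < d ==> j < d ==> rp i = rp j ==> \<beta> i j (x + y) = \<beta> i j x + \<beta> i j y"
 by (rule \<beta>_eqI) (auto simp: algebra_simps scl_simps cut[unfolded mult.assoc])

lemma \<beta>_scl: "x \<in> S ==> i < d ==> j < d ==> rp i = rp j ==> \<beta> i j (c *c x) = c * \<beta> i j x"
 by (rule \<beta>_eqI) (auto simp: cut)

lemma \<beta>_st: assumes "x \<in> S" "i < d" "j < d" "rp i = rp j" shows "\<beta> i j (st x) = cnj (\<beta> j i x)"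
proof (rule \<beta>_eqI)
 have "m i i * st x * m j j = st (m j j * x * m i i)"
  using assms by (simp add: st_mult m mult.assoc)
 also have "\<dots> = cnj (\<beta> j i x) *c m i j" using assms by (simp add: cut st_scl m)
 finally show "m i i * st x * m j j = cnj (\<beta> j i x) *c m i j" .
qed (use assms in auto)

lemma \<beta>_mult: assumes "x \<in> S" "y \<in> S" "i < d" "j < d" "rp i = rp j"
 shows "\<beta> i j (x * y) = (\<Sum>k<d. if rp k = rp i then \<beta> i k x * \<beta> k j y else 0)"
proof (rule \<beta>_eqI)
 have "m i i * (x * y) * m j j = m i i * x * u * (y * m j j)" using assms m by (simp add: mult.assoc)
 also have "\<dots> = (\<Sum>k<d. m i i * x * m k k * (y * m j j))"
  by (subst u_sum) (simp add: sum_distrib_left sum_distrib_right)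
 also have "\<dots> = (\<Sum>k<d. (if rp k = rp i then \<beta> i k x * \<beta> k j y else 0) *c m i j)"
 proof (intro sum.cong refl)
  fix k assume "k \<in> {..<d}"
  then have k: "k < d" by simp
  have "m i i * x * m k k * (y * m j j) = m i i * x * m k k * (m k k * y * m j j)"
   using m_mult[of k k k k] k by (simp add: mult.assoc) (simp flip: mult.assoc)
  also have "\<dots> = (if rp k = rp i then \<beta> i k x * \<beta> k j y else 0) *c m i j"
   using assms k m_mult[of i k k j] by (simp add: cut)
  finally show "m i i * x * m k k * (y * m j j) = (if rp k = rp i then \<beta> i k x * \<beta> k j y else 0) *c m i j" .
 qed
 finally show "m i i * (x * y) * m j j = (\<Sum>k<d. if rp k = rp i then \<beta> i k x * \<beta> k j y else 0) *c m i j"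
  by (simp only: scl_sum_left)
qed (use assms in auto)

lemma \<beta>_m: assumes "k < d" "l < d" "rp k = rp l" "i < d" "j < d" "rp i = rp j"
 shows "\<beta> i j (m k l) = (if i = k & j = l then 1 else 0)"
 by (rule \<beta>_eqI) (use assms m m_mult[of i i k l] m_mult[of i l j j] in auto)

lemma \<beta>_u: assumes "i < d" "j < d" "rp i = rp j" shows "\<beta> i j u = (if i = j then 1 else 0)"
 by (rule \<beta>_eqI) (use assms m m_mult[of i i j j] in auto)

lemma nm_m: "i < d ==> nm (m i i) = 1"
proof -
 assume i: "i < d"
 have "nm (m i i) = (nm (m i i))\<^sup>2" using nm_cstar[of "m i i"] m[OF i i] m_mult[OF i i i i] by simp
 moreover have "nm (m i i) ~= 0" using nm_eq_0 m i by blast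
 ultimately show ?thesis by (simp add: power2_eq_square)
qed

definition \<tau> :: "'h => complex" where "\<tau> x = (\<Sum>i<d. \<beta> i i x)"

lemma \<tau>_add: "x \<in> S ==> y \<in> S ==> \<tau> (x + y) = \<tau> x + \<tau> y"
 by (simp add: \<tau>_def \<beta>_add sum.distrib)
lemma \<tau>_scl: "x \<in> S ==> \<tau> (c *c x) = c * \<tau> x"
 by (simp add: \<tau>_def \<beta>_scl sum_distrib_left)
lemma \<tau>_0 [simp]: "\<tau> 0 = 0" using \<tau>_scl[of 0 0] by simp
lemma \<tau>_sum: "(!!i. i \<in> I ==> f i \<in> S) ==> \<tau> (sum f I) = (\<Sum>i\<in>I. \<tau> (f i))"
 by (induction I rule: infinite_finite_induct) (auto simp: \<tau>_add)
lemma \<tau>_commute: assumes "x \<in> S" "y \<in> S" shows "\<tau> (x * y) = \<tau> (y * x)"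
proof -
 have "\<tau> (x * y) = (\<Sum>i<d. \<Sum>k<d. if rp k = rp i then \<beta> i k x * \<beta> k i y else 0)"
  using assms by (simp add: \<tau>_def \<beta>_mult)
 also have "\<dots> = (\<Sum>k<d. \<Sum>i<d. if rp i = rp k then \<beta> k i y * \<beta> i k x else 0)"
  by (subst sum.swap) (intro sum.cong; auto)
 also have "\<dots> = \<tau> (y * x)" using assms by (simp add: \<tau>_def \<beta>_mult)
 finally show ?thesis .
qed

text \<open>Compare the expansion of \<open>e = e * u * e\<close> along the diagonal with the diagonal coordinates of \<open>e\<close>.\<close>

lemma \<tau>_minproj: assumes e: "minproj e" shows "\<tau> e = 1"
proof -
 have eS: "e \<in> S" "e ~= 0" "e * e = e" using e by (auto simp: minproj_def)
 have "\<exists>c. e * m i i * e = c *c e" if "i < d" for i using e m that unfolding minproj_def by blast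
 then obtain c where c: "!!i. i < d ==> e * m i i * e = c i *c e" by metis
 have "(\<Sum>i<d. c i) *c e = (\<Sum>i<d. e * m i i * e)" by (simp add: scl_sum_left c)
 also have "\<dots> = e * u * e" by (subst u_sum) (simp add: sum_distrib_left sum_distrib_right)
 also have "\<dots> = 1 *c e" using eS by simp
 finally have "(\<Sum>i<d. c i) = 1" by (rule scl_cancel[OF _ eS(2)])
 moreover have "\<beta> i i e = c i" if i: "i < d" for i
 proof (cases "e * m i i = 0")
  case True
  then have "c i *c e = 0" using c[OF i] by simp
  then have "c i = 0" using eS by (simp add: scl_eq_0_iff)
  moreover have "\<beta> i i e *c m i i = 0" using cut[OF eS(1) i i] True by (simp add: mult.assoc)
  then have "\<beta> i i e = 0" using m(2)[OF i i] by (simp add: scl_eq_0_iff)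
  ultimately show ?thesis by simp
 next
  case False
  have "c i *c (e * m i i) = e * m i i * e * m i i" using c[OF i] by simp
  also have "\<dots> = e * (m i i * e * m i i)" by (simp only: mult.assoc)
  also have "\<dots> = \<beta> i i e *c (e * m i i)" using cut[OF eS(1) i i] by simp
  finally have "c i = \<beta> i i e" by (rule scl_cancel[OF _ False])
  then show ?thesis by simp
 qed
 then have "\<tau> e = (\<Sum>i<d. c i)" unfolding \<tau>_def by (intro sum.cong) auto
 ultimately show ?thesis by simp
qed

end

context hfd begin

text \<open>Decompose the unit into minimal projections. Two of them are equivalent if a nonzero element connects them;
such an element is a multiple of a partial isometry, and the partial isometries towards a representative generate the units.\<close>

lemma munits_exist: "\<exists>u d rp m \<beta>. munits S st nm u d rp m \<beta>"
proof -
 obtain u where u: "hcstar1 S st nm u" using unit_exists by blast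
 then interpret hcstar1 S st nm u .
 obtain d and es :: "nat => 'h" where es: "!!i. i < d ==> minproj (es i)"
  "!!i j. i < d ==> j < d ==> i ~= j ==> es i * es j = 0" "u = (\<Sum>i<d. es i)"
  using proj_decomposition[OF e_S e_left[OF e_S] st_e] by blast
 have e: "es i \<in> S" "es i ~= 0" "es i * es i = es i" "st (es i) = es i" if "i < d" for i
  using es(1)[OF that] by (auto simp: minproj_def)
 define rel where "rel i j \<longleftrightarrow> (\<exists>x\<in>S. es i * x * es j ~= 0)" for i j
 have refl: "rel i i" if "i < d" for i
  unfolding rel_def using e[OF that] by (intro bexI[of _ "es i"]) auto
 have sym: "rel j i" if "i < d" "j < d" "rel i j" for i j
 proof -
  obtain x where x: "x \<in> S" "es i * x * es j ~= 0" using \<open>rel i j\<close> unfolding rel_def by blast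
  have "st (es j * st x * es i) = es i * x * es j" using x e that by (simp add: st_mult mult.assoc)
  then have "es j * st x * es i ~= 0" using x(2) st_0 by force
  then show ?thesis unfolding rel_def by (rule bexI[OF _ S_st[OF x(1)]])
 qed
 have iso: "\<exists>v\<in>S. es i * v = v & v * es j = v & st v * v = es j & v * st v = es i"
  if ij: "i < d" "j < d" "rel i j" for i j
 proof -
  obtain x where x: "x \<in> S" "es i * x * es j ~= 0" using \<open>rel i j\<close> unfolding rel_def by blast
  define v where "v = es i * x * es j"
  have v: "v \<in> S" "v ~= 0" "es i * v = v" "v * es j = v"
   using x e ij by (simp_all add: v_def mult.assoc) (simp add: e flip: mult.assoc)
  obtain c :: real where c: "0 < c" "st v * v = of_real c *c es j" "v * st v = of_real c *c es i"
   using minproj_isometry[OF es(1)[OF ij(1)] es(1)[OF ij(2)] v] by blast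
  define t :: complex where "t = of_real (1 / sqrt c)"
  have t: "cnj t = t" "t * (t * of_real c) = 1" using c(1) by (simp_all add: t_def flip: of_real_mult)
  have stv: "st (t *c v) = t *c st v" using v t by (simp add: st_scl)
  show ?thesis
   using v c t by (intro bexI[of _ "t *c v"]) (simp_all add: stv)
 qed
 have trans: "rel i k" if ijk: "i < d" "j < d" "k < d" "rel i j" "rel j k" for i j k
 proof -
  obtain v where v: "v \<in> S" "es i * v = v" "v * es j = v" "st v * v = es j" using iso ijk by blast
  obtain w where w: "w \<in> S" "es j * w = w" "w * es k = w" "st w * w = es k" using iso ijk by blast
  have "st v * (v * w) = w" using v w by (simp flip: mult.assoc)
  moreover have "w ~= 0" using w e ijk by auto
  ultimately have "v * w ~= 0" by auto
  moreover have "es i * (v * w) * es k = v * w" using v w by (simp add: mult.assoc) (simp flip: mult.assoc)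
  ultimately show ?thesis unfolding rel_def using v w by (intro bexI[of _ "v * w"]) auto
 qed
 define rp where "rp i = (LEAST j. j < d & rel i j)" for i
 have rp: "rp i < d" "rel i (rp i)" if "i < d" for i
  using LeastI[of "\<lambda>j. j < d & rel i j" i] refl[OF that] that unfolding rp_def by auto
 have rp_eq: "rp i = rp j" if "i < d" "j < d" "rel i j" for i j
 proof -
  have "(k < d & rel i k) = (k < d & rel j k)" for k
   using trans[OF that(1,2) _ that(3), of k] trans[OF that(2,1) _ sym[OF that], of k] by blast
  then show ?thesis unfolding rp_def by simp
 qed
 have rp_iff: "rp i = rp j \<longleftrightarrow> rel i j" if ij: "i < d" "j < d" for i j
 proof
  assume eq: "rp i = rp j"
  have "rel (rp i) j" unfolding eq by (rule sym[OF ij(2) rp(1)[OF ij(2)] rp(2)[OF ij(2)]])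
  then show "rel i j" by (rule trans[OF ij(1) rp(1)[OF ij(1)] ij(2) rp(2)[OF ij(1)]])
 qed (rule rp_eq[OF ij])
 have "\<exists>v. v \<in> S & es (rp i) * v = v & v * es i = v & st v * v = es i & v * st v = es (rp i)" if "i < d" for i
  using iso[OF rp(1)[OF that] that sym[OF that rp(1)[OF that] rp(2)[OF that]]] by blast
 then obtain v where v: "!!i. i < d ==> v i \<in> S" "!!i. i < d ==> es (rp i) * v i = v i" "!!i. i < d ==> v i * es i = v i"
  "!!i. i < d ==> st (v i) * v i = es i" "!!i. i < d ==> v i * st (v i) = es (rp i)" by metis
 have sv: "es i * st (v i) = st (v i)" "st (v i) * es (rp i) = st (v i)" if "i < d" for i
  using st_mult[OF v(1)[OF that] e(1)[OF that]] st_mult[OF e(1)[OF rp(1)[OF that]] v(1)[OF that]]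
   v(2,3)[OF that] e(4) that rp(1)[OF that] by simp_all
 define m where "m i j = st (v i) * v j" for i j
 have mii: "m i i = es i" if "i < d" for i using v(4)[OF that] by (simp add: m_def)
 have vv: "v j * st (v k) = (if j = k then es (rp j) else 0)" if "j < d" "k < d" for j k
 proof (cases "j = k")
  case False
  have "v j * st (v k) = (v j * es j) * (es k * st (v k))" using v(3) sv(1) that by simp
  also have "\<dots> = v j * (es j * es k) * st (v k)" by (simp only: mult.assoc)
  finally show ?thesis using es(2)[OF that False] False by simp
 qed (use v that in simp)
 have mm: "m i j * m k l = (if j = k then m i l else 0)"
  if "i < d" "j < d" "k < d" "l < d" "rp i = rp j" "rp k = rp l" for i j k l
 proof -
  have "m i j * m k l = st (v i) * (v j * st (v k)) * v l" by (simp add: m_def mult.assoc)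
  then show ?thesis using vv[of j k] sv(2)[OF that(1)] that by (auto simp: m_def)
 qed
 have m_ne: "m i j ~= 0" if "i < d" "j < d" "rp i = rp j" for i j
 proof
  assume "m i j = 0"
  then have "m i i = 0" using mm[OF that(1) that(2) that(2) that(1) that(3) that(3)[symmetric]] by simp
  then show False using mii[OF that(1)] e(2)[OF that(1)] by simp
 qed
 have ex: "\<exists>c. es i * x * es j = c *c m i j" if ij: "i < d" "j < d" "rp i = rp j" and x: "x \<in> S" for i j x
 proof -
  have "v i * x * st (v j) \<in> S" using v ij x by simp
  then obtain c where c: "es (rp i) * (v i * x * st (v j)) * es (rp i) = c *c es (rp i)"
   using es(1)[OF rp(1)[OF ij(1)]] unfolding minproj_def by blast
  have "es i * x * es j = (st (v i) * v i) * x * (st (v j) * v j)"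
   unfolding v(4)[OF ij(1)] v(4)[OF ij(2)] ..
  also have "\<dots> = st (v i) * (v i * x * st (v j)) * v j" by (simp only: mult.assoc)
  also have "\<dots> = (st (v i) * es (rp i)) * (v i * x * st (v j)) * (es (rp i) * v j)"
   unfolding sv(2)[OF ij(1)] using v(2)[OF ij(2)] ij(3) by simp
  also have "\<dots> = st (v i) * (es (rp i) * (v i * x * st (v j)) * es (rp i)) * v j" by (simp only: mult.assoc)
  also have "\<dots> = c *c m i j" unfolding c using sv(2)[OF ij(1)] by (simp add: m_def)
  finally show ?thesis by blast
 qed
 define \<beta> where "\<beta> i j x = (SOME c. es i * x * es j = c *c m i j)" for i j x
 have \<beta>: "es i * x * es j = \<beta> i j x *c m i j" if "i < d" "j < d" "rp i = rp j" "x \<in> S" for i j x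
  unfolding \<beta>_def using ex[OF that] by (rule someI_ex)
 have "munits S st nm u d rp m \<beta>"
 proof unfold_locales
  fix i assume "i < d"
  then show "rp i < d" "rp (rp i) = rp i" using rp[of i] rp_eq[of i "rp i"] by auto
 next
  fix i j assume ij: "i < d" "j < d" "rp i = rp j"
  then show "m i j \<in> S" "st (m i j) = m j i" using v by (simp_all add: m_def st_mult)
  show "m i j ~= 0" by (rule m_ne[OF ij])
 next
  show "u = (\<Sum>i<d. m i i)" using es(3) mii by simp
 next
  fix x i j assume x: "x \<in> S" "i < d" "j < d"
  show "m i i * x * m j j = (if rp i = rp j then \<beta> i j x *c m i j else 0)"
  proof (cases "rp i = rp j")
   case False
   then have "\<not> rel i j" using rp_iff x by blast
   then show ?thesis using False x mii unfolding rel_def by auto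
  qed (use x mii \<beta> in simp)
 qed (use mm in auto)
 then show ?thesis by blast
qed

end

locale munits_fd = munits + hfd
begin

lemma \<tau>_proj: assumes "p \<in> S" "p * p = p" "st p = p"
 shows "\<exists>k (es :: nat => 'a). (\<forall>i<k. minproj (es i)) & (\<forall>i<k. \<forall>j<k. i ~= j --> es i * es j = 0) & p = (\<Sum>i<k. es i) & \<tau> p = of_nat k"
proof -
 obtain k and es :: "nat => 'a" where es: "\<forall>i<k. minproj (es i)" "\<forall>i<k. \<forall>j<k. i ~= j --> es i * es j = 0" "p = (\<Sum>i<k. es i)"
  using proj_decomposition[OF assms] by blast
 have "\<tau> p = (\<Sum>i<k. \<tau> (es i))" unfolding es(3) using es(1) by (intro \<tau>_sum) (auto simp: minproj_def)
 then have "\<tau> p = of_nat k" using es(1) by (simp add: \<tau>_minproj)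
 then show ?thesis using es by blast
qed

text \<open>Decompose \<open>p\<close> into minimal projections; each compresses \<open>x\<close> to a scalar bounded by its norm, and \<open>\<tau> p\<close> counts them.\<close>

lemma \<tau>_bound: assumes p: "p \<in> S" "p * p = p" "st p = p" and x: "x \<in> S" "p * x * p = x"
 shows "cmod (\<tau> x) <= nm x * Re (\<tau> p)"
proof -
 obtain k and es :: "nat => 'a" where es: "\<forall>i<k. minproj (es i)" "p = (\<Sum>i<k. es i)" "\<tau> p = of_nat k"
  using \<tau>_proj[OF p] by blast
 have e: "es i \<in> S" "es i ~= 0" "es i * es i = es i" "st (es i) = es i" "\<exists>c. es i * x * es i = c *c es i" if "i < k" for i
  using es(1) that x by (auto simp: minproj_def)
 have "x = p * x" using x p by (metis mult.assoc)
 then have "\<tau> x = \<tau> (\<Sum>i<k. es i * x)" by (simp add: es(2) sum_distrib_right)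
 also have "\<dots> = (\<Sum>i<k. \<tau> (es i * x))" using e x by (intro \<tau>_sum) auto
 finally have "cmod (\<tau> x) <= (\<Sum>i<k. cmod (\<tau> (es i * x)))" by (simp add: norm_sum)
 also have "\<dots> <= (\<Sum>i<k. nm x)"
 proof (rule sum_mono)
  fix i assume "i \<in> {..<k}"
  then have i: "i < k" by simp
  obtain c where c: "es i * x * es i = c *c es i" using e(5)[OF i] by blast
  have "\<tau> (es i * x) = \<tau> (es i * (es i * x))" using e(3)[OF i] by (simp flip: mult.assoc)
  also have "\<dots> = \<tau> (es i * x * es i)" using \<tau>_commute[of "es i" "es i * x"] e[OF i] x by simp
  also have "\<dots> = c" unfolding c using es(1) e[OF i] i by (simp add: \<tau>_scl \<tau>_minproj)
  finally have \<tau>c: "\<tau> (es i * x) = c" .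
  have ne: "nm (es i) <= 1" using proj_nm_le_1 e[OF i] by blast
  have "cmod c * nm (es i) = nm (es i * x * es i)" unfolding c using e[OF i] by (simp add: nm_scl)
  also have "\<dots> <= nm (es i) * nm x * 1" using e[OF i] x ne by (intro nm_mult_le nm_mult) auto
  finally have "cmod c * nm (es i) <= nm x * nm (es i)" by (simp add: mult.commute)
  moreover have "nm (es i) ~= 0" using nm_eq_0[OF e(1)[OF i]] e(2)[OF i] by simp
  then have "0 < nm (es i)" using nm_nonneg[OF e(1)[OF i]] by linarith
  ultimately show "cmod (\<tau> (es i * x)) <= nm x" unfolding \<tau>c by simp
 qed
 also have "\<dots> = nm x * Re (\<tau> p)" by (simp add: es(3))
 finally show ?thesis .
qed

end

section \<open>Matrix rank as a trace\<close>

lemma vectorspace_cstar: "cstar_algebra A ==> vectorspace class_ring A"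
 by (rule cstar_algebra.axioms(1))

lemma cstar_closed_subset_fin:
 fixes A :: "'a cstar"
 assumes "cstar_algebra A" "finite I" "!!i. i \<in> I ==> f i \<in> carrier A"
 shows "finsum A f I \<in> carrier A & emb A (finsum A f I) = (\<Sum>i\<in>I. emb A (f i))"
 using assms(2,3)
proof (induction I)
 case empty
 interpret abelian_group A using cstar_smult(8)[OF assms(1)] .
 show ?case by (simp add: emb_zero[OF assms(1)])
next
 case (insert i I)
 interpret abelian_group A using cstar_smult(8)[OF assms(1)] .
 have "finsum A f (insert i I) = f i \<oplus>\<^bsub>A\<^esub> finsum A f I"
  using insert by (intro finsum_insert) auto
 then show ?case using insert by (simp add: emb_add[OF assms(1)])
qed

lemma hfd_hosted:
 fixes F :: "'a cstar"
 assumes F: "fd_cstar_algebra F"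
 shows "\<exists>X. hfd (hS F) (hst F) (hnm F) X"
proof -
 have A: "cstar_algebra F" using F by (simp add: fd_cstar_algebra_def)
 interpret V: vectorspace class_ring F by (rule vectorspace_cstar[OF A])
 obtain B where B: "finite B" "B \<subseteq> carrier F" "V.span B = carrier F"
  using F unfolding fd_cstar_algebra_def V.fin_dim_def by blast
 have "hS F \<subseteq> cvs.span (emb F ` B)"
 proof
  fix x assume "x \<in> hS F"
  then obtain y where y: "y \<in> carrier F" "x = emb F y" by (auto simp: hS_def)
  then have "y \<in> V.span B" using B by simp
  then obtain a C where C: "finite C" "C \<subseteq> B" "y = V.lincomb a C" by (auto simp: V.span_def)
  have "x = (\<Sum>v\<in>C. emb F (a v \<odot>\<^bsub>F\<^esub> v))"
   unfolding y(2) C(3) V.lincomb_def using C B cstar_smult(1)[OF A]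
   by (intro cstar_closed_subset_fin[OF A, THEN conjunct2]) auto
  also have "\<dots> = (\<Sum>v\<in>C. a v *c emb F v)"
   using C B by (intro sum.cong refl emb_scl[OF A]) auto
  also have "\<dots> \<in> cvs.span (emb F ` B)"
   using C by (intro cvs.span_sum cvs.span_scale cvs.span_base) auto
  finally show "x \<in> cvs.span (emb F ` B)" .
 qed
 then have "hfd (hS F) (hst F) (hnm F) (emb F ` B)"
  using hcstar_hosted[OF A] B(1) by (simp add: hfd_def hfd_axioms_def)
 then show ?thesis by blast
qed

lemma fd_unit:
 fixes F :: "'a cstar"
 assumes F: "fd_cstar_algebra F"
 shows "monoid F" "\<one>\<^bsub>F\<^esub> \<in> carrier F" "!!u. hcstar1 (hS F) (hst F) (hnm F) u ==> u = hone F"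
proof -
 have A: "cstar_algebra F" using F by (simp add: fd_cstar_algebra_def)
 obtain X where "hfd (hS F) (hst F) (hnm F) X" using hfd_hosted[OF F] by blast
 then interpret hfd "hS F" "hst F" "hnm F" X .
 have key: "unemb F u = \<one>\<^bsub>F\<^esub> & unemb F u \<in> carrier F & (\<forall>x\<in>carrier F. unemb F u \<otimes>\<^bsub>F\<^esub> x = x & x \<otimes>\<^bsub>F\<^esub> unemb F u = x)"
  if u: "hcstar1 (hS F) (hst F) (hnm F) u" for u
 proof -
  interpret hcstar1 "hS F" "hst F" "hnm F" u by (rule u)
  have c: "unemb F u \<in> carrier F" by (simp add: A)
  have "emb F (unemb F u \<otimes>\<^bsub>F\<^esub> x) = emb F x" "emb F (x \<otimes>\<^bsub>F\<^esub> unemb F u) = emb F x" if "x \<in> carrier F" for x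
   using that c by (simp_all add: emb_mult[OF A] A)
  then have "unemb F u \<otimes>\<^bsub>F\<^esub> x = x & x \<otimes>\<^bsub>F\<^esub> unemb F u = x" if "x \<in> carrier F" for x
   using that c emb_inj[OF A] carrier_simps(1)[OF A] by blast
  then show ?thesis using c cstar_algebra.one_unique[OF A, of "unemb F u"] by auto
 qed
 show "u = hone F" if u: "hcstar1 (hS F) (hst F) (hnm F) u" for u
 proof -
  interpret hcstar1 "hS F" "hst F" "hnm F" u by (rule u)
  have "emb F (unemb F u) = u" by (simp add: A)
  then show ?thesis using key[OF u] by simp
 qed
 obtain u where u: "hcstar1 (hS F) (hst F) (hnm F) u" using unit_exists by blast
 show "\<one>\<^bsub>F\<^esub> \<in> carrier F" using key[OF u] by metis
 show "monoid F"
 proof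
  show "\<one>\<^bsub>F\<^esub> \<in> carrier F" "!!x. x \<in> carrier F ==> \<one>\<^bsub>F\<^esub> \<otimes>\<^bsub>F\<^esub> x = x" "!!x. x \<in> carrier F ==> x \<otimes>\<^bsub>F\<^esub> \<one>\<^bsub>F\<^esub> = x"
   using key[OF u] by metis+
 qed (use cstar_algebra.mult_closed[OF A] cstar_algebra.mult_assoc[OF A] in auto)
qed

lemma fd_munits:
 fixes F :: "'a cstar"
 assumes F: "fd_cstar_algebra F"
 shows "\<exists>d rp m \<beta> X. munits_fd (hS F) (hst F) (hnm F) (hone F) d rp m \<beta> X"
proof -
 obtain X where X: "hfd (hS F) (hst F) (hnm F) X" using hfd_hosted[OF F] by blast
 then interpret hfd "hS F" "hst F" "hnm F" X .
 obtain u d rp m \<beta> where M: "munits (hS F) (hst F) (hnm F) u d rp m \<beta>" using munits_exist by blast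
 then have "u = hone F" by (intro fd_unit(3)[OF F]) (simp add: munits_def)
 then show ?thesis using M X unfolding munits_fd_def by blast
qed

abbreviation "mats ls \<equiv> direct_sum (map matrix_alg ls)"

lemma mats_carrier: "Ms \<in> carrier (mats ls) \<longleftrightarrow> length Ms = length ls & (\<forall>b<length ls. Ms ! b \<in> carrier_mat (ls ! b) (ls ! b))"
 by (auto simp: direct_sum_def list_all2_conv_all_nth matrix_alg_def)

lemma mats_simps:
 "Ms \<oplus>\<^bsub>mats ls\<^esub> Ns = map (\<lambda>b. Ms ! b + Ns ! b) [0..<length ls]"
 "Ms \<otimes>\<^bsub>mats ls\<^esub> Ns = map (\<lambda>b. Ms ! b * Ns ! b) [0..<length ls]"
 "c \<odot>\<^bsub>mats ls\<^esub> Ms = map (\<lambda>b. c \<cdot>\<^sub>m Ms ! b) [0..<length ls]"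
 "adj (mats ls) Ms = map (\<lambda>b. mat_adjoint (Ms ! b)) [0..<length ls]"
 by (auto simp: direct_sum_def matrix_alg_def)

lemma mats_mult_entry:
 assumes "Ms \<in> carrier (mats ls)" "Ns \<in> carrier (mats ls)" "b < length ls" "x < ls ! b" "y < ls ! b"
 shows "(Ms \<otimes>\<^bsub>mats ls\<^esub> Ns) ! b $$ (x, y) = (\<Sum>k<ls ! b. (Ms ! b) $$ (x, k) * (Ns ! b) $$ (k, y))"
proof -
 have "Ms ! b \<in> carrier_mat (ls ! b) (ls ! b)" "Ns ! b \<in> carrier_mat (ls ! b) (ls ! b)"
  using assms by (auto simp: mats_carrier)
 then show ?thesis using assms(3-5) by (simp add: mats_simps scalar_prod_def atLeast0LessThan)
qed

lemma mats_add_entry: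
 assumes "Ms \<in> carrier (mats ls)" "Ns \<in> carrier (mats ls)" "b < length ls" "x < ls ! b" "y < ls ! b"
 shows "(Ms \<oplus>\<^bsub>mats ls\<^esub> Ns) ! b $$ (x, y) = (Ms ! b) $$ (x, y) + (Ns ! b) $$ (x, y)"
proof -
 have "Ms ! b \<in> carrier_mat (ls ! b) (ls ! b)" "Ns ! b \<in> carrier_mat (ls ! b) (ls ! b)"
  using assms by (auto simp: mats_carrier)
 then show ?thesis using assms(3-5) by (simp add: mats_simps)
qed

lemma mats_smult_entry:
 assumes "Ms \<in> carrier (mats ls)" "b < length ls" "x < ls ! b" "y < ls ! b"
 shows "(c \<odot>\<^bsub>mats ls\<^esub> Ms) ! b $$ (x, y) = c * (Ms ! b) $$ (x, y)"
proof -
 have "Ms ! b \<in> carrier_mat (ls ! b) (ls ! b)" using assms by (auto simp: mats_carrier)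
 then show ?thesis using assms(2-4) by (simp add: mats_simps)
qed

lemma mats_smult_closed: "Ms \<in> carrier (mats ls) ==> c \<odot>\<^bsub>mats ls\<^esub> Ms \<in> carrier (mats ls)"
 by (auto simp: mats_carrier mats_simps)

lemma mat_adjoint_entry: "M \<in> carrier_mat l l ==> x < l ==> y < l ==> mat_adjoint M $$ (x, y) = cnj (M $$ (y, x))"
 by (auto simp: mat_adjoint_def mat_of_rows_def cols_def)

lemma mat_adjoint_carrier: "M \<in> carrier_mat l l ==> mat_adjoint M \<in> carrier_mat l l"
 by (auto simp: mat_adjoint_def mat_of_rows_def)

lemma mats_eqI:
 assumes "Ms \<in> carrier (mats ls)" "Ns \<in> carrier (mats ls)"
  "!!b x y. b < length ls ==> x < ls ! b ==> y < ls ! b ==> Ms ! b $$ (x, y) = Ns ! b $$ (x, y)"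
 shows "Ms = Ns"
proof (rule nth_equalityI)
 fix b assume "b < length Ms"
 then have b: "b < length ls" "Ms ! b \<in> carrier_mat (ls ! b) (ls ! b)" "Ns ! b \<in> carrier_mat (ls ! b) (ls ! b)"
  using assms by (auto simp: mats_carrier)
 then show "Ms ! b = Ns ! b" using assms(3)[OF b(1)] by (intro eq_matI) auto
qed (use assms in \<open>auto simp: mats_carrier\<close>)

lemma diag_block_carrier:
 "length Ms = length ls ==> (\<forall>b<length ls. Ms ! b \<in> carrier_mat (ls ! b) (ls ! b)) ==>
  diag_block_mat Ms \<in> carrier_mat (sum_list ls) (sum_list ls)"
proof (induction Ms ls rule: list_induct2)
 case (Cons M Ms l ls)
 then have "M \<in> carrier_mat l l" "Ms ! b \<in> carrier_mat (ls ! b) (ls ! b)" if "b < length ls" for b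
  using Cons.prems[rule_format, of 0] Cons.prems[rule_format, of "Suc b"] that by simp_all
 moreover have "M \<in> carrier_mat l l" using Cons.prems[rule_format, of 0] by simp
 ultimately have "M \<in> carrier_mat l l" "\<forall>b<length ls. Ms ! b \<in> carrier_mat (ls ! b) (ls ! b)" by blast+
 then show ?case using Cons.IH by (auto simp: Let_def)
qed auto

lemma diag_block_add:
 "length Ms = length ls ==> length Ns = length ls ==> (\<forall>b<length ls. Ms ! b \<in> carrier_mat (ls ! b) (ls ! b)) ==>
  (\<forall>b<length ls. Ns ! b \<in> carrier_mat (ls ! b) (ls ! b)) ==>
  diag_block_mat (map (\<lambda>b. Ms ! b + Ns ! b) [0..<length ls]) = diag_block_mat Ms + (diag_block_mat Ns :: complex mat)"
proof (induction ls arbitrary: Ms Ns)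
 case (Cons l ls)
 obtain M Ms' where Ms: "Ms = M # Ms'" using Cons by (cases Ms) auto
 obtain N Ns' where Ns: "Ns = N # Ns'" using Cons by (cases Ns) auto
 have c: "M \<in> carrier_mat l l" "N \<in> carrier_mat l l"
  "\<forall>b<length ls. Ms' ! b \<in> carrier_mat (ls ! b) (ls ! b)" "\<forall>b<length ls. Ns' ! b \<in> carrier_mat (ls ! b) (ls ! b)"
  "length Ms' = length ls" "length Ns' = length ls"
 proof -
  show "M \<in> carrier_mat l l" "N \<in> carrier_mat l l"
   using Cons.prems(3)[rule_format, of 0] Cons.prems(4)[rule_format, of 0] by (simp_all add: Ms Ns)
  show "\<forall>b<length ls. Ms' ! b \<in> carrier_mat (ls ! b) (ls ! b)" "\<forall>b<length ls. Ns' ! b \<in> carrier_mat (ls ! b) (ls ! b)"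
  proof -
   have "Ms' ! b \<in> carrier_mat (ls ! b) (ls ! b) & Ns' ! b \<in> carrier_mat (ls ! b) (ls ! b)" if "b < length ls" for b
    using Cons.prems(3)[rule_format, of "Suc b"] Cons.prems(4)[rule_format, of "Suc b"] that by (simp add: Ms Ns)
   then show "\<forall>b<length ls. Ms' ! b \<in> carrier_mat (ls ! b) (ls ! b)" "\<forall>b<length ls. Ns' ! b \<in> carrier_mat (ls ! b) (ls ! b)"
    by blast+
  qed
  show "length Ms' = length ls" "length Ns' = length ls" using Cons.prems(1,2) by (simp_all add: Ms Ns)
 qed
 have dM: "diag_block_mat Ms' \<in> carrier_mat (sum_list ls) (sum_list ls)" "diag_block_mat Ns' \<in> carrier_mat (sum_list ls) (sum_list ls)"
  using c by (auto intro: diag_block_carrier)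
 have "map (\<lambda>b. Ms ! b + Ns ! b) [0..<length (l # ls)] = (M + N) # map (\<lambda>b. Ms' ! b + Ns' ! b) [0..<length ls]"
  unfolding Ms Ns by (simp add: upt_conv_Cons flip: map_Suc_upt del: upt_Suc)
 then show ?case
  using Cons.IH[OF c(5,6,3,4)] c dM
   add_four_block_mat[OF c(1) zero_carrier_mat[of l "sum_list ls"] zero_carrier_mat[of "sum_list ls" l] dM(1)
    c(2) zero_carrier_mat zero_carrier_mat dM(2)]
  unfolding Ms Ns by (simp add: Let_def left_add_zero_mat[OF zero_carrier_mat] del: upt_Suc)
qed auto

lemma diag_block_one: "diag_block_mat (map 1\<^sub>m ls) = (1\<^sub>m (sum_list ls) :: complex mat)"
proof (induction ls)
 case (Cons l ls)
 then show ?case by (simp add: Let_def)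
qed auto

definition product_entries :: "complex mat => bool" where
 "product_entries M \<longleftrightarrow> (\<exists>f g. \<forall>i<dim_row M. \<forall>j<dim_col M. M $$ (i, j) = f i * g j)"

lemma diag_block_zero: "(\<forall>M\<in>set Ms. M = 0\<^sub>m (dim_row M) (dim_col M)) ==>
 diag_block_mat Ms = (0\<^sub>m (sum_list (map dim_row Ms)) (sum_list (map dim_col Ms)) :: complex mat)"
proof (induction Ms)
 case (Cons M Ms)
 then have M: "M = 0\<^sub>m (dim_row M) (dim_col M)" by simp
 have M0: "M $$ (i, j) = 0" if "i < dim_row M" "j < dim_col M" for i j
  using arg_cong[OF M, of "\<lambda>t. t $$ (i, j)"] that by simp
 have IH: "diag_block_mat Ms = 0\<^sub>m (sum_list (map dim_row Ms)) (sum_list (map dim_col Ms))" using Cons by simp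
 show ?case unfolding diag_block_mat.simps Let_def IH by (rule eq_matI) (auto simp: M0)
qed auto

lemma diag_block_product:
 assumes "b0 < length Ms" "product_entries (Ms ! b0)" "\<forall>b<length Ms. b ~= b0 --> Ms ! b = 0\<^sub>m (dim_row (Ms ! b)) (dim_col (Ms ! b))"
 shows "product_entries (diag_block_mat Ms)"
 using assms
proof (induction Ms arbitrary: b0)
 case (Cons M Ms)
 show ?case
 proof (cases b0)
  case 0
  have "Ms ! b = 0\<^sub>m (dim_row (Ms ! b)) (dim_col (Ms ! b))" if "b < length Ms" for b
   using Cons.prems(3)[rule_format, of "Suc b"] that 0 by simp
  then have z: "diag_block_mat Ms = 0\<^sub>m (sum_list (map dim_row Ms)) (sum_list (map dim_col Ms))"
   by (intro diag_block_zero) (auto simp: in_set_conv_nth)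
  obtain f g where "\<forall>i<dim_row M. \<forall>j<dim_col M. M $$ (i, j) = f i * g j"
   using Cons.prems(2) 0 by (auto simp: product_entries_def)
  then show ?thesis unfolding product_entries_def
   by (intro exI[of _ "\<lambda>i. if i < dim_row M then f i else 0"] exI[of _ "\<lambda>j. if j < dim_col M then g j else 0"])
    (auto simp: Let_def z)
 next
  case (Suc b1)
  have M0: "M = 0\<^sub>m (dim_row M) (dim_col M)" using Cons.prems(3)[rule_format, of 0] Suc by simp
  have M0': "M $$ (i, j) = 0" if "i < dim_row M" "j < dim_col M" for i j 
   using arg_cong[OF M0, of "\<lambda>t. t $$ (i, j)"] that by simp
  have "product_entries (diag_block_mat Ms)"
  proof (rule Cons.IH[of b1])
   show "\<forall>b<length Ms. b ~= b1 --> Ms ! b = 0\<^sub>m (dim_row (Ms ! b)) (dim_col (Ms ! b))"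
    using Cons.prems(3) Suc by fastforce
  qed (use Cons.prems Suc in auto)
  then obtain f g where "\<forall>i<dim_row (diag_block_mat Ms). \<forall>j<dim_col (diag_block_mat Ms). diag_block_mat Ms $$ (i, j) = f i * g j"
   by (auto simp: product_entries_def)
  then show ?thesis unfolding product_entries_def
   by (intro exI[of _ "\<lambda>i. if i < dim_row M then 0 else f (i - dim_row M)"] exI[of _ "\<lambda>j. if j < dim_col M then 0 else g (j - dim_col M)"])
    (auto simp: Let_def M0')
 qed
qed auto

lemma product_entries_rank: "M \<in> carrier_mat n n ==> product_entries M ==> vec_space.rank n M <= 1"
 unfolding product_entries_def using vec_space.rank_le_1_product_entries[of M n n] by auto

lemma mats_add_closed: "Ms \<in> carrier (mats ls) ==> Ns \<in> carrier (mats ls) ==> Ms \<oplus>\<^bsub>mats ls\<^esub> Ns \<in> carrier (mats ls)"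
 by (auto simp: mats_carrier mats_simps)

text \<open>A projection is a sum of \<open>\<tau> p\<close> minimal ones, and each of these is a matrix of rank at most one. So the rank is at most
\<open>\<tau> p\<close>, likewise for the complement. Since the two bounds add up to the size of the identity matrix, both are equalities.\<close>

lemma rank_of_projection:
 fixes F :: "'a cstar"
 assumes M: "munits_fd (hS F) (hst F) (hnm F) (hone F) d rp m \<beta> X" and A: "cstar_algebra F"
  and h: "h \<in> star_iso F (mats ls)" and p: "projection F p"
 shows "munits.\<tau> d \<beta> (emb F p) = of_nat (vec_space.rank (sum_list ls) (diag_block_mat (h p)))"
proof -
 interpret munits_fd "hS F" "hst F" "hnm F" "hone F" d rp m \<beta> X by (rule M)
 let ?L = "sum_list ls"
 have hom: "h \<in> star_hom F (mats ls)" and bij: "bij_betw h (carrier F) (carrier (mats ls))"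
  using h by (auto simp: star_iso_def)
 note H = star_homD[OF hom]
 define D where "D x = diag_block_mat (h (unemb F x))" for x
 have hc: "h (unemb F x) \<in> carrier (mats ls)" if "x \<in> hS F" for x using H(1) that by (simp add: A)
 have D_carrier: "D x \<in> carrier_mat ?L ?L" if "x \<in> hS F" for x
  using hc[OF that] unfolding D_def mats_carrier by (intro diag_block_carrier) auto
 have h_add: "h (unemb F (x + y)) = h (unemb F x) \<oplus>\<^bsub>mats ls\<^esub> h (unemb F y)" if "x \<in> hS F" "y \<in> hS F" for x y
 proof -
  have "unemb F (x + y) = unemb F x \<oplus>\<^bsub>F\<^esub> unemb F y"
   using that by (subst unemb_ops(1)[OF A that]) (simp add: A)
  then show ?thesis using H(2) that by (simp add: A)
 qed
 have h_mult: "h (unemb F (x * y)) = h (unemb F x) \<otimes>\<^bsub>mats ls\<^esub> h (unemb F y)" if "x \<in> hS F" "y \<in> hS F" for x y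
 proof -
  have "unemb F (x * y) = unemb F x \<otimes>\<^bsub>F\<^esub> unemb F y"
   using that by (subst unemb_ops(3)[OF A that]) (simp add: A carrier_simps(1)[OF A])
  then show ?thesis using H(4) that by (simp add: A)
 qed
 have h_scl: "h (unemb F (c *c x)) = c \<odot>\<^bsub>mats ls\<^esub> h (unemb F x)" if "x \<in> hS F" for x c
 proof -
  have "unemb F (c *c x) = c \<odot>\<^bsub>F\<^esub> unemb F x"
   using that by (subst unemb_ops(4)[OF A that that]) (simp add: A carrier_simps(3)[OF A])
  then show ?thesis using H(3) that by (simp add: A)
 qed
 have h_st: "h (unemb F (hst F x)) = adj (mats ls) (h (unemb F x))" if "x \<in> hS F" for x
  using H(5) that by (simp add: hst_def A carrier_simps(2)[OF A])
 have D_add: "D (x + y) = D x + D y" if "x \<in> hS F" "y \<in> hS F" for x y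
  using hc[OF that(1)] hc[OF that(2)] unfolding D_def h_add[OF that] mats_simps(1) mats_carrier
  by (intro diag_block_add) auto
 have ex: "\<exists>x\<in>hS F. h (unemb F x) = Ms" if Ms: "Ms \<in> carrier (mats ls)" for Ms
 proof -
  have "Ms \<in> h ` carrier F" using bij Ms by (simp add: bij_betw_def)
  then obtain y where "y \<in> carrier F" "h y = Ms" by blast
  then show ?thesis by (intro bexI[of _ "emb F y"]) (simp_all add: A)
 qed
 have inj: "x = y" if "x \<in> hS F" "y \<in> hS F" "h (unemb F x) = h (unemb F y)" for x y
 proof -
  have "unemb F x = unemb F y" using bij that by (auto simp: bij_betw_def A dest: inj_onD)
  from arg_cong[OF this, of "emb F"] show ?thesis using that by (simp add: A)
 qed
 have D_unit: "D (hone F) = 1\<^sub>m ?L"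
 proof -
  have one: "map 1\<^sub>m ls \<in> carrier (mats ls)" by (simp add: mats_carrier)
  obtain x where x: "x \<in> hS F" "h (unemb F x) = map 1\<^sub>m ls" using ex[OF one] by blast
  have "h (unemb F (x * hone F)) = h (unemb F (hone F))"
   unfolding h_mult[OF x(1) e_S] x(2) using hc[OF e_S]
   by (intro nth_equalityI) (auto simp: mats_simps mats_carrier)
  then have "x = hone F" using inj[of "x * hone F" "hone F"] x e_S by simp
  then show ?thesis using x(2) diag_block_one by (simp add: D_def)
 qed
 define tr where "tr Ms = (\<Sum>b<length ls. \<Sum>x<ls ! b. (Ms ! b) $$ (x, x))" for Ms :: "complex mat list"
 have tr_add: "tr (Ms \<oplus>\<^bsub>mats ls\<^esub> Ns) = tr Ms + tr Ns" if "Ms \<in> carrier (mats ls)" "Ns \<in> carrier (mats ls)" for Ms Ns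
  unfolding tr_def sum.distrib[symmetric] using mats_add_entry[OF that] by (intro sum.cong refl) auto
 have min: "product_entries (D x) & tr (h (unemb F x)) = 1" if x: "minproj x" for x
 proof -
  have xS: "x \<in> hS F" "x ~= 0" "x * x = x" "hst F x = x" using x by (auto simp: minproj_def)
  define Q where "Q = h (unemb F x)"
  have Q: "Q \<in> carrier (mats ls)" using hc[OF xS(1)] by (simp add: Q_def)
  have Qc: "length Q = length ls" "!!b. b < length ls ==> Q ! b \<in> carrier_mat (ls ! b) (ls ! b)"
   using Q by (auto simp: mats_carrier)
  have QQ: "Q \<otimes>\<^bsub>mats ls\<^esub> Q = Q" using h_mult[OF xS(1,1)] xS(3) by (simp add: Q_def)
  have Qadj: "adj (mats ls) Q = Q" using h_st[OF xS(1)] xS(4) by (simp add: Q_def)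
  have Qstar: "(Q ! b) $$ (k, l) = cnj ((Q ! b) $$ (l, k))" if "b < length ls" "k < ls ! b" "l < ls ! b" for b k l
   using arg_cong[OF Qadj, of "\<lambda>t. t ! b $$ (k, l)"] that Qc(2)[OF that(1)]
   by (simp add: mats_simps mat_adjoint_entry)
  have Qsq: "(Q ! b) $$ (k, l) = (\<Sum>j<ls ! b. (Q ! b) $$ (k, j) * (Q ! b) $$ (j, l))" if "b < length ls" "k < ls ! b" "l < ls ! b" for b k l
   using mats_mult_entry[OF Q Q that] QQ by simp
  have "\<exists>b k l. b < length ls & k < ls ! b & l < ls ! b & (Q ! b) $$ (k, l) ~= 0"
  proof (rule ccontr)
   assume "\<not> ?thesis"
   then have z: "(Q ! b) $$ (k, l) = 0" if "b < length ls" "k < ls ! b" "l < ls ! b" for b k l using that by blast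
   have "Q = h (unemb F (0 *c x))" unfolding h_scl[OF xS(1)]
    unfolding Q_def[symmetric] using mats_smult_entry[OF Q] z by (intro mats_eqI[OF Q] mats_smult_closed[OF Q]) auto
   then show False using inj[of x "0 *c x"] xS by (simp add: Q_def)
  qed
  then obtain b0 k0 a where b0: "b0 < length ls" "k0 < ls ! b0" "a < ls ! b0" "(Q ! b0) $$ (k0, a) ~= 0" by blast
  define c where "c = (Q ! b0) $$ (a, a)"
  have "(Q ! b0) $$ (a, a) = (\<Sum>j<ls ! b0. of_real ((cmod ((Q ! b0) $$ (j, a)))\<^sup>2))"
   unfolding Qsq[OF b0(1,3,3)]
  proof (rule sum.cong[OF refl])
   fix j assume "j \<in> {..<ls ! b0}"
   then have "(Q ! b0) $$ (a, j) = cnj ((Q ! b0) $$ (j, a))" using Qstar[of b0 a j] b0 by simp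
   then show "(Q ! b0) $$ (a, j) * (Q ! b0) $$ (j, a) = of_real ((cmod ((Q ! b0) $$ (j, a)))\<^sup>2)"
    by (simp only: complex_norm_square mult.commute)
  qed
  then have c_eq: "c = of_real (\<Sum>j<ls ! b0. (cmod ((Q ! b0) $$ (j, a)))\<^sup>2)" by (simp add: c_def)
  have "0 < (\<Sum>j<ls ! b0. (cmod ((Q ! b0) $$ (j, a)))\<^sup>2)" using b0 by (intro sum_pos2[of _ k0]) auto
  then have c0: "c ~= 0" unfolding c_eq by (simp only: of_real_eq_0_iff) 
  define U where "U = map (\<lambda>b. mat (ls ! b) (ls ! b) (\<lambda>(i, j). if b = b0 & i = a & j = a then 1 else 0 :: complex)) [0..<length ls]"
  have U: "U \<in> carrier (mats ls)" by (simp add: U_def mats_carrier)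
  obtain y where y: "y \<in> hS F" "h (unemb F y) = U" using ex[OF U] by blast
  obtain c' where c': "x * y * x = c' *c x" using x y unfolding minproj_def by blast
  have QU: "Q \<otimes>\<^bsub>mats ls\<^esub> U \<in> carrier (mats ls)" using Q U by (auto simp: mats_carrier mats_simps)
  have "Q \<otimes>\<^bsub>mats ls\<^esub> U \<otimes>\<^bsub>mats ls\<^esub> Q = c' \<odot>\<^bsub>mats ls\<^esub> Q"
   using arg_cong[OF c', of "\<lambda>t. h (unemb F t)"] xS y by (simp add: h_mult h_scl Q_def)
  then have ent: "(\<Sum>j<ls ! b. (\<Sum>i<ls ! b. (Q ! b) $$ (k, i) * (U ! b) $$ (i, j)) * (Q ! b) $$ (j, l)) = c' * (Q ! b) $$ (k, l)"
   if "b < length ls" "k < ls ! b" "l < ls ! b" for b k l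
   using mats_mult_entry[OF QU Q that] mats_mult_entry[OF Q U that(1,2)] that Qc(2)[OF that(1)]
   by (simp add: mats_simps(3))
  have prod: "c' * (Q ! b) $$ (k, l) = (if b = b0 then (Q ! b0) $$ (k, a) * (Q ! b0) $$ (a, l) else 0)"
   if "b < length ls" "k < ls ! b" "l < ls ! b" for b k l
  proof -
   have "(\<Sum>i<ls ! b. (Q ! b) $$ (k, i) * (U ! b) $$ (i, j)) = (if b = b0 & j = a then (Q ! b) $$ (k, a) else 0)" if "j < ls ! b" for j
    using that \<open>b < length ls\<close> b0 by (auto simp: U_def if_distrib[of "\<lambda>t. _ * t"] cong: if_cong)
   then have "(\<Sum>j<ls ! b. (\<Sum>i<ls ! b. (Q ! b) $$ (k, i) * (U ! b) $$ (i, j)) * (Q ! b) $$ (j, l))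
    = (\<Sum>j<ls ! b. if j = a then (if b = b0 then (Q ! b0) $$ (k, a) * (Q ! b0) $$ (a, l) else 0) else 0)"
    by (intro sum.cong) auto
   also have "\<dots> = (if b = b0 then (Q ! b0) $$ (k, a) * (Q ! b0) $$ (a, l) else 0)" using b0 by auto
   finally show ?thesis using ent[OF that] by simp
  qed
  have "c' * c = c * c" using prod[OF b0(1,3,3)] by (simp add: c_def)
  then have cc': "c' = c" using c0 by simp
  have zero: "(Q ! b) $$ (k, l) = 0" if "b < length ls" "b ~= b0" "k < ls ! b" "l < ls ! b" for b k l
   using prod[OF that(1,3,4)] that(2) c0 cc' by simp
  have ent0: "(Q ! b0) $$ (k, l) = ((Q ! b0) $$ (k, a) / c) * (Q ! b0) $$ (a, l)" if "k < ls ! b0" "l < ls ! b0" for k l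
   using prod[OF b0(1) that] c0 cc' by (simp add: field_simps)
  have "product_entries (D x)" unfolding D_def Q_def[symmetric]
  proof (rule diag_block_product[of b0])
   show "product_entries (Q ! b0)" unfolding product_entries_def using ent0 Qc(2)[OF b0(1)]
    by (intro exI[of _ "\<lambda>k. (Q ! b0) $$ (k, a) / c"] exI[of _ "\<lambda>l. (Q ! b0) $$ (a, l)"]) auto
   show "\<forall>b<length Q. b ~= b0 --> Q ! b = 0\<^sub>m (dim_row (Q ! b)) (dim_col (Q ! b))"
   proof (intro allI impI)
    fix b assume b: "b < length Q" "b ~= b0"
    then show "Q ! b = 0\<^sub>m (dim_row (Q ! b)) (dim_col (Q ! b))"
     using Qc(1) Qc(2)[of b] zero[of b] by (intro eq_matI) auto
   qed
  qed (use b0 Qc in simp)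
  moreover have "tr Q = 1"
  proof -
   have "tr Q = (\<Sum>b<length ls. if b = b0 then \<Sum>k<ls ! b0. (Q ! b0) $$ (k, k) else 0)"
    unfolding tr_def by (intro sum.cong) (auto simp: zero)
   also have "\<dots> = (\<Sum>k<ls ! b0. (Q ! b0) $$ (k, k))" using b0 by simp
   also have "\<dots> = (\<Sum>k<ls ! b0. ((Q ! b0) $$ (a, k) * (Q ! b0) $$ (k, a)) / c)"
    by (intro sum.cong refl) (subst ent0, auto simp: field_simps)
   also have "\<dots> = c / c" unfolding c_def[of] sum_divide_distrib[symmetric] using Qsq[OF b0(1,3,3)] by simp
   finally show ?thesis using c0 by simp
  qed
  ultimately show ?thesis by (simp add: Q_def)
 qed
 have sums: "vec_space.rank ?L (D (\<Sum>i<k. es i)) <= k & tr (h (unemb F (\<Sum>i<k. es i))) = of_nat k"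
  if "\<forall>i<k. minproj (es i)" for k :: nat and es
  using that
 proof (induction k)
  case 0
  have "h (unemb F 0) \<in> carrier (mats ls)" using hc by simp
  have z: "h (unemb F 0) = 0 \<odot>\<^bsub>mats ls\<^esub> h (unemb F 0)" using h_scl[of 0 0] by simp
  have z2: "D 0 = 0\<^sub>m ?L ?L"
  proof -
   have "h (unemb F 0) = map (\<lambda>l. 0\<^sub>m l l) ls"
    using hc[OF S_0] by (subst z, intro mats_eqI) (auto simp: mats_simps mats_carrier)
   moreover have "diag_block_mat (map (\<lambda>l. 0\<^sub>m l l) ls) = (0\<^sub>m ?L ?L :: complex mat)"
    using diag_block_zero[of "map (\<lambda>l. 0\<^sub>m l l) ls"] by (simp add: comp_def)
   ultimately show ?thesis by (simp add: D_def)
  qed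
  have "tr (h (unemb F 0)) = 0" 
   using mats_smult_entry[OF hc[OF S_0]] by (subst z) (simp add: tr_def)
  then show ?case by (simp add: z2 vec_space.rank_0I)
 next
  case (Suc k)
  have "es i \<in> hS F" if "i < Suc k" for i using Suc.prems that by (simp add: minproj_def)
  then have S: "es k \<in> hS F" "(\<Sum>i<k. es i) \<in> hS F" by (auto intro!: S_sum)
  have "vec_space.rank ?L (D (es k)) <= 1"
   using min[of "es k"] Suc.prems D_carrier[OF S(1)] by (intro product_entries_rank) auto
  moreover have "vec_space.rank ?L (D (\<Sum>i<k. es i) + D (es k)) <= vec_space.rank ?L (D (\<Sum>i<k. es i)) + vec_space.rank ?L (D (es k))"
   using D_carrier S by (intro vec_space.rank_subadditive) auto
  moreover have "tr (h (unemb F (es k))) = 1" using min Suc.prems by simp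
  ultimately show ?case using Suc S hc by (simp add: D_add h_add tr_add)
 qed
 define P where "P = emb F p"
 have P: "P \<in> hS F" "P * P = P" "hst F P = P"
  using p by (auto simp: projection_def P_def A emb_mult[OF A, symmetric] emb_st[OF A])
 define Q where "Q = hone F - P"
 have Q: "Q \<in> hS F" "Q * Q = Q" "hst F Q = Q" using P by (simp_all add: Q_def st_diff algebra_simps)
 obtain k and es :: "nat => 'a host" where k: "\<forall>i<k. minproj (es i)" "P = (\<Sum>i<k. es i)" "\<tau> P = of_nat k" using \<tau>_proj[OF P] by blast
 obtain k' and es' :: "nat => 'a host" where k': "\<forall>i<k'. minproj (es' i)" "Q = (\<Sum>i<k'. es' i)" using \<tau>_proj[OF Q] by blast
 have rP: "vec_space.rank ?L (D P) <= k" "tr (h (unemb F P)) = of_nat k" using sums[OF k(1)] k(2) by auto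
 have rQ: "vec_space.rank ?L (D Q) <= k'" "tr (h (unemb F Q)) = of_nat k'" using sums[OF k'(1)] k'(2) by auto
 have PQ: "P + Q = hone F" by (simp add: Q_def)
 have "vec_space.rank ?L (1\<^sub>m ?L :: complex mat) = ?L"
  using vec_space.det_rank_iff[of "1\<^sub>m ?L :: complex mat" ?L] by simp
 then have "?L <= vec_space.rank ?L (D P) + vec_space.rank ?L (D Q)"
  using vec_space.rank_subadditive[OF D_carrier[OF P(1)] D_carrier[OF Q(1)]] D_add[OF P(1) Q(1)] PQ D_unit by simp
 moreover have "complex_of_nat ?L = of_nat (k + k')"
 proof -
  have "h (unemb F (hone F)) = map 1\<^sub>m ls"
  proof -
   have one: "map 1\<^sub>m ls \<in> carrier (mats ls)" by (simp add: mats_carrier)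
   obtain x where x: "x \<in> hS F" "h (unemb F x) = map 1\<^sub>m ls" using ex[OF one] by blast
   have "h (unemb F (x * hone F)) = h (unemb F (hone F))"
    unfolding h_mult[OF x(1) e_S] x(2) using hc[OF e_S]
    by (intro nth_equalityI) (auto simp: mats_simps mats_carrier)
   then show ?thesis using x e_S by simp
  qed
  moreover have "tr (map 1\<^sub>m ls) = of_nat ?L" by (simp add: tr_def sum_list_sum_nth atLeast0LessThan)
  moreover have "tr (h (unemb F (P + Q))) = of_nat k + of_nat k'"
   using h_add[OF P(1) Q(1)] tr_add hc P Q rP rQ by simp
  ultimately show ?thesis by (simp add: PQ)
 qed
 then have "?L = k + k'" by (simp only: of_nat_eq_iff)
 ultimately have "vec_space.rank ?L (D P) = k" using rP(1) rQ(1) by linarith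
 then show ?thesis using k(3) p by (simp add: P_def D_def projection_def A)
qed

context munits begin

lemma \<beta>_0: "i < d ==> j < d ==> rp i = rp j ==> \<beta> i j 0 = 0"
 using \<beta>_scl[of 0 i j 0] by simp

lemma \<beta>_sum: "(!!k. k \<in> I ==> f k \<in> S) ==> i < d ==> j < d ==> rp i = rp j ==> \<beta> i j (sum f I) = (\<Sum>k\<in>I. \<beta> i j (f k))"
 by (induction I rule: infinite_finite_induct) (auto simp: \<beta>_add \<beta>_0)

lemma \<beta>_synthesis:
 assumes "k < d" "l < d" "rp k = rp l"
 shows "\<beta> k l (\<Sum>i<d. \<Sum>j<d. if rp i = rp j then \<gamma> i j *c m i j else 0) = \<gamma> k l"
proof -
 have t: "(if rp i = rp j then \<gamma> i j *c m i j else 0) \<in> S" if "i < d" "j < d" for i j using m that by simp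
 then have r: "(\<Sum>j<d. if rp i = rp j then \<gamma> i j *c m i j else 0) \<in> S" if "i < d" for i
  using that by (intro S_sum) auto
 have "\<beta> k l (\<Sum>i<d. \<Sum>j<d. if rp i = rp j then \<gamma> i j *c m i j else 0)
  = (\<Sum>i<d. \<beta> k l (\<Sum>j<d. if rp i = rp j then \<gamma> i j *c m i j else 0))"
  using r by (intro \<beta>_sum assms) auto
 also have "\<dots> = (\<Sum>i<d. \<Sum>j<d. \<beta> k l (if rp i = rp j then \<gamma> i j *c m i j else 0))"
  using t by (intro sum.cong refl \<beta>_sum assms) auto
 also have "\<dots> = (\<Sum>i<d. \<Sum>j<d. if i = k then if j = l then \<gamma> k l else 0 else 0)"
  using assms m by (intro sum.cong refl) (auto simp: \<beta>_0 \<beta>_scl \<beta>_m)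
 also have "\<dots> = (\<Sum>i<d. if i = k then \<gamma> k l else 0)" using assms by (intro sum.cong) auto
 also have "\<dots> = \<gamma> k l" using assms by simp
 finally show ?thesis .
qed

end

lemma matrix_iso_exists:
 fixes F :: "'a cstar"
 assumes A: "cstar_algebra F" and M: "munits_fd (hS F) (hst F) (hnm F) (hone F) d rp m \<beta> X"
 shows "\<exists>ls h. (\<forall>l\<in>set ls. 0 < l) & h \<in> star_iso F (mats ls)"
proof -
 interpret munits_fd "hS F" "hst F" "hnm F" "hone F" d rp m \<beta> X by (rule M)
 define R where "R = sorted_list_of_set {r. r < d & rp r = r}"
 define cl where "cl r = sorted_list_of_set {i. i < d & rp i = r}" for r
 have R: "distinct R" "set R = {r. r < d & rp r = r}" by (simp_all add: R_def)
 have cl: "distinct (cl r)" "set (cl r) = {i. i < d & rp i = r}" for r by (simp_all add: cl_def)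
 define ls where "ls = map (\<lambda>r. length (cl r)) R"
 have len: "length ls = length R" by (simp add: ls_def)
 have lsb: "ls ! b = length (cl (R ! b))" if "b < length ls" for b using that by (simp add: ls_def)
 have pos: "\<forall>l\<in>set ls. 0 < l"
 proof
  fix l assume "l \<in> set ls"
  then obtain r where r: "r < d" "rp r = r" "l = length (cl r)" using R by (auto simp: ls_def)
  then have "r \<in> set (cl r)" by (simp add: cl)
  then show "0 < l" using r by (auto simp: length_pos_if_in_set)
 qed
 define idx where "idx b x = cl (R ! b) ! x" for b x
 have bij: "bij_betw (idx b) {..<ls ! b} {k. k < d & rp k = R ! b}" if "b < length ls" for b
  unfolding idx_def using cl[of "R ! b"] lsb[OF that] by (intro bij_betw_nth) auto
 have idx: "idx b x < d" "rp (idx b x) = R ! b" if "b < length ls" "x < ls ! b" for b x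
  using bij_betwE[OF bij[OF that(1)]] that(2) by auto
 have class_sum: "(\<Sum>k<d. if rp k = R ! b then f k else 0) = (\<Sum>x<ls ! b. f (idx b x))" if "b < length ls" for b and f :: "nat => complex"
 proof -
  have "(\<Sum>k<d. if rp k = R ! b then f k else 0) = (\<Sum>k\<in>{k. k < d & rp k = R ! b}. f k)"
   by (simp add: sum.If_cases Int_def lessThan_def)
  then show ?thesis using sum.reindex_bij_betw[OF bij[OF that], of f] by simp
 qed
 have "\<exists>b x. b < length ls & x < ls ! b & idx b x = i" if i: "i < d" for i
 proof -
  have "rp i \<in> set R" using rp i by (simp add: R)
  then obtain b where b: "b < length R" "R ! b = rp i" by (auto simp: in_set_conv_nth)
  then have "i \<in> idx b ` {..<ls ! b}" using bij[of b] len i by (auto simp: bij_betw_def)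
  then show ?thesis using b len by auto
 qed
 then obtain bi xi where bx: "!!i. i < d ==> bi i < length ls & xi i < ls ! (bi i) & idx (bi i) (xi i) = i" by metis
 have bx_idx: "bi (idx b x) = b" "xi (idx b x) = x" if "b < length ls" "x < ls ! b" for b x
 proof -
  have i: "idx b x < d" "rp (idx b x) = R ! b" using idx that by auto
  note c = bx[OF i(1)]
  have "R ! bi (idx b x) = R ! b" using idx[of "bi (idx b x)" "xi (idx b x)"] c i by simp
  then show bb: "bi (idx b x) = b" using c that len R(1) by (simp add: nth_eq_iff_index_eq)
  have "idx b (xi (idx b x)) = idx b x" using c bb by simp
  then show "xi (idx b x) = x" using bij[OF that(1)] c bb that(2) by (auto simp: bij_betw_def dest: inj_onD)
 qed
 define h where "h x = map (\<lambda>b. mat (ls ! b) (ls ! b) (\<lambda>(s, t). \<beta> (idx b s) (idx b t) (emb F x))) [0..<length ls]" for x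
 have hc: "h x \<in> carrier (mats ls)" for x by (simp add: h_def mats_carrier)
 have ent: "(h x ! b) $$ (s, t) = \<beta> (idx b s) (idx b t) (emb F x)" if "b < length ls" "s < ls ! b" "t < ls ! b" for x b s t
  using that by (simp add: h_def)
 have idx2: "idx b s < d" "idx b t < d" "rp (idx b s) = rp (idx b t)" if "b < length ls" "s < ls ! b" "t < ls ! b" for b s t
  using idx that by auto
 have "h \<in> star_hom F (mats ls)"
 proof (rule star_homI)
  fix x y assume xy: "x \<in> carrier F" "y \<in> carrier F"
  have E: "emb F x \<in> hS F" "emb F y \<in> hS F" using xy by (simp_all add: A)
  show "h (x \<oplus>\<^bsub>F\<^esub> y) = h x \<oplus>\<^bsub>mats ls\<^esub> h y"
  proof (rule mats_eqI[OF hc mats_add_closed[OF hc hc]])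
   fix b s t assume b: "b < length ls" "s < ls ! b" "t < ls ! b"
   show "h (x \<oplus>\<^bsub>F\<^esub> y) ! b $$ (s, t) = (h x \<oplus>\<^bsub>mats ls\<^esub> h y) ! b $$ (s, t)"
    using \<beta>_add[OF E idx2[OF b]] by (simp only: ent[OF b] mats_add_entry[OF hc hc b] emb_add[OF A xy])
  qed
  have mc: "h x \<otimes>\<^bsub>mats ls\<^esub> h y \<in> carrier (mats ls)"
   using hc[of x] hc[of y] by (auto simp: mats_carrier mats_simps intro!: mult_carrier_mat)
  show "h (x \<otimes>\<^bsub>F\<^esub> y) = h x \<otimes>\<^bsub>mats ls\<^esub> h y"
  proof (rule mats_eqI[OF hc mc])
   fix b s t assume b: "b < length ls" "s < ls ! b" "t < ls ! b"
   have "h (x \<otimes>\<^bsub>F\<^esub> y) ! b $$ (s, t) = (\<Sum>k<d. if rp k = R ! b then \<beta> (idx b s) k (emb F x) * \<beta> k (idx b t) (emb F y) else 0)"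
    using \<beta>_mult[OF E idx2[OF b]] idx(2)[OF b(1,2)] by (simp only: ent[OF b] emb_mult[OF A xy])
   also have "\<dots> = (h x \<otimes>\<^bsub>mats ls\<^esub> h y) ! b $$ (s, t)"
    unfolding class_sum[OF b(1)] mats_mult_entry[OF hc hc b] using b by (intro sum.cong refl) (simp add: ent)
   finally show "h (x \<otimes>\<^bsub>F\<^esub> y) ! b $$ (s, t) = (h x \<otimes>\<^bsub>mats ls\<^esub> h y) ! b $$ (s, t)" .
  qed
 next
  fix c x assume x: "x \<in> carrier F"
  show "h (c \<odot>\<^bsub>F\<^esub> x) = c \<odot>\<^bsub>mats ls\<^esub> h x"
  proof (rule mats_eqI[OF hc mats_smult_closed[OF hc]])
   fix b s t assume b: "b < length ls" "s < ls ! b" "t < ls ! b"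
   show "h (c \<odot>\<^bsub>F\<^esub> x) ! b $$ (s, t) = (c \<odot>\<^bsub>mats ls\<^esub> h x) ! b $$ (s, t)"
    using \<beta>_scl[OF emb_in[OF A x] idx2[OF b]] by (simp only: ent[OF b] mats_smult_entry[OF hc b] emb_scl[OF A x])
  qed
 next
  fix x assume x: "x \<in> carrier F"
  have ac: "adj (mats ls) (h x) \<in> carrier (mats ls)"
   using hc[of x] by (auto simp: mats_carrier mats_simps intro!: mat_adjoint_carrier)
  show "h (adj F x) = adj (mats ls) (h x)"
  proof (rule mats_eqI[OF hc ac])
   fix b s t assume b: "b < length ls" "s < ls ! b" "t < ls ! b"
   have hx: "h x ! b \<in> carrier_mat (ls ! b) (ls ! b)" using b by (simp add: h_def)
   have "adj (mats ls) (h x) ! b $$ (s, t) = cnj (h x ! b $$ (t, s))"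
    using hx b by (simp add: mats_simps mat_adjoint_entry[OF hx])
   then show "h (adj F x) ! b $$ (s, t) = adj (mats ls) (h x) ! b $$ (s, t)"
    using \<beta>_st[OF emb_in[OF A x] idx2[OF b]] by (simp only: ent[OF b] ent[OF b(1,3,2)] emb_st[OF A x])
  qed
 qed (rule hc)
 moreover have "bij_betw h (carrier F) (carrier (mats ls))"
 proof (rule bij_betw_imageI)
  show "inj_on h (carrier F)"
  proof (rule inj_onI)
   fix x y assume xy: "x \<in> carrier F" "y \<in> carrier F" "h x = h y"
   have "\<beta> i j (emb F x) = \<beta> i j (emb F y)" if ij: "i < d" "j < d" "rp i = rp j" for i j
   proof -
    note bi = bx[OF ij(1)] and bj = bx[OF ij(2)]
    have "R ! bi i = R ! bi j" using idx(2)[of "bi i" "xi i"] idx(2)[of "bi j" "xi j"] bi bj ij(3) by simp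
    then have "bi i = bi j" using bi bj len R(1) by (simp add: nth_eq_iff_index_eq)
    then show ?thesis using ent[of "bi i" "xi i" "xi j" x] ent[of "bi i" "xi i" "xi j" y] bi bj xy(3) by simp
   qed
   then have "(\<Sum>i<d. \<Sum>j<d. if rp i = rp j then \<beta> i j (emb F x) *c m i j else 0)
    = (\<Sum>i<d. \<Sum>j<d. if rp i = rp j then \<beta> i j (emb F y) *c m i j else 0)"
    by (intro sum.cong refl) auto
   then have "emb F x = emb F y"
    using trans[OF expand[OF emb_in[OF A xy(1)]] trans[OF _ expand[OF emb_in[OF A xy(2)], symmetric]]] by blast
   then show "x = y" using emb_inj[OF A] xy by blast
  qed
  have "Ms \<in> h ` carrier F" if Ms: "Ms \<in> carrier (mats ls)" for Ms
  proof -
   define \<gamma> where "\<gamma> i j = (Ms ! bi i) $$ (xi i, xi j)" for i j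
   define y where "y = (\<Sum>i<d. \<Sum>j<d. if rp i = rp j then \<gamma> i j *c m i j else 0)"
   have "(if rp i = rp j then \<gamma> i j *c m i j else 0) \<in> hS F" if "i < d" "j < d" for i j using m that by simp
   then have y: "y \<in> hS F" unfolding y_def by (intro S_sum) auto
   have "h (unemb F y) = Ms"
   proof (rule mats_eqI[OF hc Ms])
    fix b s t assume b: "b < length ls" "s < ls ! b" "t < ls ! b"
    have "h (unemb F y) ! b $$ (s, t) = \<beta> (idx b s) (idx b t) y" using y by (simp add: ent[OF b] A)
    also have "\<dots> = \<gamma> (idx b s) (idx b t)" unfolding y_def by (rule \<beta>_synthesis[OF idx2[OF b]])
    also have "\<dots> = Ms ! b $$ (s, t)" using b by (simp add: \<gamma>_def bx_idx)
    finally show "h (unemb F y) ! b $$ (s, t) = Ms ! b $$ (s, t)" .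
   qed
   then show ?thesis using y by (intro image_eqI[of _ _ "unemb F y"]) (simp_all add: A)
  qed
  then show "h ` carrier F = carrier (mats ls)" using hc by blast
 qed
 ultimately show ?thesis using pos by (auto simp: star_iso_def)
qed

text \<open>The trace does not refer to the identification with matrices, so the value in \<open>fd_rank\<close> is unique.\<close>

lemma fd_rank_eq:
 fixes F :: "'a cstar"
 assumes A: "cstar_algebra F" and M: "munits_fd (hS F) (hst F) (hnm F) (hone F) d rp m \<beta> X" and p: "projection F p"
 shows "munits.\<tau> d \<beta> (emb F p) = of_nat (fd_rank F p)"
proof -
 obtain ls h where lh: "\<forall>l\<in>set ls. 0 < l" "h \<in> star_iso F (mats ls)" using matrix_iso_exists[OF A M] by blast
 have "fd_rank F p = vec_space.rank (sum_list ls) (diag_block_mat (h p))"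
  unfolding fd_rank_def
 proof (rule the_equality)
  fix r assume "\<exists>ls h. (\<forall>l\<in>set ls. 0 < l) & h \<in> star_iso F (mats ls) & r = vec_space.rank (sum_list ls) (diag_block_mat (h p))"
  then obtain ls' h' where "h' \<in> star_iso F (mats ls')" "r = vec_space.rank (sum_list ls') (diag_block_mat (h' p))" by blast
  then have "complex_of_nat r = of_nat (vec_space.rank (sum_list ls) (diag_block_mat (h p)))"
   using rank_of_projection[OF M A _ p] lh(2) by metis
  then show "r = vec_space.rank (sum_list ls) (diag_block_mat (h p))" by (simp only: of_nat_eq_iff)
 qed (use lh in blast)
 then show ?thesis using rank_of_projection[OF M A lh(2) p] by simp
qed

text \<open>The three properties of a rank function that the counting argument uses; the bound says that the functional is positive and
that its norm on a corner is its value at the unit of the corner.\<close>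

definition trace_for :: "'a cstar => ('a => nat) => ('a => complex) => bool" where
 "trace_for F rk T \<longleftrightarrow>
  (\<forall>x\<in>carrier F. \<forall>y\<in>carrier F. T (x \<oplus>\<^bsub>F\<^esub> y) = T x + T y) &
  (\<forall>p. projection F p --> T p = of_nat (rk p)) &
  (\<forall>p x. projection F p --> x \<in> carrier F --> p \<otimes>\<^bsub>F\<^esub> x \<otimes>\<^bsub>F\<^esub> p = x --> cmod (T x) <= nrm F x * Re (T p))"

lemma trace_forD:
 assumes "trace_for F rk T"
 shows "x \<in> carrier F ==> y \<in> carrier F ==> T (x \<oplus>\<^bsub>F\<^esub> y) = T x + T y"
  "projection F p ==> T p = of_nat (rk p)"
  "projection F p ==> x \<in> carrier F ==> p \<otimes>\<^bsub>F\<^esub> x \<otimes>\<^bsub>F\<^esub> p = x ==> cmod (T x) <= nrm F x * Re (T p)"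
 using assms unfolding trace_for_def by blast+

lemma fd_trace_exists:
 fixes F :: "'a cstar"
 assumes "fd_cstar_algebra F"
 shows "\<exists>T. trace_for F (fd_rank F) T"
proof -
 have A: "cstar_algebra F" using assms by (simp add: fd_cstar_algebra_def)
 obtain d rp m \<beta> X where M: "munits_fd (hS F) (hst F) (hnm F) (hone F) d rp m \<beta> X"
  using fd_munits[OF assms] by blast
 interpret munits_fd "hS F" "hst F" "hnm F" "hone F" d rp m \<beta> X by (rule M)
 have proj: "emb F p \<in> hS F" "emb F p * emb F p = emb F p" "hst F (emb F p) = emb F p" if "projection F p" for p
  using that by (auto simp: projection_def A emb_mult[OF A, symmetric] emb_st[OF A])
 have "cmod (\<tau> (emb F x)) <= nrm F x * Re (\<tau> (emb F p))"
  if "projection F p" "x \<in> carrier F" "p \<otimes>\<^bsub>F\<^esub> x \<otimes>\<^bsub>F\<^esub> p = x" for p x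
 proof -
  have pc: "p \<in> carrier F" using that by (simp add: projection_def)
  have eq: "emb F p * emb F x * emb F p = emb F x"
   using arg_cong[OF that(3), of "emb F"] pc that(2) by (simp add: emb_mult[OF A] carrier_simps(1)[OF A])
  note p = proj[OF that(1)]
  show ?thesis using \<tau>_bound[OF p emb_in[OF A that(2)] eq] that(2) by (simp add: emb_nm[OF A])
 qed
 then have "trace_for F (fd_rank F) (\<lambda>x. \<tau> (emb F x))"
  unfolding trace_for_def using fd_rank_eq[OF A M] by (auto simp: emb_add[OF A] \<tau>_add A)
 then show ?thesis by blast
qed

section \<open>The building blocks as C*-algebras\<close>

instantiation "fun" :: (type, complex_alg) complex_alg
begin
definition scl_fun: "c *c f = (\<lambda>x. c *c f x)"
instance by standard (auto simp: scl_fun fun_eq_iff scl_simps)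
end

lemma scl_fun_apply [simp]: "(c *c f) x = c *c f x" by (simp add: scl_fun)

text \<open>Converse of the representation: verifying the axioms is easier for subsets of a ring type.\<close>

lemma cstar_algebra_of_hosted:
 fixes R :: "'r cstar" and S :: "'h::complex_alg set"
 assumes H: "hcstar1 S st nm u" and ran: "carrier R = \<iota> ` S" and inj: "inj_on \<iota> S"
  and add: "!!x y. x \<in> S ==> y \<in> S ==> \<iota> x \<oplus>\<^bsub>R\<^esub> \<iota> y = \<iota> (x + y)"
  and mult: "!!x y. x \<in> S ==> y \<in> S ==> \<iota> x \<otimes>\<^bsub>R\<^esub> \<iota> y = \<iota> (x * y)"
  and scl: "!!c x. x \<in> S ==> c \<odot>\<^bsub>R\<^esub> \<iota> x = \<iota> (c *c x)"
  and adj: "!!x. x \<in> S ==> adj R (\<iota> x) = \<iota> (st x)"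
  and nm: "!!x. x \<in> S ==> nrm R (\<iota> x) = nm x"
  and zero: "\<zero>\<^bsub>R\<^esub> = \<iota> 0" and one: "\<one>\<^bsub>R\<^esub> = \<iota> u"
 shows "cstar_algebra R"
proof -
 interpret hcstar1 S st nm u by (rule H)
 note simps = ran add mult scl adj nm zero
 have vs: "vectorspace class_ring R"
 proof (rule vs_criteria)
  show "\<forall>v\<in>carrier R. \<exists>neg_v\<in>carrier R. v \<oplus>\<^bsub>R\<^esub> neg_v = \<zero>\<^bsub>R\<^esub>"
  proof
   fix v assume "v \<in> carrier R"
   then obtain x where "x \<in> S" "v = \<iota> x" by (auto simp: ran)
   then show "\<exists>neg_v\<in>carrier R. v \<oplus>\<^bsub>R\<^esub> neg_v = \<zero>\<^bsub>R\<^esub>"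
    by (intro bexI[of _ "\<iota> (- x)"]) (simp_all add: simps)
  qed
 qed (auto simp: simps class_field scl_simps algebra_simps)
 interpret vectorspace class_ring R by (rule vs)
 have minus: "\<iota> x \<ominus>\<^bsub>R\<^esub> \<iota> y = \<iota> (x - y)" if "x \<in> S" "y \<in> S" for x y
 proof -
  have "\<ominus>\<^bsub>R\<^esub> \<iota> y = \<iota> (- y)" using that by (intro M.minus_equality) (auto simp: simps)
  then show ?thesis using that by (simp add: a_minus_def simps)
 qed
 show ?thesis
 proof (intro cstar_algebra.intro vs cstar_algebra_axioms.intro)
  fix X :: "nat => 'r"
  assume X: "!!n. X n \<in> carrier R" and c: "!!e. 0 < e ==> \<exists>N. \<forall>m\<ge>N. \<forall>n\<ge>N. nrm R (X m \<ominus>\<^bsub>R\<^esub> X n) < e"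
  define Y where "Y n = inv_into S \<iota> (X n)" for n
  have Y: "Y n \<in> S" "X n = \<iota> (Y n)" for n
   using X[of n] by (auto simp: Y_def ran f_inv_into_f inv_into_into)
  obtain y where "y \<in> S" "(\<lambda>n. nm (Y n - y)) \<longlonglongrightarrow> 0"
   using S_complete[of Y] c Y(1) by (auto simp: Y(2) minus nm)
  then show "\<exists>x\<in>carrier R. (\<lambda>n. nrm R (X n \<ominus>\<^bsub>R\<^esub> x)) \<longlonglongrightarrow> 0"
   by (intro bexI[of _ "\<iota> y"]) (simp_all add: Y minus nm ran)
 next
  fix f assume f: "f \<in> carrier R" "!!x. x \<in> carrier R ==> f \<otimes>\<^bsub>R\<^esub> x = x & x \<otimes>\<^bsub>R\<^esub> f = x"
  then obtain x where x: "x \<in> S" "f = \<iota> x" by (auto simp: ran)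
  have "\<iota> x \<otimes>\<^bsub>R\<^esub> \<iota> u = \<iota> u" using f(2)[of "\<iota> u"] x by (simp add: ran)
  then show "\<one>\<^bsub>R\<^esub> = f" using x by (simp add: mult one)
 qed (auto simp: simps algebra_simps st_add st_scl st_mult nm_add nm_scl nm_mult nm_cstar nm_eq_0 inj_on_eq_iff[OF inj])
qed

text \<open>An element \<open>(f, a)\<close> of a building block is represented by a function on \<open>real option\<close>
with value \<open>a\<close> at \<open>None\<close> and \<open>f t\<close> at \<open>Some t\<close>, extended by 0. Operations are then the pointwise ones.\<close>

locale et_data =
 fixes F1 F2 :: "'f cstar" and \<phi>0 \<phi>1 :: "'f => 'f"
 assumes block: "is_et_block (ET F1 F2 \<phi>0 \<phi>1)"
begin

lemma fd: "fd_cstar_algebra F1" "fd_cstar_algebra F2"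
 and ends: "\<phi>0 \<in> unital_star_hom F1 F2" "\<phi>1 \<in> unital_star_hom F1 F2"
 using block by auto
lemma cstar: "cstar_algebra F1" "cstar_algebra F2" using fd by (auto simp: fd_cstar_algebra_def)

abbreviation "S1 \<equiv> hS F1"
abbreviation "S2 \<equiv> hS F2"
abbreviation "st1 \<equiv> hst F1"
abbreviation "st2 \<equiv> hst F2"
abbreviation "nm1 \<equiv> hnm F1"
abbreviation "nm2 \<equiv> hnm F2"
abbreviation "u1 \<equiv> hone F1"
abbreviation "u2 \<equiv> hone F2"
abbreviation "p0 \<equiv> hmap F1 F2 \<phi>0"
abbreviation "p1 \<equiv> hmap F1 F2 \<phi>1"

lemma H1: "hcstar1 S1 st1 nm1 u1" and H2: "hcstar1 S2 st2 nm2 u2"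
proof -
 interpret A: monoid F1 by (rule fd_unit(1)[OF fd(1)])
 interpret B: monoid F2 by (rule fd_unit(1)[OF fd(2)])
 show "hcstar1 S1 st1 nm1 u1" "hcstar1 S2 st2 nm2 u2" by (rule hcstar1_hosted; simp add: cstar)+
qed

sublocale I1: hcstar1 S1 st1 nm1 u1 by (rule H1)
sublocale I2: hcstar1 S2 st2 nm2 u2 by (rule H2)

lemma p: "star_map S1 st1 S2 st2 p0" "star_map S1 st1 S2 st2 p1" "p0 u1 = u2" "p1 u1 = u2"
 using ends fd_unit(2)[OF fd(1)] by (auto simp: unital_star_hom_def hmap_emb cstar intro!: star_map_hmap)

lemmas p0D = star_mapD[OF p(1)] and p1D = star_mapD[OF p(2)]
lemma p_0: "p0 0 = 0" "p1 0 = 0"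
 using star_map_diff(2)[OF p(1) I1.hcstar_axioms I1.S_0 I1.S_0] star_map_diff(2)[OF p(2) I1.hcstar_axioms I1.S_0 I1.S_0] by auto

definition cts :: "(real => 'f host) => bool" where
 "cts f \<longleftrightarrow> (\<forall>t\<in>{0..1}. f t \<in> S2) & (\<forall>t\<in>{0..1}. ((\<lambda>s. nm2 (f s - f t)) \<longlongrightarrow> 0) (at t within {0..1}))"

lemma cts_in: "cts f ==> t \<in> {0..1} ==> f t \<in> S2" by (simp add: cts_def)
lemma cts_lim: "cts f ==> t \<in> {0..1} ==> ((\<lambda>s. nm2 (f s - f t)) \<longlongrightarrow> 0) (at t within {0..1})" by (simp add: cts_def)

lemma ctsI:
 assumes "!!t. t \<in> {0..1} ==> f t \<in> S2"
  and "!!s t. s \<in> {0..1} ==> t \<in> {0..1} ==> nm2 (f s - f t) <= g s t"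
  and "!!t. t \<in> {0..1} ==> ((\<lambda>s. g s t) \<longlongrightarrow> 0) (at t within {0..1})"
 shows "cts f"
 unfolding cts_def
proof (intro conjI ballI)
 fix t :: real assume t: "t \<in> {0..1}"
 have ev: "\<forall>\<^sub>F s in at t within {0..1}. s \<in> {0..1}" by (simp add: eventually_at_filter)
 show "((\<lambda>s. nm2 (f s - f t)) \<longlongrightarrow> 0) (at t within {0..1})"
 proof (rule tendsto_sandwich[OF _ _ tendsto_const assms(3)[OF t]])
  show "\<forall>\<^sub>F s in at t within {0..1}. 0 <= nm2 (f s - f t)" using ev assms(1) t by (auto elim!: eventually_mono)
  show "\<forall>\<^sub>F s in at t within {0..1}. nm2 (f s - f t) <= g s t" using ev assms(2) t by (auto elim!: eventually_mono)
 qed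
qed (use assms(1) in simp)

lemma cts_cong: assumes "cts f" "!!t. t \<in> {0..1} ==> g t = f t" shows "cts g"
 by (rule ctsI[where g = "\<lambda>s t. nm2 (f s - f t)"]) (use assms cts_in[OF assms(1)] cts_lim[OF assms(1)] in auto)

lemma cts_nm: assumes "cts f" shows "continuous_on {0..1} (\<lambda>t. nm2 (f t))"
 unfolding continuous_on_def
proof
 fix t :: real assume t: "t \<in> {0..1}"
 have ev: "\<forall>\<^sub>F s in at t within {0..1}. s \<in> {0..1}" by (simp add: eventually_at_filter)
 have "\<bar>nm2 (f s) - nm2 (f t)\<bar> <= nm2 (f s - f t)" if "s \<in> {0..1}" for s
  using I2.nm_add[of "f s - f t" "f t"] I2.nm_add[of "f t - f s" "f s"] I2.nm_diff_commute[of "f s" "f t"] cts_in[OF assms] t that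
  by simp
 then have "((\<lambda>s. nm2 (f s) - nm2 (f t)) \<longlongrightarrow> 0) (at t within {0..1})"
  using ev by (intro tendsto_0_le[OF cts_lim[OF assms t], of _ 1]) (force elim!: eventually_mono intro: order_trans[OF _ abs_ge_self])
 then show "((\<lambda>s. nm2 (f s)) \<longlongrightarrow> nm2 (f t)) (at t within {0..1})" by (simp add: LIM_zero_iff)
qed

lemma cts_bound: assumes "cts f" obtains K where "0 <= K" "!!t. t \<in> {0..1} ==> nm2 (f t) <= K"
proof -
 obtain x :: real where x: "x \<in> {0..1}" "\<forall>t\<in>{0..1}. nm2 (f t) <= nm2 (f x)"
  using continuous_attains_sup[OF compact_Icc _ cts_nm[OF assms]] by auto
 then show ?thesis using that[of "nm2 (f x)"] cts_in[OF assms x(1)] by simp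
qed

lemma cts_add: assumes f: "cts f" and g: "cts g" shows "cts (\<lambda>t. f t + g t)"
proof (rule ctsI[where g = "\<lambda>s t. nm2 (f s - f t) + nm2 (g s - g t)"])
 show "nm2 (f s + g s - (f t + g t)) <= nm2 (f s - f t) + nm2 (g s - g t)" if "s \<in> {0..1}" "t \<in> {0..1}" for s t
  using I2.nm_add[of "f s - f t" "g s - g t"] cts_in[OF f] cts_in[OF g] that by (simp add: algebra_simps)
qed (use tendsto_add_zero[OF cts_lim[OF f] cts_lim[OF g]] cts_in[OF f] cts_in[OF g] in auto)

lemma cts_mult: assumes f: "cts f" and g: "cts g" shows "cts (\<lambda>t. f t * g t)"
proof -
 obtain K where K: "!!t. t \<in> {0..1} ==> nm2 (f t) <= K" using cts_bound[OF f] by blast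
 show ?thesis
 proof (rule ctsI[where g = "\<lambda>s t. K * nm2 (g s - g t) + nm2 (f s - f t) * nm2 (g t)"])
  fix s t :: real assume st: "s \<in> {0..1}" "t \<in> {0..1}"
  note S = cts_in[OF f st(1)] cts_in[OF f st(2)] cts_in[OF g st(1)] cts_in[OF g st(2)]
  have "nm2 (f s * g s - f t * g t) = nm2 (f s * (g s - g t) + (f s - f t) * g t)" by (simp add: algebra_simps)
  also have "\<dots> <= K * nm2 (g s - g t) + nm2 (f s - f t) * nm2 (g t)"
   using S K[OF st(1)] by (intro I2.nm_add_le I2.nm_mult_le) auto
  finally show "nm2 (f s * g s - f t * g t) <= K * nm2 (g s - g t) + nm2 (f s - f t) * nm2 (g t)" .
 next
  fix t :: real assume t: "t \<in> {0..1}"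
  show "((\<lambda>s. K * nm2 (g s - g t) + nm2 (f s - f t) * nm2 (g t)) \<longlongrightarrow> 0) (at t within {0..1})"
   using tendsto_add_zero[OF tendsto_mult_right_zero[OF cts_lim[OF g t], of K] tendsto_mult_left_zero[OF cts_lim[OF f t], of "nm2 (g t)"]] .
 qed (use cts_in[OF f] cts_in[OF g] in auto)
qed

lemma cts_scaled:
 assumes b: "continuous_on {0..1} b" and x: "x \<in> S2" shows "cts (\<lambda>t. of_real (b t) *c x)"
proof (rule ctsI[where g = "\<lambda>s t. \<bar>b s - b t\<bar> * nm2 x"])
 show "nm2 (of_real (b s) *c x - of_real (b t) *c x) <= \<bar>b s - b t\<bar> * nm2 x" for s t
  using I2.nm_scl[OF x, of "of_real (b s - b t)"] by (simp only: norm_of_real scl_diff_left[symmetric] of_real_diff[symmetric])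
 show "((\<lambda>s. \<bar>b s - b t\<bar> * nm2 x) \<longlongrightarrow> 0) (at t within {0..1})" if "t \<in> {0..1}" for t
  using b that by (auto intro!: tendsto_mult_left_zero tendsto_rabs_zero simp: continuous_on_def LIM_zero_iff)
qed (use x in auto)

lemma cts_st: assumes f: "cts f" shows "cts (\<lambda>t. st2 (f t))"
proof (rule ctsI[where g = "\<lambda>s t. nm2 (f s - f t)"])
 show "nm2 (st2 (f s) - st2 (f t)) <= nm2 (f s - f t)" if "s \<in> {0..1}" "t \<in> {0..1}" for s t
  using cts_in[OF f] that by (simp flip: I2.st_diff)
qed (use cts_lim[OF f] cts_in[OF f] in auto)

lemma cts_scl: assumes f: "cts f" shows "cts (\<lambda>t. c *c f t)"
proof (rule ctsI[where g = "\<lambda>s t. cmod c * nm2 (f s - f t)"])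
 show "nm2 (c *c f s - c *c f t) <= cmod c * nm2 (f s - f t)" if "s \<in> {0..1}" "t \<in> {0..1}" for s t
  using cts_in[OF f] that by (simp flip: scl_diff_right add: I2.nm_scl)
qed (use tendsto_mult_right_zero[OF cts_lim[OF f]] cts_in[OF f] in auto)

definition ES :: "(real option => 'f host) set" where
 "ES = {X. X None \<in> S1 & cts (\<lambda>t. X (Some t)) & (\<forall>t. t \<notin> {0..1} --> X (Some t) = 0) &
  X (Some 0) = p0 (X None) & X (Some 1) = p1 (X None)}"
definition Est :: "(real option => 'f host) => real option => 'f host" where
 "Est X i = (case i of None => st1 (X None) | Some t => if t \<in> {0..1} then st2 (X (Some t)) else 0)"
definition Enm :: "(real option => 'f host) => real" where
 "Enm X = max (Sup ((\<lambda>t. nm2 (X (Some t))) ` {0..1})) (nm1 (X None))"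
definition Eu :: "real option => 'f host" where
 "Eu i = (case i of None => u1 | Some t => if t \<in> {0..1} then u2 else 0)"

lemma ESD: assumes "X \<in> ES" shows "X None \<in> S1" "cts (\<lambda>t. X (Some t))" "t \<in> {0..1} ==> X (Some t) \<in> S2"
  "t \<notin> {0..1} ==> X (Some t) = 0" "X (Some 0) = p0 (X None)" "X (Some 1) = p1 (X None)"
 using assms cts_in[of "\<lambda>t. X (Some t)" t] by (auto simp: ES_def)

lemma Est_apply [simp]: "Est X None = st1 (X None)" "t \<in> {0..1} ==> Est X (Some t) = st2 (X (Some t))"
 "t \<notin> {0..1} ==> Est X (Some t) = 0"
 by (auto simp: Est_def)
lemma Eu_apply [simp]: "Eu None = u1" "t \<in> {0..1} ==> Eu (Some t) = u2" "t \<notin> {0..1} ==> Eu (Some t) = 0"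
 by (auto simp: Eu_def)

lemma Enm_le: assumes X: "X \<in> ES" shows "Enm X <= c \<longleftrightarrow> (\<forall>t\<in>{0..1}. nm2 (X (Some t)) <= c) & nm1 (X None) <= c"
proof -
 obtain K where "!!t. t \<in> {0..1} ==> nm2 (X (Some t)) <= K" using cts_bound[OF ESD(2)[OF X]] by blast
 then have "bdd_above ((\<lambda>t. nm2 (X (Some t))) ` {0..1})" by (intro bdd_aboveI2)
 then show ?thesis unfolding Enm_def by (simp add: cSup_le_iff)
qed

lemma nm_le_Enm: assumes X: "X \<in> ES" shows "t \<in> {0..1} ==> nm2 (X (Some t)) <= Enm X" "nm1 (X None) <= Enm X"
 using Enm_le[OF X, of "Enm X"] by auto

lemma ES_eqI: "X \<in> ES ==> Y \<in> ES ==> X None = Y None ==> (!!t. t \<in> {0..1} ==> X (Some t) = Y (Some t)) ==> X = Y"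
 using ESD(4)[of X] ESD(4)[of Y] by (intro ext, rename_tac i, case_tac i) metis+

lemma ES_ops: assumes "X \<in> ES" "Y \<in> ES" shows "X + Y \<in> ES" "X * Y \<in> ES" "c *c X \<in> ES" "Est X \<in> ES"
proof -
 note D = ESD[OF assms(1)] ESD[OF assms(2)]
 show "X + Y \<in> ES" using D cts_add[OF D(2,8)] by (auto simp: ES_def p0D(4) p1D(4))
 show "X * Y \<in> ES" using D cts_mult[OF D(2,8)] by (auto simp: ES_def p0D(5) p1D(5))
 show "c *c X \<in> ES" using D cts_scl[OF D(2)] by (auto simp: ES_def p0D(3) p1D(3))
 have "cts (\<lambda>t. Est X (Some t))" by (rule cts_cong[OF cts_st[OF D(2)]]) simp
 then show "Est X \<in> ES" using D by (auto simp: ES_def p0D(2) p1D(2))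
qed

lemma cts_limit:
 assumes f: "!!n. cts (f n)" and g: "!!t. t \<in> {0..1} ==> g t \<in> S2"
  and unif: "!!d. 0 < d ==> \<exists>n. \<forall>t\<in>{0..1}. nm2 (f n t - g t) <= d"
 shows "cts g"
 unfolding cts_def
proof (intro conjI ballI g)
 fix t :: real assume t: "t \<in> {0..1}"
 show "((\<lambda>s. nm2 (g s - g t)) \<longlongrightarrow> 0) (at t within {0..1})"
 proof (rule tendstoI)
  fix d :: real assume d: "0 < d"
  obtain n where n: "!!s. s \<in> {0..1} ==> nm2 (f n s - g s) <= d/4" using unif[of "d/4"] d by (meson divide_pos_pos zero_less_numeral)
  have "\<forall>\<^sub>F s in at t within {0..1}. nm2 (f n s - f n t) < d/2"
   using order_tendstoD(2)[OF cts_lim[OF f t], of "d/2" n] d by simp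
  moreover have "\<forall>\<^sub>F s in at t within {0..1}. s \<in> {0..1}" by (simp add: eventually_at_filter)
  ultimately show "\<forall>\<^sub>F s in at t within {0..1}. dist (nm2 (g s - g t)) 0 < d"
  proof eventually_elim
   fix s :: real assume s: "nm2 (f n s - f n t) < d/2" "s \<in> {0..1}"
   note S = cts_in[OF f s(2), of n] cts_in[OF f t, of n] g[OF s(2)] g[OF t]
   have "nm2 (g s - g t) <= nm2 (g s - f n s) + (nm2 (f n s - f n t) + nm2 (f n t - g t))"
    using I2.nm_diff_triangle[of "g s" "f n s" "g t"] I2.nm_diff_triangle[of "f n s" "f n t" "g t"] S by linarith
   also have "nm2 (g s - f n s) = nm2 (f n s - g s)" using S by (intro I2.nm_diff_commute)
   finally have "nm2 (g s - g t) < d" using n[OF s(2)] n[OF t] s(1) by linarith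
   then show "dist (nm2 (g s - g t)) 0 < d" using S by simp
  qed
 qed
qed

lemma E: "hcstar1 ES Est Enm Eu"
proof -
 have Z: "0 \<in> ES" using cts_scaled[of "\<lambda>_. 0" 0] by (simp add: ES_def p_0)
 have U: "Eu \<in> ES"
 proof -
  have "cts (\<lambda>t. of_real 1 *c u2)" by (rule cts_scaled) auto
  then have "cts (\<lambda>t. Eu (Some t))" by (rule cts_cong) auto
  then show ?thesis by (auto simp: ES_def p)
 qed
 have M: "X - Y \<in> ES" if "X \<in> ES" "Y \<in> ES" for X Y
  using ES_ops(1)[OF that(1) ES_ops(3)[OF that(2) that(2), of "-1"]] by simp
 have nn: "0 <= Enm X" if "X \<in> ES" for X
  using nm_le_Enm(2)[OF that] I1.nm_nonneg[OF ESD(1)[OF that]] by linarith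
 have scl_le: "Enm (c *c X) <= cmod c * Enm X" if X: "X \<in> ES" for c X
  using nm_le_Enm[OF X] ESD(1,3)[OF X] by (auto simp: Enm_le[OF ES_ops(3)[OF X X]] I1.nm_scl I2.nm_scl mult_left_mono)
 show ?thesis
 proof
  show "0 \<in> ES" "Eu \<in> ES" by (rule Z U)+
  fix X assume X: "X \<in> ES"
  note D = ESD[OF X] and O = ES_ops(3,4)[OF X X]
  show "Eu * X = X" by (rule ES_eqI[OF ES_ops(2)[OF U X] X]) (use D in auto)
  show "X * Eu = X" by (rule ES_eqI[OF ES_ops(2)[OF X U] X]) (use D in auto)
  show "c *c X \<in> ES" for c using ES_ops(3)[OF X X] .
  show "Est X \<in> ES" using O by simp
  show "Est (Est X) = X" by (rule ES_eqI[OF ES_ops(4)[OF O(2) O(2)] X]) (use D in auto)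
  show "Est (c *c X) = cnj c *c Est X" for c
   by (rule ES_eqI[OF ES_ops(4)[OF O(1) O(1)] ES_ops(3)[OF O(2) O(2)]]) (use D in \<open>auto simp: I1.st_scl I2.st_scl\<close>)
  show "0 <= Enm X" by (rule nn[OF X])
  show "Enm X = 0 \<longleftrightarrow> X = 0"
  proof
   assume "Enm X = 0"
   then have "nm1 (X None) = 0" "!!t. t \<in> {0..1} ==> nm2 (X (Some t)) = 0"
    using nm_le_Enm[OF X] I1.nm_nonneg[OF D(1)] I2.nm_nonneg[OF D(3)] by (metis order_antisym)+
   then show "X = 0"
    using D(1,3) I1.nm_eq_0 I2.nm_eq_0 by (intro ES_eqI[OF X Z]) auto
  qed (use nn[OF Z] Enm_le[OF Z, of 0] in auto)
  show "Enm (c *c X) = cmod c * Enm X" for c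
  proof (cases "c = 0")
   case False
   have "Enm X <= cmod (1/c) * Enm (c *c X)"
    using scl_le[OF O(1)[of c], of "1/c"] False by simp
   then show ?thesis using scl_le[OF X, of c] False by (simp add: norm_divide field_simps)
  qed (use nn[OF Z] Enm_le[OF Z, of 0] in auto)
  have sX: "Est X * X \<in> ES" by (rule ES_ops(2)[OF O(2) X])
  show "Enm (Est X * X) = (Enm X)\<^sup>2"
  proof (rule antisym)
   show "Enm (Est X * X) <= (Enm X)\<^sup>2"
    using nm_le_Enm[OF X] D by (auto simp: Enm_le[OF sX] I1.nm_cstar I2.nm_cstar power_mono)
   have "nm2 (X (Some t)) <= sqrt (Enm (Est X * X))" if "t \<in> {0..1}" for t
    using nm_le_Enm(1)[OF sX that] D(3)[OF that] that by (intro real_le_rsqrt) (simp add: I2.nm_cstar)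
   moreover have "nm1 (X None) <= sqrt (Enm (Est X * X))"
    using nm_le_Enm(2)[OF sX] D(1) by (intro real_le_rsqrt) (simp add: I1.nm_cstar)
   ultimately have "Enm X <= sqrt (Enm (Est X * X))" by (simp add: Enm_le[OF X])
   then have "(Enm X)\<^sup>2 <= (sqrt (Enm (Est X * X)))\<^sup>2" using nn[OF X] by (intro power_mono) auto
   then show "(Enm X)\<^sup>2 <= Enm (Est X * X)" using nn[OF sX] by simp
  qed
  fix Y assume Y: "Y \<in> ES"
  note DY = ESD[OF Y] and OY = ES_ops(4)[OF Y Y] and OXY = ES_ops(1,2)[OF X Y]
  show "X + Y \<in> ES" "X * Y \<in> ES" by (rule OXY)+
  show "Est (X + Y) = Est X + Est Y"
   by (rule ES_eqI[OF ES_ops(4)[OF OXY(1) X] ES_ops(1)[OF O(2) OY]]) (use D DY in \<open>auto simp: I1.st_add I2.st_add\<close>)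
  show "Est (X * Y) = Est Y * Est X"
   by (rule ES_eqI[OF ES_ops(4)[OF OXY(2) X] ES_ops(2)[OF OY O(2)]]) (use D DY in \<open>auto simp: I1.st_mult I2.st_mult\<close>)
  show "Enm (X + Y) <= Enm X + Enm Y"
   using nm_le_Enm[OF X] nm_le_Enm[OF Y] D DY by (auto simp: Enm_le[OF OXY(1)] intro!: I1.nm_add_le I2.nm_add_le)
  show "Enm (X * Y) <= Enm X * Enm Y"
   using nm_le_Enm[OF X] nm_le_Enm[OF Y] D DY by (auto simp: Enm_le[OF OXY(2)] intro!: I1.nm_mult_le I2.nm_mult_le)
 next
  fix X :: "nat => real option => 'f host"
  assume X: "!!n. X n \<in> ES" and c: "!!d. 0 < d ==> \<exists>N. \<forall>m\<ge>N. \<forall>n\<ge>N. Enm (X m - X n) < d"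
  have c2: "\<exists>N. \<forall>m\<ge>N. \<forall>n\<ge>N. nm1 (X m None - X n None) < d & (\<forall>t\<in>{0..1}. nm2 (X m (Some t) - X n (Some t)) < d)" if d: "0 < d" for d
  proof -
   obtain N where "\<forall>m\<ge>N. \<forall>n\<ge>N. Enm (X m - X n) < d" using c[OF d] by blast
   then have N: "Enm (X m - X n) < d" if "m \<ge> N" "n \<ge> N" for m n using that by blast
   have "nm1 (X m None - X n None) < d" "t \<in> {0..1} ==> nm2 (X m (Some t) - X n (Some t)) < d" if "m \<ge> N" "n \<ge> N" for m n t
    using nm_le_Enm(1)[OF M[OF X X], of t m n] nm_le_Enm(2)[OF M[OF X X], of m n] N[OF that] by auto
   then show ?thesis by blast
  qed
  have "\<exists>x\<in>S1. (\<lambda>n. nm1 (X n None - x)) \<longlonglongrightarrow> 0"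
   by (rule I1.S_complete) (use ESD(1)[OF X] c2 in blast)+
  then obtain a where a: "a \<in> S1" "(\<lambda>n. nm1 (X n None - a)) \<longlonglongrightarrow> 0" by blast
  have "\<exists>x\<in>S2. (\<lambda>n. nm2 (X n (Some t) - x)) \<longlonglongrightarrow> 0" if "t \<in> {0..1}" for t
   by (rule I2.S_complete) (use ESD(3)[OF X that] c2 that in blast)+
  then obtain g where g: "!!t. t \<in> {0..1} ==> g t \<in> S2" "!!t. t \<in> {0..1} ==> (\<lambda>n. nm2 (X n (Some t) - g t)) \<longlonglongrightarrow> 0" by metis
  have ca: "I1.conv (\<lambda>n. X n None) a" unfolding I1.conv_def using a ESD(1)[OF X] by blast
  have cg: "I2.conv (\<lambda>n. X n (Some t)) (g t)" if "t \<in> {0..1}" for t unfolding I2.conv_def using g[OF that] ESD(3)[OF X that] by blast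
  have unif: "\<exists>N. \<forall>n\<ge>N. nm1 (X n None - a) <= d & (\<forall>t\<in>{0..1}. nm2 (X n (Some t) - g t) <= d)" if d: "0 < d" for d
  proof -
   obtain N where N: "!!m n. m \<ge> N ==> n \<ge> N ==> nm1 (X m None - X n None) < d"
    "!!m n t. m \<ge> N ==> n \<ge> N ==> t \<in> {0..1} ==> nm2 (X m (Some t) - X n (Some t)) < d" using c2[OF d] by blast
   have shift: "I1.conv (\<lambda>k. X (k + N) None) a" "t \<in> {0..1} ==> I2.conv (\<lambda>k. X (k + N) (Some t)) (g t)" for t
    using ca cg[of t] LIMSEQ_ignore_initial_segment[of "\<lambda>n. nm1 (X n None - a)" 0 N]
     LIMSEQ_ignore_initial_segment[of "\<lambda>n. nm2 (X n (Some t) - g t)" 0 N] by (auto simp: I1.conv_def I2.conv_def)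
   have "nm1 (X n None - a) <= d" if n: "n \<ge> N" for n
   proof -
    have "nm1 (X (k + N) None - X n None) <= d" for k using N(1)[of "k + N" n] n by simp
    then show ?thesis using I1.conv_nm_le[OF shift(1) _ ESD(1)[OF X]] I1.nm_diff_commute[OF a(1) ESD(1)[OF X]] by simp
   qed
   moreover have "nm2 (X n (Some t) - g t) <= d" if n: "n \<ge> N" and t: "t \<in> {0..1}" for n t
   proof -
    have "nm2 (X (k + N) (Some t) - X n (Some t)) <= d" for k using N(2)[of "k + N" n t] n t by simp
    then show ?thesis using I2.conv_nm_le[OF shift(2)[OF t] _ ESD(3)[OF X t]] I2.nm_diff_commute[OF g(1)[OF t] ESD(3)[OF X t]] by simp
   qed
   ultimately show ?thesis by blast
  qed
  have ctsg: "cts g"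
   by (rule cts_limit[of "\<lambda>n t. X n (Some t)", OF ESD(2)[OF X] g(1)]) (use unif in blast)+
  have bdry: "g t = p a" if t: "t \<in> {0..1}" and p: "star_map S1 st1 S2 st2 p" and eq: "!!n. X n (Some t) = p (X n None)" for t p
  proof (rule I2.conv_unique[OF cg[OF t]])
   show "I2.conv (\<lambda>n. X n (Some t)) (p a)"
   proof (rule I2.conv_bound[OF _ _ _ a(2)])
    fix n
    have "nm2 (p (X n None - a)) <= nm1 (X n None - a)" using ESD(1)[OF X] a by (intro star_map_contractive[OF H1 H2 p]) auto
    then show "nm2 (X n (Some t) - p a) <= nm1 (X n None - a)"
     using star_map_diff(1)[OF p I1.hcstar_axioms ESD(1)[OF X] a(1)] by (simp add: eq)
   qed (use star_mapD(1)[OF p a(1)] ESD(3)[OF X t] in auto)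
  qed
  define Y where "Y i = (case i of None => a | Some t => if t \<in> {0..1} then g t else 0)" for i
  have Yt: "Y None = a" "!!t. t \<in> {0..1} ==> Y (Some t) = g t" by (auto simp: Y_def)
  have "cts (\<lambda>t. Y (Some t))" by (rule cts_cong[OF ctsg Yt(2)])
  then have YE: "Y \<in> ES"
   using bdry[OF _ p(1) ESD(5)[OF X]] bdry[OF _ p(2) ESD(6)[OF X]] a(1) by (auto simp: ES_def Y_def)
  have "(\<lambda>n. Enm (X n - Y)) \<longlonglongrightarrow> 0"
  proof (rule LIMSEQ_I)
   fix r :: real assume "0 < r"
   then obtain N where N: "\<forall>n\<ge>N. nm1 (X n None - a) <= r/2 & (\<forall>t\<in>{0..1}. nm2 (X n (Some t) - g t) <= r/2)"
    using unif[of "r/2"] by auto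
   have "Enm (X n - Y) <= r/2" if "n \<ge> N" for n
    using N that Yt by (subst Enm_le[OF M[OF X YE]]) (metis minus_apply)
   then show "\<exists>N. \<forall>n\<ge>N. norm (Enm (X n - Y) - 0) < r"
    using nn[OF M[OF X YE]] \<open>0 < r\<close> by (intro exI[of _ N]) fastforce
  qed
  then show "\<exists>x\<in>ES. (\<lambda>n. Enm (X n - x)) \<longlonglongrightarrow> 0" using YE by blast
 qed
qed

sublocale E: hcstar1 ES Est Enm Eu by (rule E)

abbreviation "R \<equiv> et_alg F1 F2 \<phi>0 \<phi>1"
definition \<iota> :: "(real option => 'f host) => (real => 'f) \<times> 'f" where
 "\<iota> X = (\<lambda>t\<in>{0..1}. unemb F2 (X (Some t)), unemb F1 (X None))"
definition \<iota>' :: "(real => 'f) \<times> 'f => (real option => 'f host)" where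
 "\<iota>' y i = (case i of None => emb F1 (snd y) | Some t => if t \<in> {0..1} then emb F2 (fst y t) else 0)"

lemma R_simps:
 "carrier R = {(f, a). f \<in> {0..1} \<rightarrow>\<^sub>E carrier F2 & a \<in> carrier F1 &
    (\<forall>t\<in>{0..1}. ((\<lambda>s. nrm F2 (f s \<ominus>\<^bsub>F2\<^esub> f t)) \<longlongrightarrow> 0) (at t within {0..1})) & f 0 = \<phi>0 a & f 1 = \<phi>1 a}"
 "x \<otimes>\<^bsub>R\<^esub> y = (\<lambda>t\<in>{0..1}. fst x t \<otimes>\<^bsub>F2\<^esub> fst y t, snd x \<otimes>\<^bsub>F1\<^esub> snd y)"
 "x \<oplus>\<^bsub>R\<^esub> y = (\<lambda>t\<in>{0..1}. fst x t \<oplus>\<^bsub>F2\<^esub> fst y t, snd x \<oplus>\<^bsub>F1\<^esub> snd y)"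
 "c \<odot>\<^bsub>R\<^esub> x = (\<lambda>t\<in>{0..1}. c \<odot>\<^bsub>F2\<^esub> fst x t, c \<odot>\<^bsub>F1\<^esub> snd x)"
 "adj R x = (\<lambda>t\<in>{0..1}. adj F2 (fst x t), adj F1 (snd x))"
 "nrm R x = max (Sup ((\<lambda>t. nrm F2 (fst x t)) ` {0..1})) (nrm F1 (snd x))"
 "\<zero>\<^bsub>R\<^esub> = (\<lambda>t\<in>{0..1}. \<zero>\<^bsub>F2\<^esub>, \<zero>\<^bsub>F1\<^esub>)" "\<one>\<^bsub>R\<^esub> = (\<lambda>t\<in>{0..1}. \<one>\<^bsub>F2\<^esub>, \<one>\<^bsub>F1\<^esub>)"
 by (auto simp: et_alg_def split: prod.split)

lemma \<iota>_carrier: "X \<in> ES ==> \<iota> X \<in> carrier R"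
proof -
 assume X: "X \<in> ES"
 note D = ESD[OF X]
 have eq: "nrm F2 (unemb F2 (X (Some s)) \<ominus>\<^bsub>F2\<^esub> unemb F2 (X (Some t))) = nm2 (X (Some s) - X (Some t))"
  if "s \<in> {0..1}" "t \<in> {0..1}" for s t
  using D(3)[OF that(1)] D(3)[OF that(2)] by (simp add: cstar emb_nm[symmetric] emb_minus minus_carrier)
 have "((\<lambda>s. nrm F2 (fst (\<iota> X) s \<ominus>\<^bsub>F2\<^esub> fst (\<iota> X) t)) \<longlongrightarrow> 0) (at t within {0..1})" if t: "t \<in> {0..1}" for t
 proof (rule Lim_transform_eventually[OF cts_lim[OF D(2) t]])
  have "\<forall>\<^sub>F s in at t within {0..1}. s \<in> {0..1}" by (simp add: eventually_at_filter)
  then show "\<forall>\<^sub>F s in at t within {0..1}. nm2 (X (Some s) - X (Some t)) = nrm F2 (fst (\<iota> X) s \<ominus>\<^bsub>F2\<^esub> fst (\<iota> X) t)"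
   by eventually_elim (use t in \<open>simp add: \<iota>_def eq\<close>)
 qed
 moreover have "unemb F2 (X (Some 0)) = \<phi>0 (unemb F1 (X None))" "unemb F2 (X (Some 1)) = \<phi>1 (unemb F1 (X None))"
  using D(1,5,6) star_homD(1)[of \<phi>0 F1 F2] star_homD(1)[of \<phi>1 F1 F2] ends by (simp_all add: hmap_def cstar unital_star_hom_def)
 ultimately show ?thesis using D(1,3) by (auto simp: R_simps(1) \<iota>_def cstar)
qed

lemma \<iota>'_in: assumes y: "y \<in> carrier R" shows "\<iota>' y \<in> ES" "\<iota> (\<iota>' y) = y"
proof -
 obtain f a where fa: "y = (f, a)" "f \<in> {0..1} \<rightarrow>\<^sub>E carrier F2" "a \<in> carrier F1"
  "!!t. t \<in> {0..1} ==> ((\<lambda>s. nrm F2 (f s \<ominus>\<^bsub>F2\<^esub> f t)) \<longlongrightarrow> 0) (at t within {0..1})" "f 0 = \<phi>0 a" "f 1 = \<phi>1 a"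
  using y by (auto simp: R_simps(1))
 have fc: "f t \<in> carrier F2" if "t \<in> {0..1}" for t using fa(2) that by auto
 have "cts (\<lambda>t. \<iota>' y (Some t))"
 proof (rule ctsI[where g = "\<lambda>s t. nrm F2 (f s \<ominus>\<^bsub>F2\<^esub> f t)"])
  show "nm2 (\<iota>' y (Some s) - \<iota>' y (Some t)) <= nrm F2 (f s \<ominus>\<^bsub>F2\<^esub> f t)" if "s \<in> {0..1}" "t \<in> {0..1}" for s t
   using fc[OF that(1)] fc[OF that(2)] that by (simp add: \<iota>'_def fa(1) emb_minus[symmetric] cstar emb_nm minus_carrier)
 qed (use fc fa(4) in \<open>auto simp: \<iota>'_def fa(1) cstar\<close>)
 then show "\<iota>' y \<in> ES" using fa(3,5,6) by (auto simp: ES_def \<iota>'_def fa(1) cstar hmap_emb)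
 show "\<iota> (\<iota>' y) = y" using fc fa(2,3) by (auto simp: \<iota>_def \<iota>'_def fa(1) cstar fun_eq_iff PiE_def extensional_def)
qed

lemma \<iota>_inj: "inj_on \<iota> ES"
proof (rule inj_onI)
 fix X Y assume X: "X \<in> ES" and Y: "Y \<in> ES" and eq: "\<iota> X = \<iota> Y"
 have "unemb F1 (X None) = unemb F1 (Y None)" using eq by (simp add: \<iota>_def)
 then have 1: "X None = Y None" using ESD(1)[OF X] ESD(1)[OF Y] cstar(1) emb_unemb by metis
 have "X (Some t) = Y (Some t)" if "t \<in> {0..1}" for t
 proof -
  have "fst (\<iota> X) t = fst (\<iota> Y) t" using eq by simp
  then have "unemb F2 (X (Some t)) = unemb F2 (Y (Some t))" using that by (simp add: \<iota>_def)
  then show ?thesis using ESD(3)[OF X that] ESD(3)[OF Y that] cstar(2) emb_unemb by metis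
 qed
 then show "X = Y" by (rule ES_eqI[OF X Y 1])
qed

lemma \<iota>_ops:
 assumes X: "X \<in> ES" and Y: "Y \<in> ES"
 shows "\<iota> X \<oplus>\<^bsub>R\<^esub> \<iota> Y = \<iota> (X + Y)" "\<iota> X \<otimes>\<^bsub>R\<^esub> \<iota> Y = \<iota> (X * Y)" "c \<odot>\<^bsub>R\<^esub> \<iota> X = \<iota> (c *c X)"
  "adj R (\<iota> X) = \<iota> (Est X)" "nrm R (\<iota> X) = Enm X"
proof -
 note D = ESD[OF X] ESD[OF Y]
 have u: "unemb G (x + y) = unemb G x \<oplus>\<^bsub>G\<^esub> unemb G y" "unemb G (x * y) = unemb G x \<otimes>\<^bsub>G\<^esub> unemb G y"
   "unemb G (c *c x) = c \<odot>\<^bsub>G\<^esub> unemb G x" "unemb G (hst G x) = adj G (unemb G x)"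
  if "cstar_algebra G" "x \<in> hS G" "y \<in> hS G" for G :: "'f cstar" and x y
  using that unemb_ops[OF that] by (simp_all add: hst_def carrier_simps add_carrier)
 show "\<iota> X \<oplus>\<^bsub>R\<^esub> \<iota> Y = \<iota> (X + Y)" using D by (auto simp: R_simps \<iota>_def u cstar intro!: restrict_ext)
 show "\<iota> X \<otimes>\<^bsub>R\<^esub> \<iota> Y = \<iota> (X * Y)" using D by (auto simp: R_simps \<iota>_def u cstar intro!: restrict_ext)
 show "c \<odot>\<^bsub>R\<^esub> \<iota> X = \<iota> (c *c X)" using D u(3)[OF cstar(1) D(1) D(1)] u(3)[OF cstar(2) D(3) D(3)]
  by (auto simp: R_simps \<iota>_def intro!: restrict_ext)
 show "adj R (\<iota> X) = \<iota> (Est X)" using u(4)[OF cstar(1) D(1) D(1)] u(4)[OF cstar(2) D(3) D(3)]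
  by (auto simp: R_simps \<iota>_def intro!: restrict_ext)
 show "nrm R (\<iota> X) = Enm X" by (simp add: R_simps \<iota>_def Enm_def hnm_def cong: image_cong_simp)
qed

lemma \<iota>_units: "\<zero>\<^bsub>R\<^esub> = \<iota> 0" "\<one>\<^bsub>R\<^esub> = \<iota> Eu"
proof -
 have z: "unemb G 0 = \<zero>\<^bsub>G\<^esub>" if "cstar_algebra G" for G :: "'f cstar"
  using unemb_emb[OF that zero_carrier[OF that]] by (simp add: emb_zero[OF that])
 show "\<zero>\<^bsub>R\<^esub> = \<iota> 0" by (auto simp: R_simps \<iota>_def z cstar intro!: restrict_ext)
 show "\<one>\<^bsub>R\<^esub> = \<iota> Eu" using fd_unit(2)[OF fd(1)] fd_unit(2)[OF fd(2)]
  by (auto simp: R_simps \<iota>_def cstar intro!: restrict_ext)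
qed

lemma R_cstar: "cstar_algebra R"
proof (rule cstar_algebra_of_hosted[OF E, where \<iota> = \<iota>])
 show "carrier R = \<iota> ` ES"
 proof
  show "carrier R \<subseteq> \<iota> ` ES" using \<iota>'_in by (metis image_eqI subsetI)
 qed (use \<iota>_carrier in blast)
qed (use \<iota>_inj \<iota>_ops \<iota>_units in auto)

lemma R_monoid: "monoid R"
proof
 show "\<one>\<^bsub>R\<^esub> \<in> carrier R" using \<iota>_carrier[OF E.e_S] by (simp add: \<iota>_units)
 fix x assume x: "x \<in> carrier R"
 show "\<one>\<^bsub>R\<^esub> \<otimes>\<^bsub>R\<^esub> x = x" "x \<otimes>\<^bsub>R\<^esub> \<one>\<^bsub>R\<^esub> = x"
  using \<iota>_ops(2)[OF E.e_S \<iota>'_in(1)[OF x]] \<iota>_ops(2)[OF \<iota>'_in(1)[OF x] E.e_S] \<iota>'_in[OF x] by (simp_all add: \<iota>_units)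
qed (use cstar_algebra.mult_closed[OF R_cstar] cstar_algebra.mult_assoc[OF R_cstar] in auto)

text \<open>Norm continuity is continuity for a metric that is not the one of a type class, so the compactness argument is
carried out by bisection.\<close>

lemma cts_uniform:
 assumes f: "cts f" and d: "0 < d"
 shows "\<exists>\<eta>>0. \<forall>s\<in>{0..1}. \<forall>t\<in>{0..1}. \<bar>s - t\<bar> < \<eta> --> nm2 (f s - f t) <= d"
proof -
 define P where "P a b \<longleftrightarrow> (\<exists>\<eta>>0. \<forall>s\<in>{a..b}. \<forall>t\<in>{0..1}. s \<in> {0..1} --> \<bar>s - t\<bar> < \<eta> --> nm2 (f s - f t) <= d)" for a b :: real
 have "P 0 1" using zero_le_one
 proof (induction rule: Bolzano)
  case (trans a b c)
  then obtain \<eta> \<eta>' where "0 < \<eta>" "0 < \<eta>'"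
   "\<forall>s\<in>{a..b}. \<forall>t\<in>{0..1}. s \<in> {0..1} --> \<bar>s - t\<bar> < \<eta> --> nm2 (f s - f t) <= d"
   "\<forall>s\<in>{b..c}. \<forall>t\<in>{0..1}. s \<in> {0..1} --> \<bar>s - t\<bar> < \<eta>' --> nm2 (f s - f t) <= d" unfolding P_def by metis
  note \<eta> = this
  have "nm2 (f s - f t) <= d" if "s \<in> {a..c}" "t \<in> {0..1}" "s \<in> {0..1}" "\<bar>s - t\<bar> < min \<eta> \<eta>'" for s t
  proof (cases "s <= b")
   case True
   then show ?thesis using \<eta>(3)[rule_format, of s t] that by simp
  next
   case False
   then show ?thesis using \<eta>(4)[rule_format, of s t] that by simp
  qed
  then show ?case unfolding P_def using \<eta>(1,2) by (intro exI[of _ "min \<eta> \<eta>'"]) auto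
 next
  case (local x)
  then have x: "x \<in> {0..1}" by simp
  have "\<forall>\<^sub>F s in at x within {0..1}. nm2 (f s - f x) < d/2"
   using order_tendstoD(2)[OF cts_lim[OF f x], of "d/2"] d by simp
  then obtain \<delta> where \<delta>: "0 < \<delta>" "!!s. s \<in> {0..1} ==> s ~= x ==> \<bar>s - x\<bar> < \<delta> ==> nm2 (f s - f x) < d/2"
   unfolding eventually_at dist_real_def by metis
  have near: "nm2 (f s - f x) <= d/2" if "s \<in> {0..1}" "\<bar>s - x\<bar> < \<delta>" for s
   using \<delta>(2)[OF that(1) _ that(2)] d cts_in[OF f x] by (cases "s = x") auto
  have "nm2 (f s - f t) <= d" if "s \<in> {0..1}" "t \<in> {0..1}" "\<bar>s - x\<bar> < \<delta>/2" "\<bar>s - t\<bar> < \<delta>/2" for s t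
  proof -
   note S = cts_in[OF f that(1)] cts_in[OF f that(2)] cts_in[OF f x]
   have "\<bar>s - x\<bar> < \<delta>" "\<bar>t - x\<bar> < \<delta>" using that(3,4) by linarith+
   then show ?thesis
    using near[OF that(1)] near[OF that(2)] I2.nm_diff_triangle[OF S(1,3,2)] I2.nm_diff_commute[OF S(3,2)] by linarith
  qed
  note near2 = this
  have "P a b" if ab: "a <= x" "x <= b" "b - a < \<delta>/2" for a b
  proof -
   have "\<bar>s - x\<bar> < \<delta>/2" if "s \<in> {a..b}" for s
   proof -
    have "\<bar>s - x\<bar> <= b - a" using that ab by (simp add: abs_le_iff)
    then show ?thesis using ab(3) by linarith
   qed
   then show ?thesis unfolding P_def using near2 \<delta>(1) half_gt_zero by blast
  qed
  then show ?case using \<delta>(1) half_gt_zero by blast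
 qed
 then show ?thesis unfolding P_def by auto
qed

end

section \<open>Traces that compute the rank in a block\<close>

lemma transport_simps:
 assumes "!!x. g (f x) = x"
 shows "carrier (transport f g F) = f ` carrier F" "f x \<oplus>\<^bsub>transport f g F\<^esub> f y = f (x \<oplus>\<^bsub>F\<^esub> y)"
  "f x \<otimes>\<^bsub>transport f g F\<^esub> f y = f (x \<otimes>\<^bsub>F\<^esub> y)" "c \<odot>\<^bsub>transport f g F\<^esub> f x = f (c \<odot>\<^bsub>F\<^esub> x)"
  "adj (transport f g F) (f x) = f (adj F x)" "nrm (transport f g F) (f x) = nrm F x"
  "\<zero>\<^bsub>transport f g F\<^esub> = f \<zero>\<^bsub>F\<^esub>" "\<one>\<^bsub>transport f g F\<^esub> = f \<one>\<^bsub>F\<^esub>"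
 using assms by (simp_all add: transport_def)

lemma transport_cstar:
 assumes F: "cstar_algebra F" "monoid F" and gf: "!!x. g (f x) = x"
 shows "cstar_algebra (transport f g F)" "monoid (transport f g F)" "f \<in> star_hom F (transport f g F)"
  "g \<in> star_hom (transport f g F) F" "g \<one>\<^bsub>transport f g F\<^esub> = \<one>\<^bsub>F\<^esub>"
proof -
 interpret M: monoid F by (rule F)
 note t = transport_simps[where f = f and g = g, OF gf]
 have H: "hcstar1 (hS F) (hst F) (hnm F) (hone F)" by (rule hcstar1_hosted[OF F(1)]) auto
 have un: "unemb F (x + y) = unemb F x \<oplus>\<^bsub>F\<^esub> unemb F y" "unemb F (x * y) = unemb F x \<otimes>\<^bsub>F\<^esub> unemb F y"
   "unemb F (c *c x) = c \<odot>\<^bsub>F\<^esub> unemb F x" "unemb F (hst F x) = adj F (unemb F x)"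
  if "x \<in> hS F" "y \<in> hS F" for x y c
  using that unemb_ops[OF F(1) that] by (simp_all add: hst_def carrier_simps[OF F(1)] add_carrier F(1))
 have inj: "inj f" by (metis gf injI)
 show "cstar_algebra (transport f g F)"
 proof (rule cstar_algebra_of_hosted[OF H, where \<iota> = "\<lambda>x. f (unemb F x)"])
  show "carrier (transport f g F) = (\<lambda>x. f (unemb F x)) ` hS F"
   by (force simp: t hS_def F(1) image_image)
  show "inj_on (\<lambda>x. f (unemb F x)) (hS F)" by (auto simp: inj_on_def inj_eq[OF inj] hS_def F(1))
  show "\<zero>\<^bsub>transport f g F\<^esub> = f (unemb F 0)" using unemb_emb[OF F(1) zero_carrier[OF F(1)]] by (simp add: t emb_zero[OF F(1)])
 qed (use un in \<open>auto simp: t F(1) hnm_def\<close>)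
 show "monoid (transport f g F)"
  by (rule monoidI) (auto simp: t M.m_assoc)
 show "f \<in> star_hom F (transport f g F)" by (rule star_homI) (auto simp: t)
 show "g \<in> star_hom (transport f g F) F" by (rule star_homI) (auto simp: t gf carrier_simps[OF F(1)] add_carrier[OF F(1)])
 show "g \<one>\<^bsub>transport f g F\<^esub> = \<one>\<^bsub>F\<^esub>" by (simp add: t gf)
qed

lemma trace_for_transport:
 assumes "trace_for F rk T" and gf: "!!x. g (f x) = x"
 shows "trace_for (transport f g F) (\<lambda>x. rk (g x)) (\<lambda>x. T (g x))"
proof -
 note t = transport_simps[where f = f and g = g, OF gf]
 note D = trace_forD[OF assms(1)]
 have proj: "\<exists>q. p = f q & projection F q" if "projection (transport f g F) p" for p
  using that by (auto simp: projection_def t) (metis gf)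
 show ?thesis unfolding trace_for_def
 proof (intro conjI allI ballI impI)
  fix p x assume p: "projection (transport f g F) p" and x: "x \<in> carrier (transport f g F)" and eq: "p \<otimes>\<^bsub>transport f g F\<^esub> x \<otimes>\<^bsub>transport f g F\<^esub> p = x"
  obtain q where q: "p = f q" "projection F q" using proj[OF p] by blast
  obtain y where y: "x = f y" "y \<in> carrier F" using x by (auto simp: t)
  have "q \<otimes>\<^bsub>F\<^esub> y \<otimes>\<^bsub>F\<^esub> q = y" using arg_cong[OF eq, of g] by (simp add: q y t gf)
  then show "cmod (T (g x)) <= nrm (transport f g F) x * Re (T (g p))" using D(3) q y by (simp add: t gf)
 next
  fix p assume "projection (transport f g F) p"
  then obtain q where "p = f q" "projection F q" using proj by blast
  then show "T (g p) = of_nat (rk (g p))" using D(2) by (simp add: gf)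
 next
  fix x y assume "x \<in> carrier (transport f g F)" "y \<in> carrier (transport f g F)"
  then obtain a b where "x = f a" "a \<in> carrier F" "y = f b" "b \<in> carrier F" by (auto simp: t)
  then show "T (g (x \<oplus>\<^bsub>transport f g F\<^esub> y)) = T (g x) + T (g y)" using D(1) by (simp add: t gf)
 qed
qed

context et_data
begin

text \<open>If the block is not finite dimensional, evaluate at 0 and use the trace of the fibre. For a projection the rank at \<open>t\<close> is an
integer depending continuously on \<open>t\<close>, hence constant.\<close>

lemma trace_exists: "\<exists>T. trace_for R (\<lambda>x. block_rank (ET F1 F2 \<phi>0 \<phi>1) (Inr x)) T"
proof (cases "vectorspace.fin_dim class_ring R")
 case True
 then have "fd_cstar_algebra R" using R_cstar by (simp add: fd_cstar_algebra_def)
 then show ?thesis using fd_trace_exists[of R] True by simp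
next
 case False
 obtain T where T: "trace_for F2 (fd_rank F2) T" using fd_trace_exists[OF fd(2)] by blast
 note D = trace_forD[OF T]
 interpret M2: monoid F2 by (rule fd_unit(1)[OF fd(2)])
 have fc: "fst x t \<in> carrier F2" if "x \<in> carrier R" "t \<in> {0..1}" for x t using that by (auto simp: R_simps(1))
 have proj: "projection F2 (fst p t)" if "projection R p" "t \<in> {0..1}" for p t
 proof -
  have "fst (p \<otimes>\<^bsub>R\<^esub> p) t = fst p t" "fst (adj R p) t = fst p t" "p \<in> carrier R" using that by (simp_all add: projection_def)
  then show ?thesis using fc that by (simp add: projection_def R_simps(2,5))
 qed
 have st1: "adj F2 \<one>\<^bsub>F2\<^esub> = \<one>\<^bsub>F2\<^esub>"
  using I2.st_e emb_st[OF cstar(2) M2.one_closed] emb_inj[OF cstar(2)] carrier_simps(2)[OF cstar(2)] by simp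
 then have one: "projection F2 \<one>\<^bsub>F2\<^esub>" by (simp add: projection_def)
 have Tdiff: "T x - T y = T (x \<ominus>\<^bsub>F2\<^esub> y)" if "x \<in> carrier F2" "y \<in> carrier F2" for x y
 proof -
  have "emb F2 ((x \<ominus>\<^bsub>F2\<^esub> y) \<oplus>\<^bsub>F2\<^esub> y) = emb F2 x" using that by (simp add: cstar emb_add emb_minus minus_carrier)
  then have "(x \<ominus>\<^bsub>F2\<^esub> y) \<oplus>\<^bsub>F2\<^esub> y = x" using that by (simp add: cstar emb_inj minus_carrier add_carrier)
  then show ?thesis using D(1)[of "x \<ominus>\<^bsub>F2\<^esub> y" y] that by (simp add: cstar minus_carrier)
 qed
 have const: "fd_rank F2 (fst p s) = fd_rank F2 (fst p t)" if p: "projection R p" and st: "s \<in> {0..1}" "t \<in> {0..1}" for p s t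
 proof -
  define f where "f t = fst p t" for t
  have pR: "p \<in> carrier R" using p by (simp add: projection_def)
  have fp: "projection F2 (f t)" "f t \<in> carrier F2" if "t \<in> {0..1}" for t using proj[OF p that] fc[OF pR that] by (simp_all add: f_def)
  have lim: "((\<lambda>s. nrm F2 (f s \<ominus>\<^bsub>F2\<^esub> f t)) \<longlongrightarrow> 0) (at t within {0..1})" if "t \<in> {0..1}" for t
   using pR that by (auto simp: R_simps(1) f_def)
  define K where "K = Re (T \<one>\<^bsub>F2\<^esub>)"
  have K: "0 <= K" using D(2)[OF one] by (simp add: K_def)
  have near: "fd_rank F2 (f s) = fd_rank F2 (f t)" if "s \<in> {0..1}" "t \<in> {0..1}" "nrm F2 (f s \<ominus>\<^bsub>F2\<^esub> f t) < 1 / (K + 1)" for s t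
  proof -
   have "cmod (of_nat (fd_rank F2 (f s)) - of_nat (fd_rank F2 (f t))) <= nrm F2 (f s \<ominus>\<^bsub>F2\<^esub> f t) * K"
    using D(3)[OF one, of "f s \<ominus>\<^bsub>F2\<^esub> f t"] Tdiff[OF fp(2)[OF that(1)] fp(2)[OF that(2)]] D(2)[OF fp(1)[OF that(1)]] D(2)[OF fp(1)[OF that(2)]] fp that(1,2)
    by (simp add: cstar minus_carrier K_def)
   also have "\<dots> <= 1 / (K + 1) * K" using that(3) K by (intro mult_right_mono) auto
   also have "\<dots> < 1" using K by (simp add: field_simps)
   finally have "cmod (of_int (int (fd_rank F2 (f s)) - int (fd_rank F2 (f t)))) < 1" by simp
   then show ?thesis unfolding norm_of_int by linarith
  qed
  define P where "P a b \<longleftrightarrow> (\<forall>s\<in>{a..b}. \<forall>t\<in>{a..b}. s \<in> {0..1} --> t \<in> {0..1} --> fd_rank F2 (f s) = fd_rank F2 (f t))" for a b :: real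
  have "P 0 1" using zero_le_one
  proof (induction rule: Bolzano)
   case (trans a b c)
   show ?case unfolding P_def
   proof (intro ballI impI)
    fix s t :: real assume st: "s \<in> {a..c}" "t \<in> {a..c}" "s \<in> {0..1}" "t \<in> {0..1}"
    note L = trans(1)[unfolded P_def, rule_format] and R' = trans(2)[unfolded P_def, rule_format]
    consider "s <= b" "t <= b" | "b <= s" "b <= t" | "s <= b" "b <= t" | "b <= s" "t <= b" by linarith
    then show "fd_rank F2 (f s) = fd_rank F2 (f t)"
    proof cases
     case 1
     then show ?thesis using st by (intro L) auto
    next
     case 2
     then show ?thesis using st by (intro R') auto
    next
     case 3
     then have "fd_rank F2 (f s) = fd_rank F2 (f b)" "fd_rank F2 (f b) = fd_rank F2 (f t)" using st trans(3,4) by (auto intro: L R')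
     then show ?thesis by simp
    next
     case 4
     then have "fd_rank F2 (f s) = fd_rank F2 (f b)" "fd_rank F2 (f b) = fd_rank F2 (f t)" using st trans(3,4) by (auto intro: L R')
     then show ?thesis by simp
    qed
   qed
  next
   case (local x)
   then have x: "x \<in> {0..1}" by simp
   have "\<forall>\<^sub>F s in at x within {0..1}. nrm F2 (f s \<ominus>\<^bsub>F2\<^esub> f x) < 1 / (K + 1)"
    using order_tendstoD(2)[OF lim[OF x], of "1 / (K + 1)"] K by simp
   then obtain \<delta> where \<delta>: "0 < \<delta>" "!!s. s \<in> {0..1} ==> s ~= x ==> \<bar>s - x\<bar> < \<delta> ==> nrm F2 (f s \<ominus>\<^bsub>F2\<^esub> f x) < 1 / (K + 1)"
    unfolding eventually_at dist_real_def by metis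
   have eqx: "fd_rank F2 (f s) = fd_rank F2 (f x)" if "s \<in> {0..1}" "\<bar>s - x\<bar> < \<delta>" for s
    using near[OF that(1) x] \<delta>(2)[OF that(1) _ that(2)] by (cases "s = x") auto
   have "P a b" if ab: "a <= x" "x <= b" "b - a < \<delta>" for a b
   proof -
    have "\<bar>s - x\<bar> < \<delta>" if "s \<in> {a..b}" for s
    proof -
     have "\<bar>s - x\<bar> <= b - a" using that ab by (simp add: abs_le_iff)
     then show ?thesis using ab(3) by linarith
    qed
    then show ?thesis unfolding P_def using eqx by auto
   qed
   then show ?case using \<delta>(1) by blast
  qed
  then show ?thesis using st unfolding P_def f_def by blast
 qed
 have zero: "(0::real) \<in> {0..1}" by simp
 have rank: "block_rank (ET F1 F2 \<phi>0 \<phi>1) (Inr p) = fd_rank F2 (fst p 0)" if "projection R p" for p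
 proof -
  have "(THE r. \<forall>t\<in>{0..1}. fd_rank F2 (fst p t) = r) = fd_rank F2 (fst p 0)"
  proof (rule the_equality)
   show "\<forall>t\<in>{0..1}. fd_rank F2 (fst p t) = fd_rank F2 (fst p 0)" using const[OF that _ zero] by blast
  qed simp
  then show ?thesis using False by simp
 qed
 have "trace_for R (\<lambda>x. block_rank (ET F1 F2 \<phi>0 \<phi>1) (Inr x)) (\<lambda>x. T (fst x 0))"
  unfolding trace_for_def
 proof (intro conjI allI ballI impI)
  fix x y assume "x \<in> carrier R" "y \<in> carrier R"
  then show "T (fst (x \<oplus>\<^bsub>R\<^esub> y) 0) = T (fst x 0) + T (fst y 0)" using D(1) fc zero by (simp add: R_simps(3))
 next
  fix p assume "projection R p"
  then show "T (fst p 0) = of_nat (block_rank (ET F1 F2 \<phi>0 \<phi>1) (Inr p))" using rank D(2) proj[OF _ zero] by simp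
 next
  fix p x assume p: "projection R p" and x: "x \<in> carrier R" and eq: "p \<otimes>\<^bsub>R\<^esub> x \<otimes>\<^bsub>R\<^esub> p = x"
  have "fst p 0 \<otimes>\<^bsub>F2\<^esub> fst x 0 \<otimes>\<^bsub>F2\<^esub> fst p 0 = fst x 0" using arg_cong[OF eq, of "\<lambda>z. fst z 0"] by (simp add: R_simps(2))
  then have "cmod (T (fst x 0)) <= nrm F2 (fst x 0) * Re (T (fst p 0))" using D(3) proj[OF p zero] fc[OF x zero] by blast
  also have "\<dots> <= nrm R x * Re (T (fst p 0))"
  proof (rule mult_right_mono)
   have "nm2 (\<iota>' x (Some 0)) <= Enm (\<iota>' x)" using nm_le_Enm(1)[OF \<iota>'_in(1)[OF x] zero] .
   moreover have "Enm (\<iota>' x) = nrm R x" using \<iota>_ops(5)[OF \<iota>'_in(1)[OF x] \<iota>'_in(1)[OF x]] \<iota>'_in(2)[OF x] by simp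
   ultimately show "nrm F2 (fst x 0) <= nrm R x" using fc[OF x zero] by (simp add: \<iota>'_def cstar emb_nm)
   show "0 <= Re (T (fst p 0))" using D(2)[OF proj[OF p zero]] by simp
  qed
  finally show "cmod (T (fst x 0)) <= nrm R x * Re (T (fst p 0))" .
 qed
 then show ?thesis by blast
qed

end

lemma block_facts:
 assumes C: "is_et_block C"
 shows "cstar_algebra (block_alg C)" "monoid (block_alg C)" "\<exists>T. trace_for (block_alg C) (block_rank C) T"
proof -
 have "cstar_algebra (block_alg C) & monoid (block_alg C) & (\<exists>T. trace_for (block_alg C) (block_rank C) T)"
 proof (cases C)
  case (FinDim F)
  then have F: "fd_cstar_algebra F" "cstar_algebra F" using C by (auto simp: fd_cstar_algebra_def)
  obtain T where T: "trace_for F (fd_rank F) T" using fd_trace_exists[OF F(1)] by blast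
  have "block_rank C = (\<lambda>x. fd_rank F (projl x))" by (simp add: FinDim fun_eq_iff)
  then have "trace_for (block_alg C) (block_rank C) (\<lambda>x. T (projl x))"
   using trace_for_transport[OF T, of projl Inl] by (simp add: FinDim)
  then show ?thesis using transport_cstar[OF F(2) fd_unit(1)[OF F(1)], of projl Inl] FinDim by auto
 next
  case (ET F1 F2 \<phi>0 \<phi>1)
  then interpret et_data F1 F2 \<phi>0 \<phi>1 using C by unfold_locales simp
  obtain T where "trace_for R (\<lambda>x. block_rank (ET F1 F2 \<phi>0 \<phi>1) (Inr x)) T" using trace_exists by blast
  from trace_for_transport[OF this, of projr Inr]
  have "trace_for (block_alg C) (block_rank C) (\<lambda>x. T (projr x))" by (simp add: ET cong: if_cong) (simp add: trace_for_def ET)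
  then show ?thesis using transport_cstar[OF R_cstar R_monoid, of projr Inr] ET by auto
 qed
 then show "cstar_algebra (block_alg C)" "monoid (block_alg C)" "\<exists>T. trace_for (block_alg C) (block_rank C) T" by auto
qed

section \<open>Direct sums of blocks\<close>

lemma direct_sum_simps:
 "xs \<in> carrier (direct_sum As) \<longleftrightarrow> length xs = length As & (\<forall>k<length As. xs ! k \<in> carrier (As ! k))"
 "k < length As ==> (xs \<oplus>\<^bsub>direct_sum As\<^esub> ys) ! k = xs ! k \<oplus>\<^bsub>As ! k\<^esub> ys ! k"
 "k < length As ==> (xs \<otimes>\<^bsub>direct_sum As\<^esub> ys) ! k = xs ! k \<otimes>\<^bsub>As ! k\<^esub> ys ! k"
 "k < length As ==> (c \<odot>\<^bsub>direct_sum As\<^esub> xs) ! k = c \<odot>\<^bsub>As ! k\<^esub> xs ! k"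
 "k < length As ==> adj (direct_sum As) xs ! k = adj (As ! k) (xs ! k)"
 by (auto simp: direct_sum_def list_all2_conv_all_nth)

lemma zero_ops:
 assumes A: "cstar_algebra A"
 shows "\<zero>\<^bsub>A\<^esub> \<oplus>\<^bsub>A\<^esub> \<zero>\<^bsub>A\<^esub> = \<zero>\<^bsub>A\<^esub>" "\<zero>\<^bsub>A\<^esub> \<otimes>\<^bsub>A\<^esub> \<zero>\<^bsub>A\<^esub> = \<zero>\<^bsub>A\<^esub>" "c \<odot>\<^bsub>A\<^esub> \<zero>\<^bsub>A\<^esub> = \<zero>\<^bsub>A\<^esub>" "adj A \<zero>\<^bsub>A\<^esub> = \<zero>\<^bsub>A\<^esub>"
proof -
 interpret hcstar "hS A" "hst A" "hnm A" by (rule hcstar_hosted[OF A])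
 have z: "emb A x = 0 ==> x \<in> carrier A ==> x = \<zero>\<^bsub>A\<^esub>" for x using emb_eq_0[OF A] by blast
 note c = carrier_simps[OF A] zero_carrier[OF A] add_carrier[OF A]
 show "\<zero>\<^bsub>A\<^esub> \<oplus>\<^bsub>A\<^esub> \<zero>\<^bsub>A\<^esub> = \<zero>\<^bsub>A\<^esub>" by (rule z) (simp_all add: emb_add[OF A] emb_zero[OF A] c)
 show "\<zero>\<^bsub>A\<^esub> \<otimes>\<^bsub>A\<^esub> \<zero>\<^bsub>A\<^esub> = \<zero>\<^bsub>A\<^esub>" by (rule z) (simp_all add: emb_mult[OF A] emb_zero[OF A] c)
 show "c \<odot>\<^bsub>A\<^esub> \<zero>\<^bsub>A\<^esub> = \<zero>\<^bsub>A\<^esub>" by (rule cstar_smult(7)[OF A])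
 show "adj A \<zero>\<^bsub>A\<^esub> = \<zero>\<^bsub>A\<^esub>" by (rule z) (simp_all add: emb_st[OF A, symmetric] emb_zero[OF A] c)
qed

locale decomposed =
 fixes A :: "'a cstar" and Cs :: "'f et_block list" and \<theta> :: "'a => ('f + (real => 'f) \<times> 'f) list"
 assumes A: "cstar_algebra A" and dec: "et_decomposition A Cs \<theta>"
begin

abbreviation "l \<equiv> length Cs"
abbreviation "blk k \<equiv> block_alg (Cs ! k)"

lemma block: "k < l ==> is_et_block (Cs ! k)"
 using dec nth_mem unfolding et_decomposition_def minimal_block_def nonzero_et_block_def by blast
lemma blk: "k < l ==> cstar_algebra (blk k)" "k < l ==> monoid (blk k)"
 using block block_facts by blast+

lemma \<theta>_hom: "\<theta> \<in> star_hom A (direct_sum (map block_alg Cs))" and \<theta>_bij: "bij_betw \<theta> (carrier A) (carrier (direct_sum (map block_alg Cs)))"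
 using dec by (auto simp: et_decomposition_def star_iso_def)

lemma cmp_hom: "k < l ==> (\<lambda>x. \<theta> x ! k) \<in> star_hom A (blk k)"
 using star_homD[OF \<theta>_hom] by (intro star_homI) (auto simp: direct_sum_simps)

lemma cmp_eqI: assumes "x \<in> carrier A" "y \<in> carrier A" "!!k. k < l ==> \<theta> x ! k = \<theta> y ! k" shows "x = y"
proof -
 have "\<theta> x \<in> carrier (direct_sum (map block_alg Cs))" "\<theta> y \<in> carrier (direct_sum (map block_alg Cs))"
  using star_homD(1)[OF \<theta>_hom] assms by auto
 then have "\<theta> x = \<theta> y" using assms(3) by (intro nth_equalityI) (auto simp: direct_sum_simps)
 then show ?thesis using \<theta>_bij assms by (auto simp: bij_betw_def dest: inj_onD)
qed

text \<open>The element of the direct sum with prescribed components.\<close>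

definition asm :: "(nat => 'f + (real => 'f) \<times> 'f) => 'a" where
 "asm f = inv_into (carrier A) \<theta> (map f [0..<l])"

text \<open>The element of the direct sum with prescribed components.\<close>

lemma asm: assumes "!!k. k < l ==> f k \<in> carrier (blk k)"
 shows "asm f \<in> carrier A" "k < l ==> \<theta> (asm f) ! k = f k"
proof -
 have "map f [0..<l] \<in> carrier (direct_sum (map block_alg Cs))" using assms by (auto simp: direct_sum_simps)
 then have "map f [0..<l] \<in> \<theta> ` carrier A" using \<theta>_bij by (simp add: bij_betw_def)
 then have "asm f \<in> carrier A" "\<theta> (asm f) = map f [0..<l]" by (simp_all add: asm_def inv_into_into f_inv_into_f)
 then show "asm f \<in> carrier A" "k < l ==> \<theta> (asm f) ! k = f k" by simp_all
qed

lemma monoid_A: "monoid A" and cmp_one: "k < l ==> \<theta> \<one>\<^bsub>A\<^esub> ! k = \<one>\<^bsub>blk k\<^esub>"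
proof -
 \<comment> \<open>The record field of \<open>A\<close> is identified as the unit only after a unit has been exhibited.\<close>
 define u where "u = asm (\<lambda>k. \<one>\<^bsub>blk k\<^esub>)"
 have one: "\<one>\<^bsub>blk k\<^esub> \<in> carrier (blk k)" "!!x. x \<in> carrier (blk k) ==> \<one>\<^bsub>blk k\<^esub> \<otimes>\<^bsub>blk k\<^esub> x = x & x \<otimes>\<^bsub>blk k\<^esub> \<one>\<^bsub>blk k\<^esub> = x" if "k < l" for k
  using blk(2)[OF that] by (simp_all add: monoid.one_closed monoid.l_one monoid.r_one)
 have u: "u \<in> carrier A" "!!k. k < l ==> \<theta> u ! k = \<one>\<^bsub>blk k\<^esub>" using asm one(1) by (auto simp: u_def)
 have un: "u \<otimes>\<^bsub>A\<^esub> x = x & x \<otimes>\<^bsub>A\<^esub> u = x" if x: "x \<in> carrier A" for x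
 proof
  note H = star_homD[OF cmp_hom]
  show "u \<otimes>\<^bsub>A\<^esub> x = x" using H(4)[OF _ u(1) x] H(1)[OF _ x] one(2) u by (intro cmp_eqI) (auto simp: x carrier_simps[OF A])
  show "x \<otimes>\<^bsub>A\<^esub> u = x" using H(4)[OF _ x u(1)] H(1)[OF _ x] one(2) u by (intro cmp_eqI) (auto simp: x carrier_simps[OF A])
 qed
 have eq: "\<one>\<^bsub>A\<^esub> = u" using cstar_algebra.one_unique[OF A u(1) un] by blast
 show "monoid A" by (rule monoidI) (use u un eq carrier_simps(1)[OF A] cstar_algebra.mult_assoc[OF A] in auto)
 show "k < l ==> \<theta> \<one>\<^bsub>A\<^esub> ! k = \<one>\<^bsub>blk k\<^esub>" using u eq by simp
qed

definition inj :: "nat => 'f + (real => 'f) \<times> 'f => 'a" where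
 "inj k y = asm (\<lambda>j. if j = k then y else \<zero>\<^bsub>blk j\<^esub>)"

lemma inj: assumes "k < l" "y \<in> carrier (blk k)"
 shows "inj k y \<in> carrier A" "j < l ==> \<theta> (inj k y) ! j = (if j = k then y else \<zero>\<^bsub>blk j\<^esub>)"
 using asm[of "\<lambda>j. if j = k then y else \<zero>\<^bsub>blk j\<^esub>"] assms zero_carrier[OF blk(1)] by (auto simp: inj_def)

lemma inj_hom: assumes k: "k < l" shows "inj k \<in> star_hom (blk k) A"
proof (rule star_homI)
 note H = star_homD[OF cmp_hom] and B = carrier_simps[OF blk(1)[OF k]] add_carrier[OF blk(1)[OF k]]
  and C = carrier_simps[OF A] add_carrier[OF A] and Z = zero_ops[OF blk(1)]
 fix x assume x: "x \<in> carrier (blk k)"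
 note ix = inj[OF k x]
 show "inj k x \<in> carrier A" by (rule ix)
 show "inj k (c \<odot>\<^bsub>blk k\<^esub> x) = c \<odot>\<^bsub>A\<^esub> inj k x" for c
  using inj[OF k, of "c \<odot>\<^bsub>blk k\<^esub> x"] ix x H(3)[OF _ ix(1)] Z by (intro cmp_eqI) (auto simp: B C)
 show "inj k (adj (blk k) x) = adj A (inj k x)"
  using inj[OF k, of "adj (blk k) x"] ix x H(5)[OF _ ix(1)] Z by (intro cmp_eqI) (auto simp: B C)
 fix y assume y: "y \<in> carrier (blk k)"
 note iy = inj[OF k y]
 show "inj k (x \<oplus>\<^bsub>blk k\<^esub> y) = inj k x \<oplus>\<^bsub>A\<^esub> inj k y"
  using inj[OF k, of "x \<oplus>\<^bsub>blk k\<^esub> y"] ix iy x y H(2)[OF _ ix(1) iy(1)] Z by (intro cmp_eqI) (auto simp: B C)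
 show "inj k (x \<otimes>\<^bsub>blk k\<^esub> y) = inj k x \<otimes>\<^bsub>A\<^esub> inj k y"
  using inj[OF k, of "x \<otimes>\<^bsub>blk k\<^esub> y"] ix iy x y H(4)[OF _ ix(1) iy(1)] Z by (intro cmp_eqI) (auto simp: B C)
qed

abbreviation "u \<equiv> hone A"
abbreviation "ub k \<equiv> hone (blk k)"
definition cH :: "nat => 'a host => ('f + (real => 'f) \<times> 'f) host" where "cH k = hmap A (blk k) (\<lambda>x. \<theta> x ! k)"
definition jH :: "nat => ('f + (real => 'f) \<times> 'f) host => 'a host" where "jH k = hmap (blk k) A (inj k)"
text \<open>The central projection that cuts out one block.\<close>

definition z :: "nat => 'a host" where "z k = jH k (ub k)"

lemma H: "hcstar1 (hS A) (hst A) (hnm A) u"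
 using monoid_A by (intro hcstar1_hosted[OF A]) (simp_all add: monoid.one_closed monoid.l_one monoid.r_one)
sublocale hcstar1 "hS A" "hst A" "hnm A" u by (rule H)
lemma Hb: "k < l ==> hcstar1 (hS (blk k)) (hst (blk k)) (hnm (blk k)) (ub k)"
 using blk by (intro hcstar1_hosted) (simp_all add: monoid.one_closed monoid.l_one monoid.r_one)
lemma Hb0: "k < l ==> hcstar (hS (blk k)) (hst (blk k)) (hnm (blk k))"
 using blk hcstar_hosted by blast

lemma cH: "k < l ==> star_map (hS A) (hst A) (hS (blk k)) (hst (blk k)) (cH k)"
 unfolding cH_def by (intro star_map_hmap A blk cmp_hom)
lemma jH: "k < l ==> star_map (hS (blk k)) (hst (blk k)) (hS A) (hst A) (jH k)"
 unfolding jH_def by (intro star_map_hmap A blk inj_hom)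

lemma cH_eqI: assumes "x \<in> hS A" "y \<in> hS A" "!!k. k < l ==> cH k x = cH k y" shows "x = y"
proof -
 have "unemb A x = unemb A y"
 proof (rule cmp_eqI)
  fix k assume k: "k < l"
  then show "\<theta> (unemb A x) ! k = \<theta> (unemb A y) ! k"
   using assms(3)[OF k] star_homD(1)[OF cmp_hom[OF k]] assms(1,2) by (simp add: cH_def hmap_def A emb_inj[OF blk(1)[OF k]])
 qed (use assms A in auto)
 then show ?thesis using assms emb_unemb[OF A] by metis
qed

lemma cH_jH: assumes "k < l" "y \<in> hS (blk k)" "j < l" shows "cH j (jH k y) = (if j = k then y else 0)"
proof -
 have "unemb (blk k) y \<in> carrier (blk k)" using assms blk by simp
 then show ?thesis using inj[OF assms(1)] assms blk(1) by (auto simp: cH_def jH_def hmap_emb A emb_zero) (simp_all add: hmap_def A emb_zero)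
qed

lemma cH_u: "k < l ==> cH k u = ub k"
 using monoid_A cmp_one by (simp add: cH_def hmap_emb A monoid.one_closed)

lemma cH_z: assumes "k < l" "j < l" shows "cH j (z k) = (if j = k then ub j else 0)"
 using cH_jH[OF assms(1) hcstar1.e_S[OF Hb[OF assms(1)]] assms(2)] by (auto simp: z_def)

lemma z_S: "k < l ==> z k \<in> hS A"
 unfolding z_def by (rule star_mapD(1)[OF jH hcstar1.e_S[OF Hb]])

lemma z_props:
 assumes k: "k < l"
 shows "z k * z k = z k" "hst A (z k) = z k" "j < l ==> j ~= k ==> z k * z j = 0"
  "x \<in> hS A ==> z k * x = x * z k" "x \<in> hS A ==> jH k (cH k x) = z k * x"
  "y \<in> hS (blk k) ==> z k * jH k y = jH k y"
proof -
 note D = star_mapD[OF cH] and zS = z_S[OF k]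
 have b: "x * ub j = x" "ub j * x = x" if "j < l" "x \<in> hS (blk j)" for j x
  using hcstar1.e_right[OF Hb] hcstar1.e_left[OF Hb] that by blast+
 have c0: "cH j 0 = 0" "hst (blk j) 0 = 0" "hst (blk j) (ub j) = ub j" if "j < l" for j
  using star_map_diff(2)[OF cH[OF that] hcstar_axioms S_0 S_0] hcstar.st_0[OF Hb0[OF that]] hcstar1.st_e[OF Hb[OF that]] by auto
 have ubS: "ub j \<in> hS (blk j)" if "j < l" for j using hcstar1.e_S[OF Hb[OF that]] .
 show "z k * z k = z k" using zS D(5)[OF _ zS zS] b ubS by (intro cH_eqI) (auto simp: cH_z[OF k])
 show "hst A (z k) = z k" using zS D(2)[OF _ zS] c0 by (intro cH_eqI) (auto simp: cH_z[OF k])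
 show "z k * z j = 0" if "j < l" "j ~= k"
  using zS z_S[OF that(1)] D(5)[OF _ zS z_S[OF that(1)]] c0 that by (intro cH_eqI) (auto simp: cH_z[OF k] cH_z[OF that(1)])
 show "z k * x = x * z k" if x: "x \<in> hS A"
  using zS x D(5)[OF _ zS x] D(5)[OF _ x zS] D(1)[OF _ x] b by (intro cH_eqI) (auto simp: cH_z[OF k])
 show "jH k (cH k x) = z k * x" if x: "x \<in> hS A"
  using zS x D(5)[OF _ zS x] D(1)[OF _ x] b star_mapD(1)[OF jH[OF k] D(1)[OF k x]] cH_jH[OF k D(1)[OF k x]]
  by (intro cH_eqI) (auto simp: cH_z[OF k])
 show "z k * jH k y = jH k y" if y: "y \<in> hS (blk k)"
  using zS star_mapD(1)[OF jH[OF k] y] D(5)[OF _ zS star_mapD(1)[OF jH[OF k] y]] b y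
  by (intro cH_eqI) (auto simp: cH_z[OF k] cH_jH[OF k y])
qed

lemma z_sum: "(\<Sum>k<l. z k) = u"
proof (rule cH_eqI)
 show "(\<Sum>k<l. z k) \<in> hS A" using z_S by (intro S_sum) auto
 fix j assume j: "j < l"
 have "cH j (\<Sum>k<l. z k) = (\<Sum>k<l. cH j (z k))" using z_S by (intro star_map_sum[OF cH[OF j] hcstar_axioms]) auto
 also have "\<dots> = (\<Sum>k<l. if k = j then ub j else 0)" using j by (intro sum.cong) (auto simp: cH_z)
 finally show "cH j (\<Sum>k<l. z k) = cH j u" using j by (simp add: cH_u)
qed simp

lemma z_expand: assumes "x \<in> hS A" shows "x = (\<Sum>k<l. z k * x)"
proof -
 have "x = (\<Sum>k<l. z k) * x" using assms by (simp add: z_sum)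
 then show ?thesis by (simp only: sum_distrib_right)
qed

definition tr :: "nat => 'a host => complex" where
 "tr k x = (SOME T. trace_for (blk k) (block_rank (Cs ! k)) T) (unemb (blk k) (cH k x))"

lemma tr:
 assumes k: "k < l"
 shows tr_add: "x \<in> hS A ==> y \<in> hS A ==> tr k (x + y) = tr k x + tr k y"
  and tr_z: "x \<in> hS A ==> j < l ==> tr k (z j * x) = (if j = k then tr k x else 0)"
  and tr_proj: "p \<in> hS A ==> p * p = p ==> hst A p = p ==> tr k p = of_nat (block_rank (Cs ! k) (\<theta> (unemb A p) ! k))"
  and tr_bound: "p \<in> hS A ==> p * p = p ==> hst A p = p ==> x \<in> hS A ==> p * x * p = x ==>
   cmod (tr k x) <= hnm A x * Re (tr k p)"
proof -
 define T where "T = (SOME T. trace_for (blk k) (block_rank (Cs ! k)) T)"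
 have "trace_for (blk k) (block_rank (Cs ! k)) T" unfolding T_def using block_facts(3)[OF block[OF k]] by (rule someI_ex)
 note T = trace_forD[OF this] and D = star_mapD[OF cH[OF k]] and K = blk(1)[OF k]
 have tr: "tr k x = T (unemb (blk k) (cH k x))" for x by (simp add: tr_def T_def)
 have add: "tr k (x + y) = tr k x + tr k y" if "x \<in> hS A" "y \<in> hS A" for x y
 proof -
  have "unemb (blk k) (cH k x + cH k y) = unemb (blk k) (cH k x) \<oplus>\<^bsub>blk k\<^esub> unemb (blk k) (cH k y)"
   using D(1)[OF that(1)] D(1)[OF that(2)] by (subst unemb_ops(1)[OF K]) (simp_all add: K add_carrier)
  then show ?thesis using T(1) D(1)[OF that(1)] D(1)[OF that(2)] D(4)[OF that] by (simp add: tr K)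
 qed
 then show "x \<in> hS A ==> y \<in> hS A ==> tr k (x + y) = tr k x + tr k y" by blast
 have tr0: "tr k 0 = 0" using add[of 0 0] by simp
 show "x \<in> hS A ==> j < l ==> tr k (z j * x) = (if j = k then tr k x else 0)"
 proof -
  assume x: "x \<in> hS A" and j: "j < l"
  have "cH k (z j * x) = (if j = k then cH k x else cH k 0)"
   using D(5)[OF z_S[OF j] x] cH_z[OF j k] D(1)[OF x] hcstar1.e_left[OF Hb[OF k]] star_map_diff(2)[OF cH[OF k] hcstar_axioms S_0 S_0] by auto
  then show ?thesis using tr0 by (auto simp: tr)
 qed
 have proj: "projection (blk k) (unemb (blk k) (cH k p))" if "p \<in> hS A" "p * p = p" "hst A p = p" for p
 proof -
  note P = D(1)[OF that(1)] D(5)[OF that(1) that(1)] D(2)[OF that(1)]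
  have "emb (blk k) (unemb (blk k) (cH k p) \<otimes>\<^bsub>blk k\<^esub> unemb (blk k) (cH k p)) = cH k p"
   "emb (blk k) (adj (blk k) (unemb (blk k) (cH k p))) = cH k p"
   using P that by (simp_all add: K emb_mult emb_st[symmetric])
  from this[THEN arg_cong, of "unemb (blk k)"] show ?thesis using P(1) by (simp add: projection_def K carrier_simps[OF K])
 qed
 show "p \<in> hS A ==> p * p = p ==> hst A p = p ==> tr k p = of_nat (block_rank (Cs ! k) (\<theta> (unemb A p) ! k))"
  using T(2)[OF proj] star_homD(1)[OF cmp_hom[OF k]] by (simp add: tr) (simp add: cH_def hmap_def K A)
 assume p: "p \<in> hS A" "p * p = p" "hst A p = p" and x: "x \<in> hS A" "p * x * p = x"
 have "cH k p * cH k x * cH k p = cH k x" using D(5)[OF p(1) x(1)] D(5)[OF S_mult[OF p(1) x(1)] p(1)] x by simp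
 moreover have "unemb (blk k) (cH k p * cH k x * cH k p) = unemb (blk k) (cH k p) \<otimes>\<^bsub>blk k\<^esub> unemb (blk k) (cH k x) \<otimes>\<^bsub>blk k\<^esub> unemb (blk k) (cH k p)"
 proof -
  have "emb (blk k) (unemb (blk k) (cH k p) \<otimes>\<^bsub>blk k\<^esub> unemb (blk k) (cH k x) \<otimes>\<^bsub>blk k\<^esub> unemb (blk k) (cH k p)) = cH k p * cH k x * cH k p"
   using D(1)[OF p(1)] D(1)[OF x(1)] by (simp add: K emb_mult carrier_simps[OF K])
  from arg_cong[OF this, of "unemb (blk k)"] show ?thesis using D(1)[OF p(1)] D(1)[OF x(1)] by (simp add: K carrier_simps[OF K])
 qed
 ultimately have "cmod (tr k x) <= nrm (blk k) (unemb (blk k) (cH k x)) * Re (tr k p)"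
  using T(3)[OF proj[OF p], of "unemb (blk k) (cH k x)"] D(1)[OF x(1)] by (simp add: tr K)
 also have "\<dots> <= hnm A x * Re (tr k p)"
 proof (rule mult_right_mono)
  have "hnm (blk k) (cH k x) <= hnm A x" by (rule star_map_contractive[OF H Hb[OF k] cH[OF k] x(1)])
  then show "nrm (blk k) (unemb (blk k) (cH k x)) <= hnm A x" by (simp add: hnm_def)
  show "0 <= Re (tr k p)" using T(2)[OF proj[OF p]] by (simp add: tr)
 qed
 finally show "cmod (tr k x) <= hnm A x * Re (tr k p)" .
qed

end

section \<open>Bumps along the interval\<close>

text \<open>Finitely many mutually orthogonal pieces. Piece \<open>ka\<close> has a finite dimensional fibre, an evaluation \<open>\<pi> ka\<close> onto the fibre,
and four maps from the fibre back into the algebra: \<open>lev ka j x\<close> is \<open>x\<close> spread over an arc with the bump of level \<open>j\<close>. Higher levels have larger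
bumps, and a product of bumps of different levels is the smaller one.\<close>

locale pieces = hcstar1 S st nm e for S :: "'h::complex_alg set" and st nm e +
 fixes K :: "'k set" and Fib :: "'k => 'f cstar" and lev :: "'k => nat => 'f host => 'h" and \<pi> :: "'k => 'h => 'f host"
  and \<epsilon> :: real and G :: "'h set"
 assumes K: "finite K" and Fib: "ka \<in> K ==> fd_cstar_algebra (Fib ka)"
  and lev_S: "ka \<in> K ==> x \<in> hS (Fib ka) ==> j < 4 ==> lev ka j x \<in> S"
  and lev_add: "ka \<in> K ==> x \<in> hS (Fib ka) ==> y \<in> hS (Fib ka) ==> j < 4 ==> lev ka j (x + y) = lev ka j x + lev ka j y"
  and lev_scl: "ka \<in> K ==> x \<in> hS (Fib ka) ==> j < 4 ==> lev ka j (c *c x) = c *c lev ka j x"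
  and lev_st: "ka \<in> K ==> x \<in> hS (Fib ka) ==> j < 4 ==> st (lev ka j x) = lev ka j (hst (Fib ka) x)"
  and lev_mult: "ka \<in> K ==> x \<in> hS (Fib ka) ==> y \<in> hS (Fib ka) ==> j < 4 ==> j' < 4 ==> j ~= j' ==>
   lev ka j x * lev ka j' y = lev ka (min j j') (x * y)"
  and lev_orth: "ka \<in> K ==> ka' \<in> K ==> ka ~= ka' ==> x \<in> hS (Fib ka) ==> y \<in> hS (Fib ka') ==> j < 4 ==> j' < 4 ==>
   lev ka j x * lev ka' j' y = 0"
  and lev_nm: "ka \<in> K ==> x \<in> hS (Fib ka) ==> j < 4 ==> nm (lev ka j x) <= hnm (Fib ka) x"
  and \<pi>: "ka \<in> K ==> star_map S st (hS (Fib ka)) (hst (Fib ka)) (\<pi> ka)" "ka \<in> K ==> \<pi> ka e = hone (Fib ka)"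
  and approx: "g \<in> G ==> nm (\<Sum>ka\<in>K. g * lev ka 3 (hone (Fib ka)) - lev ka 3 (\<pi> ka g)) <= \<epsilon>"

text \<open>The part of the unit that the smallest bumps cover; its complement is supported near the cut points.\<close>

definition core :: "'k set => ('k => 'f cstar) => ('k => nat => 'f host => 'h::comm_monoid_add) => 'h" where
 "core K Fib lev = (\<Sum>ka\<in>K. lev ka 0 (hone (Fib ka)))"

text \<open>Cut point \<open>k\<close> of family \<open>i\<close>: the interval is divided into \<open>Q\<close> equal parts, and family \<open>i\<close> cuts each part at the relative
position \<open>(i + 1) / (N + 1)\<close>, so that no cut point is an end point.\<close>

definition cut :: "nat => nat => nat => nat => real" where
 "cut Q N i k = (real k * (real N + 1) + (real i + 1)) / (real Q * (real N + 1))"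

text \<open>Cut points of different families have distance at least \<open>10 / slope\<close>, while the smallest bump is one at distance
\<open>5 / slope\<close> from the cut points.\<close>

definition slope :: "nat => nat => real" where "slope Q N = 10 * (real Q * (real N + 1))"

lemma slope_pos: "0 < Q ==> 0 < slope Q N" by (simp add: slope_def)

lemma slope_cut: "0 < Q ==> slope Q N * cut Q N i k = 10 * (real k * (real N + 1) + (real i + 1))"
 by (simp add: slope_def cut_def)

lemma cut_le: "0 < Q ==> k <= k' ==> cut Q N i k <= cut Q N i k'"
 unfolding cut_def by (intro divide_right_mono add_mono mult_right_mono) auto

lemma cut_bounds: assumes "0 < Q" "i < N" shows "real k / real Q < cut Q N i k" "cut Q N i k < real (Suc k) / real Q"
proof -
 have D: "0 < real Q * (real N + 1)" using assms by simp
 have eq: "real k' / real Q = real k' * (real N + 1) / (real Q * (real N + 1))" for k' by simp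
 have 1: "real k * (real N + 1) < real k * (real N + 1) + (real i + 1)" by simp
 have 2: "real k * (real N + 1) + (real i + 1) < real (Suc k) * (real N + 1)" using assms(2) by (simp add: algebra_simps)
 show "real k / real Q < cut Q N i k" "cut Q N i k < real (Suc k) / real Q"
  unfolding eq cut_def using divide_strict_right_mono[OF 1 D] divide_strict_right_mono[OF 2 D] by auto
qed

lemma cut_separated:
 assumes Q: "0 < Q" and i: "i < N" and j: "j < N" and ij: "i ~= j"
 shows "10 <= \<bar>slope Q N * cut Q N i k - slope Q N * cut Q N j k'\<bar>"
proof -
 have "int (k * (N + 1) + (i + 1)) ~= int (k' * (N + 1) + (j + 1))"
 proof
  assume "int (k * (N + 1) + (i + 1)) = int (k' * (N + 1) + (j + 1))"
  then have "k * (N + 1) + (i + 1) = k' * (N + 1) + (j + 1)" by (simp only: of_nat_eq_iff)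
  then have "(k * (N + 1) + (i + 1)) mod (N + 1) = (k' * (N + 1) + (j + 1)) mod (N + 1)" by simp
  then show False using i j ij by (simp only: mod_mult_self3) simp
 qed
 then have "1 <= \<bar>int (k * (N + 1) + (i + 1)) - int (k' * (N + 1) + (j + 1))\<bar>" by linarith
 then have "1 <= \<bar>real_of_int (int (k * (N + 1) + (i + 1)) - int (k' * (N + 1) + (j + 1)))\<bar>" by linarith
 moreover have "slope Q N * cut Q N i k - slope Q N * cut Q N j k' = 10 * real_of_int (int (k * (N + 1) + (i + 1)) - int (k' * (N + 1) + (j + 1)))"
  by (simp add: slope_cut[OF Q] algebra_simps)
 ultimately show ?thesis by simp
qed

definition clamp :: "real => real" where "clamp s = max 0 (min 1 s)"

lemma clamp: "0 <= clamp s" "clamp s <= 1" "clamp s ~= 0 ==> 0 < s" "1 <= s ==> clamp s = 1" "s <= 0 ==> clamp s = 0"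
 by (auto simp: clamp_def split: if_splits)

text \<open>The distance \<open>s\<close> is measured in units of the inverse slope. The levels \<open>j < 4\<close> switch on one after the other as \<open>s\<close> grows from 1 to 5, the highest first.\<close>

definition bump :: "nat => real => real" where "bump j s = clamp (s - 4 + real j)"

text \<open>The distance \<open>s\<close> is measured in units of the inverse slope. The levels \<open>j < 4\<close> switch on one after the other as \<open>s\<close> grows from 1 to 5, the highest first.\<close>

lemma bump: "0 <= bump j s" "bump j s <= 1" "j < 4 ==> bump j s ~= 0 ==> 1 < s" "5 <= s ==> bump j s = 1" "j < 4 ==> s <= 1 ==> bump j s = 0"
 by (auto simp: bump_def clamp_def split: if_splits)

lemma bump_mult: "j ~= j' ==> bump j s * bump j' s = bump (min j j') s"
proof (induction j j' rule: linorder_wlog)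
 case (le j j')
 then have "j < j'" by simp
 then have "real j + 1 <= real j'" by linarith
 then show ?case using le by (auto simp: bump_def clamp_def min_def max_def)
qed (simp add: mult.commute min.commute)

lemma bump_cts: "continuous_on X f ==> continuous_on X (\<lambda>t. bump j (f t))"
 unfolding bump_def clamp_def by (intro continuous_intros)

locale et_pieces = et_data F1 F2 \<phi>0 \<phi>1 for F1 F2 :: "'f cstar" and \<phi>0 \<phi>1 +
 fixes Q N i :: nat
 assumes Q: "0 < Q" and i: "i < N"
begin

abbreviation "M \<equiv> slope Q N"
abbreviation "t\<^sub>c \<equiv> cut Q N i"

definition win :: "nat => nat => real => real" where "win q j t = bump j (min (M * (t - t\<^sub>c (q - 1))) (M * (t\<^sub>c q - t)))"
definition wl :: "nat => real => real" where "wl j t = bump j (M * (t\<^sub>c 0 - t))"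
definition wr :: "nat => real => real" where "wr j t = bump j (M * (t - t\<^sub>c (Q - 1)))"

lemma M: "0 < M" by (rule slope_pos[OF Q])

lemma support: assumes j: "j < 4"
 shows "win q j t ~= 0 ==> t\<^sub>c (q - 1) < t & t < t\<^sub>c q" "wl j t ~= 0 ==> t < t\<^sub>c 0" "wr j t ~= 0 ==> t\<^sub>c (Q - 1) < t"
proof -
 have pos: "a < b" if "0 < M * (b - a)" for a b using that M by (simp add: zero_less_mult_iff)
 show "t\<^sub>c (q - 1) < t & t < t\<^sub>c q" if "win q j t ~= 0"
  using bump(3)[OF j that[unfolded win_def]] pos[of t "t\<^sub>c (q - 1)"] pos[of "t\<^sub>c q" t] by (simp add: order_less_trans[OF zero_less_one])
 show "t < t\<^sub>c 0" if "wl j t ~= 0" using bump(3)[OF j that[unfolded wl_def]] pos[of "t\<^sub>c 0" t] by linarith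
 show "t\<^sub>c (Q - 1) < t" if "wr j t ~= 0" using bump(3)[OF j that[unfolded wr_def]] pos[of t "t\<^sub>c (Q - 1)"] by linarith
qed

lemma cutQ: "k <= k' ==> t\<^sub>c k <= t\<^sub>c k'" "real k / real Q < t\<^sub>c k" "t\<^sub>c k < real (Suc k) / real Q" "0 < t\<^sub>c 0" "t\<^sub>c (Q - 1) < 1"
proof -
 show "k <= k' ==> t\<^sub>c k <= t\<^sub>c k'" by (rule cut_le[OF Q])
 show "real k / real Q < t\<^sub>c k" "t\<^sub>c k < real (Suc k) / real Q" using cut_bounds[OF Q i] by auto
 show "0 < t\<^sub>c 0" "t\<^sub>c (Q - 1) < 1" using cut_bounds(1)[OF Q i, of 0] cut_bounds(2)[OF Q i, of "Q - 1"] Q by simp_all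
qed

lemma disjoint:
 assumes j: "j < 4" "j' < 4"
 shows "wl j t = 0 \<or> wr j' t = 0" "0 < q ==> q < Q ==> win q j t = 0 \<or> wl j' t = 0" "0 < q ==> q < Q ==> win q j t = 0 \<or> wr j' t = 0"
  "q ~= q' ==> win q j t = 0 \<or> win q' j' t = 0"
proof -
 note s = support[OF j(1)] support[OF j(2)]
 show "wl j t = 0 \<or> wr j' t = 0" using s(2)[of t] s(6)[of t] cutQ(1)[of 0 "Q - 1"] by fastforce
 show "win q j t = 0 \<or> wl j' t = 0" using s(1)[of q t] s(5)[of t] cutQ(1)[of 0 "q - 1"] by fastforce
 show "win q j t = 0 \<or> wr j' t = 0" if "0 < q" "q < Q" using s(1)[of q t] s(6)[of t] cutQ(1)[of q "Q - 1"] that by fastforce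
 show "win q j t = 0 \<or> win q' j' t = 0" if "q ~= q'"
 proof (rule ccontr)
  assume "\<not> ?thesis"
  then have "t\<^sub>c (q - 1) < t" "t < t\<^sub>c q" "t\<^sub>c (q' - 1) < t" "t < t\<^sub>c q'" using s(1)[of q t] s(4)[of q' t] by auto
  moreover have "t\<^sub>c q <= t\<^sub>c (q' - 1) \<or> t\<^sub>c q' <= t\<^sub>c (q - 1)" using that cutQ(1) by (cases "q < q'") auto
  ultimately show False by linarith
 qed
qed

lemma ends: assumes j: "j < 4" shows "wl j 0 = 1" "wr j 1 = 1" "wr j 0 = 0" "wl j 1 = 0" "0 < q ==> win q j 0 = 0" "q < Q ==> win q j 1 = 0"
proof -
 have "M * t\<^sub>c 0 = 10 * (real i + 1)" using slope_cut[OF Q, of N i 0] by simp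
 then show "wl j 0 = 1" unfolding wl_def by (intro bump(4)) simp
 have "M * t\<^sub>c (Q - 1) = 10 * (real (Q - 1) * (real N + 1) + (real i + 1))" by (rule slope_cut[OF Q])
 moreover have "real (Q - 1) = real Q - 1" using Q by (simp add: of_nat_diff)
 ultimately have "M * (1 - t\<^sub>c (Q - 1)) = 10 * (real N - real i)" by (simp add: slope_def algebra_simps)
 then show "wr j 1 = 1" unfolding wr_def using i by (intro bump(4)) simp
 show "wr j 0 = 0" using support(3)[OF j, of 0] cutQ(1)[of 0 "Q - 1"] cutQ(4) by fastforce
 show "wl j 1 = 0" using support(2)[OF j, of 1] cutQ(1)[of 0 "Q - 1"] cutQ(5) by fastforce
 show "win q j 0 = 0" using support(1)[OF j, of q 0] cutQ(1)[of 0 "q - 1"] cutQ(4) by fastforce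
 show "q < Q ==> win q j 1 = 0" using support(1)[OF j, of q 1] cutQ(1)[of q "Q - 1"] cutQ(5) by fastforce
qed

text \<open>Piece 0 is the arc around the end points with fibre \<open>F1\<close>, whose two halves are weighted separately;
piece \<open>q > 0\<close> is the arc between two consecutive cut points.\<close>

definition piece :: "nat => nat => 'f host => real option => 'f host" where
 "piece q j x s = (case s of None => if q = 0 then x else 0
  | Some t => if t \<in> {0..1} then if q = 0 then of_real (wl j t) *c p0 x + of_real (wr j t) *c p1 x else of_real (win q j t) *c x else 0)"
definition fib :: "nat => 'f cstar" where "fib q = (if q = 0 then F1 else F2)"
text \<open>The point \<open>q / Q\<close> lies between the cut points \<open>q - 1\<close> and \<open>q\<close>.\<close>

definition val :: "nat => (real option => 'f host) => 'f host" where
 "val q X = (if q = 0 then X None else X (Some (real q / real Q)))"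

lemma piece_apply:
 "piece 0 j x None = x" "0 < q ==> piece q j x None = 0" "t \<notin> {0..1} ==> piece q j x (Some t) = 0"
 "t \<in> {0..1} ==> piece 0 j x (Some t) = of_real (wl j t) *c p0 x + of_real (wr j t) *c p1 x"
 "t \<in> {0..1} ==> 0 < q ==> piece q j x (Some t) = of_real (win q j t) *c x"
 by (auto simp: piece_def)

lemma piece_ES: assumes q: "q < Q" and x: "x \<in> hS (fib q)" and j: "j < 4" shows "piece q j x \<in> ES"
proof (cases "q = 0")
 case True
 then have x: "x \<in> S1" "p0 x \<in> S2" "p1 x \<in> S2" using x p0D(1) p1D(1) by (simp_all add: fib_def)
 have "cts (\<lambda>t. of_real (wl j t) *c p0 x + of_real (wr j t) *c p1 x)"
  unfolding wl_def wr_def by (intro cts_add cts_scaled x bump_cts continuous_intros)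
 then have "cts (\<lambda>t. piece q j x (Some t))" by (rule cts_cong) (simp add: True piece_apply)
 then show ?thesis using x True by (auto simp: ES_def piece_apply ends[OF j])
next
 case False
 then have x: "x \<in> S2" using x by (simp add: fib_def)
 have "cts (\<lambda>t. of_real (win q j t) *c x)" unfolding win_def by (intro cts_scaled x bump_cts continuous_intros)
 then have "cts (\<lambda>t. piece q j x (Some t))" by (rule cts_cong) (use False in \<open>simp add: piece_apply\<close>)
 then show ?thesis using x False by (auto simp: ES_def piece_apply ends[OF j] p_0 q)
qed

lemma q_Q: "q < Q ==> real q / real Q \<in> {0..1}" using Q by simp

end

context et_pieces
begin

lemma piece_at: assumes "t \<in> {0..1}" shows "piece q j x (Some t) = (if q = 0 then of_real (wl j t) *c p0 x + of_real (wr j t) *c p1 x else of_real (win q j t) *c x)"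
 using assms by (simp add: piece_def)

lemma scaled_products:
 "(of_real a *c x) * (of_real b *c y) = of_real (a * b) *c (x * y)" for x y :: "'f host" by simp

lemma piece_mult:
 assumes q: "q < Q" and x: "x \<in> hS (fib q)" and y: "y \<in> hS (fib q)" and j: "j < 4" "j' < 4" "j ~= j'"
 shows "piece q j x * piece q j' y = piece q (min j j') (x * y)"
proof (rule ES_eqI[OF ES_ops(2)[OF piece_ES[OF q x j(1)] piece_ES[OF q y j(2)]]])
 have fS: "x * y \<in> hS (fib q)" using x y by (auto simp: fib_def split: if_splits)
 show "piece q (min j j') (x * y) \<in> ES" using j by (intro piece_ES[OF q fS]) simp
 show "(piece q j x * piece q j' y) None = piece q (min j j') (x * y) None" by (simp add: piece_def)
 fix t :: real assume t: "t \<in> {0..1}"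
 show "(piece q j x * piece q j' y) (Some t) = piece q (min j j') (x * y) (Some t)"
 proof (cases "q = 0")
  case False
  then show ?thesis using bump_mult[OF j(3)] by (simp only: times_fun_apply piece_at[OF t] if_False scaled_products win_def)
 next
  case True
  then have xy: "x \<in> S1" "y \<in> S1" using x y by (simp_all add: fib_def)
  have w: "wl j t * wr j' t = 0" "wr j t * wl j' t = 0" using disjoint(1)[OF j(1,2), of t] disjoint(1)[OF j(2,1), of t] by auto
  have "(of_real (wl j t) *c p0 x + of_real (wr j t) *c p1 x) * (of_real (wl j' t) *c p0 y + of_real (wr j' t) *c p1 y)
   = of_real (wl j t * wl j' t) *c (p0 x * p0 y) + of_real (wr j t * wr j' t) *c (p1 x * p1 y)
    + (of_real (wl j t * wr j' t) *c (p0 x * p1 y) + of_real (wr j t * wl j' t) *c (p1 x * p0 y))"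
   by (simp only: distrib_left distrib_right scaled_products) (simp only: ac_simps)
  also have "\<dots> = of_real (wl (min j j') t) *c p0 (x * y) + of_real (wr (min j j') t) *c p1 (x * y)"
   using xy by (simp only: w p0D(5) p1D(5)) (simp add: wl_def wr_def bump_mult[OF j(3)] flip: of_real_mult)
  finally show ?thesis using True by (simp add: piece_at[OF t])
 qed
qed

lemma piece_orth:
 assumes q: "q < Q" "q' < Q" "q ~= q'" and x: "x \<in> hS (fib q)" and y: "y \<in> hS (fib q')" and j: "j < 4" "j' < 4"
 shows "piece q j x * piece q' j' y = 0"
proof (rule ES_eqI[OF ES_ops(2)[OF piece_ES[OF q(1) x j(1)] piece_ES[OF q(2) y j(2)]] E.S_0])
 show "(piece q j x * piece q' j' y) None = 0 None" using q(3) by (auto simp: piece_def)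
 fix t :: real assume t: "t \<in> {0..1}"
 show "(piece q j x * piece q' j' y) (Some t) = 0 (Some t)"
 proof -
  consider "q = 0" "q' ~= 0" | "q ~= 0" "q' = 0" | "q ~= 0" "q' ~= 0" using q(3) by metis
  then show ?thesis
  proof cases
   case 1
   then have "win q' j' t = 0 \<or> wl j t = 0 & wr j t = 0" using disjoint(2,3)[OF j(2,1), of q' t] q by auto
   then show ?thesis using 1 by (auto simp: piece_at[OF t])
  next
   case 2
   then have "win q j t = 0 \<or> wl j' t = 0 & wr j' t = 0" using disjoint(2,3)[OF j, of q t] q by auto
   then show ?thesis using 2 by (auto simp: piece_at[OF t])
  next
   case 3
   then show ?thesis using disjoint(4)[OF j q(3), of t] by (auto simp: piece_at[OF t])
  qed
 qed
qed

lemma one_active: "\<exists>q0<Q. \<forall>q<Q. q ~= q0 --> (\<forall>x. piece q 3 x (Some t) = 0)"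
proof (cases "\<exists>q0. 0 < q0 & q0 < Q & win q0 3 t ~= 0")
 case True
 then obtain q0 where q0: "0 < q0" "q0 < Q" "win q0 3 t ~= 0" by blast
 have j: "(3::nat) < 4" by simp
 have "wl 3 t = 0" "wr 3 t = 0" "win q 3 t = 0" if "q ~= q0" for q
  using disjoint(2,3)[OF j j q0(1,2), of t] disjoint(4)[OF j j that, of t] q0(3) by auto
 then show ?thesis using q0(2) by (intro exI[of _ q0]) (auto simp: piece_def)
next
 case False
 then show ?thesis using Q by (intro exI[of _ 0]) (auto simp: piece_def)
qed

lemma half_sum_le:
 assumes "0 <= a" "a <= 1" "0 <= b" "b <= 1" "a = 0 \<or> b = 0" "x \<in> S2" "y \<in> S2" "nm2 x <= c" "nm2 y <= c"
 shows "nm2 (of_real a *c x + of_real b *c y) <= c"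
proof -
 have c: "0 <= c" using assms(6,8) I2.nm_nonneg[of x] by linarith
 have s: "nm2 (of_real r *c v) <= c" if "0 <= r" "r <= 1" "v \<in> S2" "nm2 v <= c" for r v
  using mult_mono[of r 1 "nm2 v" c] that by (simp add: I2.nm_scl)
 show ?thesis using assms(5) s[OF assms(1,2,6,8)] s[OF assms(3,4,7,9)] by auto
qed

lemma piece_nm:
 assumes q: "q < Q" and x: "x \<in> hS (fib q)" and j: "j < 4"
 shows "Enm (piece q j x) <= hnm (fib q) x"
 unfolding Enm_le[OF piece_ES[OF assms]]
proof (intro conjI ballI)
 have n0: "0 <= hnm (fib q) x" using x by (auto simp: fib_def split: if_splits)
 show "nm1 (piece q j x None) <= hnm (fib q) x" using n0 by (auto simp: piece_def fib_def)
 fix t :: real assume t: "t \<in> {0..1}"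
 show "nm2 (piece q j x (Some t)) <= hnm (fib q) x"
 proof (cases "q = 0")
  case True
  then have x: "x \<in> S1" using x by (simp add: fib_def)
  have "nm2 (of_real (wl j t) *c p0 x + of_real (wr j t) *c p1 x) <= nm1 x"
   using disjoint(1)[OF j j, of t] star_map_contractive[OF H1 H2 p(1) x] star_map_contractive[OF H1 H2 p(2) x] p0D(1)[OF x] p1D(1)[OF x]
   by (intro half_sum_le) (auto simp: wl_def wr_def bump)
  then show ?thesis using True by (simp add: piece_at[OF t] fib_def)
 next
  case False
  then have "x \<in> S2" using x by (simp add: fib_def)
  then have "nm2 (of_real (win q j t) *c x + of_real 0 *c x) <= nm2 x" by (intro half_sum_le) (auto simp: win_def bump)
  then show ?thesis using False by (simp add: piece_at[OF t] fib_def)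
 qed
qed

lemma sum_fun_apply: "(\<Sum>q\<in>I. f q) s = (\<Sum>q\<in>I. f q s)" for f :: "nat => 's => 'f host"
 by (induction I rule: infinite_finite_induct) auto

text \<open>At each point at most one piece is active, and there the difference is a convex weight times an oscillation of \<open>X\<close> over the arc.\<close>

lemma pieces_approx:
 assumes X: "X \<in> ES" and osc: "\<forall>s\<in>{0..1}. \<forall>t\<in>{0..1}. \<bar>s - t\<bar> < 2 / real Q --> nm2 (X (Some s) - X (Some t)) <= \<epsilon>" and \<epsilon>: "0 < \<epsilon>"
 shows "Enm (\<Sum>q\<in>{..<Q}. X * piece q 3 (hone (fib q)) - piece q 3 (val q X)) <= \<epsilon>"
proof -
 note D = ESD[OF X]
 have u: "hone (fib q) \<in> hS (fib q)" for q using I1.e_S I2.e_S by (auto simp: fib_def)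
 have v: "val q X \<in> hS (fib q)" if "q < Q" for q using D(1) D(3)[OF q_Q[OF that]] by (auto simp: fib_def val_def)
 have P: "piece q 3 (hone (fib q)) \<in> ES" "piece q 3 (val q X) \<in> ES" if "q < Q" for q
  using piece_ES[OF that u] piece_ES[OF that v[OF that]] by auto
 have j: "(3::nat) < 4" by simp
 have S: "(\<Sum>q\<in>{..<Q}. X * piece q 3 (hone (fib q)) - piece q 3 (val q X)) \<in> ES" (is "?S \<in> ES")
  using P X by (intro E.S_sum E.S_diff E.S_mult) auto
 show ?thesis unfolding Enm_le[OF S]
 proof (intro conjI ballI)
  have "?S None = (\<Sum>q\<in>{..<Q}. X None * piece q 3 (hone (fib q)) None - piece q 3 (val q X) None)"
   by (simp add: sum_fun_apply)
  also have "\<dots> = 0" using D(1) by (intro sum.neutral) (auto simp: piece_def fib_def val_def)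
  finally show "nm1 (?S None) <= \<epsilon>" using \<epsilon> by simp
  fix t :: real assume t: "t \<in> {0..1}"
  let ?g = "\<lambda>q. X (Some t) * piece q 3 (hone (fib q)) (Some t) - piece q 3 (val q X) (Some t)"
  obtain q0 where q0: "q0 < Q" "!!q x. q < Q ==> q ~= q0 ==> piece q 3 x (Some t) = 0" using one_active[of t] by blast
  have "?S (Some t) = sum ?g {..<Q}" by (simp add: sum_fun_apply)
  also have "\<dots> = sum ?g {q0}" using q0 by (intro sum.mono_neutral_right) auto
  finally have eq: "?S (Some t) = ?g q0" by simp
  have "nm2 (?g q0) <= \<epsilon>"
  proof (cases "q0 = 0")
   case True
   have z: "0 \<in> {0..1::real}" "1 \<in> {0..1::real}" by auto
   have "?g q0 = of_real (wl 3 t) *c (X (Some t) - X (Some 0)) + of_real (wr 3 t) *c (X (Some t) - X (Some 1))"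
    using D(3)[OF t] by (simp add: True piece_at[OF t] fib_def val_def D(5,6) p distrib_left scl_simps)
   moreover have "nm2 \<dots> <= \<epsilon>"
   proof -
    have dl: "nm2 (X (Some t) - X (Some 0)) <= \<epsilon>" if "wl 3 t ~= 0"
    proof -
     have "t < 1 / real Q" using support(2)[OF j that] cutQ(3)[of 0] by simp
     then show ?thesis using osc t Q by (simp add: field_simps)
    qed
    have dr: "nm2 (X (Some t) - X (Some 1)) <= \<epsilon>" if "wr 3 t ~= 0"
    proof -
     have "real (Q - 1) / real Q < t" using support(3)[OF j that] cutQ(2)[of "Q - 1"] by simp
     then have "\<bar>t - 1\<bar> < 2 / real Q" using t Q by (simp add: field_simps of_nat_diff)
     then show ?thesis using osc t z by blast
    qed
    have s: "nm2 (of_real r *c v) <= \<epsilon>" if "0 <= r" "r <= 1" "v \<in> S2" "r ~= 0 ==> nm2 v <= \<epsilon>" for r v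
     using mult_mono[of r 1 "nm2 v" \<epsilon>] that \<epsilon> by (cases "r = 0") (auto simp: I2.nm_scl)
    have SS: "X (Some t) - X (Some 0) \<in> S2" "X (Some t) - X (Some 1) \<in> S2" using D(3) t z by auto
    consider "wl 3 t = 0" | "wr 3 t = 0" using disjoint(1)[OF j j, of t] by blast
    then show ?thesis using s[OF _ _ SS(1) dl] s[OF _ _ SS(2) dr] by cases (auto simp: wl_def wr_def bump)
   qed
   ultimately show ?thesis by simp
  next
   case False
   let ?p = "real q0 / real Q"
   have pS: "X (Some ?p) \<in> S2" by (rule D(3)[OF q_Q[OF q0(1)]])
   have "?g q0 = of_real (win q0 3 t) *c (X (Some t) - X (Some ?p)) + of_real 0 *c u2"
    using D(3)[OF t] False by (simp add: piece_at[OF t] fib_def val_def scl_simps)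
   moreover have "nm2 \<dots> <= \<epsilon>"
   proof (cases "win q0 3 t = 0")
    case True
    then show ?thesis using \<epsilon> by simp
   next
    case w: False
    have "real (q0 - 1) / real Q < t" "t < real (Suc q0) / real Q"
     using support(1)[OF j w] cutQ(2)[of "q0 - 1"] cutQ(3)[of q0] by auto
    then have "\<bar>t - ?p\<bar> < 2 / real Q" using False Q by (simp add: abs_less_iff field_simps of_nat_diff)
    then have "nm2 (X (Some t) - X (Some ?p)) <= \<epsilon>" using osc t q_Q[OF q0(1)] by blast
    then have "nm2 (of_real (win q0 3 t) *c (X (Some t) - X (Some ?p)) + of_real 0 *c (X (Some t) - X (Some ?p))) <= \<epsilon>"
     using D(3)[OF t] pS by (intro half_sum_le) (auto simp: win_def bump)
    then show ?thesis by simp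
   qed
   ultimately show ?thesis by simp
  qed
  then show "nm2 (?S (Some t)) <= \<epsilon>" using eq by simp
 qed
qed

lemma val_hom: assumes "q < Q" shows "star_map ES Est (hS (fib q)) (hst (fib q)) (val q)" "val q Eu = hone (fib q)"
 using q_Q[OF assms] ESD(1,3) by (auto simp: star_map_def val_def fib_def simp del: atLeastAtMost_iff)

lemma et_pieces_pieces:
 assumes "\<forall>X\<in>G. \<forall>s\<in>{0..1}. \<forall>t\<in>{0..1}. \<bar>s - t\<bar> < 2 / real Q --> nm2 (X (Some s) - X (Some t)) <= \<epsilon>" "G \<subseteq> ES" "0 < \<epsilon>"
 shows "pieces ES Est Enm Eu {..<Q} fib piece val \<epsilon> G"
proof (intro pieces.intro E pieces_axioms.intro)
 fix q :: nat and x y and j j' :: nat assume "q \<in> {..<Q}" and x: "x \<in> hS (fib q)" and j: "j < 4"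
 then have q: "q < Q" by simp
 note PE = piece_ES[OF q _ j]
 have S: "x \<in> S1" if "q = 0" using x that by (simp add: fib_def)
 have S': "x \<in> S2" if "q ~= 0" using x that by (simp add: fib_def)
 show "piece q j x \<in> ES" by (rule PE[OF x])
 show "Enm (piece q j x) <= hnm (fib q) x" by (rule piece_nm[OF q x j])
 have cx: "c *c x \<in> hS (fib q)" "hst (fib q) x \<in> hS (fib q)" for c using x by (auto simp: fib_def split: if_splits)
 show "piece q j (c *c x) = c *c piece q j x" for c
  using S S' by (intro ES_eqI[OF PE[OF cx(1)] ES_ops(3)[OF PE[OF x] PE[OF x]]])
   (auto simp: piece_def p0D(3) p1D(3) scl_simps mult.commute)
 show "Est (piece q j x) = piece q j (hst (fib q) x)"
  using S S' p0D(1) p1D(1) by (intro ES_eqI[OF ES_ops(4)[OF PE[OF x] PE[OF x]] PE[OF cx(2)]])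
   (auto simp: piece_def fib_def p0D(2) p1D(2) I2.st_add I2.st_scl)
 show "piece q j (x + y) = piece q j x + piece q j y" if y: "y \<in> hS (fib q)" for y
 proof -
  have xy: "x + y \<in> hS (fib q)" using x y by (auto simp: fib_def split: if_splits)
  show ?thesis using S S' y by (intro ES_eqI[OF PE[OF xy] ES_ops(1)[OF PE[OF x] PE[OF y]]])
   (auto simp: piece_def fib_def p0D(4) p1D(4) scl_simps)
 qed
 show "piece q j x * piece q j' y = piece q (min j j') (x * y)" if "y \<in> hS (fib q)" "j' < 4" "j ~= j'" for y j'
  by (rule piece_mult[OF q x that(1) j that(2,3)])
 show "piece q j x * piece q' j' y = 0" if "q' \<in> {..<Q}" "q ~= q'" "y \<in> hS (fib q')" "j' < 4" for q' y j'
  using that by (intro piece_orth[OF q _ _ x _ j]) auto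
qed (use fd val_hom pieces_approx assms in \<open>auto simp: fib_def\<close>)

text \<open>A point at distance at least \<open>5 / slope\<close> from all cut points lies in exactly one arc, where the smallest bump is one.\<close>

lemma core_at: assumes t: "t \<in> {0..1}" and away: "!!k. k < Q ==> 5 <= M * \<bar>t - t\<^sub>c k\<bar>"
 shows "core {..<Q} fib piece (Some t) = u2"
proof -
 let ?g = "\<lambda>q. piece q 0 (hone (fib q)) (Some t)"
 have u: "hone (fib q) \<in> hS (fib q)" for q using I1.e_S I2.e_S by (auto simp: fib_def)
 have ne: "t ~= t\<^sub>c k" if "k < Q" for k using away[OF that] by auto
 have j: "(0::nat) < 4" by simp
 have "\<exists>q0<Q. ?g q0 = u2 & (\<forall>q<Q. q ~= q0 --> ?g q = 0)"
 proof (cases "t < t\<^sub>c 0 \<or> t\<^sub>c (Q - 1) < t")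
  case True
  then have "(wl 0 t = 1 & wr 0 t = 0) \<or> (wl 0 t = 0 & wr 0 t = 1)"
  proof
   assume "t < t\<^sub>c 0"
   then have "wl 0 t = 1" unfolding wl_def using away[OF Q] by (intro bump(4)) simp
   then show ?thesis using disjoint(1)[OF j j, of t] by simp
  next
   assume "t\<^sub>c (Q - 1) < t"
   then have "wr 0 t = 1" unfolding wr_def using away[of "Q - 1"] Q by (intro bump(4)) simp
   then show ?thesis using disjoint(1)[OF j j, of t] by simp
  qed
  then have "?g 0 = u2 & (\<forall>q<Q. q ~= 0 --> ?g q = 0)"
   using disjoint(2)[OF j j, of _ t] disjoint(3)[OF j j, of _ t] by (auto simp: piece_at[OF t] fib_def p)
  then show ?thesis using Q by blast
 next
  case False
  define q0 where "q0 = (LEAST q. t < t\<^sub>c q)"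
  have ex: "t < t\<^sub>c (Q - 1)" using False ne[of "Q - 1"] Q by auto
  have q0: "t < t\<^sub>c q0" "q0 <= Q - 1" unfolding q0_def using LeastI[of "\<lambda>q. t < t\<^sub>c q", OF ex] Least_le[of "\<lambda>q. t < t\<^sub>c q", OF ex] by auto
  have "q0 ~= 0" using False q0(1) by (intro notI) auto
  then have "\<not> t < t\<^sub>c (q0 - 1)" unfolding q0_def by (intro not_less_Least) simp
  moreover have "q0 - 1 < Q" using q0(2) Q by linarith
  ultimately have "t\<^sub>c (q0 - 1) < t" using ne[of "q0 - 1"] by (simp add: not_less less_le)
  then have w: "win q0 0 t = 1" unfolding win_def using away[of q0] away[of "q0 - 1"] q0 Q by (intro bump(4)) auto
  have "?g q0 = u2 & (\<forall>q<Q. q ~= q0 --> ?g q = 0)"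
   using disjoint(2)[OF j j, of q0 t] disjoint(3)[OF j j, of q0 t] disjoint(4)[OF j j, of q0 _ t] w \<open>q0 ~= 0\<close> q0(2) Q
   by (auto simp: piece_at[OF t] fib_def)
  then show ?thesis using q0(2) Q by (intro exI[of _ q0]) auto
 qed
 then obtain q0 where q0: "q0 < Q" "?g q0 = u2" "!!q. q < Q ==> q ~= q0 ==> ?g q = 0" by blast
 have "core {..<Q} fib piece (Some t) = sum ?g {..<Q}" by (simp add: core_def sum_fun_apply)
 also have "\<dots> = sum ?g {q0}" using q0 by (intro sum.mono_neutral_right) auto
 finally show ?thesis using q0 by simp
qed

lemma core_None: "core {..<Q} fib piece None = u1"
proof -
 have "core {..<Q} fib piece None = (\<Sum>q\<in>{..<Q}. if q = 0 then u1 else 0)"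
  unfolding core_def sum_fun_apply by (intro sum.cong) (auto simp: piece_def fib_def)
 then show ?thesis using Q by simp
qed

lemma core_ES: "core {..<Q} fib piece \<in> ES"
 unfolding core_def using I1.e_S I2.e_S by (intro E.S_sum piece_ES) (auto simp: fib_def)

end

lemma (in et_data) oscillation_control:
 assumes "finite G" "G \<subseteq> ES" "0 < \<epsilon>"
 shows "\<exists>Q>0. \<forall>X\<in>G. \<forall>s\<in>{0..1}. \<forall>t\<in>{0..1}. \<bar>s - t\<bar> < 2 / real Q --> nm2 (X (Some s) - X (Some t)) <= \<epsilon>"
proof -
 have "\<exists>\<eta>>0. \<forall>X\<in>G. \<forall>s\<in>{0..1}. \<forall>t\<in>{0..1}. \<bar>s - t\<bar> < \<eta> --> nm2 (X (Some s) - X (Some t)) <= \<epsilon>"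
  using assms(1,2)
 proof (induction G)
  case (insert X G)
  then obtain \<eta> where \<eta>: "0 < \<eta>" "\<forall>X\<in>G. \<forall>s\<in>{0..1}. \<forall>t\<in>{0..1}. \<bar>s - t\<bar> < \<eta> --> nm2 (X (Some s) - X (Some t)) <= \<epsilon>" by auto
  obtain \<eta>' where \<eta>': "0 < \<eta>'" "\<forall>s\<in>{0..1}. \<forall>t\<in>{0..1}. \<bar>s - t\<bar> < \<eta>' --> nm2 (X (Some s) - X (Some t)) <= \<epsilon>"
   using cts_uniform[OF ESD(2), of X \<epsilon>] insert.prems assms(3) by auto
  show ?case using \<eta> \<eta>' by (intro exI[of _ "min \<eta> \<eta>'"]) auto
 qed (auto intro: exI[of _ 1])
 then obtain \<eta> where \<eta>: "0 < \<eta>" "\<forall>X\<in>G. \<forall>s\<in>{0..1}. \<forall>t\<in>{0..1}. \<bar>s - t\<bar> < \<eta> --> nm2 (X (Some s) - X (Some t)) <= \<epsilon>" by blast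
 obtain Q :: nat where Q: "2 / \<eta> < real Q" using reals_Archimedean2 by blast
 have Q0: "0 < Q" using Q \<eta>(1) by (cases Q) (auto simp: field_simps)
 then have "2 / real Q < \<eta>" using Q \<eta>(1) by (simp add: field_simps)
 then show ?thesis using \<eta>(2) Q0 by (intro exI[of _ Q]) (meson order_less_trans)
qed

text \<open>Near a given point at most one family has a cut point, so one of the two factors vanishes.\<close>

lemma (in et_data) et_pieces_exist:
 fixes N :: nat
 assumes G: "finite G" "G \<subseteq> ES" and \<epsilon>: "0 < \<epsilon>"
 shows "\<exists>(K::nat set) (Fib :: nat => 'f cstar) lev \<pi>. (\<forall>i<N. pieces ES Est Enm Eu K Fib (lev i) (\<pi> i) \<epsilon> G) &
  (\<forall>i<N. \<forall>j<N. i ~= j --> (Eu - core K Fib (lev i)) * (Eu - core K Fib (lev j)) = 0)"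
proof -
 obtain Q where Q: "0 < Q" and osc: "\<forall>X\<in>G. \<forall>s\<in>{0..1}. \<forall>t\<in>{0..1}. \<bar>s - t\<bar> < 2 / real Q --> nm2 (X (Some s) - X (Some t)) <= \<epsilon>"
  using oscillation_control[OF G \<epsilon>] by blast
 define lev where "lev i = et_pieces.piece F1 F2 \<phi>0 \<phi>1 Q N i" for i
 define Fib where "Fib = et_pieces.fib F1 F2"
 define \<pi> :: "nat => (real option => 'f host) => 'f host" where "\<pi> = et_pieces.val Q"
 have EP: "et_pieces F1 F2 \<phi>0 \<phi>1 Q N i" if "i < N" for i using Q that by unfold_locales
 have fib: "et_pieces.fib F1 F2 = Fib" by (simp add: Fib_def)
 show ?thesis
 proof (intro exI conjI allI impI)
  fix i assume i: "i < N"
  show "pieces ES Est Enm Eu {..<Q} Fib (lev i) \<pi> \<epsilon> G"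
   using et_pieces.et_pieces_pieces[OF EP[OF i] osc G(2) \<epsilon>] by (simp add: lev_def Fib_def \<pi>_def)
  fix j assume j: "j < N" and ij: "i ~= j"
  interpret i: et_pieces F1 F2 \<phi>0 \<phi>1 Q N i by (rule EP[OF i])
  interpret j: et_pieces F1 F2 \<phi>0 \<phi>1 Q N j by (rule EP[OF j])
  show "(Eu - core {..<Q} Fib (lev i)) * (Eu - core {..<Q} Fib (lev j)) = 0"
   unfolding lev_def Fib_def
  proof (rule ES_eqI[OF E.S_mult[OF E.S_diff[OF E.e_S i.core_ES] E.S_diff[OF E.e_S j.core_ES]] E.S_0])
   show "((Eu - core {..<Q} i.fib i.piece) * (Eu - core {..<Q} i.fib j.piece)) None = 0 None" by (simp add: i.core_None)
   fix t :: real assume t: "t \<in> {0..1}"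
   have "(\<forall>k<Q. 5 <= slope Q N * \<bar>t - cut Q N i k\<bar>) \<or> (\<forall>k<Q. 5 <= slope Q N * \<bar>t - cut Q N j k\<bar>)"
   proof (rule ccontr)
    assume "\<not> ?thesis"
    then obtain k k' where "slope Q N * \<bar>t - cut Q N i k\<bar> < 5" "slope Q N * \<bar>t - cut Q N j k'\<bar> < 5" by (auto simp: not_le)
    moreover have "slope Q N * \<bar>x\<bar> = \<bar>slope Q N * x\<bar>" for x using i.M by (simp add: abs_mult)
    ultimately have "\<bar>slope Q N * t - slope Q N * cut Q N i k\<bar> < 5" "\<bar>slope Q N * t - slope Q N * cut Q N j k'\<bar> < 5"
     by (simp_all add: right_diff_distrib)
    then show False using cut_separated[OF Q i j ij, of k k'] by linarith
   qed
   then show "((Eu - core {..<Q} i.fib i.piece) * (Eu - core {..<Q} i.fib j.piece)) (Some t) = 0 (Some t)"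
    using i.core_at[OF t] j.core_at[OF t] t by auto
  qed
 qed
qed

section \<open>Pieces in a direct sum of blocks\<close>

lemma star_map_comp: "star_map S st S' st' f ==> star_map S' st' S'' st'' g ==> star_map S st S'' st'' (\<lambda>x. g (f x))"
 unfolding star_map_def by simp

lemma star_map_inv:
 assumes f: "star_map S st S' st' f" and b: "bij_betw f S S'" and H: "hcstar S st nm"
 shows "star_map S' st' S st (inv_into S f)"
proof -
 interpret hcstar S st nm by (rule H)
 note D = star_mapD[OF f]
 have ff: "inv_into S f (f x) = x" if "x \<in> S" for x using b that by (simp add: bij_betw_def)
 show ?thesis unfolding star_map_def
 proof
  fix x' assume "x' \<in> S'"
  then obtain x where x: "x \<in> S" "x' = f x" using b by (auto simp: bij_betw_def)
  show "inv_into S f x' \<in> S & inv_into S f (st' x') = st (inv_into S f x') & (\<forall>c. inv_into S f (c *c x') = c *c inv_into S f x') &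
   (\<forall>y\<in>S'. inv_into S f (x' + y) = inv_into S f x' + inv_into S f y & inv_into S f (x' * y) = inv_into S f x' * inv_into S f y)"
  proof (intro conjI allI ballI)
   fix y' assume "y' \<in> S'"
   then obtain y where y: "y \<in> S" "y' = f y" using b by (auto simp: bij_betw_def)
   show "inv_into S f (x' + y') = inv_into S f x' + inv_into S f y'" "inv_into S f (x' * y') = inv_into S f x' * inv_into S f y'"
    using ff[OF S_add[OF x(1) y(1)]] ff[OF S_mult[OF x(1) y(1)]] ff[OF x(1)] ff[OF y(1)] D(4,5)[OF x(1) y(1)] x(2) y(2) by simp_all
  qed (use ff[OF S_st[OF x(1)]] ff[OF S_scl[OF x(1)]] ff[OF x(1)] D(2,3)[OF x(1)] x in simp_all)
 qed
qed

text \<open>Pieces of a summand are pieces of the whole algebra; the map \<open>j\<close> embeds the summand and \<open>c\<close> is the coordinate map.\<close>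

lemma pieces_transport:
 assumes P: "pieces S' st' nm' e' K Fib lev \<pi> \<epsilon> (c ` G)" and H: "hcstar1 S st nm e" and G: "G \<subseteq> S"
  and c: "star_map S st S' st' c" "c e = e'" and j: "star_map S' st' S st j"
  and mod: "!!x y. x \<in> S ==> y \<in> S' ==> x * j y = j (c x * y)"
 shows "pieces S st nm e K Fib (\<lambda>ka i x. j (lev ka i x)) (\<lambda>ka x. \<pi> ka (c x)) \<epsilon> G"
proof -
 interpret P: pieces S' st' nm' e' K Fib lev \<pi> \<epsilon> "c ` G" by (rule P)
 interpret hcstar1 S st nm e by (rule H)
 note J = star_mapD[OF j]
 have con: "nm (j y) <= nm' y" if "y \<in> S'" for y by (rule star_map_contractive[OF P.hcstar1_axioms H j that])
 note j0 = star_map_diff[OF j P.hcstar_axioms]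
 show ?thesis
 proof (intro pieces.intro H pieces_axioms.intro)
  fix g assume g: "g \<in> G"
  have gS: "g \<in> S" "c g \<in> S'" using g G star_mapD(1)[OF c(1)] by auto
  have u: "hone (Fib ka) \<in> hS (Fib ka)" "\<pi> ka (c g) \<in> hS (Fib ka)" if "ka \<in> K" for ka
   using star_mapD(1)[OF P.\<pi>(1)[OF that] P.e_S] P.\<pi>(2)[OF that] star_mapD(1)[OF P.\<pi>(1)[OF that] gS(2)] by auto
  have L: "lev ka 3 (hone (Fib ka)) \<in> S'" "lev ka 3 (\<pi> ka (c g)) \<in> S'" if "ka \<in> K" for ka
   using P.lev_S[OF that] u[OF that] by auto
  have T: "c g * lev ka 3 (hone (Fib ka)) - lev ka 3 (\<pi> ka (c g)) \<in> S'" if "ka \<in> K" for ka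
   using L[OF that] gS by simp
  have "(\<Sum>ka\<in>K. g * j (lev ka 3 (hone (Fib ka))) - j (lev ka 3 (\<pi> ka (c g))))
   = (\<Sum>ka\<in>K. j (c g * lev ka 3 (hone (Fib ka)) - lev ka 3 (\<pi> ka (c g))))"
   using L gS by (intro sum.cong refl) (simp add: mod j0(1))
  also have "\<dots> = j (\<Sum>ka\<in>K. c g * lev ka 3 (hone (Fib ka)) - lev ka 3 (\<pi> ka (c g)))"
   using T by (intro star_map_sum[OF j P.hcstar_axioms, symmetric]) auto
  finally show "nm (\<Sum>ka\<in>K. g * j (lev ka 3 (hone (Fib ka))) - j (lev ka 3 (\<pi> ka (c g)))) <= \<epsilon>"
   using order_trans[OF con P.approx[of "c g"]] P.S_sum[OF T, of K "\<lambda>ka. ka"] g by simp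
 next
  fix ka assume k: "ka \<in> K"
  show "star_map S st (hS (Fib ka)) (hst (Fib ka)) (\<lambda>x. \<pi> ka (c x))" by (rule star_map_comp[OF c(1) P.\<pi>(1)[OF k]])
  show "\<pi> ka (c e) = hone (Fib ka)" using P.\<pi>(2)[OF k] c(2) by simp
  fix x and i :: nat assume x: "x \<in> hS (Fib ka)" and i: "i < 4"
  note Lx = P.lev_S[OF k x i]
  show "j (lev ka i x) \<in> S" by (rule J(1)[OF Lx])
  show "j (lev ka i (a *c x)) = a *c j (lev ka i x)" for a using P.lev_scl[OF k x i] J(3)[OF Lx] by simp
  show "st (j (lev ka i x)) = j (lev ka i (hst (Fib ka) x))" using P.lev_st[OF k x i] J(2)[OF Lx] by simp
  show "nm (j (lev ka i x)) <= hnm (Fib ka) x" using P.lev_nm[OF k x i] con[OF Lx] by simp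
  show "j (lev ka i (x + y)) = j (lev ka i x) + j (lev ka i y)" if "y \<in> hS (Fib ka)" for y
   using P.lev_add[OF k x that i] J(4)[OF Lx P.lev_S[OF k that i]] by simp
  show "j (lev ka i x) * j (lev ka i' y) = j (lev ka (min i i') (x * y))" if "y \<in> hS (Fib ka)" "i' < 4" "i ~= i'" for y i'
   using P.lev_mult[OF k x that(1) i that(2,3)] J(5)[OF Lx P.lev_S[OF k that(1,2)]] by simp
  show "j (lev ka i x) * j (lev ka' i' y) = 0" if "ka' \<in> K" "ka ~= ka'" "y \<in> hS (Fib ka')" "i' < 4" for ka' y i'
   using P.lev_orth[OF k that(1,2) x that(3) i that(4)] J(5)[OF Lx P.lev_S[OF that(1,3,4)]] j0(2)[OF P.S_0 P.S_0] by simp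
 qed (use P.K P.Fib in auto)
qed

lemma fd_pieces:
 assumes F: "fd_cstar_algebra F" and \<epsilon>: "0 < \<epsilon>" and G: "G \<subseteq> hS F"
 shows "pieces (hS F) (hst F) (hnm F) (hone F) {0::nat} (\<lambda>_. F) (\<lambda>_ _ x. x) (\<lambda>_ x. x) \<epsilon> G"
proof -
 have A: "cstar_algebra F" using F by (simp add: fd_cstar_algebra_def)
 interpret M: monoid F by (rule fd_unit(1)[OF F])
 have H: "hcstar1 (hS F) (hst F) (hnm F) (hone F)" by (rule hcstar1_hosted[OF A]) auto
 interpret hcstar1 "hS F" "hst F" "hnm F" "hone F" by (rule H)
 show ?thesis by (intro pieces.intro H pieces_axioms.intro) (use F G \<epsilon> in \<open>auto simp: star_map_def subset_iff\<close>)
qed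

context decomposed
begin

lemma transported_pieces:
 fixes N :: nat
 assumes k: "k < l" and G: "finite G" "G \<subseteq> hS A"
  and H': "hcstar1 S' st' nm' e'" and r: "star_map S' st' (hS (blk k)) (hst (blk k)) r" "bij_betw r S' (hS (blk k))" "r e' = ub k"
  and ex: "!!G. finite G ==> G \<subseteq> S' ==> \<exists>(K::nat set) (Fib :: nat => 'f cstar) lev \<pi>. (\<forall>i<N. pieces S' st' nm' e' K Fib (lev i) (\<pi> i) \<epsilon> G) &
   (\<forall>i<N. \<forall>j<N. i ~= j --> (e' - core K Fib (lev i)) * (e' - core K Fib (lev j)) = 0)"
 shows "\<exists>(K::nat set) (Fib :: nat => 'f cstar) lev \<pi>. (\<forall>i<N. pieces (hS A) (hst A) (hnm A) u K Fib (lev i) (\<pi> i) \<epsilon> G) &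
   (\<forall>i<N. \<forall>j<N. i ~= j --> (z k - core K Fib (lev i)) * (z k - core K Fib (lev j)) = 0) &
   (\<forall>i<N. \<forall>ka\<in>K. \<forall>x\<in>hS (Fib ka). \<forall>j<4. z k * lev i ka j x = lev i ka j x)"
proof -
 interpret S': hcstar1 S' st' nm' e' by (rule H')
 define c where "c x = inv_into S' r (cH k x)" for x
 define j where "j y = jH k (r y)" for y
 have c: "star_map (hS A) (hst A) S' st' c"
  unfolding c_def by (rule star_map_comp[OF cH[OF k] star_map_inv[OF r(1,2) S'.hcstar_axioms]])
 have j: "star_map S' st' (hS A) (hst A) j" unfolding j_def by (rule star_map_comp[OF r(1) jH[OF k]])
 have cu: "c u = e'" using r(2) S'.e_S by (simp add: c_def cH_u[OF k] r(3)[symmetric] bij_betw_def)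
 have je: "j e' = z k" by (simp add: j_def r(3) z_def)
 have jc: "j (c x) = z k * x" if x: "x \<in> hS A" for x
 proof -
  have "cH k x \<in> r ` S'" using r(2) star_mapD(1)[OF cH[OF k] x] by (simp add: bij_betw_def)
  then show ?thesis using z_props(5)[OF k x] by (simp add: j_def c_def f_inv_into_f)
 qed
 have zj: "z k * j y = j y" if "y \<in> S'" for y unfolding j_def by (rule z_props(6)[OF k star_mapD(1)[OF r(1) that]])
 have mod: "x * j y = j (c x * y)" if x: "x \<in> hS A" and y: "y \<in> S'" for x y
 proof -
  have "j (c x * y) = z k * x * j y" using star_mapD(5)[OF j star_mapD(1)[OF c x] y] jc[OF x] by simp
  also have "\<dots> = x * (z k * j y)" using z_props(4)[OF k x] by (simp add: mult.assoc)
  finally show ?thesis using zj[OF y] by simp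
 qed
 have cG: "c ` G \<subseteq> S'" using G star_mapD(1)[OF c] by auto
 from ex[OF finite_imageI[OF G(1)] cG] obtain K :: "nat set" and Fib :: "nat => 'f cstar" and lev \<pi>
  where PO: "(\<forall>i<N. pieces S' st' nm' e' K Fib (lev i) (\<pi> i) \<epsilon> (c ` G)) &
   (\<forall>i<N. \<forall>j<N. i ~= j --> (e' - core K Fib (lev i)) * (e' - core K Fib (lev j)) = 0)"
  by (elim exE)
 note P = PO[THEN conjunct1, rule_format] and O = PO[THEN conjunct2, rule_format]
 have ones: "hone (Fib ka) \<in> hS (Fib ka)" if "i < N" "ka \<in> K" for i ka
  using star_mapD(1)[OF pieces.\<pi>(1)[OF P[OF that(1)] that(2)] S'.e_S] pieces.\<pi>(2)[OF P[OF that(1)] that(2)] by simp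
 have coreS: "lev i ka 0 (hone (Fib ka)) \<in> S'" if "i < N" "ka \<in> K" for i ka
  using pieces.lev_S[OF P[OF that(1)] that(2) ones[OF that]] by simp
 have core_in: "core K Fib (lev i) \<in> S'" if "i < N" for i unfolding core_def using coreS[OF that] by (rule S'.S_sum)
 have core_j: "z k - core K Fib (\<lambda>ka n x. j (lev i ka n x)) = j (e' - core K Fib (lev i))" if i: "i < N" for i
 proof -
  have "core K Fib (\<lambda>ka n x. j (lev i ka n x)) = j (core K Fib (lev i))"
   unfolding core_def using coreS[OF i] by (intro star_map_sum[OF j S'.hcstar_axioms, symmetric]) auto
  then show ?thesis using star_map_diff(1)[OF j S'.hcstar_axioms S'.e_S core_in[OF i]] by (simp add: je)
 qed
 show ?thesis
 proof (intro exI conjI allI impI ballI)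
  fix i assume i: "i < N"
  show "pieces (hS A) (hst A) (hnm A) u K Fib (\<lambda>ka n x. j (lev i ka n x)) (\<lambda>ka x. \<pi> i ka (c x)) \<epsilon> G"
   by (rule pieces_transport[OF P[OF i] H G(2) c cu j mod])
  fix i' assume i': "i' < N" "i ~= i'"
  show "(z k - core K Fib (\<lambda>ka n x. j (lev i ka n x))) * (z k - core K Fib (\<lambda>ka n x. j (lev i' ka n x))) = 0"
   unfolding core_j[OF i] core_j[OF i'(1)]
   using star_mapD(5)[OF j S'.S_diff[OF S'.e_S core_in[OF i]] S'.S_diff[OF S'.e_S core_in[OF i'(1)]]] O[OF i i']
    star_map_diff(2)[OF j S'.hcstar_axioms S'.S_0 S'.S_0] by simp
 next
  fix i ka x and n :: nat assume "i < N" "ka \<in> K" "x \<in> hS (Fib ka)" "n < 4"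
  then show "z k * j (lev i ka n x) = j (lev i ka n x)" using pieces.lev_S[OF P] by (intro zj) auto
 qed
qed

lemma block_pieces:
 fixes N :: nat
 assumes k: "k < l" and G: "finite G" "G \<subseteq> hS A" and \<epsilon>: "0 < \<epsilon>"
 shows "\<exists>(K::nat set) (Fib :: nat => 'f cstar) lev \<pi>. (\<forall>i<N. pieces (hS A) (hst A) (hnm A) u K Fib (lev i) (\<pi> i) \<epsilon> G) &
   (\<forall>i<N. \<forall>j<N. i ~= j --> (z k - core K Fib (lev i)) * (z k - core K Fib (lev j)) = 0) &
   (\<forall>i<N. \<forall>ka\<in>K. \<forall>x\<in>hS (Fib ka). \<forall>j<4. z k * lev i ka j x = lev i ka j x)"
proof (cases "Cs ! k")
 case (FinDim F)
 then have F: "fd_cstar_algebra F" "cstar_algebra F" using block[OF k] by (auto simp: fd_cstar_algebra_def)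
 have b: "blk k = transport Inl projl F" by (simp add: FinDim)
 note t = transport_simps[where f = "Inl :: 'f => 'f + (real => 'f) \<times> 'f" and g = projl and F = F, simplified, folded b]
 have f1: "\<one>\<^bsub>F\<^esub> \<in> carrier F" by (rule fd_unit(2)[OF F(1)])
 have r: "star_map (hS F) (hst F) (hS (blk k)) (hst (blk k)) (hmap F (blk k) Inl)"
  using transport_cstar(3)[OF F(2) fd_unit(1)[OF F(1)], of projl Inl] by (intro star_map_hmap F blk k) (simp add: b)
 have bij: "bij_betw (hmap F (blk k) Inl) (hS F) (hS (blk k))"
 proof (rule bij_betw_imageI)
  show "inj_on (hmap F (blk k) Inl) (hS F)"
   by (auto simp: inj_on_def hS_def hmap_emb[OF F(2)] emb_inj[OF blk(1)[OF k]] t(1))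
  show "hmap F (blk k) Inl ` hS F = hS (blk k)" by (auto simp: hS_def hmap_emb[OF F(2)] t image_iff)
 qed
 show ?thesis
 proof (rule transported_pieces[OF k G _ r bij])
  show "hcstar1 (hS F) (hst F) (hnm F) (hone F)" using fd_pieces[OF F(1) \<epsilon>, of "{}"] by (simp add: pieces_def)
  show "hmap F (blk k) Inl (hone F) = ub k" by (simp add: hmap_emb[OF F(2) f1] t)
  fix G' :: "'f host set" assume "G' \<subseteq> hS F"
  then show "\<exists>(K::nat set) (Fib :: nat => 'f cstar) lev \<pi>. (\<forall>i<N. pieces (hS F) (hst F) (hnm F) (hone F) K Fib (lev i) (\<pi> i) \<epsilon> G') &
   (\<forall>i<N. \<forall>j<N. i ~= j --> (hone F - core K Fib (lev i)) * (hone F - core K Fib (lev j)) = 0)"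
   using fd_pieces[OF F(1) \<epsilon>]
   by (intro exI[of _ "{0::nat}"] exI[of _ "\<lambda>_::nat. F"] exI[of _ "\<lambda>(_::nat) (_::nat) (_::nat) x::'f host. x"] exI[of _ "\<lambda>(_::nat) (_::nat) x::'f host. x"]) (simp add: core_def)
 qed
next
 case (ET F1 F2 \<phi>0 \<phi>1)
 interpret et_data F1 F2 \<phi>0 \<phi>1 using block[OF k] ET by unfold_locales simp
 have b: "blk k = transport Inr projr R" by (simp add: ET)
 note t = transport_simps[where f = "Inr :: (real => 'f) \<times> 'f => 'f + (real => 'f) \<times> 'f" and g = projr and F = R, simplified, folded b]
 define r where "r X = emb (blk k) (Inr (\<iota> X))" for X
 have Rc: "carrier R = \<iota> ` ES"
 proof
  show "carrier R \<subseteq> \<iota> ` ES" using \<iota>'_in by (metis image_eqI subsetI)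
 qed (use \<iota>_carrier in blast)
 note B = blk(1)[OF k]
 have rc: "Inr (\<iota> X) \<in> carrier (blk k)" if "X \<in> ES" for X using \<iota>_carrier[OF that] by (simp add: t)
 have r: "star_map ES Est (hS (blk k)) (hst (blk k)) r"
  unfolding star_map_def r_def
 proof (intro ballI conjI allI)
  fix X assume X: "X \<in> ES"
  note o = \<iota>_ops[OF X X]
  show "emb (blk k) (Inr (\<iota> X)) \<in> hS (blk k)" by (rule emb_in[OF B rc[OF X]])
  show "emb (blk k) (Inr (\<iota> (Est X))) = hst (blk k) (emb (blk k) (Inr (\<iota> X)))"
   unfolding emb_st[OF B rc[OF X]] t(5) o(4) ..
  show "emb (blk k) (Inr (\<iota> (a *c X))) = a *c emb (blk k) (Inr (\<iota> X))" for a
   unfolding emb_scl[OF B rc[OF X], symmetric] t(4) o(3) ..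
  fix Y assume Y: "Y \<in> ES"
  show "emb (blk k) (Inr (\<iota> (X + Y))) = emb (blk k) (Inr (\<iota> X)) + emb (blk k) (Inr (\<iota> Y))"
   unfolding emb_add[OF B rc[OF X] rc[OF Y], symmetric] t(2) \<iota>_ops(1)[OF X Y] ..
  show "emb (blk k) (Inr (\<iota> (X * Y))) = emb (blk k) (Inr (\<iota> X)) * emb (blk k) (Inr (\<iota> Y))"
   unfolding emb_mult[OF B rc[OF X] rc[OF Y], symmetric] t(3) \<iota>_ops(2)[OF X Y] ..
 qed
 have bij: "bij_betw r ES (hS (blk k))"
 proof (rule bij_betw_imageI)
  show "inj_on r ES" using rc \<iota>_inj by (auto simp: inj_on_def r_def emb_inj[OF B])
  show "r ` ES = hS (blk k)" unfolding r_def hS_def t(1) Rc by (simp add: image_image)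
 qed
 have "r Eu = ub k" unfolding r_def t(8) \<iota>_units(2) ..
 then show ?thesis by (rule transported_pieces[OF k G E r bij _ et_pieces_exist[OF _ _ \<epsilon>]])
qed

text \<open>The union of the pieces of all blocks. The defect is estimated block by block, since the blocks are
cut out by orthogonal central projections.\<close>

lemma sum_pieces_exist:
 fixes N :: nat
 assumes G: "finite G" "G \<subseteq> hS A" and \<epsilon>: "0 < \<epsilon>"
 shows "\<exists>(K::(nat \<times> nat) set) (Fib :: nat \<times> nat => 'f cstar) lev \<pi>. (\<forall>i<N. pieces (hS A) (hst A) (hnm A) u K Fib (lev i) (\<pi> i) \<epsilon> G) &
   (\<forall>i<N. \<forall>j<N. i ~= j --> (u - core K Fib (lev i)) * (u - core K Fib (lev j)) = 0)"
proof (cases "N = 0")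
 case False
 define PP where "PP k K Fib lev \<pi> \<longleftrightarrow> (\<forall>i<N. pieces (hS A) (hst A) (hnm A) u K Fib (lev i) (\<pi> i) \<epsilon> G) &
   (\<forall>i<N. \<forall>j<N. i ~= j --> (z k - core K Fib (lev i)) * (z k - core K Fib (lev j)) = 0) &
   (\<forall>i<N. \<forall>ka\<in>K. \<forall>x\<in>hS (Fib ka). \<forall>j<4. z k * lev i ka j x = lev i ka j x)"
  for k and K :: "nat set" and Fib :: "nat => 'f cstar" and lev \<pi>
 have "\<exists>K Fib lev \<pi>. PP k K Fib lev \<pi>" if "k < l" for k unfolding PP_def by (rule block_pieces[OF that G \<epsilon>])
 then obtain K Fib lev \<pi> where "!!k. k < l ==> PP k (K k) (Fib k) (lev k) (\<pi> k)" by metis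
 then have P: "!!k i. k < l ==> i < N ==> pieces (hS A) (hst A) (hnm A) u (K k) (Fib k) (lev k i) (\<pi> k i) \<epsilon> G"
  and O: "!!k i j. k < l ==> i < N ==> j < N ==> i ~= j ==> (z k - core (K k) (Fib k) (lev k i)) * (z k - core (K k) (Fib k) (lev k j)) = 0"
  and Z: "!!k i ka x j. k < l ==> i < N ==> ka \<in> K k ==> x \<in> hS (Fib k ka) ==> j < 4 ==> z k * lev k i ka j x = lev k i ka j x"
  unfolding PP_def by blast+
 define K' where "K' = Sigma {..<l} K"
 define Fib' where "Fib' = (\<lambda>(k, q). Fib k q)"
 define lev' where "lev' i = (\<lambda>(k, q). lev k i q)" for i
 define \<pi>' where "\<pi>' i = (\<lambda>(k, q). \<pi> k i q)" for i
 have finK: "finite (K k)" if "k < l" for k using pieces.K[OF P[OF that, of 0]] False by simp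
 have sum_K': "(\<Sum>ka\<in>K'. f ka) = (\<Sum>k<l. \<Sum>q\<in>K k. f (k, q))" for f :: "nat \<times> nat => 'a host"
  unfolding K'_def using finK by (subst sum.Sigma) auto
 have ones: "hone (Fib k q) \<in> hS (Fib k q)" if "k < l" "i < N" "q \<in> K k" for k i q
  using star_mapD(1)[OF pieces.\<pi>(1)[OF P[OF that(1,2)] that(3)] e_S] pieces.\<pi>(2)[OF P[OF that(1,2)] that(3)] by simp
 have core_in: "core (K k) (Fib k) (lev k i) \<in> hS A" if "k < l" "i < N" for k i
  unfolding core_def using ones[OF that] pieces.lev_S[OF P[OF that]] by (intro S_sum) auto
 have zcore: "z k * core (K k) (Fib k) (lev k i) = core (K k) (Fib k) (lev k i)" if "k < l" "i < N" for k i
  unfolding core_def sum_distrib_left using Z[OF that] ones[OF that] by (intro sum.cong) auto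
 show ?thesis
 proof (intro exI conjI allI impI)
  fix i assume i: "i < N"
  show "pieces (hS A) (hst A) (hnm A) u K' Fib' (lev' i) (\<pi>' i) \<epsilon> G"
  proof (intro pieces.intro H pieces_axioms.intro)
   show "finite K'" unfolding K'_def using finK by auto
   fix g assume g: "g \<in> G"
   define y where "y k = (\<Sum>q\<in>K k. g * lev k i q 3 (hone (Fib k q)) - lev k i q 3 (\<pi> k i q g))" for k
   have gS: "g \<in> hS A" using g G by blast
   have pg: "\<pi> k i q g \<in> hS (Fib k q)" if "k < l" "q \<in> K k" for k q using star_mapD(1)[OF pieces.\<pi>(1)[OF P[OF that(1) i] that(2)] gS] .
   have L: "lev k i q 3 (hone (Fib k q)) \<in> hS A" "lev k i q 3 (\<pi> k i q g) \<in> hS A" if "k < l" "q \<in> K k" for k q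
    using pieces.lev_S[OF P[OF that(1) i] that(2)] ones[OF that(1) i that(2)] pg[OF that] by auto
   have yS: "y k \<in> hS A" if "k < l" for k unfolding y_def using L[OF that] gS by (intro S_sum S_diff S_mult) auto
   have zy: "z k * y k = y k" if k: "k < l" for k
    unfolding y_def sum_distrib_left
   proof (rule sum.cong[OF refl])
    fix q assume q: "q \<in> K k"
    have "z k * (g * lev k i q 3 (hone (Fib k q))) = g * (z k * lev k i q 3 (hone (Fib k q)))"
     using z_props(4)[OF k gS] by (simp flip: mult.assoc)
    then show "z k * (g * lev k i q 3 (hone (Fib k q)) - lev k i q 3 (\<pi> k i q g))
      = g * lev k i q 3 (hone (Fib k q)) - lev k i q 3 (\<pi> k i q g)"
     using Z[OF k i q ones[OF k i q]] Z[OF k i q pg[OF k q]] by (simp add: right_diff_distrib)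
   qed
   have "(\<Sum>ka\<in>K'. g * lev' i ka 3 (hone (Fib' ka)) - lev' i ka 3 (\<pi>' i ka g)) = (\<Sum>k<l. y k)"
    unfolding sum_K' by (simp add: y_def Fib'_def lev'_def \<pi>'_def)
   also have "\<dots> = (\<Sum>k<l. z k * y k)" using zy by (intro sum.cong) auto
   also have "hnm A \<dots> <= \<epsilon>"
   proof (rule nm_central_sum_le)
    fix k assume "k \<in> {..<l}"
    then have k: "k < l" by simp
    show "z k \<in> hS A" "z k * z k = z k" "hst A (z k) = z k" by (rule z_S[OF k] z_props[OF k])+
    show "z k * x = x * z k" if "x \<in> hS A" for x by (rule z_props(4)[OF k that])
    show "z k * z j = 0" if "j \<in> {..<l}" "k ~= j" for j using that by (intro z_props(3)[OF k]) auto
    show "y k \<in> hS A" by (rule yS[OF k])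
    show "hnm A (y k) <= \<epsilon>" unfolding y_def by (rule pieces.approx[OF P[OF k i] g])
   qed (use \<epsilon> in auto)
   finally show "hnm A (\<Sum>ka\<in>K'. g * lev' i ka 3 (hone (Fib' ka)) - lev' i ka 3 (\<pi>' i ka g)) <= \<epsilon>" .
  next
   fix ka assume "ka \<in> K'"
   then obtain k q where kq: "ka = (k, q)" "k < l" "q \<in> K k" by (auto simp: K'_def)
   note Pk = P[OF kq(2) i]
   have s: "Fib' ka = Fib k q" "lev' i ka = lev k i q" "\<pi>' i ka = \<pi> k i q" by (simp_all add: Fib'_def lev'_def \<pi>'_def kq)
   show "fd_cstar_algebra (Fib' ka)" unfolding s by (rule pieces.Fib[OF Pk kq(3)])
   show "star_map (hS A) (hst A) (hS (Fib' ka)) (hst (Fib' ka)) (\<pi>' i ka)" "\<pi>' i ka u = hone (Fib' ka)"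
    unfolding s by (rule pieces.\<pi>[OF Pk kq(3)])+
   fix x and j :: nat assume x: "x \<in> hS (Fib' ka)" and j: "j < 4"
   show "lev' i ka j x \<in> hS A" "hnm A (lev' i ka j x) <= hnm (Fib' ka) x" "hst A (lev' i ka j x) = lev' i ka j (hst (Fib' ka) x)"
    "lev' i ka j (a *c x) = a *c lev' i ka j x" for a
    using pieces.lev_S[OF Pk kq(3) x[unfolded s] j] pieces.lev_nm[OF Pk kq(3) x[unfolded s] j]
     pieces.lev_st[OF Pk kq(3) x[unfolded s] j] pieces.lev_scl[OF Pk kq(3) x[unfolded s] j] unfolding s by blast+
   show "lev' i ka j (x + y) = lev' i ka j x + lev' i ka j y" if "y \<in> hS (Fib' ka)" for y
    using pieces.lev_add[OF Pk kq(3) x[unfolded s] that[unfolded s] j] unfolding s .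
   show "lev' i ka j x * lev' i ka j' y = lev' i ka (min j j') (x * y)" if "y \<in> hS (Fib' ka)" "j' < 4" "j ~= j'" for y j'
    using pieces.lev_mult[OF Pk kq(3) x[unfolded s] that(1)[unfolded s] j that(2,3)] unfolding s .
   show "lev' i ka j x * lev' i ka' j' y = 0" if y: "ka' \<in> K'" "ka ~= ka'" "y \<in> hS (Fib' ka')" "j' < 4" for ka' y j'
   proof -
    obtain k' q' where kq': "ka' = (k', q')" "k' < l" "q' \<in> K k'" using y(1) by (auto simp: K'_def)
    have s': "Fib' ka' = Fib k' q'" "lev' i ka' = lev k' i q'" by (simp_all add: Fib'_def lev'_def kq')
    note ys = y(3)[unfolded s'] and xs = x[unfolded s]
    show ?thesis
    proof (cases "k = k'")
     case True
     then show ?thesis using pieces.lev_orth[OF Pk kq(3), of q' x y j j'] kq kq' y(2,4) ys xs j unfolding s s' by simp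
    next
     case False
     have "lev k i q j x * lev k' i q' j' y = (z k * lev k i q j x) * (z k' * lev k' i q' j' y)"
      using Z[OF kq(2) i kq(3) xs j] Z[OF kq'(2) i kq'(3) ys y(4)] by simp
     also have "\<dots> = lev k i q j x * (z k * z k') * lev k' i q' j' y"
      using z_props(4)[OF kq(2) pieces.lev_S[OF Pk kq(3) xs j]] by (simp add: mult.assoc)
     finally show ?thesis using z_props(3)[OF kq(2) kq'(2)] False unfolding s s' by simp
    qed
   qed
  qed
  fix j assume j: "j < N" "i ~= j"
  define v where "v i k = z k - core (K k) (Fib k) (lev k i)" for i k
  have v: "u - core K' Fib' (lev' i) = (\<Sum>k<l. v i k)" for i
   unfolding v_def sum_subtractf z_sum unfolding core_def sum_K' by (simp add: Fib'_def lev'_def)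
  have vS: "v i k \<in> hS A" "z k * v i k = v i k" if "k < l" "i < N" for i k
   using core_in[OF that] z_S[OF that(1)] zcore[OF that] z_props(1)[OF that(1)] by (simp_all add: v_def right_diff_distrib)
  have "(\<Sum>k<l. v i k) * (\<Sum>k<l. v j k) = (\<Sum>k<l. \<Sum>k'<l. v i k * v j k')" by (rule sum_product)
  also have "\<dots> = 0"
  proof (intro sum.neutral ballI)
   fix k k' assume "k \<in> {..<l}" "k' \<in> {..<l}"
   then have k: "k < l" "k' < l" by auto
   show "v i k * v j k' = 0"
   proof (cases "k = k'")
    case True
    then show ?thesis using O[OF k(1) i j] by (simp add: v_def)
   next
    case False
    have "v i k * v j k' = (z k * v i k) * (z k' * v j k')" using vS[OF k(1) i] vS[OF k(2) j(1)] by simp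
    also have "\<dots> = v i k * (z k * z k') * v j k'" using z_props(4)[OF k(1) vS(1)[OF k(1) i]] by (simp add: mult.assoc)
    finally show ?thesis using z_props(3)[OF k] False by simp
   qed
  qed
  finally show "(u - core K' Fib' (lev' i)) * (u - core K' Fib' (lev' j)) = 0" by (simp add: v)
 qed
qed simp

end

section \<open>Moving matrix units onto a projection\<close>

lemma (in munits) nm_m_le_1: assumes "i < d" "j < d" "rp i = rp j" shows "nm (m i j) <= 1"
proof -
 have "(nm (m i j))\<^sup>2 = nm (m j j)" using nm_cstar[OF m(1)[OF assms]] m(3)[OF assms] m_mult[OF assms(2,1,1,2) assms(3)[symmetric] assms(3)] by simp
 then have "(nm (m i j))\<^sup>2 = 1\<^sup>2" using nm_m[OF assms(2)] by simp
 then show ?thesis using power2_le_imp_le[of "nm (m i j)" 1] by simp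
qed

text \<open>The image of a system of pieces at a later stage together with, for every class of matrix units in a fibre, a projection \<open>s\<close> between
the bumps of level 0 and level 2 of a minimal projection.\<close>

locale stage = pieces S st nm e K Fib lev \<pi> \<epsilon> G + T: hcstar1 S' st' nm' e'
 for S :: "'h::complex_alg set" and st nm e and K :: "'k set" and Fib :: "'k => 'f cstar" and lev \<pi> \<epsilon> G
  and S' :: "'g::complex_alg set" and st' nm' e' +
 fixes f :: "'h => 'g" and d :: "'k => nat" and rp :: "'k => nat => nat" and mu :: "'k => nat => nat => 'f host"
  and \<beta> :: "'k => nat => nat => 'f host => complex" and s :: "'k => nat => 'g" and \<delta> :: real
 assumes f: "star_map S st S' st' f"
  and mun: "ka \<in> K ==> munits (hS (Fib ka)) (hst (Fib ka)) (hnm (Fib ka)) (hone (Fib ka)) (d ka) (rp ka) (mu ka) (\<beta> ka)"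
  and s: "ka \<in> K ==> a < d ka ==> rp ka a = a ==> s ka a \<in> S'" "ka \<in> K ==> a < d ka ==> rp ka a = a ==> s ka a * s ka a = s ka a"
   "ka \<in> K ==> a < d ka ==> rp ka a = a ==> st' (s ka a) = s ka a"
  and s_near: "ka \<in> K ==> a < d ka ==> rp ka a = a ==> nm' (f (lev ka 0 (mu ka a a)) - s ka a * f (lev ka 0 (mu ka a a))) <= \<delta>"
  and s_kill: "ka \<in> K ==> a < d ka ==> rp ka a = a ==> x \<in> S' ==> x * f (lev ka 2 (mu ka a a)) = 0 ==> x * s ka a = 0"
begin

definition E :: "nat => 'k => nat => nat => 'g" where "E j ka a b = f (lev ka j (mu ka a b))"

lemmas fD = star_mapD[OF f]
lemmas f0 = star_map_diff[OF f hcstar_axioms]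
lemma f_zero [simp]: "f 0 = 0" by (rule f0(2)[OF S_0 S_0])

lemma mu_S: "ka \<in> K ==> a < d ka ==> b < d ka ==> rp ka a = rp ka b ==> mu ka a b \<in> hS (Fib ka)"
 using munits.m(1)[OF mun] .
lemma rpr: "ka \<in> K ==> a < d ka ==> rp ka a < d ka" "ka \<in> K ==> a < d ka ==> rp ka (rp ka a) = rp ka a"
 using munits.rp[OF mun] by blast+
lemma fib0: "ka \<in> K ==> hcstar (hS (Fib ka)) (hst (Fib ka)) (hnm (Fib ka))"
 using mun by (simp add: munits_def hcstar1_def)
lemma L0: assumes "ka \<in> K" "j < 4" shows "lev ka j 0 = 0"
 using lev_scl[OF assms(1) hcstar.S_0[OF fib0[OF assms(1)]] assms(2), of 0] by simp

lemma E_S: "ka \<in> K ==> a < d ka ==> b < d ka ==> rp ka a = rp ka b ==> j < 4 ==> E j ka a b \<in> S'"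
 unfolding E_def by (intro fD(1) lev_S mu_S)

lemma E_st: assumes "ka \<in> K" "a < d ka" "b < d ka" "rp ka a = rp ka b" "j < 4" shows "st' (E j ka a b) = E j ka b a"
 unfolding E_def
 using fD(2)[OF lev_S[OF assms(1) mu_S[OF assms(1-4)] assms(5)]] lev_st[OF assms(1) mu_S[OF assms(1-4)] assms(5)] munits.m(3)[OF mun[OF assms(1)] assms(2-4)] by simp

lemma E_mult: assumes "ka \<in> K" "a < d ka" "b < d ka" "rp ka a = rp ka b" "b' < d ka" "c < d ka" "rp ka b' = rp ka c" "j < 4" "j' < 4" "j ~= j'"
 shows "E j ka a b * E j' ka b' c = (if b = b' then E (min j j') ka a c else 0)"
proof -
 note ab = mu_S[OF assms(1-4)] and bc = mu_S[OF assms(1,5-7)]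
 have "E j ka a b * E j' ka b' c = f (lev ka (min j j') (mu ka a b * mu ka b' c))"
  unfolding E_def using fD(5)[OF lev_S[OF assms(1) ab assms(8)] lev_S[OF assms(1) bc assms(9)]] lev_mult[OF assms(1) ab bc assms(8-10)] by simp
 moreover have "mu ka a b * mu ka b' c = (if b = b' then mu ka a c else 0)"
  using munits.m_mult[OF mun[OF assms(1)] assms(2,3,5,6,4,7)] .
 ultimately show ?thesis using L0[OF assms(1), of "min j j'"] assms(8) by (simp add: E_def)
qed

lemma E_orth: assumes "ka \<in> K" "a < d ka" "b < d ka" "rp ka a = rp ka b" "ka' \<in> K" "b' < d ka'" "c < d ka'" "rp ka' b' = rp ka' c" "j < 4" "j' < 4" "ka ~= ka'"
 shows "E j ka a b * E j' ka' b' c = 0"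
 unfolding E_def
 using fD(5)[OF lev_S[OF assms(1) mu_S[OF assms(1-4)] assms(9)] lev_S[OF assms(5) mu_S[OF assms(5-8)] assms(10)]]
  lev_orth[OF assms(1,5,11) mu_S[OF assms(1-4)] mu_S[OF assms(5-8)] assms(9,10)] by simp

definition w :: "'k => nat => 'g" where "w ka a = E 3 ka a (rp ka a)"
definition q :: "'k => nat => 'g" where "q ka a = s ka (rp ka a)"
text \<open>The projection of the representative, moved by the bumps of level 3 to all matrix units of the class.\<close>

definition mm :: "'k => nat => nat => 'g" where "mm ka a b = w ka a * q ka a * st' (w ka b)"
definition r :: 'g where "r = (\<Sum>ka\<in>K. \<Sum>a<d ka. mm ka a a)"

lemma w_S: "ka \<in> K ==> a < d ka ==> w ka a \<in> S'" unfolding w_def using rpr by (intro E_S) auto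
lemma w_st: "ka \<in> K ==> a < d ka ==> st' (w ka a) = E 3 ka (rp ka a) a" unfolding w_def using rpr by (intro E_st) auto
lemma q: "ka \<in> K ==> a < d ka ==> q ka a \<in> S'" "ka \<in> K ==> a < d ka ==> q ka a * q ka a = q ka a" "ka \<in> K ==> a < d ka ==> st' (q ka a) = q ka a"
 unfolding q_def using s rpr by blast+
lemma q_kill: "ka \<in> K ==> a < d ka ==> x \<in> S' ==> x * E 2 ka (rp ka a) (rp ka a) = 0 ==> x * q ka a = 0"
 unfolding q_def E_def using s_kill[of ka "rp ka a"] rpr by blast
lemma mm_S: "ka \<in> K ==> a < d ka ==> b < d ka ==> mm ka a b \<in> S'"
 unfolding mm_def using w_S q by simp
lemma r_S: "r \<in> S'" unfolding r_def using mm_S by (intro T.S_sum) auto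

text \<open>The identity holds after multiplication by the bump of level 2 instead of \<open>q\<close>, by the product rule for levels; the
property \<open>s_kill\<close> transfers it to \<open>q\<close>. So the bumps of level 3, which do not multiply like matrix units, do so on the projections.\<close>

lemma Ew: assumes "ka \<in> K" "a < d ka" "b < d ka" "rp ka a = rp ka b" "ka' \<in> K" "c < d ka'"
 shows "E 3 ka a b * w ka' c * q ka' c = (if ka = ka' & b = c then w ka a * q ka a else 0)"
proof (cases "ka = ka'")
 case False
 then show ?thesis using E_orth[OF assms(1-6) rpr(1)[OF assms(5,6)] _ _ _ False, of 3 3] rpr(2)[OF assms(5,6)] by (simp add: w_def)
next
 case True
 then have c: "c < d ka" using assms(6) by simp
 define R where "R = rp ka c"
 have R: "R < d ka" "rp ka c = rp ka R" "rp ka R = rp ka R" "rp ka c = R" "rp ka R = R" using rpr[OF assms(1) c] by (simp_all add: R_def)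
 have e2: "w ka c * E 2 ka R R = E 2 ka c R"
  using E_mult[OF assms(1) c R(1,2) R(1,1,3), of 3 2] R(4) by (simp add: w_def)
 have e3: "E 3 ka a b * E 2 ka c R = (if b = c then E 2 ka a R else 0)"
  using E_mult[OF assms(1-4) c R(1,2), of 3 2] by simp
 have w3: "w ka a * E 2 ka R R = E 2 ka a R" if "b = c"
 proof -
  have "rp ka a = R" using assms(4) that R(4) by simp
  then show ?thesis using E_mult[OF assms(1,2) R(1) _ R(1,1,3), of 3 2] R(5) by (simp add: w_def)
 qed
 have z: "(E 3 ka a b * w ka c - (if b = c then w ka a else 0)) * E 2 ka R R = 0"
  using e2 e3 w3 by (simp add: left_diff_distrib mult.assoc)
 have zS: "E 3 ka a b * w ka c - (if b = c then w ka a else 0) \<in> S'"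
  using E_S[OF assms(1-4), of 3] w_S[OF assms(1) c] w_S[OF assms(1,2)] by simp
 have "(E 3 ka a b * w ka c - (if b = c then w ka a else 0)) * q ka c = 0"
  by (rule q_kill[OF assms(1) c zS]) (use z R(4) in simp)
 moreover have "q ka c = q ka a" if "b = c" using that assms(4) by (simp add: q_def)
 ultimately show ?thesis using True by (auto simp: left_diff_distrib)
qed

lemma w_mult: assumes "ka \<in> K" "b < d ka" "ka' \<in> K" "c < d ka'"
 shows "st' (w ka b) * w ka' c * q ka' c = (if ka = ka' & b = c then q ka b else 0)"
proof -
 have R: "rp ka b < d ka" "rp ka (rp ka b) = rp ka b" using rpr[OF assms(1,2)] by auto
 note 1 = Ew[OF assms(1) R(1) assms(2) R(2) assms(3,4)]
 have 2: "w ka (rp ka b) * q ka (rp ka b) = q ka b"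
 proof -
  have "(w ka (rp ka b) - e') * q ka (rp ka b) = 0"
  proof (rule q_kill[OF assms(1) R(1)])
   have "w ka (rp ka b) * E 2 ka (rp ka b) (rp ka b) = E 2 ka (rp ka b) (rp ka b)"
    using E_mult[OF assms(1) R(1,1) refl R(1,1) refl, of 3 2] R(2) by (simp add: w_def)
   then show "(w ka (rp ka b) - e') * E 2 ka (rp ka (rp ka b)) (rp ka (rp ka b)) = 0"
    using E_S[OF assms(1) R(1,1) refl, of 2] R(2) by (simp add: left_diff_distrib)
  qed (use w_S[OF assms(1) R(1)] in simp)
  moreover have "q ka (rp ka b) = q ka b" using R(2) by (simp add: q_def)
  ultimately show ?thesis using q(1)[OF assms(1,2)] by (simp add: left_diff_distrib)
 qed
 show ?thesis unfolding w_st[OF assms(1,2)] 1 2 ..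
qed

lemma mm_mult: assumes "ka \<in> K" "a < d ka" "b < d ka" "rp ka a = rp ka b" "ka' \<in> K" "b' < d ka'" "c < d ka'"
 shows "mm ka a b * mm ka' b' c = (if ka = ka' & b = b' then mm ka a c else 0)"
proof -
 have "mm ka a b * mm ka' b' c = w ka a * q ka a * (st' (w ka b) * w ka' b' * q ka' b') * st' (w ka' c)"
  by (simp add: mm_def mult.assoc)
 also have "\<dots> = (if ka = ka' & b = b' then w ka a * (q ka a * q ka b) * st' (w ka c) else 0)"
  using w_mult[OF assms(1,3,5,6)] by (simp add: mult.assoc)
 also have "q ka a * q ka b = q ka a" using q(2)[OF assms(1,2)] assms(4) by (simp add: q_def)
 finally show ?thesis by (simp add: mm_def)
qed

lemma mm_st: assumes "ka \<in> K" "a < d ka" "b < d ka" "rp ka a = rp ka b" shows "st' (mm ka a b) = mm ka b a"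
proof -
 have "q ka a = q ka b" using assms(4) by (simp add: q_def)
 then show ?thesis using w_S[OF assms(1,2)] w_S[OF assms(1,3)] q(1,3)[OF assms(1,3)] by (simp add: mm_def T.st_mult mult.assoc)
qed

lemma r_st: "st' r = r"
proof -
 have "st' r = (\<Sum>ka\<in>K. st' (\<Sum>a<d ka. mm ka a a))" unfolding r_def using mm_S by (intro T.st_sum T.S_sum) auto
 also have "\<dots> = (\<Sum>ka\<in>K. \<Sum>a<d ka. st' (mm ka a a))" using mm_S by (intro sum.cong refl T.st_sum) auto
 also have "\<dots> = r" unfolding r_def using mm_st by (intro sum.cong refl) auto
 finally show ?thesis .
qed

lemma double_delta: assumes "ka \<in> K" "b < d ka"
 shows "(\<Sum>ka'\<in>K. \<Sum>a<d ka'. if ka = ka' & b = a then g else 0) = (g::'g)"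
proof -
 have "(\<Sum>ka'\<in>K. \<Sum>a<d ka'. if ka = ka' & b = a then g else 0) = (\<Sum>ka'\<in>K. if ka' = ka then g else 0)"
  using assms by (intro sum.cong refl) auto
 then show ?thesis using K assms by simp
qed

lemma E_r: assumes "ka \<in> K" "a < d ka" "b < d ka" "rp ka a = rp ka b" shows "E 3 ka a b * r = mm ka a b" "r * E 3 ka a b = mm ka a b"
proof -
 have 1: "E 3 ka a b * r = mm ka a b" if ab: "a < d ka" "b < d ka" "rp ka a = rp ka b" for a b
 proof -
  have "E 3 ka a b * r = (\<Sum>ka'\<in>K. \<Sum>c<d ka'. E 3 ka a b * w ka' c * q ka' c * st' (w ka' c))"
   unfolding r_def mm_def by (simp only: sum_distrib_left mult.assoc)
  also have "\<dots> = (\<Sum>ka'\<in>K. \<Sum>c<d ka'. if ka = ka' & b = c then mm ka a b else 0)"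
   using Ew[OF assms(1) ab] by (intro sum.cong refl) (auto simp: mm_def)
  finally show ?thesis using double_delta[OF assms(1) ab(2)] by simp
 qed
 then show "E 3 ka a b * r = mm ka a b" using assms by blast
 have "st' (E 3 ka b a * r) = st' (mm ka b a)" using 1[OF assms(3,2) assms(4)[symmetric]] by simp
 then show "r * E 3 ka a b = mm ka a b"
  using E_S[OF assms(1,3,2) assms(4)[symmetric], of 3] E_st[OF assms(1,3,2) assms(4)[symmetric], of 3] mm_st[OF assms(1,3,2) assms(4)[symmetric]] r_st r_S
  by (simp add: T.st_mult)
qed

lemma r_idem: "r * r = r"
proof -
 have mr: "mm ka a a * r = mm ka a a" if "ka \<in> K" "a < d ka" for ka a
 proof -
  have "mm ka a a * r = (\<Sum>ka'\<in>K. \<Sum>c<d ka'. if ka = ka' & a = c then mm ka a a else 0)"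
   unfolding r_def sum_distrib_left using mm_mult[OF that that(2) refl] by (intro sum.cong refl) auto
  then show ?thesis using double_delta[OF that] by simp
 qed
 have "r * r = (\<Sum>ka\<in>K. \<Sum>a<d ka. mm ka a a * r)" by (subst (1) r_def) (simp only: sum_distrib_right)
 also have "\<dots> = (\<Sum>ka\<in>K. \<Sum>a<d ka. mm ka a a)" using mr by (intro sum.cong refl) auto
 finally show ?thesis by (simp only: r_def[symmetric])
qed

lemmas r_proj = r_st r_idem

lemma L_expand: assumes "ka \<in> K" "x \<in> hS (Fib ka)" "j < 4"
 shows "f (lev ka j x) = (\<Sum>a<d ka. \<Sum>b<d ka. if rp ka a = rp ka b then \<beta> ka a b x *c E j ka a b else 0)"
proof -
 interpret F: munits "hS (Fib ka)" "hst (Fib ka)" "hnm (Fib ka)" "hone (Fib ka)" "d ka" "rp ka" "mu ka" "\<beta> ka" by (rule mun[OF assms(1)])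
 have sum: "f (lev ka j (sum g I)) = (\<Sum>i\<in>I. f (lev ka j (g i)))" if "!!i. i \<in> I ==> g i \<in> hS (Fib ka)" for g :: "nat => 'f host" and I
  using that
 proof (induction I rule: infinite_finite_induct)
  case (insert i I)
  then have "g i \<in> hS (Fib ka)" "sum g I \<in> hS (Fib ka)" by (auto intro: F.S_sum)
  then show ?case using insert by (simp add: lev_add[OF assms(1) _ _ assms(3)] fD(4) lev_S[OF assms(1) _ assms(3)])
 qed (simp_all add: L0[OF assms(1,3)])
 define t where "t a b = (if rp ka a = rp ka b then \<beta> ka a b x *c mu ka a b else 0)" for a b
 have t: "t a b \<in> hS (Fib ka)" if "a < d ka" "b < d ka" for a b unfolding t_def using F.m(1)[OF that] by simp
 have "f (lev ka j x) = f (lev ka j (\<Sum>a<d ka. \<Sum>b<d ka. t a b))"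
  unfolding t_def using F.expand[OF assms(2)] by (rule arg_cong)
 also have "\<dots> = (\<Sum>a<d ka. \<Sum>b<d ka. f (lev ka j (t a b)))"
 proof -
  have rS: "(\<Sum>b<d ka. t a b) \<in> hS (Fib ka)" if "a < d ka" for a using t[OF that] by (intro F.S_sum) auto
  have "f (lev ka j (\<Sum>a<d ka. \<Sum>b<d ka. t a b)) = (\<Sum>a<d ka. f (lev ka j (\<Sum>b<d ka. t a b)))" using rS by (intro sum) auto
  also have "\<dots> = (\<Sum>a<d ka. \<Sum>b<d ka. f (lev ka j (t a b)))" using t by (intro sum.cong refl sum) auto
  finally show ?thesis .
 qed
 also have "\<dots> = (\<Sum>a<d ka. \<Sum>b<d ka. if rp ka a = rp ka b then \<beta> ka a b x *c E j ka a b else 0)"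
 proof (intro sum.cong refl)
  fix a b assume "a \<in> {..<d ka}" "b \<in> {..<d ka}"
  then have ab: "a < d ka" "b < d ka" by auto
  show "f (lev ka j (t a b)) = (if rp ka a = rp ka b then \<beta> ka a b x *c E j ka a b else 0)"
  proof (cases "rp ka a = rp ka b")
   case True
   note mS = mu_S[OF assms(1) ab True]
   show ?thesis using True lev_scl[OF assms(1) mS assms(3)] fD(3)[OF lev_S[OF assms(1) mS assms(3)]] by (simp add: t_def E_def)
  qed (simp add: t_def L0[OF assms(1,3)])
 qed
 finally show ?thesis .
qed

lemma L_r: assumes "ka \<in> K" "x \<in> hS (Fib ka)"
 shows "f (lev ka 3 x) * r = (\<Sum>a<d ka. \<Sum>b<d ka. if rp ka a = rp ka b then \<beta> ka a b x *c mm ka a b else 0)"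
  "r * f (lev ka 3 x) = f (lev ka 3 x) * r"
proof -
 have j: "(3::nat) < 4" by simp
 show 1: "f (lev ka 3 x) * r = (\<Sum>a<d ka. \<Sum>b<d ka. if rp ka a = rp ka b then \<beta> ka a b x *c mm ka a b else 0)"
  unfolding L_expand[OF assms j] sum_distrib_right using E_r(1)[OF assms(1)] by (intro sum.cong refl) auto
 show "r * f (lev ka 3 x) = f (lev ka 3 x) * r"
  unfolding 1 unfolding L_expand[OF assms j] sum_distrib_left using E_r(2)[OF assms(1)] by (intro sum.cong refl) auto
qed

text \<open>The difference annihilates everything of level 2, hence the projections under level 2 of which \<open>r\<close> is made.\<close>

lemma L_mult_r: assumes k: "ka \<in> K" and x: "x \<in> hS (Fib ka)" and y: "y \<in> hS (Fib ka)"
 shows "f (lev ka 3 x) * f (lev ka 3 y) * r = f (lev ka 3 (x * y)) * r"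
proof -
 interpret F: hcstar "hS (Fib ka)" "hst (Fib ka)" "hnm (Fib ka)" by (rule fib0[OF k])
 have j: "(3::nat) < 4" "(2::nat) < 4" by auto
 note LS = lev_S[OF k _ j(1)] and LS2 = lev_S[OF k _ j(2)]
 define D where "D = f (lev ka 3 x) * f (lev ka 3 y) - f (lev ka 3 (x * y))"
 have DS: "D \<in> S'" using fD(1)[OF LS] x y by (simp add: D_def)
 have D2: "D * f (lev ka 2 v) = 0" if v: "v \<in> hS (Fib ka)" for v
 proof -
  have m: "f (lev ka 3 a) * f (lev ka 2 b) = f (lev ka 2 (a * b))" if "a \<in> hS (Fib ka)" "b \<in> hS (Fib ka)" for a b
   using fD(5)[OF LS[OF that(1)] LS2[OF that(2)]] lev_mult[OF k that j(1,2)] by simp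
  show ?thesis using m[OF y v] m[OF x F.S_mult[OF y v]] m[OF F.S_mult[OF x y] v] by (simp add: D_def left_diff_distrib mult.assoc)
 qed
 have "D * mm ka' a a = 0" if k': "ka' \<in> K" and a: "a < d ka'" for ka' a
 proof -
  have R: "rp ka' a < d ka'" "rp ka' (rp ka' a) = rp ka' a" using rpr[OF k' a] by auto
  have "D * w ka' a * E 2 ka' (rp ka' a) (rp ka' a) = 0"
  proof (cases "ka' = ka")
   case True
   have "w ka' a * E 2 ka' (rp ka' a) (rp ka' a) = f (lev ka 2 (mu ka' a (rp ka' a)))"
    using E_mult[OF k' a R(1) R(2)[symmetric] R(1,1) refl, of 3 2] True by (simp add: w_def E_def)
   then show ?thesis using D2[of "mu ka' a (rp ka' a)"] mu_S[OF k' a R(1) R(2)[symmetric]] True by (simp add: mult.assoc)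
  next
   case False
   have z: "f (lev ka 3 v) * w ka' a = 0" if "v \<in> hS (Fib ka)" for v
    unfolding w_def E_def using fD(5)[OF LS[OF that] lev_S[OF k' mu_S[OF k' a R(1) R(2)[symmetric]] j(1)]]
     lev_orth[OF k k' _ that mu_S[OF k' a R(1) R(2)[symmetric]] j(1,1)] False by simp
   show ?thesis using z[OF y] z[OF F.S_mult[OF x y]] by (simp add: D_def left_diff_distrib mult.assoc)
  qed
  then have "D * w ka' a * q ka' a = 0" using DS w_S[OF k' a] by (intro q_kill[OF k' a]) auto
  then show ?thesis by (simp add: mm_def flip: mult.assoc)
 qed
 then have "D * r = 0" unfolding r_def sum_distrib_left by (intro sum.neutral ballI) auto
 then show ?thesis by (simp add: D_def left_diff_distrib)
qed

text \<open>The value of \<open>c\<close> on each piece, spread out by the largest bump and cut down to \<open>r\<close>.\<close>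

definition \<Psi> :: "'h => 'g" where "\<Psi> c = (\<Sum>ka\<in>K. f (lev ka 3 (\<pi> ka c)) * r)"

abbreviation "un ka \<equiv> hone (Fib ka)"
lemma un_S: "ka \<in> K ==> un ka \<in> hS (Fib ka)" using star_mapD(1)[OF \<pi>(1) e_S] \<pi>(2) by metis

lemma un_r: "(\<Sum>ka\<in>K. f (lev ka 3 (un ka)) * r) = r"
proof -
 have "f (lev ka 3 (un ka)) * r = (\<Sum>a<d ka. mm ka a a)" if k: "ka \<in> K" for ka
 proof -
  have "f (lev ka 3 (un ka)) * r = (\<Sum>a<d ka. \<Sum>b<d ka. if a = b then mm ka a b else 0)"
   unfolding L_r(1)[OF k un_S[OF k]] using munits.\<beta>_u[OF mun[OF k]] by (intro sum.cong refl) auto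
  then show ?thesis by simp
 qed
 then have "(\<Sum>ka\<in>K. f (lev ka 3 (un ka)) * r) = (\<Sum>ka\<in>K. \<Sum>a<d ka. mm ka a a)" by (rule sum.cong[OF refl])
 then show ?thesis by (simp only: r_def[symmetric])
qed

lemma \<Psi>_unit: "\<Psi> e = r" unfolding \<Psi>_def using un_r \<pi>(2) by simp

lemma fL_S: "ka \<in> K ==> c \<in> S ==> f (lev ka 3 (\<pi> ka c)) \<in> S'"
 using fD(1)[OF lev_S] star_mapD(1)[OF \<pi>(1)] by simp

lemma \<Psi>_hom: "star_map S st S' st' \<Psi>"
 unfolding star_map_def
proof (intro ballI conjI allI)
 have j: "(3::nat) < 4" by simp
 fix x assume x: "x \<in> S"
 have px: "\<pi> ka x \<in> hS (Fib ka)" if "ka \<in> K" for ka by (rule star_mapD(1)[OF \<pi>(1)[OF that] x])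
 note LS = lev_S[OF _ px j]
 show "\<Psi> x \<in> S'" unfolding \<Psi>_def using fL_S[OF _ x] r_S by (intro T.S_sum) auto
 show "\<Psi> (a *c x) = a *c \<Psi> x" for a
  unfolding \<Psi>_def scl_sum_right using star_mapD(3)[OF \<pi>(1) x] lev_scl[OF _ px j] fD(3)[OF LS] by (intro sum.cong refl) simp
 show "\<Psi> (st x) = st' (\<Psi> x)"
 proof -
  have "st' (\<Psi> x) = (\<Sum>ka\<in>K. st' (f (lev ka 3 (\<pi> ka x)) * r))" unfolding \<Psi>_def using fL_S[OF _ x] r_S by (intro T.st_sum) auto
  also have "\<dots> = \<Psi> (st x)" unfolding \<Psi>_def
  proof (rule sum.cong[OF refl])
   fix ka assume k: "ka \<in> K"
   have "st' (f (lev ka 3 (\<pi> ka x)) * r) = r * f (lev ka 3 (\<pi> ka (st x)))"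
    using fL_S[OF k x] r_S r_proj(1) fD(2)[OF LS[OF k k]] lev_st[OF k px[OF k] j] star_mapD(2)[OF \<pi>(1)[OF k] x] by (simp add: T.st_mult)
   then show "st' (f (lev ka 3 (\<pi> ka x)) * r) = f (lev ka 3 (\<pi> ka (st x))) * r"
    using L_r(2)[OF k star_mapD(1)[OF \<pi>(1)[OF k] S_st[OF x]]] by simp
  qed
  finally show ?thesis by simp
 qed
 fix y assume y: "y \<in> S"
 have py: "\<pi> ka y \<in> hS (Fib ka)" if "ka \<in> K" for ka by (rule star_mapD(1)[OF \<pi>(1)[OF that] y])
 show "\<Psi> (x + y) = \<Psi> x + \<Psi> y"
  unfolding \<Psi>_def sum.distrib[symmetric]
 proof (rule sum.cong[OF refl])
  fix ka assume k: "ka \<in> K"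
  show "f (lev ka 3 (\<pi> ka (x + y))) * r = f (lev ka 3 (\<pi> ka x)) * r + f (lev ka 3 (\<pi> ka y)) * r"
   using star_mapD(4)[OF \<pi>(1)[OF k] x y] lev_add[OF k px[OF k] py[OF k] j] fD(4)[OF lev_S[OF k px[OF k] j] lev_S[OF k py[OF k] j]]
   by (simp add: distrib_right)
 qed
 have "\<Psi> x * \<Psi> y = (\<Sum>ka\<in>K. \<Sum>ka'\<in>K. f (lev ka 3 (\<pi> ka x)) * r * (f (lev ka' 3 (\<pi> ka' y)) * r))"
  unfolding \<Psi>_def by (rule sum_product)
 also have "\<dots> = (\<Sum>ka\<in>K. \<Sum>ka'\<in>K. if ka' = ka then f (lev ka 3 (\<pi> ka (x * y))) * r else 0)"
 proof (intro sum.cong refl)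
  fix ka ka' assume k: "ka \<in> K" "ka' \<in> K"
  have "f (lev ka 3 (\<pi> ka x)) * r * (f (lev ka' 3 (\<pi> ka' y)) * r) = f (lev ka 3 (\<pi> ka x)) * (r * f (lev ka' 3 (\<pi> ka' y))) * r"
   by (simp only: mult.assoc)
  also have "\<dots> = f (lev ka 3 (\<pi> ka x)) * f (lev ka' 3 (\<pi> ka' y)) * r"
   unfolding L_r(2)[OF k(2) py[OF k(2)]] using r_proj(2) by (simp add: mult.assoc)
  also have "\<dots> = (if ka' = ka then f (lev ka 3 (\<pi> ka (x * y))) * r else 0)"
  proof (cases "ka' = ka")
   case True
   then show ?thesis using L_mult_r[OF k(1) px[OF k(1)] py[OF k(1)]] star_mapD(5)[OF \<pi>(1)[OF k(1)] x y] by simp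
  next
   case False
   then have "f (lev ka 3 (\<pi> ka x)) * f (lev ka' 3 (\<pi> ka' y)) = 0"
    using fD(5)[OF lev_S[OF k(1) px[OF k(1)] j] lev_S[OF k(2) py[OF k(2)] j]] lev_orth[OF k _ px[OF k(1)] py[OF k(2)] j j] by simp
   then show ?thesis using False by simp
  qed
  finally show "f (lev ka 3 (\<pi> ka x)) * r * (f (lev ka' 3 (\<pi> ka' y)) * r) = (if ka' = ka then f (lev ka 3 (\<pi> ka (x * y))) * r else 0)" .
 qed
 also have "\<dots> = \<Psi> (x * y)" unfolding \<Psi>_def using K by simp
 finally show "\<Psi> (x * y) = \<Psi> x * \<Psi> y" by simp
qed

lemma \<Psi>_span: "c \<in> S ==> \<Psi> c \<in> cvs.span ((\<lambda>(ka, a, b). mm ka a b) ` (SIGMA ka:K. {..<d ka} \<times> {..<d ka}))"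
 unfolding \<Psi>_def
proof (rule cvs.span_sum)
 fix ka assume c: "c \<in> S" and k: "ka \<in> K"
 have mem: "mm ka a b \<in> (\<lambda>(ka, a, b). mm ka a b) ` (SIGMA ka:K. {..<d ka} \<times> {..<d ka})" if "a < d ka" "b < d ka" for a b
  using k that by (intro image_eqI[of _ _ "(ka, a, b)"]) auto
 show "f (lev ka 3 (\<pi> ka c)) * r \<in> cvs.span ((\<lambda>(ka, a, b). mm ka a b) ` (SIGMA ka:K. {..<d ka} \<times> {..<d ka}))"
  unfolding L_r(1)[OF k star_mapD(1)[OF \<pi>(1)[OF k] c]]
  using cvs.span_scale[OF cvs.span_base[OF mem]] cvs.span_zero by (intro cvs.span_sum) auto
qed

lemma \<Psi>_approx: assumes g: "g \<in> G" and gS: "g \<in> S" shows "nm' (f g * r - \<Psi> g) <= \<epsilon>"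
proof -
 have j: "(3::nat) < 4" by simp
 have pS: "\<pi> ka g \<in> hS (Fib ka)" if "ka \<in> K" for ka by (rule star_mapD(1)[OF \<pi>(1)[OF that] gS])
 define y where "y ka = g * lev ka 3 (un ka) - lev ka 3 (\<pi> ka g)" for ka
 have LS: "lev ka 3 (un ka) \<in> S" "lev ka 3 (\<pi> ka g) \<in> S" if "ka \<in> K" for ka using lev_S[OF that _ j] un_S[OF that] pS[OF that] by auto
 have yS: "y ka \<in> S" if "ka \<in> K" for ka unfolding y_def using LS[OF that] gS by simp
 have "f g * r = (\<Sum>ka\<in>K. f g * (f (lev ka 3 (un ka)) * r))" unfolding sum_distrib_left[symmetric] un_r ..
 then have "f g * r - \<Psi> g = (\<Sum>ka\<in>K. f g * (f (lev ka 3 (un ka)) * r) - f (lev ka 3 (\<pi> ka g)) * r)"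
  unfolding \<Psi>_def by (simp only: sum_subtractf)
 also have "\<dots> = (\<Sum>ka\<in>K. f (y ka)) * r"
  unfolding sum_distrib_right y_def using LS gS by (intro sum.cong refl) (simp add: f0(1) fD(5) left_diff_distrib mult.assoc)
 also have "\<dots> = f (\<Sum>ka\<in>K. y ka) * r" using star_map_sum[OF f hcstar_axioms yS, of K] by simp
 also have "nm' \<dots> <= \<epsilon> * 1"
 proof (rule T.nm_mult_le)
  have S: "(\<Sum>ka\<in>K. y ka) \<in> S" using yS by (rule S_sum)
  show "nm' (f (\<Sum>ka\<in>K. y ka)) <= \<epsilon>"
   using star_map_contractive[OF hcstar1_axioms T.hcstar1_axioms f S] approx[OF g] by (simp add: y_def)
  show "f (\<Sum>ka\<in>K. y ka) \<in> S'" by (rule fD(1)[OF S])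
  show "nm' r <= 1" by (rule T.proj_nm_le_1[OF r_S r_proj(2,1)])
 qed (rule r_S)
 finally show ?thesis by simp
qed

lemma r_below: "f e * r = r" "r * f e = r"
proof -
 have "f e * r = f e * (\<Sum>ka\<in>K. f (lev ka 3 (un ka)) * r)" by (simp only: un_r)
 also have "\<dots> = (\<Sum>ka\<in>K. f (lev ka 3 (un ka)) * r)"
  unfolding sum_distrib_left
 proof (rule sum.cong[OF refl])
  fix ka assume k: "ka \<in> K"
  have L: "lev ka 3 (un ka) \<in> S" using lev_S[OF k un_S[OF k]] by simp
  have "f e * f (lev ka 3 (un ka)) = f (lev ka 3 (un ka))" using fD(5)[OF e_S L] e_left[OF L] by simp
  then show "f e * (f (lev ka 3 (un ka)) * r) = f (lev ka 3 (un ka)) * r" by (simp flip: mult.assoc)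
 qed
 finally show 1: "f e * r = r" by (simp only: un_r)
 have "st' (f e * r) = st' r" using 1 by simp
 then show "r * f e = r" using r_S fD(1)[OF e_S] fD(2)[OF e_S] r_proj(1) by (simp add: T.st_mult)
qed

text \<open>Each diagonal matrix unit of level 0 factors through the bump of level 0 at the representative, which \<open>s\<close> fixes up to \<open>\<delta>\<close>.\<close>

lemma r_core: assumes \<delta>: "0 <= \<delta>" shows "nm' ((f e - r) * f (core K Fib lev)) <= real (\<Sum>ka\<in>K. d ka) * \<delta>"
proof -
 have j: "(0::nat) < 4" by simp
 have "f (core K Fib lev) = (\<Sum>ka\<in>K. f (lev ka 0 (un ka)))"
  unfolding core_def using lev_S[OF _ un_S j] by (intro star_map_sum[OF f hcstar_axioms]) auto
 also have "\<dots> = (\<Sum>ka\<in>K. \<Sum>a<d ka. E 0 ka a a)"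
 proof (rule sum.cong[OF refl])
  fix ka assume k: "ka \<in> K"
  have "f (lev ka 0 (un ka)) = (\<Sum>a<d ka. \<Sum>b<d ka. if a = b then E 0 ka a b else 0)"
   unfolding L_expand[OF k un_S[OF k] j] using munits.\<beta>_u[OF mun[OF k]] by (intro sum.cong refl) auto
  then show "f (lev ka 0 (un ka)) = (\<Sum>a<d ka. E 0 ka a a)" by simp
 qed
 finally have eq: "(f e - r) * f (core K Fib lev) = (\<Sum>ka\<in>K. \<Sum>a<d ka. (f e - r) * E 0 ka a a)"
  by (simp only: sum_distrib_left)
 have "nm' ((f e - r) * E 0 ka a a) <= \<delta>" if k: "ka \<in> K" and a: "a < d ka" for ka a
 proof -
  define R where "R = rp ka a"
  have R: "R < d ka" "rp ka a = R" "rp ka R = R" using rpr[OF k a] by (simp_all add: R_def)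
  have aR: "rp ka a = rp ka R" "rp ka R = rp ka a" using R by simp_all
  have e1: "E 0 ka a a = w ka a * E 0 ka R R * E 3 ka R a"
   using E_mult[OF k a R(1) aR(1) R(1,1) refl, of 3 0] E_mult[OF k a R(1) aR(1) R(1) a aR(2), of 0 3] R(2) by (simp add: w_def)
  have e2: "r * w ka a = w ka a * q ka a * E 3 ka R R"
   using E_r(2)[OF k a R(1) aR(1)] w_st[OF k R(1)] R by (simp add: w_def mm_def)
  have e3: "E 3 ka R R * E 0 ka R R = E 0 ka R R" using E_mult[OF k R(1,1) refl R(1,1) refl, of 3 0] by simp
  have fw: "f e * w ka a = w ka a"
   unfolding w_def E_def using fD(5)[OF e_S lev_S[OF k mu_S[OF k a R(1) aR(1)]], of 3] lev_S[OF k mu_S[OF k a R(1) aR(1)], of 3] R(2) by simp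
  have "r * E 0 ka a a = r * w ka a * E 0 ka R R * E 3 ka R a" by (simp only: e1 mult.assoc)
  also have "\<dots> = w ka a * q ka a * (E 3 ka R R * E 0 ka R R) * E 3 ka R a" by (simp only: e2 mult.assoc)
  also have "\<dots> = w ka a * (q ka a * E 0 ka R R) * E 3 ka R a" by (simp only: e3 mult.assoc)
  finally have "r * E 0 ka a a = w ka a * (q ka a * E 0 ka R R) * E 3 ka R a" .
  moreover have "f e * E 0 ka a a = w ka a * E 0 ka R R * E 3 ka R a" unfolding e1 using fw by (simp flip: mult.assoc)
  ultimately have "(f e - r) * E 0 ka a a = w ka a * (E 0 ka R R - q ka a * E 0 ka R R) * E 3 ka R a"
   by (simp add: left_diff_distrib right_diff_distrib)
  moreover have nmE: "nm' (E 3 ka b c) <= 1" if "b < d ka" "c < d ka" "rp ka b = rp ka c" for b c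
   unfolding E_def using star_map_contractive[OF hcstar1_axioms T.hcstar1_axioms f lev_S[OF k mu_S[OF k that], of 3]]
    lev_nm[OF k mu_S[OF k that], of 3] munits.nm_m_le_1[OF mun[OF k] that] by simp
  moreover have "nm' (w ka a * (E 0 ka R R - q ka a * E 0 ka R R) * E 3 ka R a) <= 1 * \<delta> * 1"
  proof (intro T.nm_mult_le)
   show "nm' (w ka a) <= 1" unfolding w_def R(2) by (rule nmE[OF a R(1) aR(1)])
   show "nm' (E 3 ka R a) <= 1" by (rule nmE[OF R(1) a aR(2)])
   show "nm' (E 0 ka R R - q ka a * E 0 ka R R) <= \<delta>" using s_near[OF k R(1,3)] by (simp add: E_def q_def R(2))
  qed (use w_S[OF k a] E_S[OF k R(1,1) refl j] E_S[OF k R(1) a aR(2), of 3] q(1)[OF k a] in auto)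
  ultimately show ?thesis by simp
 qed
 note b = this
 have S: "(f e - r) * E 0 ka a a \<in> S'" if "ka \<in> K" "a < d ka" for ka a
  using E_S[OF that(1,2,2) refl j] r_S fD(1)[OF e_S] by simp
 show ?thesis
 proof -
  have "nm' (\<Sum>ka\<in>K. \<Sum>a<d ka. (f e - r) * E 0 ka a a) <= (\<Sum>ka\<in>K. nm' (\<Sum>a<d ka. (f e - r) * E 0 ka a a))"
   using S by (intro T.nm_sum T.S_sum) auto
  also have "\<dots> <= (\<Sum>ka\<in>K. real (d ka) * \<delta>)"
  proof (rule sum_mono)
   fix ka assume k: "ka \<in> K"
   have "nm' (\<Sum>a<d ka. (f e - r) * E 0 ka a a) <= (\<Sum>a<d ka. nm' ((f e - r) * E 0 ka a a))" using S[OF k] by (intro T.nm_sum) auto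
   also have "\<dots> <= (\<Sum>a<d ka. \<delta>)" using b[OF k] by (intro sum_mono) auto
   finally show "nm' (\<Sum>a<d ka. (f e - r) * E 0 ka a a) <= real (d ka) * \<delta>" by simp
  qed
  also have "\<dots> = real (\<Sum>ka\<in>K. d ka) * \<delta>" by (simp add: sum_distrib_right)
  finally show ?thesis by (simp only: eq)
 qed
qed

end

section \<open>Candidates at a late stage\<close>

lemma unemb_simps:
 assumes A: "cstar_algebra A" and x: "x \<in> hS A" and y: "y \<in> hS A"
 shows "unemb A (x + y) = unemb A x \<oplus>\<^bsub>A\<^esub> unemb A y" "unemb A (x - y) = unemb A x \<ominus>\<^bsub>A\<^esub> unemb A y"
  "unemb A (x * y) = unemb A x \<otimes>\<^bsub>A\<^esub> unemb A y" "unemb A (c *c x) = c \<odot>\<^bsub>A\<^esub> unemb A x" "unemb A (hst A x) = adj A (unemb A x)"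
 using unemb_ops[OF A x y] x y by (simp_all add: A hst_def carrier_simps[OF A] add_carrier[OF A] minus_carrier[OF A])

text \<open>A spanning set has to be found inside the image itself, hence the passage to a basis.\<close>

lemma image_fin_dim:
 fixes A :: "'a cstar" and B :: "'b cstar"
 assumes A: "cstar_algebra A" and B: "cstar_algebra B" and h: "h \<in> star_hom A B"
  and X: "finite X" "hmap A B h ` hS A \<subseteq> cvs.span X"
 shows "vectorspace.fin_dim class_ring (B\<lparr>carrier := h ` carrier A\<rparr>)"
proof -
 note D = star_homD[OF h]
 interpret VB: vectorspace class_ring B by (rule vectorspace_cstar[OF B])
 have "VectorSpace.subspace class_ring (h ` carrier A) B"
 proof (intro VectorSpace.subspace.intro LinearCombinations.submodule.intro)
  show "Module.module class_ring B" by unfold_locales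
  show "h ` carrier A \<subseteq> carrier B" using D(1) by auto
  show "v \<oplus>\<^bsub>B\<^esub> w \<in> h ` carrier A" if vw: "v \<in> h ` carrier A" "w \<in> h ` carrier A" for v w
  proof -
   obtain x y where "x \<in> carrier A" "v = h x" "y \<in> carrier A" "w = h y" using vw by blast
   then show ?thesis using D(2) add_carrier[OF A] by (metis image_eqI)
  qed
  show smult: "c \<odot>\<^bsub>B\<^esub> v \<in> h ` carrier A" if "v \<in> h ` carrier A" for c v
   using that D(3) carrier_simps(3)[OF A] by (metis (no_types, lifting) imageE image_eqI)
  have "0 \<odot>\<^bsub>B\<^esub> h \<zero>\<^bsub>A\<^esub> \<in> h ` carrier A" using zero_carrier[OF A] by (intro smult) auto
  then show "\<zero>\<^bsub>B\<^esub> \<in> h ` carrier A" using cstar_smult(6)[OF B D(1)[OF zero_carrier[OF A]]] by simp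
 qed (rule vectorspace_cstar[OF B])
 then have vs: "vectorspace class_ring (B\<lparr>carrier := h ` carrier A\<rparr>)" (is "vectorspace class_ring ?V") by (rule VB.subspace_is_vs)
 interpret V: vectorspace class_ring ?V by (rule vs)
 define W where "W = hmap A B h ` hS A"
 have W: "emb B ` (h ` carrier A) = W" unfolding W_def hS_def by (auto simp: hmap_emb[OF A] image_iff)
 obtain Bs where Bs: "Bs \<subseteq> W" "cvs.independent Bs" "W \<subseteq> cvs.span Bs" using cvs.maximal_independent_subset by blast
 have fin: "finite Bs" using cvs.independent_span_bound[OF X(1) Bs(2)] Bs(1) X(2) unfolding W_def by blast
 have hc: "y \<in> carrier B" if "y \<in> h ` carrier A" for y using that D(1) by auto
 have Bs_c: "unemb B b \<in> h ` carrier A" "emb B (unemb B b) = b" if b: "b \<in> Bs" for b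
 proof -
  have "b \<in> emb B ` (h ` carrier A)" using b Bs(1) unfolding W by (rule rev_subsetD)
  then obtain y where y: "b = emb B y" "y \<in> h ` carrier A" by (rule imageE)
  show "unemb B b \<in> h ` carrier A" "emb B (unemb B b) = b" using hc[OF y(2)] B y by simp_all
 qed
 have sum: "finsum ?V f I \<in> h ` carrier A & emb B (finsum ?V f I) = (\<Sum>i\<in>I. emb B (f i))"
  if "finite I" "!!i. i \<in> I ==> f i \<in> h ` carrier A" for f :: "'b => 'b" and I
  using that
 proof (induction I)
  case empty
  have "\<zero>\<^bsub>?V\<^esub> \<in> carrier ?V" by (rule V.zero_closed)
  then show ?case by (simp add: emb_zero[OF B])
 next
  case (insert i I)
  have "finsum ?V f (insert i I) = f i \<oplus>\<^bsub>?V\<^esub> finsum ?V f I" using insert by (intro V.finsum_insert) auto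
  moreover have "f i \<oplus>\<^bsub>?V\<^esub> finsum ?V f I \<in> carrier ?V" using insert by (intro V.a_closed) auto
  ultimately show ?case using insert hc by (simp add: emb_add[OF B])
 qed
 have "V.span (unemb B ` Bs) = carrier ?V"
 proof
  show "V.span (unemb B ` Bs) \<subseteq> carrier ?V" using Bs_c by (intro V.span_is_subset2) auto
  show "carrier ?V \<subseteq> V.span (unemb B ` Bs)"
  proof
   fix y assume y: "y \<in> carrier ?V"
   then have "emb B y \<in> cvs.span Bs" using Bs(3) W by auto
   then obtain c where c: "emb B y = (\<Sum>b\<in>Bs. c b *c b)" unfolding cvs.span_finite[OF fin] by auto
   have inj: "inj_on (unemb B) Bs" using Bs_c(2) by (metis inj_onI)
   define a where "a v = c (emb B v)" for v
   have sm: "a v \<odot>\<^bsub>?V\<^esub> v \<in> h ` carrier A" if "v \<in> unemb B ` Bs" for v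
    using V.smult_closed[of "a v" v] that Bs_c(1) by auto
   have "emb B (V.lincomb a (unemb B ` Bs)) = (\<Sum>v\<in>unemb B ` Bs. emb B (a v \<odot>\<^bsub>B\<^esub> v))"
    unfolding V.lincomb_def using sum[of "unemb B ` Bs" "\<lambda>v. a v \<odot>\<^bsub>?V\<^esub> v"] fin sm by simp
   also have "\<dots> = (\<Sum>b\<in>Bs. c b *c b)"
    unfolding sum.reindex[OF inj] using Bs_c hc by (intro sum.cong refl) (simp add: emb_scl[OF B] a_def)
   finally have "emb B (V.lincomb a (unemb B ` Bs)) = emb B y" using c by simp
   moreover have "V.lincomb a (unemb B ` Bs) \<in> carrier B"
    unfolding V.lincomb_def using sum[of "unemb B ` Bs" "\<lambda>v. a v \<odot>\<^bsub>?V\<^esub> v"] fin sm hc by simp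
   ultimately have "y = V.lincomb a (unemb B ` Bs)" using emb_inj[OF B] hc y by auto
   then show "y \<in> V.span (unemb B ` Bs)" unfolding V.span_def using fin by auto
  qed
 qed
 then show ?thesis unfolding V.fin_dim_def using fin Bs_c(1) by (intro exI[of _ "unemb B ` Bs"]) auto
qed

text \<open>For the sum \<open>X\<close> the element \<open>X\<^sup>2 - X\<close> has norm at most 2, and \<open>t\<^sup>2 <= t + 2\<close> implies \<open>t <= 2\<close>.\<close>

lemma (in hcstar) almost_orthogonal_sum:
 fixes N :: nat
 assumes q: "!!i. i < N ==> q i \<in> S" "!!i. i < N ==> q i * q i = q i" "!!i. i < N ==> st (q i) = q i"
  and orth: "!!i j. i < N ==> j < N ==> i ~= j ==> nm (q i * q j) <= \<eta>" and \<eta>: "0 <= \<eta>" "real N * (real N * \<eta>) <= 2"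
 shows "nm (\<Sum>i<N. q i) <= 2"
proof -
 let ?X = "\<Sum>i<N. q i"
 have X: "?X \<in> S" using q(1) by (intro S_sum) auto
 have Xst: "st ?X = ?X" using q(1,3) st_sum[of "{..<N}" q] by simp
 define t where "t i j = (if i = j then 0 else q i * q j)" for i j
 have t: "t i j \<in> S" "nm (t i j) <= \<eta>" if "i < N" "j < N" for i j using that q(1) orth \<eta> by (auto simp: t_def)
 have rS: "(\<Sum>j<N. t i j) \<in> S" if "i < N" for i using t(1)[OF that] by (intro S_sum) auto
 have "?X * ?X = (\<Sum>i<N. \<Sum>j<N. q i * q j)" by (rule sum_product)
 also have "\<dots> = (\<Sum>i<N. \<Sum>j<N. (if j = i then q i else 0) + t i j)" using q(2) by (intro sum.cong refl) (auto simp: t_def)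
 also have "\<dots> = ?X + (\<Sum>i<N. \<Sum>j<N. t i j)" by (simp add: sum.distrib)
 finally have eq: "?X * ?X = ?X + (\<Sum>i<N. \<Sum>j<N. t i j)" .
 have "nm (\<Sum>i<N. \<Sum>j<N. t i j) <= (\<Sum>i<N. nm (\<Sum>j<N. t i j))" using rS by (intro nm_sum) auto
 also have "\<dots> <= (\<Sum>i<N. real N * \<eta>)"
 proof (rule sum_mono)
  fix i assume "i \<in> {..<N}"
  then have i: "i < N" by simp
  have "nm (\<Sum>j<N. t i j) <= (\<Sum>j<N. nm (t i j))" using t(1)[OF i] by (intro nm_sum) auto
  also have "\<dots> <= (\<Sum>j<N. \<eta>)" using t(2)[OF i] by (intro sum_mono) auto
  finally show "nm (\<Sum>j<N. t i j) <= real N * \<eta>" by simp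
 qed
 also have "\<dots> <= 2" using \<eta>(2) by simp
 finally have b: "nm (\<Sum>i<N. \<Sum>j<N. t i j) <= 2" .
 have "(\<Sum>i<N. \<Sum>j<N. t i j) \<in> S" by (rule S_sum) (use rS in simp)
 then have "nm (?X * ?X) <= nm ?X + 2" unfolding eq using nm_add_le[OF X _ order_refl b] by blast
 moreover have "nm (?X * ?X) = (nm ?X)\<^sup>2" using nm_cstar[OF X] Xst by simp
 ultimately have "(nm ?X - 2) * (nm ?X + 1) <= 0" by (simp add: power2_eq_square algebra_simps)
 then show ?thesis using nm_nonneg[OF X] by (auto simp: mult_le_0_iff)
qed

lemma (in pieces) core_S: "core K Fib lev \<in> S" "st (core K Fib lev) = core K Fib lev"
proof -
 have u: "hone (Fib ka) \<in> hS (Fib ka)" "hst (Fib ka) (hone (Fib ka)) = hone (Fib ka)" if "ka \<in> K" for ka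
  using star_mapD(1,2)[OF \<pi>(1)[OF that] e_S] \<pi>(2)[OF that] by simp_all
 have j: "(0::nat) < 4" by simp
 have L: "lev ka 0 (hone (Fib ka)) \<in> S" if "ka \<in> K" for ka by (rule lev_S[OF that u(1)[OF that] j])
 show "core K Fib lev \<in> S" unfolding core_def using L by (rule S_sum)
 show "st (core K Fib lev) = core K Fib lev" unfolding core_def
  using lev_st[OF _ u(1) j] u(2) by (subst st_sum[OF L]) (auto intro: sum.cong)
qed

context unital_limit
begin

text \<open>A projection \<open>r\<close> at stage \<open>n\<close> with a finite dimensional homomorphism onto its corner, whose complement is almost orthogonal to the element \<open>b\<close>.\<close>

definition candidate :: "nat => nat => real => 'a host set => 'a host => real => 'a host => ('a host => 'a host) => bool" where
 "candidate m n \<epsilon> G b \<eta> r \<Psi> \<longleftrightarrow> r \<in> S n & r * r = r & st n r = r & F m n (e m) * r = r & r * F m n (e m) = r &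
  star_map (S m) (st m) (S n) (st n) \<Psi> & \<Psi> (e m) = r & (\<exists>X. finite X & \<Psi> ` S m \<subseteq> cvs.span X) &
  (\<forall>g\<in>G. nm n (F m n g * r - \<Psi> g) <= \<epsilon>) & nm n ((F m n (e m) - r) * F m n b) <= \<eta>"

lemma candidate_exists:
 fixes Fib :: "'k => 'f cstar"
 assumes rr: "real_rank_zero B" and P: "pieces (S m) (st m) (nm m) (e m) K Fib lev \<pi> \<epsilon> G" and G: "G \<subseteq> S m" and \<eta>: "0 < \<eta>"
 shows "\<exists>n0\<ge>m. \<forall>n\<ge>n0. \<exists>r \<Psi>. candidate m n \<epsilon> G (core K Fib lev) \<eta> r \<Psi>"
proof -
 interpret P: pieces "S m" "st m" "nm m" "e m" K Fib lev \<pi> \<epsilon> G by (rule P)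
 have "\<exists>d rp mu \<beta>. munits (hS (Fib ka)) (hst (Fib ka)) (hnm (Fib ka)) (hone (Fib ka)) d rp mu \<beta>" if "ka \<in> K" for ka
  using fd_munits[OF P.Fib[OF that]] unfolding munits_fd_def by blast
 then obtain d rp mu \<beta> where mun: "!!ka. ka \<in> K ==> munits (hS (Fib ka)) (hst (Fib ka)) (hnm (Fib ka)) (hone (Fib ka)) (d ka) (rp ka) (mu ka) (\<beta> ka)"
  by metis
 define D where "D = real (\<Sum>ka\<in>K. d ka)"
 define \<delta> where "\<delta> = \<eta> / (1 + D)"
 have D: "0 <= D" by (simp add: D_def sum_nonneg)
 then have \<delta>: "0 < \<delta>" "D * \<delta> <= \<eta>" using \<eta> by (simp_all add: \<delta>_def field_simps)
 define I where "I = (SIGMA ka:K. {a. a < d ka & rp ka a = a})"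
 have finI: "finite I" unfolding I_def using P.K by (intro finite_SigmaI) auto
 define good where "good n ka a s \<longleftrightarrow> s \<in> S n & s * s = s & st n s = s &
   nm n (F m n (lev ka 0 (mu ka a a)) - s * F m n (lev ka 0 (mu ka a a))) <= \<delta> & (\<forall>z\<in>S n. z * F m n (lev ka 2 (mu ka a a)) = 0 --> z * s = 0)" for n ka a s
 have "\<exists>n0\<ge>m. \<forall>n\<ge>n0. \<exists>s. good n (fst i) (snd i) s" if "i \<in> I" for i
 proof -
  obtain ka a where i: "i = (ka, a)" "ka \<in> K" "a < d ka" using \<open>i \<in> I\<close> by (auto simp: I_def)
  note M = munits.m[OF mun[OF i(2)] i(3,3) refl] munits.m_mult[OF mun[OF i(2)] i(3,3,3,3) refl refl]
  note LS = P.lev_S[OF i(2) M(1)] and LM = P.lev_mult[OF i(2) M(1,1)] and Lst = P.lev_st[OF i(2) M(1)]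
  have "\<exists>n0\<ge>m. \<forall>n\<ge>n0. \<exists>s\<in>S n. s * s = s & st n s = s & nm n (F m n (lev ka 0 (mu ka a a)) - s * F m n (lev ka 0 (mu ka a a))) <= \<delta> &
    (\<forall>z\<in>S n. z * F m n (lev ka 2 (mu ka a a)) = 0 --> z * s = 0)"
   by (rule interpolating_projection[OF rr, of "lev ka 1 (mu ka a a)"]) (use LS LM Lst M \<delta>(1) in simp_all)
  then show ?thesis unfolding good_def i(1) fst_conv snd_conv by blast
 qed
 then obtain n0 where n0: "!!i. i \<in> I ==> m <= n0 i" "!!i n. i \<in> I ==> n0 i <= n ==> \<exists>s. good n (fst i) (snd i) s" by metis
 define n1 where "n1 = Max (insert m (n0 ` I))"
 have n1: "m <= n1" "!!i. i \<in> I ==> n0 i <= n1" unfolding n1_def using finI by auto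
 have "\<exists>r \<Psi>. candidate m n \<epsilon> G (core K Fib lev) \<eta> r \<Psi>" if n: "n1 <= n" for n
 proof -
  have "\<exists>s. good n (fst i) (snd i) s" if "i \<in> I" for i using n0(2)[OF that order_trans[OF n1(2)[OF that] n]] .
  then obtain s where s: "!!i. i \<in> I ==> good n (fst i) (snd i) (s i)" by metis
  have mn: "m <= n" using n1(1) n by simp
  interpret T: stage "S m" "st m" "nm m" "e m" K Fib lev \<pi> \<epsilon> G "S n" "st n" "nm n" "e n" "F m n" d rp mu \<beta> "\<lambda>ka a. s (ka, a)" \<delta>
  proof (intro stage.intro P C1 stage_axioms.intro F mn mun)
   fix ka a assume "ka \<in> K" "a < d ka" "rp ka a = a"
   then have "good n ka a (s (ka, a))" using s[of "(ka, a)"] by (simp add: I_def)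
   then show "s (ka, a) \<in> S n" "s (ka, a) * s (ka, a) = s (ka, a)" "st n (s (ka, a)) = s (ka, a)"
    "nm n (F m n (lev ka 0 (mu ka a a)) - s (ka, a) * F m n (lev ka 0 (mu ka a a))) <= \<delta>"
    "!!x. x \<in> S n ==> x * F m n (lev ka 2 (mu ka a a)) = 0 ==> x * s (ka, a) = 0" unfolding good_def by blast+
  qed
  have "finite ((\<lambda>(ka, a, b). T.mm ka a b) ` (SIGMA ka:K. {..<d ka} \<times> {..<d ka}))" using P.K by auto
  then have fin: "\<exists>X. finite X & T.\<Psi> ` S m \<subseteq> cvs.span X" using T.\<Psi>_span by blast
  have "nm n ((F m n (e m) - T.r) * F m n (core K Fib lev)) <= D * \<delta>" using T.r_core \<delta>(1) by (simp add: D_def)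
  then have "candidate m n \<epsilon> G (core K Fib lev) \<eta> T.r T.\<Psi>"
   unfolding candidate_def using T.r_S T.r_idem T.r_st T.r_below T.\<Psi>_hom T.\<Psi>_unit fin T.\<Psi>_approx G \<delta>(2) by auto
  then show ?thesis by blast
 qed
 then show ?thesis using n1(1) by blast
qed

end

section \<open>Choosing a candidate in every block\<close>

context decomposed
begin

text \<open>The element that agrees with \<open>y k\<close> in block \<open>k\<close>.\<close>

definition glue :: "(nat => 'a host) => 'a host" where "glue y = (\<Sum>k<l. z k * y k)"

lemma glue_S: "(!!k. k < l ==> y k \<in> hS A) ==> glue y \<in> hS A"
 unfolding glue_def using z_S by (intro S_sum S_mult) auto

lemma glue_const: "x \<in> hS A ==> glue (\<lambda>_. x) = x" unfolding glue_def by (rule z_expand[symmetric])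

lemma glue_add: "glue x + glue y = glue (\<lambda>k. x k + y k)" unfolding glue_def by (simp add: sum.distrib distrib_left)
lemma glue_diff: "glue x - glue y = glue (\<lambda>k. x k - y k)" unfolding glue_def by (simp add: sum_subtractf right_diff_distrib)
lemma glue_scl: "glue (\<lambda>k. c *c x k) = c *c glue x" unfolding glue_def by (simp add: scl_sum_right)

lemma glue_cong: "(!!k. k < l ==> x k = y k) ==> glue x = glue y" unfolding glue_def by (intro sum.cong) auto

lemma glue_mult:
 assumes x: "!!k. k < l ==> x k \<in> hS A"
 shows "glue x * glue y = glue (\<lambda>k. x k * y k)"
proof -
 have "glue x * glue y = (\<Sum>k<l. \<Sum>k'<l. z k * x k * (z k' * y k'))" unfolding glue_def by (rule sum_product)
 also have "\<dots> = (\<Sum>k<l. \<Sum>k'<l. if k' = k then z k * (x k * y k) else 0)"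
 proof (intro sum.cong refl)
  fix k k' assume "k \<in> {..<l}" "k' \<in> {..<l}"
  then have k: "k < l" "k' < l" by auto
  have "z k * x k * (z k' * y k') = x k * (z k * z k') * y k'"
   unfolding z_props(4)[OF k(1) x[OF k(1)]] by (simp only: mult.assoc)
  also have "\<dots> = (if k' = k then z k * (x k * y k) else 0)"
  proof (cases "k' = k")
   case True
   have "x k * z k * y k = z k * (x k * y k)" unfolding z_props(4)[OF k(1) x[OF k(1)], symmetric] by (simp only: mult.assoc)
   then show ?thesis using True z_props(1)[OF k(1)] by simp
  qed (use z_props(3)[OF k] in simp)
  finally show "z k * x k * (z k' * y k') = (if k' = k then z k * (x k * y k) else 0)" .
 qed
 finally show ?thesis by (simp add: glue_def)
qed

lemma glue_st:
 assumes x: "!!k. k < l ==> x k \<in> hS A"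
 shows "hst A (glue x) = glue (\<lambda>k. hst A (x k))"
proof -
 have "hst A (glue x) = (\<Sum>k<l. hst A (z k * x k))" unfolding glue_def using z_S x by (intro st_sum) auto
 also have "\<dots> = glue (\<lambda>k. hst A (x k))" unfolding glue_def
 proof (intro sum.cong refl)
  fix k assume "k \<in> {..<l}"
  then have k: "k < l" by simp
  show "hst A (z k * x k) = z k * hst A (x k)"
   using st_mult[OF z_S[OF k] x[OF k]] z_props(2)[OF k] z_props(4)[OF k S_st[OF x[OF k]]] by simp
 qed
 finally show ?thesis .
qed

lemma glue_nm: assumes "!!k. k < l ==> x k \<in> hS A" "!!k. k < l ==> hnm A (x k) <= M" "0 <= M" shows "hnm A (glue x) <= M"
 unfolding glue_def
proof (rule nm_central_sum_le)
 fix k assume "k \<in> {..<l}"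
 then have k: "k < l" by simp
 show "z k \<in> hS A" "z k * z k = z k" "hst A (z k) = z k" by (rule z_S[OF k] z_props[OF k])+
 show "z k * x = x * z k" if "x \<in> hS A" for x by (rule z_props(4)[OF k that])
 show "z k * z j = 0" if "j \<in> {..<l}" "k ~= j" for j using that by (intro z_props(3)[OF k]) auto
 show "x k \<in> hS A" "hnm A (x k) <= M" using assms k by auto
qed (use assms in auto)

lemma tr_sum: assumes "k < l" "!!i. i \<in> I ==> y i \<in> hS A" shows "tr k (sum y I) = (\<Sum>i\<in>I. tr k (y i))"
 using assms(2)
proof (induction I rule: infinite_finite_induct)
 case (insert i I)
 then have "sum y I \<in> hS A" by (auto intro: S_sum)
 then show ?case using insert tr_add[OF assms(1)] by simp
qed (use tr_add[OF assms(1), of 0 0] in auto)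

lemma tr_glue: assumes k: "k < l" and y: "!!j. j < l ==> y j \<in> hS A" shows "tr k (glue y) = tr k (y k)"
proof -
 have "tr k (glue y) = (\<Sum>j<l. tr k (z j * y j))" unfolding glue_def using z_S y by (intro tr_sum[OF k]) auto
 also have "\<dots> = (\<Sum>j<l. if j = k then tr k (y k) else 0)" using tr_z[OF k y] by (intro sum.cong) auto
 finally show ?thesis using k by simp
qed

end

lemma left_mult_span:
 assumes "finite X" "y \<in> cvs.span X" shows "z * y \<in> cvs.span ((\<lambda>x. z * x) ` X)"
proof -
 obtain c where "y = (\<Sum>v\<in>X. c v *c v)" using assms unfolding cvs.span_finite[OF assms(1)] by auto
 then have "z * y = (\<Sum>v\<in>X. c v *c (z * v))" by (simp add: sum_distrib_left)
 then show ?thesis by (simp add: cvs.span_sum cvs.span_scale cvs.span_base)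
qed

lemma (in hcstar) complement_proj:
 assumes P: "P \<in> S" "P * P = P" "st P = P" and r: "r \<in> S" "r * r = r" "st r = r" "P * r = r" "r * P = r"
 shows "P - r \<in> S" "(P - r) * (P - r) = P - r" "st (P - r) = P - r" "(P - r) * r = 0" "P * (P - r) = P - r" "(P - r) * P = P - r"
 using assms by (simp_all add: st_diff algebra_simps)

locale et_limit = unital_limit A \<phi> B \<mu> for A :: "nat => 'a cstar" and \<phi> and B :: "'b cstar" and \<mu> +
 fixes Cs :: "nat => 'f et_block list" and \<theta>
 assumes dec: "et_decomposition (A n) (Cs n) (\<theta> n)"
begin

lemma D: "decomposed (A n) (Cs n) (\<theta> n)" by (intro decomposed.intro alg dec)

text \<open>The complement of \<open>r1\<close> almost absorbs \<open>1 - b1\<close> and that of \<open>r2\<close> almost absorbs \<open>1 - b2\<close>, and these two have product 0.\<close>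

lemma almost_orthogonal_complements:
 assumes mn: "m <= n" and c1: "candidate m n \<epsilon> G b1 \<eta> r1 \<Psi>1" and c2: "candidate m n \<epsilon> G b2 \<eta> r2 \<Psi>2"
  and b: "b1 \<in> S m" "b2 \<in> S m" "st m b2 = b2" "(e m - b1) * (e m - b2) = 0" and \<eta>: "0 < \<eta>" "\<eta> <= 1"
 shows "nm n ((F m n (e m) - r1) * (F m n (e m) - r2)) <= 3 * \<eta>"
proof -
 interpret m: hcstar1 "S m" "st m" "nm m" "e m" by (rule C1)
 interpret n: hcstar1 "S n" "st n" "nm n" "e n" by (rule C1)
 note FD = star_mapD[OF F[OF mn]] and F0 = star_map_diff[OF F[OF mn] m.hcstar_axioms]
 define P where "P = F m n (e m)"
 have P: "P \<in> S n" "P * P = P" "st n P = P" using FD(1)[OF m.e_S] FD(5)[OF m.e_S m.e_S] FD(2)[OF m.e_S] by (simp_all add: P_def)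
 have r1: "r1 \<in> S n" "r1 * r1 = r1" "st n r1 = r1" "P * r1 = r1" "r1 * P = r1" "nm n ((P - r1) * F m n b1) <= \<eta>"
  using c1 by (auto simp: candidate_def P_def)
 have r2: "r2 \<in> S n" "r2 * r2 = r2" "st n r2 = r2" "P * r2 = r2" "r2 * P = r2" "nm n ((P - r2) * F m n b2) <= \<eta>"
  using c2 by (auto simp: candidate_def P_def)
 define q1 q2 B1 B2 where "q1 = P - r1" and "q2 = P - r2" and "B1 = F m n b1" and "B2 = F m n b2"
 note Q1 = n.complement_proj[OF P r1(1-5), folded q1_def] and Q2 = n.complement_proj[OF P r2(1-5), folded q2_def]
 have B: "B1 \<in> S n" "B2 \<in> S n" "st n B2 = B2" using FD(1)[OF b(1)] FD(1)[OF b(2)] FD(2)[OF b(2)] b(3) by (simp_all add: B1_def B2_def)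
 have PB: "(P - B1) * (P - B2) = 0"
  using FD(5)[OF m.S_diff[OF m.e_S b(1)] m.S_diff[OF m.e_S b(2)]] F0(1)[OF m.e_S b(1)] F0(1)[OF m.e_S b(2)] F0(2)[OF m.S_0 m.S_0] b(4)
  by (simp add: P_def B1_def B2_def)
 have qB: "nm n (q1 * B1) <= \<eta>" using r1(6) by (simp add: q1_def B1_def)
 have Bq: "nm n (B2 * q2) <= \<eta>"
 proof -
  have "B2 * q2 = st n (q2 * B2)" using Q2 B by (simp add: n.st_mult)
  then show ?thesis using r2(6) Q2 B by (simp add: q2_def B2_def)
 qed
 have "q1 * (P - B1) * (P - B2) * q2 = 0" using PB by (simp add: mult.assoc)
 then have "q1 * q2 = q1 * B1 * q2 + (q1 * P - q1 * B1) * (B2 * q2) + (q1 * P * (P * q2) - q1 * P * q2)"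
  using Q1(6) Q2(5) by (simp add: algebra_simps)
 then have eq: "q1 * q2 = q1 * B1 * q2 + (q1 - q1 * B1) * (B2 * q2)" using Q1(6) Q2(5) by simp
 have n1: "nm n q1 <= 1" "nm n q2 <= 1" using n.proj_nm_le_1 Q1 Q2 by auto
 have "nm n (q1 * q2) <= \<eta> * 1 + (1 + \<eta>) * \<eta>" unfolding eq
  using Q1(1) Q2(1) B n1 qB Bq by (intro n.nm_add_le n.nm_mult_le[of "q1 * B1" q2] n.nm_mult_le[of "q1 - q1 * B1"] n.nm_diff_le) auto
 also have "\<dots> <= 3 * \<eta>" using \<eta> mult_left_mono[of \<eta> 1 \<eta>] by (simp add: algebra_simps)
 finally show ?thesis by (simp add: q1_def q2_def P_def)
qed

text \<open>The numbers: \<open>N\<close> is at least \<open>2 (L + 1)\<close>, so a complement of rank at most \<open>2 / N\<close> of the total leaves at least \<open>L\<close> times its rank.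
One inequality per \<open>g\<close> suffices here; its adjoint supplies the others.\<close>

lemma hosted_decomposition:
 assumes rr: "real_rank_zero B" and G: "finite G" "G \<subseteq> S m" and \<epsilon>: "0 < \<epsilon>" and L: "0 < L"
 shows "\<exists>n\<ge>m. \<exists>q1 q2 \<Phi> X. q1 \<in> S n & q1 * q1 = q1 & st n q1 = q1 & q2 \<in> S n & q2 * q2 = q2 & st n q2 = q2 &
  q1 * q2 = 0 & q1 + q2 = F m n (e m) & star_map (S m) (st m) (S n) (st n) \<Phi> & \<Phi> (e m) = q2 &
  finite X & \<Phi> ` S m \<subseteq> cvs.span X &
  (\<forall>k<length (Cs n). L * real (block_rank (Cs n ! k) (\<theta> n (unemb (A n) q1) ! k)) <= real (block_rank (Cs n ! k) (\<theta> n (unemb (A n) q2) ! k))) &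
  (\<forall>g\<in>G. nm n (F m n g * q2 - \<Phi> g) <= \<epsilon>)"
proof -
 interpret Dm: decomposed "A m" "Cs m" "\<theta> m" by (rule D)
 define N where "N = nat \<lceil>2 * (L + 1)\<rceil>"
 have N: "2 * (L + 1) <= real N" "0 < N" using L by (simp_all add: N_def) linarith+
 obtain K :: "(nat \<times> nat) set" and Fib :: "nat \<times> nat => 'f cstar" and lev \<pi> where PO:
  "(\<forall>i<N. pieces (S m) (st m) (nm m) (e m) K Fib (lev i) (\<pi> i) \<epsilon> G) &
   (\<forall>i<N. \<forall>j<N. i ~= j --> (e m - core K Fib (lev i)) * (e m - core K Fib (lev j)) = 0)"
  using Dm.sum_pieces_exist[OF G \<epsilon>, of N] by (elim exE)
 note P = PO[THEN conjunct1, rule_format] and O = PO[THEN conjunct2, rule_format]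
 \<comment> \<open>The complements then have products of norm at most \<open>3 \<eta>\<close>, and \<open>3 \<eta> N\<^sup>2 <= 2\<close>.\<close>
 define \<eta> where "\<eta> = 1 / (2 * (real N * real N))"
 have N1: "1 <= real N" using N(2) by simp
 then have NN: "1 <= real N * real N" using mult_mono[of 1 "real N" 1 "real N"] by simp
 have \<eta>: "0 < \<eta>" "\<eta> <= 1" "real N * (real N * (3 * \<eta>)) <= 2" using N1 NN by (simp_all add: \<eta>_def field_simps)
 have "\<exists>n0\<ge>m. \<forall>n\<ge>n0. \<exists>r \<Psi>. candidate m n \<epsilon> G (core K Fib (lev i)) \<eta> r \<Psi>" if "i < N" for i
  by (rule candidate_exists[OF rr P[OF that] G(2) \<eta>(1)])
 then obtain n0 where n0: "!!i. i < N ==> m <= n0 i" "!!i n. i < N ==> n0 i <= n ==> \<exists>r \<Psi>. candidate m n \<epsilon> G (core K Fib (lev i)) \<eta> r \<Psi>" by metis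
 define n where "n = Max (insert m (n0 ` {..<N}))"
 have n: "m <= n" "!!i. i < N ==> n0 i <= n" by (simp_all add: n_def)
 have "\<exists>r \<Psi>. candidate m n \<epsilon> G (core K Fib (lev i)) \<eta> r \<Psi>" if "i < N" for i by (rule n0(2)[OF that n(2)[OF that]])
 then obtain r \<Psi> where cand: "!!i. i < N ==> candidate m n \<epsilon> G (core K Fib (lev i)) \<eta> (r i) (\<Psi> i)" by metis
 interpret Dn: decomposed "A n" "Cs n" "\<theta> n" by (rule D)
 note FD = star_mapD[OF F[OF n(1)]]
 define p where "p = F m n (e m)"
 have p: "p \<in> S n" "p * p = p" "st n p = p" using FD(1)[OF Dm.e_S] FD(5)[OF Dm.e_S Dm.e_S] FD(2)[OF Dm.e_S] by (simp_all add: p_def)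
 have r: "r i \<in> S n" "r i * r i = r i" "st n (r i) = r i" "p * r i = r i" "r i * p = r i" if "i < N" for i
  using cand[OF that] by (auto simp: candidate_def p_def)
 have \<Psi>: "star_map (S m) (st m) (S n) (st n) (\<Psi> i)" "\<Psi> i (e m) = r i" "\<exists>X. finite X & \<Psi> i ` S m \<subseteq> cvs.span X"
  "!!g. g \<in> G ==> nm n (F m n g * r i - \<Psi> i g) <= \<epsilon>" if "i < N" for i
  using cand[OF that] by (auto simp: candidate_def)
 define q where "q i = p - r i" for i
 have q: "q i \<in> S n" "q i * q i = q i" "st n (q i) = q i" "q i * r i = 0" "p * q i = q i" "q i * p = q i" if "i < N" for i
  using Dn.complement_proj[OF p r[OF that]] by (simp_all add: q_def)
 define Q where "Q = (\<Sum>i<N. q i)"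
 have QS: "Q \<in> S n" unfolding Q_def using q(1) by (intro Dn.S_sum) auto
 have "nm n (q i * q j) <= 3 * \<eta>" if "i < N" "j < N" "i ~= j" for i j
  using almost_orthogonal_complements[OF n(1) cand[OF that(1)] cand[OF that(2)] _ _ _ O[OF that] \<eta>(1,2)]
   pieces.core_S[OF P[OF that(1)]] pieces.core_S[OF P[OF that(2)]] by (simp add: q_def p_def)
 then have Q2: "nm n Q <= 2" unfolding Q_def using q(1-3) \<eta> by (intro Dn.almost_orthogonal_sum[where \<eta> = "3 * \<eta>"]) auto
 have pQp: "p * Q * p = Q" unfolding Q_def using q(5,6) by (simp add: sum_distrib_left sum_distrib_right)
 define rk where "rk k x = real (block_rank (Cs n ! k) (\<theta> n (unemb (A n) x) ! k))" for k x
 have rk: "Dn.tr k x = of_real (rk k x)" if "k < Dn.l" "x \<in> S n" "x * x = x" "st n x = x" for k x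
  using Dn.tr_proj[OF that] by (simp add: rk_def)
 \<comment> \<open>The sum of the ranks is the trace of \<open>Q\<close>, hence at most twice the rank of \<open>p\<close>.\<close>
 have "\<exists>i<N. real N * rk k (q i) <= 2 * rk k p" if k: "k < Dn.l" for k
 proof (rule ccontr)
  assume "\<not> ?thesis"
  then have less: "2 * rk k p < real N * rk k (q i)" if "i < N" for i using that by (auto simp: not_le)
  have "(\<Sum>i<N. 2 * rk k p) < (\<Sum>i<N. real N * rk k (q i))" using less N(2) by (intro sum_strict_mono) auto
  then have "2 * rk k p < (\<Sum>i<N. rk k (q i))" using N(2) by (simp flip: sum_distrib_left)
  moreover have "Dn.tr k Q = of_real (\<Sum>i<N. rk k (q i))"
   unfolding Q_def using q rk[OF k] by (subst Dn.tr_sum[OF k]) auto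
  moreover have "cmod (Dn.tr k Q) <= nm n Q * rk k p" using Dn.tr_bound[OF k p QS pQp] rk[OF k p] by simp
  moreover have "nm n Q * rk k p <= 2 * rk k p" using Q2 by (intro mult_right_mono) (simp_all add: rk_def)
  ultimately show False by (simp only: norm_of_real)
 qed
 then obtain I where I: "!!k. k < Dn.l ==> I k < N" "!!k. k < Dn.l ==> real N * rk k (q (I k)) <= 2 * rk k p" by metis
 define q1 q2 \<Phi> where "q1 = Dn.glue (\<lambda>k. q (I k))" and "q2 = Dn.glue (\<lambda>k. r (I k))" and "\<Phi> c = Dn.glue (\<lambda>k. \<Psi> (I k) c)" for c
 have q1: "q1 \<in> S n" "q1 * q1 = q1" "st n q1 = q1"
  unfolding q1_def using q I(1) by (auto simp: Dn.glue_S Dn.glue_mult Dn.glue_st intro: Dn.glue_cong)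
 have q2: "q2 \<in> S n" "q2 * q2 = q2" "st n q2 = q2"
  unfolding q2_def using r I(1) by (auto simp: Dn.glue_S Dn.glue_mult Dn.glue_st intro: Dn.glue_cong)
 have "q1 * q2 = Dn.glue (\<lambda>k. 0)" unfolding q1_def q2_def using q I(1) by (subst Dn.glue_mult) (auto intro: Dn.glue_cong)
 then have q12: "q1 * q2 = 0" by (simp add: Dn.glue_def)
 have "q1 + q2 = Dn.glue (\<lambda>k. p)" unfolding q1_def q2_def Dn.glue_add by (simp add: q_def)
 then have sum: "q1 + q2 = p" using Dn.glue_const[OF p(1)] by simp
 have \<Psi>S: "\<Psi> (I k) c \<in> S n" if "k < Dn.l" "c \<in> S m" for k c by (rule star_mapD(1)[OF \<Psi>(1)[OF I(1)[OF that(1)]] that(2)])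
 have \<Phi>: "star_map (S m) (st m) (S n) (st n) \<Phi>"
  unfolding star_map_def
 proof (intro ballI conjI allI)
  fix x assume x: "x \<in> S m"
  note H = star_mapD[OF \<Psi>(1)[OF I(1)] x]
  show "\<Phi> x \<in> S n" unfolding \<Phi>_def by (rule Dn.glue_S[OF \<Psi>S[OF _ x]])
  show "\<Phi> (st m x) = st n (\<Phi> x)"
   unfolding \<Phi>_def using Dn.glue_st[of "\<lambda>k. \<Psi> (I k) x"] \<Psi>S[OF _ x] Dn.glue_cong[of "\<lambda>k. \<Psi> (I k) (st m x)", OF H(2)] by simp
  show "\<Phi> (c *c x) = c *c \<Phi> x" for c unfolding \<Phi>_def Dn.glue_scl[symmetric] by (rule Dn.glue_cong[OF H(3)])
  fix y assume y: "y \<in> S m"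
  show "\<Phi> (x + y) = \<Phi> x + \<Phi> y" unfolding \<Phi>_def Dn.glue_add by (rule Dn.glue_cong[OF H(4)[OF _ y]])
  show "\<Phi> (x * y) = \<Phi> x * \<Phi> y" 
   unfolding \<Phi>_def using Dn.glue_mult[of "\<lambda>k. \<Psi> (I k) x" "\<lambda>k. \<Psi> (I k) y"] \<Psi>S[OF _ x]
    Dn.glue_cong[of "\<lambda>k. \<Psi> (I k) (x * y)", OF H(5)[OF _ y]] by simp
 qed
 have \<Phi>e: "\<Phi> (e m) = q2" unfolding \<Phi>_def q2_def using \<Psi>(2)[OF I(1)] by (intro Dn.glue_cong)
 have "\<exists>X. finite X & \<Psi> (I k) ` S m \<subseteq> cvs.span X" if "k < Dn.l" for k by (rule \<Psi>(3)[OF I(1)[OF that]])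
 then obtain X where X: "!!k. k < Dn.l ==> finite (X k)" "!!k. k < Dn.l ==> \<Psi> (I k) ` S m \<subseteq> cvs.span (X k)" by metis
 define Y where "Y = (\<Union>k<Dn.l. (\<lambda>x. Dn.z k * x) ` X k)"
 have finY: "finite Y" unfolding Y_def using X(1) by auto
 have span: "\<Phi> ` S m \<subseteq> cvs.span Y"
 proof
  fix y assume "y \<in> \<Phi> ` S m"
  then obtain c where c: "c \<in> S m" "y = \<Phi> c" by blast
  show "y \<in> cvs.span Y" unfolding c(2) \<Phi>_def Dn.glue_def
  proof (rule cvs.span_sum)
   fix k assume "k \<in> {..<Dn.l}"
   then have k: "k < Dn.l" by simp
   have "\<Psi> (I k) c \<in> cvs.span (X k)" using X(2)[OF k] c(1) by blast
   from left_mult_span[OF X(1)[OF k] this, of "Dn.z k"]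
   have "Dn.z k * \<Psi> (I k) c \<in> cvs.span ((\<lambda>x. Dn.z k * x) ` X k)" .
   moreover have "cvs.span ((\<lambda>x. Dn.z k * x) ` X k) \<subseteq> cvs.span Y" unfolding Y_def using k by (intro cvs.span_mono) blast
   ultimately show "Dn.z k * \<Psi> (I k) c \<in> cvs.span Y" by blast
  qed
 qed
 have rank: "L * rk k q1 <= rk k q2" if k: "k < Dn.l" for k
 proof -
  have "rk k q1 = rk k (q (I k))"
   using Dn.tr_glue[OF k, of "\<lambda>k. q (I k)"] q(1)[OF I(1)] rk[OF k q1] rk[OF k q(1-3)[OF I(1)[OF k]]] by (simp add: q1_def)
  moreover have "rk k q1 + rk k q2 = rk k p"
   using Dn.tr_add[OF k q1(1) q2(1)] sum rk[OF k q1] rk[OF k q2] rk[OF k p] by (simp flip: of_real_add)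
  moreover have "2 * (L + 1) * rk k (q (I k)) <= real N * rk k (q (I k))" using N(1) by (intro mult_right_mono) (simp_all add: rk_def)
  ultimately show ?thesis using I(2)[OF k] by (simp add: algebra_simps)
 qed
 have near: "nm n (F m n g * q2 - \<Phi> g) <= \<epsilon>" if g: "g \<in> G" for g
 proof -
  have gS: "g \<in> S m" using g G by blast
  have "F m n g * q2 = Dn.glue (\<lambda>k. F m n g * r (I k))"
   unfolding q2_def using Dn.glue_mult[of "\<lambda>_. F m n g"] Dn.glue_const[OF FD(1)[OF gS]] FD(1)[OF gS] by metis
  then have "F m n g * q2 - \<Phi> g = Dn.glue (\<lambda>k. F m n g * r (I k) - \<Psi> (I k) g)" by (simp add: \<Phi>_def Dn.glue_diff)
  then show ?thesis using \<Psi>(4)[OF I(1) g] \<Psi>S[OF _ gS] FD(1)[OF gS] r(1)[OF I(1)] \<epsilon> by (simp add: Dn.glue_nm)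
 qed
 show ?thesis
  using n(1) q1 q2 q12 sum \<Phi> \<Phi>e finY span rank near unfolding p_def rk_def
  by (intro exI[of _ n] exI[of _ q1] exI[of _ q2] exI[of _ \<Phi>] exI[of _ Y] conjI allI impI ballI) simp_all
qed

end

section \<open>The decomposition\<close>

theorem corollary3p6:
  fixes A :: "nat \<Rightarrow> 'a cstar"
    and \<phi> :: "nat \<Rightarrow> nat \<Rightarrow> 'a \<Rightarrow> 'a"
    and B :: "'b cstar"
    and \<mu> :: "nat \<Rightarrow> 'a \<Rightarrow> 'b"
    and Cs :: "nat \<Rightarrow> 'f et_block list"
    and \<theta> :: "nat \<Rightarrow> 'a \<Rightarrow> ('f + (real \<Rightarrow> 'f) \<times> 'f) list"
    and m :: nat and G :: "'a set" and \<epsilon> L :: real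
  assumes "inductive_limit A \<phi> B \<mu>"
    and "\<And>n. et_decomposition (A n) (Cs n) (\<theta> n)"
    and "real_rank_zero B"
    and "finite G" and "G \<subseteq> carrier (A m)"
    and "0 < \<epsilon>" and "0 < L"
  shows "\<exists>n\<ge>m. \<exists>q1 q2 \<phi>'.
    projection (A n) q1 \<and> projection (A n) q2 \<and> q1 \<otimes>\<^bsub>A n\<^esub> q2 = \<zero>\<^bsub>A n\<^esub> \<and>
    \<phi>' \<in> unital_star_hom (A m) (corner (A n) q2) \<and>
    vectorspace.fin_dim class_ring ((A n)\<lparr>carrier := \<phi>' ` carrier (A m)\<rparr>) \<and>
    q1 \<oplus>\<^bsub>A n\<^esub> q2 = \<phi> m n \<one>\<^bsub>A m\<^esub> \<and>
    (\<forall>k < length (Cs n).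
       real (et_rank (Cs n) (\<theta> n q2) ! k) \<ge> L * real (et_rank (Cs n) (\<theta> n q1) ! k)) \<and>
    (\<forall>g\<in>G. nrm (A n) ((q1 \<otimes>\<^bsub>A n\<^esub> \<phi> m n g) \<ominus>\<^bsub>A n\<^esub> (\<phi> m n g \<otimes>\<^bsub>A n\<^esub> q1)) < \<epsilon>) \<and>
    (\<forall>g\<in>G. nrm (A n) (\<phi> m n g \<ominus>\<^bsub>A n\<^esub>
       ((q1 \<otimes>\<^bsub>A n\<^esub> \<phi> m n g \<otimes>\<^bsub>A n\<^esub> q1) \<oplus>\<^bsub>A n\<^esub> \<phi>' g)) < \<epsilon>)"
proof -
 have alg: "cstar_algebra (A n)" for n using assms(1) by (simp add: inductive_limit_def inductive_system_def)
 have "decomposed (A n) (Cs n) (\<theta> n)" for n by (intro decomposed.intro alg assms(2))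
 then interpret et_limit A \<phi> B \<mu> Cs \<theta>
  by (intro et_limit.intro unital_limit.intro et_limit_axioms.intro assms(1,2) decomposed.monoid_A)
 interpret m: hcstar1 "S m" "st m" "nm m" "e m" by (rule C1)
 have G: "x \<in> carrier (A m)" if "x \<in> G" for x using that assms(5) by blast
 \<comment> \<open>Adjoints are added in order to control multiplication by the projections from both sides.\<close>
 define H where "H = emb (A m) ` G \<union> st m ` (emb (A m) ` G)"
 have H: "finite H" "H \<subseteq> S m" using assms(4) G by (auto simp: H_def alg)
 have "0 < \<epsilon> / 3" using assms(6) by simp
 from hosted_decomposition[OF assms(3) H this assms(7)]
 obtain n q1 q2 \<Phi> X where mn: "m <= n" and q1: "q1 \<in> S n" "q1 * q1 = q1" "st n q1 = q1"
  and q2: "q2 \<in> S n" "q2 * q2 = q2" "st n q2 = q2" and q12: "q1 * q2 = 0" "q1 + q2 = F m n (e m)"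
  and \<Phi>: "star_map (S m) (st m) (S n) (st n) \<Phi>" "\<Phi> (e m) = q2" and X: "finite X" "\<Phi> ` S m \<subseteq> cvs.span X"
  and rank: "!!k. k < length (Cs n) ==> L * real (block_rank (Cs n ! k) (\<theta> n (unemb (A n) q1) ! k)) <= real (block_rank (Cs n ! k) (\<theta> n (unemb (A n) q2) ! k))"
  and near: "!!g. g \<in> H ==> nm n (F m n g * q2 - \<Phi> g) <= \<epsilon> / 3"
  by (elim exE conjE) (simp add: mult.commute)
 interpret n: hcstar1 "S n" "st n" "nm n" "e n" by (rule C1)
 note FD = star_mapD[OF F[OF mn]] and PD = star_mapD[OF \<Phi>(1)]
 define p1 p2 where "p1 = unemb (A n) q1" and "p2 = unemb (A n) q2"
 define \<phi>' where "\<phi>' x = unemb (A n) (\<Phi> (emb (A m) x))" for x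
 have ep: "emb (A n) p1 = q1" "emb (A n) p2 = q2" "p1 \<in> carrier (A n)" "p2 \<in> carrier (A n)" using q1 q2 by (simp_all add: p1_def p2_def alg)
 have e\<phi>': "emb (A n) (\<phi>' x) = \<Phi> (emb (A m) x)" "\<phi>' x \<in> carrier (A n)" if "x \<in> carrier (A m)" for x
  using PD(1)[OF emb_in[OF alg that]] by (simp_all add: \<phi>'_def alg)
 have e\<phi>: "emb (A n) (\<phi> m n x) = F m n (emb (A m) x)" "\<phi> m n x \<in> carrier (A n)" if "x \<in> carrier (A m)" for x
  using that \<phi>_in[OF mn that] by (simp_all add: hmap_emb[OF alg])
 note U = unemb_simps[OF alg[of n]] and C = carrier_simps[OF alg] add_carrier[OF alg] minus_carrier[OF alg] and I = emb_inj[OF alg[of n], THEN iffD1]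
  and Em = emb_mult[OF alg] emb_add[OF alg] emb_scl[OF alg] emb_minus[OF alg] emb_st[OF alg, symmetric]
 have one: "\<one>\<^bsub>A m\<^esub> \<in> carrier (A m)" using unit[of m] by (rule monoid.one_closed)
 have hom: "\<phi>' \<in> star_hom (A m) (A n)"
  by (rule star_homI; (rule e\<phi>'(2), assumption)?; rule I) (simp_all add: e\<phi>' Em C PD alg)
 have below: "q2 * \<Phi> x = \<Phi> x" "\<Phi> x * q2 = \<Phi> x" if "x \<in> S m" for x
  using PD(5)[OF m.e_S that] PD(5)[OF that m.e_S] that \<Phi>(2) by simp_all
 have corner: "\<phi>' x \<in> (\<lambda>x. p2 \<otimes>\<^bsub>A n\<^esub> x \<otimes>\<^bsub>A n\<^esub> p2) ` carrier (A n)" if x: "x \<in> carrier (A m)" for x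
 proof
  show "\<phi>' x = p2 \<otimes>\<^bsub>A n\<^esub> \<phi>' x \<otimes>\<^bsub>A n\<^esub> p2"
   by (rule I) (use x below[OF emb_in[OF alg x]] in \<open>simp_all add: e\<phi>' Em C ep\<close>)
 qed (rule e\<phi>'(2)[OF x])
 have main: "nm n (q1 * F m n g - F m n g * q1) < \<epsilon>" "nm n (F m n g - (q1 * F m n g * q1 + \<Phi> g)) < \<epsilon>" if g: "g \<in> emb (A m) ` G" for g
 proof -
  have gS: "g \<in> S m" "st m g \<in> S m" "g \<in> H" "st m g \<in> H" using g H(2) by (auto simp: H_def)
  define a where "a = F m n g"
  have a: "a \<in> S n" "\<Phi> g \<in> S n" using FD(1) PD(1) gS(1) by (simp_all add: a_def)
  have pa: "(q1 + q2) * a = a" "a * (q1 + q2) = a" using FD(5)[OF m.e_S gS(1)] FD(5)[OF gS(1) m.e_S] gS(1) q12(2) by (simp_all add: a_def)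
  define t where "t = a * q2 - \<Phi> g"
  define t' where "t' = q2 * a - \<Phi> g"
  have t: "t \<in> S n" "nm n t <= \<epsilon> / 3" using near[OF gS(3)] a q2(1) by (simp_all add: t_def a_def)
  have "st n (F m n (st m g) * q2 - \<Phi> (st m g)) = t'"
   using FD(2)[OF gS(1)] PD(2)[OF gS(1)] a q2 by (simp add: t'_def a_def n.st_diff n.st_mult)
  then have t': "t' \<in> S n" "nm n t' <= \<epsilon> / 3"
   using near[OF gS(4)] FD(1)[OF gS(2)] PD(1)[OF gS(2)] q2(1) n.nm_st[of "F m n (st m g) * q2 - \<Phi> (st m g)"] by auto
  have q1a: "q1 * a = a - q2 * a" "a * q1 = a - a * q2" using pa by (simp_all add: algebra_simps)
  have "q1 * a - a * q1 = t - t'" unfolding q1a by (simp add: t_def t'_def)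
  then have "nm n (q1 * a - a * q1) <= \<epsilon> / 3 + \<epsilon> / 3" using n.nm_diff_le[OF t(1) t'(1) t(2) t'(2)] by simp
  then show "nm n (q1 * F m n g - F m n g * q1) < \<epsilon>" using assms(6) by (simp add: a_def)
  have "q1 * a * q1 = a - a * q2 - q2 * a + q2 * a * q2"
   unfolding q1a(1) left_diff_distrib mult.assoc q1a(2) by (simp add: algebra_simps)
  then have "a - (q1 * a * q1 + \<Phi> g) = t' + (t - q2 * t)" using below(1)[OF gS(1)] by (simp add: t_def t'_def algebra_simps)
  moreover have "t - q2 * t = q1 * t + (e n - (q1 + q2)) * t" using t(1) by (simp add: algebra_simps)
  moreover have "(q1 + q2) * t = t"
   using pa(1) below(1)[OF gS(1)] q12(1) q2(2) unfolding t_def right_diff_distrib by (simp add: mult.assoc[symmetric] distrib_right) (metis add_0 below(1)[OF gS(1)] mult.assoc mult_zero_left)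
  ultimately have "a - (q1 * a * q1 + \<Phi> g) = t' + q1 * t" using t(1) by (simp add: left_diff_distrib)
  moreover have "nm n (t' + q1 * t) <= \<epsilon> / 3 + 1 * (\<epsilon> / 3)"
   using q1 t t' n.proj_nm_le_1[OF q1] by (intro n.nm_add_le n.nm_mult_le) auto
  ultimately show "nm n (F m n g - (q1 * F m n g * q1 + \<Phi> g)) < \<epsilon>" using assms(6) by (simp add: a_def)
 qed
 show ?thesis
 proof (rule exI[of _ n], rule conjI[OF mn], rule exI[of _ p1], rule exI[of _ p2], rule exI[of _ \<phi>'], intro conjI ballI allI impI)
  show "projection (A n) p1" "projection (A n) p2"
   unfolding projection_def p1_def p2_def using U(3)[OF q1(1) q1(1)] U(5)[OF q1(1) q1(1)] U(3)[OF q2(1) q2(1)] U(5)[OF q2(1) q2(1)] q1 q2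
   by (simp_all add: alg)
  show "p1 \<otimes>\<^bsub>A n\<^esub> p2 = \<zero>\<^bsub>A n\<^esub>" by (rule I) (simp_all add: Em ep C q12 emb_zero[OF alg] zero_carrier[OF alg])
  show "p1 \<oplus>\<^bsub>A n\<^esub> p2 = \<phi> m n \<one>\<^bsub>A m\<^esub>" by (rule I) (simp_all add: Em ep C q12 e\<phi>[OF one])
  show "\<phi>' \<in> unital_star_hom (A m) (corner (A n) p2)"
   unfolding unital_star_hom_def
  proof (intro CollectI conjI star_homI)
   show "\<phi>' \<one>\<^bsub>A m\<^esub> = \<one>\<^bsub>corner (A n) p2\<^esub>" by (simp add: corner_def \<phi>'_def \<Phi>(2) p2_def)
  qed (use star_homD[OF hom] corner in \<open>simp_all add: corner_def\<close>)
  show "vectorspace.fin_dim class_ring (A n\<lparr>carrier := \<phi>' ` carrier (A m)\<rparr>)"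
  proof (rule image_fin_dim[OF alg alg hom X(1)])
   have "hmap (A m) (A n) \<phi>' x = \<Phi> x" if "x \<in> S m" for x
    using PD(1)[OF that] that by (simp add: hmap_def \<phi>'_def alg)
   then show "hmap (A m) (A n) \<phi>' ` S m \<subseteq> cvs.span X" using X(2) by auto
  qed
 next
  fix k assume k: "k < length (Cs n)"
  interpret D: decomposed "A n" "Cs n" "\<theta> n" by (rule D)
  have len: "length (\<theta> n p) = length (Cs n)" if "p \<in> carrier (A n)" for p
   using star_homD(1)[OF D.\<theta>_hom that] by (simp add: direct_sum_simps)
  show "real (et_rank (Cs n) (\<theta> n p2) ! k) \<ge> L * real (et_rank (Cs n) (\<theta> n p1) ! k)"
   using rank[OF k] k len[OF ep(3)] len[OF ep(4)] by (simp add: et_rank_def p1_def p2_def)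
 next
  fix g assume g: "g \<in> G"
  note gm = main[OF imageI[OF g]] and gc = e\<phi>[OF G[OF g]] e\<phi>'[OF G[OF g]]
  have "nm n (emb (A n) ((p1 \<otimes>\<^bsub>A n\<^esub> \<phi> m n g) \<ominus>\<^bsub>A n\<^esub> (\<phi> m n g \<otimes>\<^bsub>A n\<^esub> p1))) < \<epsilon>" using gm(1) gc by (simp add: Em C ep)
  then show "nrm (A n) ((p1 \<otimes>\<^bsub>A n\<^esub> \<phi> m n g) \<ominus>\<^bsub>A n\<^esub> (\<phi> m n g \<otimes>\<^bsub>A n\<^esub> p1)) < \<epsilon>" using gc by (simp add: emb_nm[OF alg] C ep)
  have "nm n (emb (A n) (\<phi> m n g \<ominus>\<^bsub>A n\<^esub> ((p1 \<otimes>\<^bsub>A n\<^esub> \<phi> m n g \<otimes>\<^bsub>A n\<^esub> p1) \<oplus>\<^bsub>A n\<^esub> \<phi>' g))) < \<epsilon>" using gm(2) gc by (simp add: Em C ep)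
  then show "nrm (A n) (\<phi> m n g \<ominus>\<^bsub>A n\<^esub> ((p1 \<otimes>\<^bsub>A n\<^esub> \<phi> m n g \<otimes>\<^bsub>A n\<^esub> p1) \<oplus>\<^bsub>A n\<^esub> \<phi>' g)) < \<epsilon>" using gc by (simp add: emb_nm[OF alg] C ep)
 qed
qed

end
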